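(* Let the perturbed system $\frac{dx}{dt}=\partial_yH(x,y,t)$, $\frac{dy}{dt}=-\partial_xH(x,y,t)+F(x,y,t)$ satisfy the standing assumptions of the context, and let $2\le n,m\le2q$, $\sigma\ge2$, $d\ge1$ be integers such that (with $N\ge n+d$, $M=m$ in the averaging procedure of the context) the following hold. (a) $\Lambda_j(v,\psi)\equiv0$ for $j<n$, $\Omega_i(v,\psi)\equiv0$ for $i<m$; for $n\le z<n+d$, $\Lambda_z(v,\psi)\equiv v^{\frac{\sigma+1}2}\big(\lambda_{z,\sigma}(\psi)+\widetilde\lambda_{z,\sigma}(v,\psi)\big)+v\,\delta_{z,2q}\frac lq$; and $\Lambda_{n+d}(v,\psi)\equiv v\big(\lambda_{n+d}(\psi)+\widetilde\lambda_{n+d}(v,\psi)+\delta_{n+d,2q}\frac lq\big)$, where all $\lambda$'s and $\widetilde\lambda$'s are $2\pi$-periodic in $\psi$ and $\widetilde\lambda_{z,\sigma}=\mathcal O(v^{1/2})$, $\widetilde\lambda_{n+d}=\mathcal O(v^{1/2})$ as $v\to0$ uniformly for $\psi\in\mathbb R$. (b) There is $\Delta_\ast\in(0,\Delta_0]$ such that $\Omega_m(v,\psi)\ne0$ for all $v\in[0,\Delta_\ast]$, $\psi\in\mathbb R$. If $n+d<m$, and $\lambda_{n+d}(\psi)>0$ and $\lambda_{n,\sigma}(\psi)<0$ for all $\psi\in\mathbb R$, then the equilibrium $(0,0)$ is polynomially stable.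
   Context: Perturbed system (standing assumptions). Consider for $t>0$ the system $\frac{dx}{dt}=\partial_yH(x,y,t)$, $\frac{dy}{dt}=-\partial_xH(x,y,t)+F(x,y,t)$, where $H,F$ are infinitely differentiable and, on every compact set of $(x,y)$, $H(x,y,t)\to H_0(x,y)$, $F(x,y,t)\to0$ as $t\to\infty$. Here $H_0=\frac{x^2+y^2}{2}+\mathcal O(r^3)$ as $r=\sqrt{x^2+y^2}\to0$; the limiting system $\dot x=\partial_yH_0$, $\dot y=-\partial_xH_0$ has $(0,0)$ as an isolated fixed point of center type; there are constants $E_0,r_0>0$ such that for $E\in(0,E_0]$ the level lines $\{H_0=E\}$ lying in $D_0=\{r\le r_0\}$ form a family of closed curves, each corresponding to a periodic solution $x_0(t,E),y_0(t,E)$ of the limiting system of period $2\pi/\omega(E)$, with $\omega(E)\ne0$ on $[0,E_0]$ and $\omega(E)=1+\mathcal O(E)$ as $E\to0$. As $t\to\infty$, for $(x,y)\in D_0$, $H=H_0+\sum_{k\ge1}t^{-k/q}H_k(x,y,S(t))$, $F=\sum_{k\ge1}t^{-k/q}F_k(x,y,S(t))$, where $q$ is a positive integer, $H_k,F_k$ are $2\pi$-periodic in $S$, and $S(t)=\sum_{k=0}^{q-1}s_kt^{1-k/q}+s_q\log t+\mathcal O(t^{-1/q})$ with constants $s_k$, $s_0>0$. These asymptotic expansions may be differentiated termwise. Moreover $\partial_xH(0,0,t)\equiv\partial_yH(0,0,t)\equiv F(0,0,t)\equiv0$, $H_k=\mathcal O(r^2)$, $F_k=\mathcal O(r)$ as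 $r\to0$, and the resonance condition $s_0=\varkappa\,\omega(0)$ holds with a positive integer $\varkappa$. Action-angle variables. Put $X(\varphi,E)=x_0(\varphi/\omega(E),E)$, $Y(\varphi,E)=y_0(\varphi/\omega(E),E)$ ($2\pi$-periodic in $\varphi$, phase chosen so that to leading order as $E\to0$, $X=\sqrt{2E}\cos\varphi$, $Y=-\sqrt{2E}\sin\varphi$). The substitution $x=X(\varphi,E)$, $y=Y(\varphi,E)$ gives $\dot E=f(E,\varphi,t)$, $\dot\varphi=\omega(E)+g(E,\varphi,t)$ with $f=-\omega(E)\big(\partial_\varphi[H(X,Y,t)]-F(X,Y,t)\partial_\varphi X\big)$, $g=\omega(E)\big(\partial_E[H(X,Y,t)]-1-F(X,Y,t)\partial_EX\big)$. These have expansions $f=\sum_{k\ge1}t^{-k/q}f_k(E,\varphi,S(t))$, $g=\sum_{k\ge1}t^{-k/q}g_k(E,\varphi,S(t))$, with $f_k=\sum_{j\ge2}E^{j/2}f_{k,j}(\varphi,S)$, $g_k=\sum_{j\ge0}E^{j/2}g_{k,j}(\varphi,S)$ as $E\to0$. Scaling. Put $E=t^{-l/q}\mathcal E$, $\varphi=\theta+\varkappa^{-1}S(t)$ with an integer $l$: $l=0$ if $\omega(E)\equiv$ const, $l\ge1$ otherwise ($l=1$ unless a larger $l$ is needed so that the first nonzero $\Omega_m$ below satisfies $\Omega_m(0,\psi)\not\equiv0$). Then $\dot{\mathcal E}=\mathcal F(\mathcal E,\theta,t)+t^{-1}\frac lq\mathcal E$, $\dot\theta=\mathcal G(\mathcal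 E,\theta,t)$, where $\mathcal F=t^{l/q}f(t^{-l/q}\mathcal E,\theta+\varkappa^{-1}S(t),t)$, $\mathcal G=\omega(t^{-l/q}\mathcal E)-\varkappa^{-1}S'(t)+g(t^{-l/q}\mathcal E,\theta+\varkappa^{-1}S(t),t)$, expanded as $\mathcal F=\sum_{k\ge2}t^{-k/(2q)}\mathcal F_k(\mathcal E,\theta,S(t))$, $\mathcal G=\sum_{k\ge2}t^{-k/(2q)}\mathcal G_k(\mathcal E,\theta,S(t))$, using $S'(t)=\sum_{j=0}^{q-1}(1-\frac jq)s_jt^{-j/q}+s_qt^{-1}$ in the formal expansions. Averaging. For integers $N,M\ge2$ put $V_N=\mathcal E+\sum_{k=2}^Nt^{-k/(2q)}v_k(\mathcal E,\theta,S(t))$, $\Psi_M=\theta+\sum_{k=2}^Mt^{-k/(2q)}\psi_k(\mathcal E,\theta,S(t))$. The functions $v_k,\Lambda_k$ ($2\le k\le N$) and $\psi_k,\Omega_k$ ($2\le k\le M$) are determined recursively in $k$ by the requirements: $v_k,\psi_k$ are $2\pi$-periodic in $\theta$ and $2\pi\varkappa$-periodic in $S$ with zero mean over $S\in[0,2\pi\varkappa]$; $\Lambda_k,\Omega_k$ do not depend on $S$; and, when the total derivatives along the $(\mathcal E,\theta)$-system are expanded in powers of $t^{-1/(2q)}$ with coefficients functions of $(\mathcal E,\theta,S)$, the coefficients of $t^{-k/(2q)}$ agree in $\frac{d}{dt}V_N=\sum_{j=2}^Nt^{-j/(2q)}\Lambda_j(V_N,\Psi_M)$ for $k\le N$ and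 in $\frac{d}{dt}\Psi_M=\sum_{j=2}^Mt^{-j/(2q)}\Omega_j(V_N,\Psi_M)$ for $k\le M$. The functions $\Lambda_k(v,\psi)=\mathcal O(v)$ and $\Omega_k(v,\psi)=\mathcal O(1)$ ($v\to0$) are $2\pi$-periodic in $\psi$. Then $v=V_N$, $\psi=\Psi_M$ satisfy $\dot v=\sum_{k=2}^Nt^{-k/(2q)}\Lambda_k(v,\psi)+\tilde\Lambda_N(v,\psi,t)$, $\dot\psi=\sum_{k=2}^Mt^{-k/(2q)}\Omega_k(v,\psi)+\tilde\Omega_M(v,\psi,t)$ with $\tilde\Lambda_N=\mathcal O(t^{-(N+1)/(2q)})$, $\tilde\Omega_M=\mathcal O(t^{-(M+1)/(2q)})$, $\tilde\Lambda_N(0,\psi,t)\equiv0$. Constant $\Delta_0$. Fix $\epsilon\in(0,1)$ and $t_0>1$ such that, with $\mathcal E_0=E_0t_0^{l/(2q)}$ and $\Delta_0=(1-\epsilon)\mathcal E_0$, for all $t\ge t_0$, $\theta\in\mathbb R$, $\mathcal E\in[0,\mathcal E_0]$ one has $|V_N-\mathcal E|\le\epsilon\mathcal E$, $|\Psi_M-\theta|\le\epsilon$, and $(\mathcal E,\theta)\mapsto(v,\psi)$ is invertible for $v\in[0,\Delta_0]$, $\psi\in\mathbb R$. Leading phase term. It is assumed that $\Omega_m(v,\psi)=\omega_{m0}(\psi)+\omega_{m1}(\psi)\sqrt v+\mathcal O(v)$ as $v\to0$, with $2\pi$-periodic $\omega_{m0}\not\equiv0$, $\omega_{m1}$. $\delta_{i,j}$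 is the Kronecker delta. Stability notions. Stable means Lyapunov stable as $t\to\infty$ for the perturbed system in $(x,y)$. Polynomially stable: stable, and there is a constant $\gamma>0$ such that every solution starting sufficiently close to $(0,0)$ satisfies $x^2(t)+y^2(t)\le Ct^{-\gamma}$ for large $t$, $C$ depending on the solution. *)

theory Defs
  imports
    "HOL-Analysis.Analysis"
    "HOL-Library.Landau_Symbols"
    "HOL-Computational_Algebra.Formal_Power_Series"
begin

section \<open>Partial derivatives and smooth functions\<close>

definition pd :: "'a::real_normed_vector \<Rightarrow> ('a \<Rightarrow> real) \<Rightarrow> 'a \<Rightarrow> real" where
  "pd b f x = deriv (\<lambda>h. f (x + h *\<^sub>R b)) 0"

definition pds :: "'a::real_normed_vector list \<Rightarrow> ('a \<Rightarrow> real) \<Rightarrow> 'a \<Rightarrow> real" where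
  "pds bs f = foldr pd bs f"

text \<open>Infinite differentiability; meant for open sets only.\<close>

definition smooth_fun_on :: "'a::euclidean_space set \<Rightarrow> ('a \<Rightarrow> real) \<Rightarrow> bool" where
  "smooth_fun_on U f \<longleftrightarrow>
     (\<forall>bs. set bs \<subseteq> Basis \<longrightarrow> (\<forall>x\<in>U. pds bs f differentiable (at x)))"


section \<open>The data of the perturbed system\<close>

text \<open>
  Functions of several variables take tuples: \<open>(x, y, t)\<close> for \<open>Ham\<close> (\<open>H\<close>) and \<open>Dis\<close> (\<open>F\<close>),
  \<open>(x, y)\<close> for \<open>Ham0\<close> (\<open>H\<^sub>0\<close>), \<open>(x, y, S)\<close> for the coefficients \<open>Ham_co k\<close> (\<open>H\<^sub>k\<close>) and
  \<open>Dis_co k\<close> (\<open>F\<^sub>k\<close>). \<open>phase\<close> is \<open>S(t)\<close> with coefficients \<open>phase_co k\<close> (\<open>s\<^sub>k\<close>);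
  \<open>xper t E\<close>, \<open>yper t E\<close> are the periodic solutions of the limiting system and \<open>freq\<close> is \<open>\<omega>\<close>.
  The last three fields are the coefficients of the expansions at \<open>E = 0\<close>: those of \<open>E\<^sup>j\<close> in
  \<open>\<omega>\<close>, and those of \<open>E\<^bsup>j/2\<^esup>\<close> in \<open>f\<^sub>k\<close> and \<open>g\<^sub>k\<close>, the latter two being functions of
  \<open>(\<phi>, S)\<close>.
\<close>

record osc_system =
  Ham :: "real \<times> real \<times> real \<Rightarrow> real"
  Dis :: "real \<times> real \<times> real \<Rightarrow> real"
  Ham0 :: "real \<times> real \<Rightarrow> real"
  Ham_co :: "nat \<Rightarrow> real \<times> real \<times> real \<Rightarrow> real"
  Dis_co :: "nat \<Rightarrow> real \<times> real \<times> real \<Rightarrow> real"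
  qpar :: nat
  phase :: "real \<Rightarrow> real"
  phase_co :: "nat \<Rightarrow> real"
  kap :: nat
  Emax :: real
  rmax :: real
  xper :: "real \<Rightarrow> real \<Rightarrow> real"
  yper :: "real \<Rightarrow> real \<Rightarrow> real"
  freq :: "real \<Rightarrow> real"
  freq_co :: "nat \<Rightarrow> real"
  act_co :: "nat \<Rightarrow> nat \<Rightarrow> real \<times> real \<Rightarrow> real"
  ang_co :: "nat \<Rightarrow> nat \<Rightarrow> real \<times> real \<Rightarrow> real"

definition vec_field :: "osc_system \<Rightarrow> real \<Rightarrow> real \<times> real \<Rightarrow> real \<times> real" where
  "vec_field P t = (\<lambda>(x, y).
     (pd (0, 1, 0) (Ham P) (x, y, t),
      - pd (1, 0, 0) (Ham P) (x, y, t) + Dis P (x, y, t)))"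

definition vec_field0 :: "osc_system \<Rightarrow> real \<times> real \<Rightarrow> real \<times> real" where
  "vec_field0 P z = (pd (0, 1) (Ham0 P) z, - pd (1, 0) (Ham0 P) z)"

definition solves_on :: "osc_system \<Rightarrow> real set \<Rightarrow> (real \<Rightarrow> real \<times> real) \<Rightarrow> bool" where
  "solves_on P I z \<longleftrightarrow> (\<forall>t\<in>I. (z has_vector_derivative vec_field P t (z t)) (at t within I))"


section \<open>Standing assumptions\<close>

definition convergent_perturbation :: "osc_system \<Rightarrow> bool" where
  "convergent_perturbation P \<longleftrightarrow>
     smooth_fun_on {(x, y, t). 0 < t} (Ham P) \<and>
     smooth_fun_on {(x, y, t). 0 < t} (Dis P) \<and>
     (\<forall>K. compact K \<longrightarrow>
        uniform_limit K (\<lambda>t (x, y). Ham P (x, y, t)) (Ham0 P) at_top \<and>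
        uniform_limit K (\<lambda>t (x, y). Dis P (x, y, t)) (\<lambda>_. 0) at_top) \<and>
     (\<forall>t>0. pd (1, 0, 0) (Ham P) (0, 0, t) = 0 \<and>
            pd (0, 1, 0) (Ham P) (0, 0, t) = 0 \<and>
            Dis P (0, 0, t) = 0)"

text \<open>The coefficients are smooth up to the boundary of the disc \<open>D\<^sub>0\<close>, i.e. near each of its points.\<close>

definition smooth_coefficients :: "osc_system \<Rightarrow> bool" where
  "smooth_coefficients P \<longleftrightarrow>
     (\<exists>U. open U \<and> cball 0 (rmax P) \<subseteq> U \<and> smooth_fun_on U (Ham0 P) \<and>
       (\<forall>k\<ge>1. smooth_fun_on {(x, y, s). (x, y) \<in> U} (Ham_co P k) \<and>
              smooth_fun_on {(x, y, s). (x, y) \<in> U} (Dis_co P k)))"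

text \<open>
  Injectivity on \<open>[0, 2\<pi>/\<omega>)\<close> says that \<open>2\<pi>/\<omega>(E)\<close> is the least period, so that the level line is a
  simple closed curve. Note \<open>norm (x, y) = sqrt (x\<^sup>2 + y\<^sup>2)\<close>.
\<close>

definition center :: "osc_system \<Rightarrow> bool" where
  "center P \<longleftrightarrow>
     (\<lambda>z. Ham0 P z - (norm z)\<^sup>2 / 2) \<in> O[at 0](\<lambda>z. norm z ^ 3) \<and>
     vec_field0 P 0 = 0 \<and> (\<forall>\<^sub>F z in at 0. vec_field0 P z \<noteq> 0) \<and>
     0 < Emax P \<and> 0 < rmax P \<and>
     (\<forall>E\<in>{0<..Emax P}.
        (\<forall>t. ((\<lambda>t. (xper P t E, yper P t E)) has_vector_derivative
                vec_field0 P (xper P t E, yper P t E)) (at t)) \<and>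
        (\<forall>t. xper P (t + 2 * pi / freq P E) E = xper P t E \<and>
             yper P (t + 2 * pi / freq P E) E = yper P t E) \<and>
        inj_on (\<lambda>t. (xper P t E, yper P t E)) {0..<2 * pi / freq P E} \<and>
        range (\<lambda>t. (xper P t E, yper P t E)) = {z \<in> cball 0 (rmax P). Ham0 P z = E}) \<and>
     (\<forall>E\<in>{0..Emax P}. freq P E \<noteq> 0) \<and>
     continuous_on {0..Emax P} (freq P) \<and>
     freq P 0 = 1 \<and> (\<lambda>E. freq P E - 1) \<in> O[at_right 0](\<lambda>E. E)"

text \<open>
  Asymptotic expansions that may be differentiated termwise: the estimate of the remainder holds,
  uniformly in \<open>D\<^sub>0\<close>, for all its iterated partial derivatives. A derivative in \<open>t\<close> does not
  improve the order because of the oscillations, except for the non-oscillating \<open>S\<close>.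
\<close>

definition expansions_at_infinity :: "osc_system \<Rightarrow> bool" where
  "expansions_at_infinity P \<longleftrightarrow>
     1 \<le> qpar P \<and>
     (\<forall>K bs. set bs \<subseteq> Basis \<longrightarrow>
        (\<exists>C T. \<forall>t\<ge>T. \<forall>x y. (x, y) \<in> cball 0 (rmax P) \<longrightarrow>
           \<bar>pds bs (\<lambda>(x, y, t). Ham P (x, y, t) - Ham0 P (x, y)
               - (\<Sum>k=1..K. t powr (- real k / real (qpar P)) * Ham_co P k (x, y, phase P t)))
              (x, y, t)\<bar> \<le> C * t powr (- real (K + 1) / real (qpar P)))) \<and>
     (\<forall>K bs. set bs \<subseteq> Basis \<longrightarrow>
        (\<exists>C T. \<forall>t\<ge>T. \<forall>x y. (x, y) \<in> cball 0 (rmax P) \<longrightarrow>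
           \<bar>pds bs (\<lambda>(x, y, t). Dis P (x, y, t)
               - (\<Sum>k=1..K. t powr (- real k / real (qpar P)) * Dis_co P k (x, y, phase P t)))
              (x, y, t)\<bar> \<le> C * t powr (- real (K + 1) / real (qpar P)))) \<and>
     (\<forall>k\<ge>1. \<forall>x y s. (x, y) \<in> cball 0 (rmax P) \<longrightarrow>
        Ham_co P k (x, y, s + 2 * pi) = Ham_co P k (x, y, s) \<and>
        Dis_co P k (x, y, s + 2 * pi) = Dis_co P k (x, y, s)) \<and>
     (\<forall>k\<ge>1. \<exists>C. \<exists>\<rho>>0. \<forall>x y s. norm (x, y) < \<rho> \<longrightarrow>
        \<bar>Ham_co P k (x, y, s)\<bar> \<le> C * (norm (x, y))\<^sup>2 \<and>
        \<bar>Dis_co P k (x, y, s)\<bar> \<le> C * norm (x, y)) \<and>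
     smooth_fun_on {0<..} (phase P) \<and>
     (\<forall>i. \<exists>C T. \<forall>t\<ge>T.
        \<bar>(deriv ^^ i) (\<lambda>t. phase P t
             - (\<Sum>k<qpar P. phase_co P k * t powr (1 - real k / real (qpar P)))
             - phase_co P (qpar P) * ln t) t\<bar> \<le> C * t powr (- 1 / real (qpar P) - real i)) \<and>
     0 < phase_co P 0"

definition resonance :: "osc_system \<Rightarrow> bool" where
  "resonance P \<longleftrightarrow> 1 \<le> kap P \<and> phase_co P 0 = real (kap P) * freq P 0"


section \<open>Action-angle variables\<close>

definition Xaa :: "osc_system \<Rightarrow> real \<times> real \<Rightarrow> real" where
  "Xaa P = (\<lambda>(\<phi>, E). xper P (\<phi> / freq P E) E)"

definition Yaa :: "osc_system \<Rightarrow> real \<times> real \<Rightarrow> real" where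
  "Yaa P = (\<lambda>(\<phi>, E). yper P (\<phi> / freq P E) E)"

text \<open>
  \<open>f = act_rate P H F\<close> and \<open>g = ang_rate P H F - \<omega>(E)\<close>. Both rates are linear in \<open>(H, F)\<close>, and
  \<open>H\<^sub>0(X, Y) = E\<close> contributes \<open>0\<close> to \<open>f\<close> and \<open>\<omega>(E)\<close> to \<open>ang_rate\<close>. Hence \<open>f\<^sub>k\<close> and \<open>g\<^sub>k\<close>, the
  coefficients of \<open>t\<^bsup>-k/q\<^esup>\<close> in \<open>f\<close> and \<open>g\<close>, arise by inserting \<open>H\<^sub>k\<close> and \<open>F\<^sub>k\<close>.
\<close>

definition act_rate ::
  "osc_system \<Rightarrow> (real \<times> real \<times> real \<Rightarrow> real) \<Rightarrow> (real \<times> real \<times> real \<Rightarrow> real)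
     \<Rightarrow> real \<times> real \<times> real \<Rightarrow> real" where
  "act_rate P h d = (\<lambda>(E, \<phi>, s).
     - freq P E *
       (deriv (\<lambda>\<phi>. h (Xaa P (\<phi>, E), Yaa P (\<phi>, E), s)) \<phi>
        - d (Xaa P (\<phi>, E), Yaa P (\<phi>, E), s) * deriv (\<lambda>\<phi>. Xaa P (\<phi>, E)) \<phi>))"

definition ang_rate ::
  "osc_system \<Rightarrow> (real \<times> real \<times> real \<Rightarrow> real) \<Rightarrow> (real \<times> real \<times> real \<Rightarrow> real)
     \<Rightarrow> real \<times> real \<times> real \<Rightarrow> real" where
  "ang_rate P h d = (\<lambda>(E, \<phi>, s).
     freq P E *
       (deriv (\<lambda>E. h (Xaa P (\<phi>, E), Yaa P (\<phi>, E), s)) E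
        - d (Xaa P (\<phi>, E), Yaa P (\<phi>, E), s) * deriv (\<lambda>E. Xaa P (\<phi>, E)) E))"

definition f_co :: "osc_system \<Rightarrow> nat \<Rightarrow> real \<times> real \<times> real \<Rightarrow> real" where
  "f_co P k = act_rate P (Ham_co P k) (Dis_co P k)"

definition g_co :: "osc_system \<Rightarrow> nat \<Rightarrow> real \<times> real \<times> real \<Rightarrow> real" where
  "g_co P k = ang_rate P (Ham_co P k) (Dis_co P k)"

text \<open>
  Expansions as \<open>E \<rightarrow> 0\<close>, uniform in the other variables and differentiable termwise: each
  derivative in \<open>E\<close> (counted by \<open>count_list\<close>) lowers the order of the remainder by one.
\<close>

definition expansions_at_zero :: "osc_system \<Rightarrow> bool" where
  "expansions_at_zero P \<longleftrightarrow>
     smooth_fun_on (UNIV \<times> {0<..<Emax P}) (Xaa P) \<and>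
     smooth_fun_on (UNIV \<times> {0<..<Emax P}) (Yaa P) \<and>
     smooth_fun_on {0<..<Emax P} (freq P) \<and>
     (\<forall>bs. set bs \<subseteq> Basis \<longrightarrow>
        (\<exists>C. \<exists>\<eta>>0. \<forall>E\<in>{0<..<\<eta>}. \<forall>\<phi>.
           \<bar>pds bs (\<lambda>(\<phi>, E). Xaa P (\<phi>, E) - sqrt (2 * E) * cos \<phi>) (\<phi>, E)\<bar>
             \<le> C * E powr (1 - real (count_list bs (0, 1))) \<and>
           \<bar>pds bs (\<lambda>(\<phi>, E). Yaa P (\<phi>, E) + sqrt (2 * E) * sin \<phi>) (\<phi>, E)\<bar>
             \<le> C * E powr (1 - real (count_list bs (0, 1))))) \<and>
     (\<forall>J i. \<exists>C. \<exists>\<eta>>0. \<forall>E\<in>{0<..<\<eta>}.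
        \<bar>(deriv ^^ i) (\<lambda>E. freq P E - (\<Sum>j\<le>J. freq_co P j * E ^ j)) E\<bar>
          \<le> C * E powr (real (J + 1) - real i)) \<and>
     (\<forall>k\<ge>1. \<forall>j. smooth_fun_on UNIV (act_co P k j) \<and> smooth_fun_on UNIV (ang_co P k j)) \<and>
     (\<forall>k\<ge>1. \<forall>J\<ge>1. \<forall>bs. set bs \<subseteq> Basis \<longrightarrow>
        (\<exists>C. \<exists>\<eta>>0. \<forall>E\<in>{0<..<\<eta>}. \<forall>\<phi> s.
           \<bar>pds bs (\<lambda>(E, \<phi>, s). f_co P k (E, \<phi>, s)
               - (\<Sum>j=2..J. E powr (real j / 2) * act_co P k j (\<phi>, s))) (E, \<phi>, s)\<bar>
             \<le> C * E powr (real (J + 1) / 2 - real (count_list bs (1, 0, 0))))) \<and>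
     (\<forall>k\<ge>1. \<forall>J. \<forall>bs. set bs \<subseteq> Basis \<longrightarrow>
        (\<exists>C. \<exists>\<eta>>0. \<forall>E\<in>{0<..<\<eta>}. \<forall>\<phi> s.
           \<bar>pds bs (\<lambda>(E, \<phi>, s). g_co P k (E, \<phi>, s)
               - (\<Sum>j\<le>J. E powr (real j / 2) * ang_co P k j (\<phi>, s))) (E, \<phi>, s)\<bar>
             \<le> C * E powr (real (J + 1) / 2 - real (count_list bs (1, 0, 0)))))"

definition standing_assumptions :: "osc_system \<Rightarrow> bool" where
  "standing_assumptions P \<longleftrightarrow>
     convergent_perturbation P \<and> smooth_coefficients P \<and> center P \<and>
     expansions_at_infinity P \<and> resonance P \<and> expansions_at_zero P"


section \<open>Scaling\<close>

text \<open>
  In the following, \<open>\<tau> = t\<^bsup>-1/(2q)\<^esup>\<close> is the variable of the formal power series, \<open>e\<close> stands for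
  the scaled energy \<open>\<E> = t\<^bsup>l/q\<^esup> E\<close>, and \<open>S_co P p\<close> is the coefficient of \<open>\<tau>\<^sup>p\<close> in \<open>S'(t)\<close>.
\<close>

definition S_co :: "osc_system \<Rightarrow> nat \<Rightarrow> real" where
  "S_co P p =
     (if p = 2 * qpar P then phase_co P (qpar P)
      else if even p \<and> p < 2 * qpar P
        then (1 - real (p div 2) / real (qpar P)) * phase_co P (p div 2)
      else 0)"

text \<open>
  Coefficients of \<open>\<tau>\<^sup>p\<close> in \<open>\<F>\<close> and \<open>\<G>\<close>. For \<open>l \<ge> 1\<close> the term \<open>E\<^bsup>j/2\<^esup>\<close> of \<open>f\<^sub>k\<close> gives the
  exponent \<open>p = 2k + l(j - 2)\<close>, that of \<open>g\<^sub>k\<close> gives \<open>p = 2k + lj\<close>, and the term \<open>E\<^sup>j\<close> of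
  \<open>\<omega>\<close> gives \<open>p = 2lj\<close>. For \<open>l = 0\<close> the energy is not rescaled, so nothing is expanded at
  \<open>E = 0\<close>. The coefficients with \<open>p < 2\<close> vanish, that of \<open>\<G>\<close> for \<open>p = 0\<close> by the resonance.
\<close>

definition scaled_F :: "osc_system \<Rightarrow> nat \<Rightarrow> nat \<Rightarrow> real \<times> real \<times> real \<Rightarrow> real" where
  "scaled_F P l p = (\<lambda>(e, \<theta>, s).
     if l = 0 then
       (if even p \<and> 2 \<le> p then f_co P (p div 2) (e, \<theta> + s / real (kap P), s) else 0)
     else
       (\<Sum>(k, j) \<in> {(k, j). k \<in> {1..p} \<and> j \<in> {2..p + 2} \<and> 2 * k + l * (j - 2) = p}.
          e powr (real j / 2) * act_co P k j (\<theta> + s / real (kap P), s)))"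

definition scaled_G :: "osc_system \<Rightarrow> nat \<Rightarrow> nat \<Rightarrow> real \<times> real \<times> real \<Rightarrow> real" where
  "scaled_G P l p = (\<lambda>(e, \<theta>, s).
     (if l = 0 then
        (if p = 0 then freq P e else 0) +
        (if even p \<and> 2 \<le> p then g_co P (p div 2) (e, \<theta> + s / real (kap P), s) else 0)
      else
        (\<Sum>j \<in> {j. j \<le> p \<and> 2 * l * j = p}. freq_co P j * e ^ j) +
        (\<Sum>(k, j) \<in> {(k, j). k \<in> {1..p} \<and> j \<in> {0..p} \<and> 2 * k + l * j = p}.
           e powr (real j / 2) * ang_co P k j (\<theta> + s / real (kap P), s)))
     - S_co P p / real (kap P))"


section \<open>Averaging\<close>

text \<open>
  Coefficients of \<open>\<tau>\<^sup>k\<close> in \<open>V\<^sub>N\<close> (with \<open>b (e, \<theta>, s) = e\<close>) and \<open>\<Psi>\<^sub>M\<close> (with \<open>b (e, \<theta>, s) = \<theta>\<close>),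
  as functions of \<open>(e, \<theta>, s)\<close>.
\<close>

definition near_id_co ::
  "(real \<times> real \<times> real \<Rightarrow> real) \<Rightarrow> (nat \<Rightarrow> real \<times> real \<times> real \<Rightarrow> real) \<Rightarrow> nat \<Rightarrow> nat
     \<Rightarrow> real \<times> real \<times> real \<Rightarrow> real" where
  "near_id_co b w N k =
     (if k = 0 then b else if 2 \<le> k \<and> k \<le> N then w k else (\<lambda>_. 0))"

definition V_co ::
  "(nat \<Rightarrow> real \<times> real \<times> real \<Rightarrow> real) \<Rightarrow> nat \<Rightarrow> nat \<Rightarrow> real \<times> real \<times> real \<Rightarrow> real" where
  "V_co w N = near_id_co (\<lambda>(e, \<theta>, s). e) w N"

definition Psi_co ::
  "(nat \<Rightarrow> real \<times> real \<times> real \<Rightarrow> real) \<Rightarrow> nat \<Rightarrow> nat \<Rightarrow> real \<times> real \<times> real \<Rightarrow> real" where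
  "Psi_co w M = near_id_co (\<lambda>(e, \<theta>, s). \<theta>) w M"

definition V_fun ::
  "osc_system \<Rightarrow> (nat \<Rightarrow> real \<times> real \<times> real \<Rightarrow> real) \<Rightarrow> nat \<Rightarrow> real \<Rightarrow> real \<Rightarrow> real \<Rightarrow> real" where
  "V_fun P w N e \<theta> t =
     e + (\<Sum>k=2..N. t powr (- real k / real (2 * qpar P)) * w k (e, \<theta>, phase P t))"

definition Psi_fun ::
  "osc_system \<Rightarrow> (nat \<Rightarrow> real \<times> real \<times> real \<Rightarrow> real) \<Rightarrow> nat \<Rightarrow> real \<Rightarrow> real \<Rightarrow> real \<Rightarrow> real" where
  "Psi_fun P w M e \<theta> t =
     \<theta> + (\<Sum>k=2..M. t powr (- real k / real (2 * qpar P)) * w k (e, \<theta>, phase P t))"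

text \<open>
  Expansion in \<open>\<tau>\<close> of the derivative of \<open>\<Sum>\<^sub>k \<tau>\<^sup>k W\<^sub>k(e, \<theta>, S(t))\<close> along
  \<open>de/dt = \<F> + t\<^sup>-\<^sup>1 (l/q) e\<close>, \<open>d\<theta>/dt = \<G>\<close>, where \<open>t\<^sup>-\<^sup>1 = \<tau>\<^bsup>2q\<^esup>\<close> and
  \<open>d\<tau>/dt = - \<tau>\<^bsup>2q+1\<^esup> / (2q)\<close>.
\<close>

definition total_deriv ::
  "osc_system \<Rightarrow> nat \<Rightarrow> (nat \<Rightarrow> real \<times> real \<times> real \<Rightarrow> real) \<Rightarrow> real \<times> real \<times> real
     \<Rightarrow> real fps" where
  "total_deriv P l W = (\<lambda>(e, \<theta>, s).
     (Abs_fps (\<lambda>p. scaled_F P l p (e, \<theta>, s))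
        + fps_const (real l / real (qpar P) * e) * fps_X ^ (2 * qpar P))
       * Abs_fps (\<lambda>k. pd (1, 0, 0) (W k) (e, \<theta>, s))
     + Abs_fps (\<lambda>p. scaled_G P l p (e, \<theta>, s)) * Abs_fps (\<lambda>k. pd (0, 1, 0) (W k) (e, \<theta>, s))
     + Abs_fps (S_co P) * Abs_fps (\<lambda>k. pd (0, 0, 1) (W k) (e, \<theta>, s))
     - fps_const (1 / real (2 * qpar P)) * fps_X ^ (2 * qpar P + 1)
         * fps_deriv (Abs_fps (\<lambda>k. W k (e, \<theta>, s))))"

definition taylor_fps :: "(real \<Rightarrow> real) \<Rightarrow> real fps" where
  "taylor_fps h = Abs_fps (\<lambda>i. (deriv ^^ i) h 0 / fact i)"

text \<open>Expansion in \<open>\<tau>\<close> of \<open>\<Sum>\<^sub>j \<tau>\<^sup>j L\<^sub>j(V\<^sub>N, \<Psi>\<^sub>M)\<close>, \<open>j = 2, \<dots>, J\<close>.\<close>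

definition averaged_rhs ::
  "(nat \<Rightarrow> real \<times> real \<Rightarrow> real) \<Rightarrow> nat \<Rightarrow>
   (nat \<Rightarrow> real \<times> real \<times> real \<Rightarrow> real) \<Rightarrow> nat \<Rightarrow>
   (nat \<Rightarrow> real \<times> real \<times> real \<Rightarrow> real) \<Rightarrow> nat \<Rightarrow> real \<times> real \<times> real \<Rightarrow> real fps" where
  "averaged_rhs L J w N u M x =
     (\<Sum>j=2..J. fps_X ^ j *
        taylor_fps (\<lambda>\<tau>. L j (\<Sum>k\<le>N. \<tau> ^ k * V_co w N k x, \<Sum>k\<le>M. \<tau> ^ k * Psi_co u M k x)))"

definition periodic_zero_mean ::
  "osc_system \<Rightarrow> real \<Rightarrow> (real \<times> real \<times> real \<Rightarrow> real) \<Rightarrow> bool" where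
  "periodic_zero_mean P R w \<longleftrightarrow>
     (\<forall>e\<in>{0..R}. \<forall>\<theta> s.
        w (e, \<theta> + 2 * pi, s) = w (e, \<theta>, s) \<and>
        w (e, \<theta>, s + 2 * pi * real (kap P)) = w (e, \<theta>, s)) \<and>
     (\<forall>e\<in>{0..R}. \<forall>\<theta>. integral {0..2 * pi * real (kap P)} (\<lambda>s. w (e, \<theta>, s)) = 0)"

text \<open>
  The functions \<open>v\<^sub>k, \<Lambda>\<^sub>k\<close> (\<open>2 \<le> k \<le> N\<close>) and \<open>\<psi>\<^sub>k, \<Omega>\<^sub>k\<close> (\<open>2 \<le> k \<le> M\<close>) of the averaging
  procedure, for energies \<open>0 \<le> e \<le> R\<close>.
\<close>

definition averaging ::
  "osc_system \<Rightarrow> nat \<Rightarrow> real \<Rightarrow> nat \<Rightarrow> nat \<Rightarrow>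
   (nat \<Rightarrow> real \<times> real \<times> real \<Rightarrow> real) \<Rightarrow> (nat \<Rightarrow> real \<times> real \<Rightarrow> real) \<Rightarrow>
   (nat \<Rightarrow> real \<times> real \<times> real \<Rightarrow> real) \<Rightarrow> (nat \<Rightarrow> real \<times> real \<Rightarrow> real) \<Rightarrow> bool" where
  "averaging P l R N M w \<Lambda> u \<Omega> \<longleftrightarrow>
     2 \<le> N \<and> 2 \<le> M \<and>
     (\<forall>k\<in>{2..N}.
        continuous_on ({0..R} \<times> UNIV \<times> UNIV) (w k) \<and>
        smooth_fun_on ({0<..<R} \<times> UNIV \<times> UNIV) (w k) \<and>
        periodic_zero_mean P R (w k) \<and>
        continuous_on ({0..R} \<times> UNIV) (\<Lambda> k) \<and>
        smooth_fun_on ({0<..<R} \<times> UNIV) (\<Lambda> k)) \<and>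
     (\<forall>k\<in>{2..M}.
        continuous_on ({0..R} \<times> UNIV \<times> UNIV) (u k) \<and>
        smooth_fun_on ({0<..<R} \<times> UNIV \<times> UNIV) (u k) \<and>
        periodic_zero_mean P R (u k) \<and>
        continuous_on ({0..R} \<times> UNIV) (\<Omega> k) \<and>
        smooth_fun_on ({0<..<R} \<times> UNIV) (\<Omega> k)) \<and>
     (\<forall>x \<in> {0<..<R} \<times> UNIV \<times> UNIV.
        (\<forall>k\<le>N. fps_nth (total_deriv P l (V_co w N) x) k
                = fps_nth (averaged_rhs \<Lambda> N w N u M x) k) \<and>
        (\<forall>k\<le>M. fps_nth (total_deriv P l (Psi_co u M) x) k
                = fps_nth (averaged_rhs \<Omega> M w N u M x) k))"

text \<open>
  For \<open>l = 1\<close>, the first nonzero \<open>\<Omega>\<^sub>m\<close> vanishes identically at \<open>v = 0\<close>; only then \<open>l > 1\<close> is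
  called for.
\<close>

definition unit_scaling_degenerate :: "osc_system \<Rightarrow> bool" where
  "unit_scaling_degenerate P \<longleftrightarrow>
     (\<exists>R>0. \<exists>N m w \<Lambda> u \<Omega>. averaging P 1 R N m w \<Lambda> u \<Omega> \<and>
        (\<forall>i\<in>{2..<m}. \<forall>v\<in>{0..R}. \<forall>\<psi>. \<Omega> i (v, \<psi>) = 0) \<and>
        (\<exists>v\<in>{0..R}. \<exists>\<psi>. \<Omega> m (v, \<psi>) \<noteq> 0) \<and>
        (\<forall>\<psi>. \<Omega> m (0, \<psi>) = 0))"

definition scaling_exponent :: "osc_system \<Rightarrow> nat \<Rightarrow> bool" where
  "scaling_exponent P l \<longleftrightarrow>
     (if \<exists>c. \<forall>E\<in>{0..Emax P}. freq P E = c then l = 0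
      else l = 1 \<or> (1 < l \<and> unit_scaling_degenerate P))"

text \<open>\<open>\<E>\<^sub>0 = E\<^sub>0 t\<^sub>0\<^bsup>l/(2q)\<^esup>\<close> and \<open>\<Delta>\<^sub>0 = (1 - \<epsilon>) \<E>\<^sub>0\<close>.\<close>

definition scaled_Emax :: "osc_system \<Rightarrow> nat \<Rightarrow> real \<Rightarrow> real" where
  "scaled_Emax P l t0 = Emax P * t0 powr (real l / real (2 * qpar P))"

definition Delta0 :: "osc_system \<Rightarrow> nat \<Rightarrow> real \<Rightarrow> real \<Rightarrow> real" where
  "Delta0 P l \<epsilon> t0 = (1 - \<epsilon>) * scaled_Emax P l t0"

definition near_identity ::
  "osc_system \<Rightarrow> nat \<Rightarrow> nat \<Rightarrow> nat \<Rightarrow> (nat \<Rightarrow> real \<times> real \<times> real \<Rightarrow> real)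
     \<Rightarrow> (nat \<Rightarrow> real \<times> real \<times> real \<Rightarrow> real) \<Rightarrow> real \<Rightarrow> real \<Rightarrow> bool" where
  "near_identity P l N M w u \<epsilon> t0 \<longleftrightarrow>
     0 < \<epsilon> \<and> \<epsilon> < 1 \<and> 1 < t0 \<and>
     (\<forall>t\<ge>t0.
        (\<forall>e\<in>{0..scaled_Emax P l t0}. \<forall>\<theta>.
           \<bar>V_fun P w N e \<theta> t - e\<bar> \<le> \<epsilon> * e \<and> \<bar>Psi_fun P u M e \<theta> t - \<theta>\<bar> \<le> \<epsilon>) \<and>
        (\<forall>v\<in>{0..Delta0 P l \<epsilon> t0}. \<forall>\<psi>. \<exists>!(e, \<theta>).
           e \<in> {0..scaled_Emax P l t0} \<and> V_fun P w N e \<theta> t = v \<and> Psi_fun P u M e \<theta> t = \<psi>))"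

definition leading_phase_term :: "(real \<times> real \<Rightarrow> real) \<Rightarrow> bool" where
  "leading_phase_term L \<longleftrightarrow>
     (\<exists>a b. (\<forall>\<psi>. a (\<psi> + 2 * pi) = a \<psi> \<and> b (\<psi> + 2 * pi) = b \<psi>) \<and> (\<exists>\<psi>. a \<psi> \<noteq> 0) \<and>
        (\<exists>C. \<exists>\<eta>>0. \<forall>v\<in>{0..<\<eta>}. \<forall>\<psi>. \<bar>L (v, \<psi>) - (a \<psi> + b \<psi> * sqrt v)\<bar> \<le> C * v))"


section \<open>Stability\<close>

text \<open>
  Solutions starting near the origin exist for all later times. As \<open>T\<close> is arbitrary, the estimate
  covers every solution, whatever its interval of existence.
\<close>

definition lyapunov_stable :: "osc_system \<Rightarrow> bool" where
  "lyapunov_stable P \<longleftrightarrow>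
     (\<forall>t1>0. \<forall>\<epsilon>>0. \<exists>\<delta>>0.
        (\<forall>z0. norm z0 < \<delta> \<longrightarrow> (\<exists>z. solves_on P {t1..} z \<and> z t1 = z0)) \<and>
        (\<forall>T>t1. \<forall>z. solves_on P {t1..<T} z \<and> norm (z t1) < \<delta> \<longrightarrow>
           (\<forall>t\<in>{t1..<T}. norm (z t) < \<epsilon>)))"

definition polynomially_stable :: "osc_system \<Rightarrow> bool" where
  "polynomially_stable P \<longleftrightarrow>
     lyapunov_stable P \<and>
     (\<exists>\<gamma>>0. \<forall>t1>0. \<exists>\<delta>>0. \<forall>z. solves_on P {t1..} z \<and> norm (z t1) < \<delta> \<longrightarrow>
        (\<exists>C. \<forall>\<^sub>F t in at_top. (fst (z t))\<^sup>2 + (snd (z t))\<^sup>2 \<le> C * t powr (- \<gamma>)))"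

end

theory Submission
  imports Defs
begin

text \<open>
  The near-identity transformation, truncated at the order \<open>n\<close> of the first nonzero \<open>\<Lambda>\<^sub>n\<close>, already
  decides: the higher averaged terms only enter through a remainder. The functions \<open>v\<^sub>k\<close> carry no
  a priori bound near \<open>\<E> = 0\<close>, but their defining recursion expresses \<open>\<partial>v\<^sub>k/\<partial>S\<close> through functions with a
  power-like behaviour \<open>O(\<E>\<^sup>a)\<close> that is preserved by differentiation (symbols), so that a zero mean forces
  \<open>v\<^sub>k = O(\<E>)\<close>, again with all derivatives. Hence, with \<open>\<tau> = t\<^bsup>-1/(2q)\<^esup>\<close>, the truncated \<open>V\<close> is comparable to
  \<open>\<E>\<close> and satisfies \<open>dV/dt \<le> - c \<tau>\<^sup>n \<E>\<^bsup>(\<sigma>+1)/2\<^esup> + C \<tau>\<^bsup>n+1\<^esup> \<E>\<close>. On the barrier \<open>V = t\<^sup>-\<^sup>a\<close> with small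
  \<open>a > 0\<close> the right-hand side is smaller than the derivative of \<open>t\<^sup>-\<^sup>a\<close>, so that \<open>V\<close> stays below it; this
  bounds \<open>x\<^sup>2 + y\<^sup>2\<close> by a multiple of \<open>t\<^sup>-\<^sup>a\<close>.
\<close>

section \<open>Smooth functions\<close>

text \<open>The averaging relations equate coefficients of formal series, whereas the decay needs
  inequalities for the true system with errors proportional to the energy down to the origin.
  Continuity of the \<open>v_k\<close> at \<open>e = 0\<close> gives no bound on their derivatives,
  which enter through the chain rule; the symbol calculus supplies it. Likewise the gradient of the
  remainder of \<open>H\<close> and the remainder of \<open>F\<close> must gain a factor
  \<open>r\<close>, which they do because both vanish at the origin. From
  \<open>n + d < m \<le> 2q\<close> follows \<open>n < 2q\<close>, so that the rescaling term
  \<open>(l/q) e / t\<close> and the explicit time dependence of \<open>\<tau>\<close> have size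
  \<open>\<tau>^(n+1) e\<close>. The leading coefficient is negative and periodic in the phase,
  hence bounded away from zero, and the estimate is uniform in the phase. Two further obstacles: the
  angle is no continuous function of the point, so the averaged energy is differentiated through
  local inverses of the action-angle map; and stability includes existence for all later times,
  obtained from a contraction and the a priori bound.\<close>

lemma pd_has_derivative:
  assumes "(f has_derivative f') (at x)"
  shows "pd b f x = f' b"
proof -
  have "((\<lambda>h::real. x + h *\<^sub>R b) has_derivative (\<lambda>h. h *\<^sub>R b)) (at 0)"
    by (auto intro!: derivative_eq_intros)
  moreover have "(f has_derivative f') (at (x + 0 *\<^sub>R b))" using assms by simp
  ultimately have "((\<lambda>h. f (x + h *\<^sub>R b)) has_derivative (\<lambda>h. f' (h *\<^sub>R b))) (at 0)"
    by (rule has_derivative_compose)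
  moreover have "(\<lambda>h. f' (h *\<^sub>R b)) = (*) (f' b)"
    using has_derivative_linear[OF assms] by (auto simp: linear_cmul)
  ultimately show ?thesis
    unfolding pd_def has_field_derivative_def[symmetric] by (metis DERIV_imp_deriv has_field_derivative_def)
qed

text \<open>\<open>pd\<close> is a bare \<open>deriv\<close>, meaningful only where the derivative
  exists. Differentiability at a point of the line turns it into a genuine derivative statement
  there, which is the form that the mean value theorem needs.\<close>

lemma pd_along:
  assumes "f differentiable (at (x + h *\<^sub>R b))"
  shows "((\<lambda>h. f (x + h *\<^sub>R b)) has_real_derivative pd b f (x + h *\<^sub>R b)) (at h)"
proof -
  obtain f' where f': "(f has_derivative f') (at (x + h *\<^sub>R b))"
    using assms differentiable_def by blast
  have "((\<lambda>h::real. x + h *\<^sub>R b) has_derivative (\<lambda>h. h *\<^sub>R b)) (at h)"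
    by (auto intro!: derivative_eq_intros)
  from has_derivative_compose[OF this f']
  have "((\<lambda>h. f (x + h *\<^sub>R b)) has_derivative (\<lambda>h. f' (h *\<^sub>R b))) (at h)" .
  moreover have "(\<lambda>h. f' (h *\<^sub>R b)) = (*) (f' b)"
    using has_derivative_linear[OF f'] by (auto simp: linear_cmul)
  ultimately show ?thesis
    using pd_has_derivative[OF f', of b] by (simp add: has_field_derivative_def)
qed

lemma differentiable_pd:
  fixes f :: "'a::euclidean_space \<Rightarrow> real"
  assumes "f differentiable (at x)"
  shows "(f has_derivative (\<lambda>v. \<Sum>b\<in>Basis. (v \<bullet> b) * pd b f x)) (at x)"
proof -
  obtain f' where f': "(f has_derivative f') (at x)"
    using assms differentiable_def by blast
  have "f' = (\<lambda>v. \<Sum>b\<in>Basis. (v \<bullet> b) * pd b f x)"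
  proof
    fix v
    have "f' v = f' (\<Sum>b\<in>Basis. (v \<bullet> b) *\<^sub>R b)" by (simp add: euclidean_representation)
    also have "\<dots> = (\<Sum>b\<in>Basis. (v \<bullet> b) * f' b)"
      using has_derivative_linear[OF f'] by (simp add: linear_sum linear_cmul)
    finally show "f' v = (\<Sum>b\<in>Basis. (v \<bullet> b) * pd b f x)"
      unfolding pd_has_derivative[OF f'] .
  qed
  with f' show ?thesis by simp
qed

lemma Basis_real2: "(Basis :: (real \<times> real) set) = {(1, 0), (0, 1)}"
  by (auto simp: Basis_prod_def zero_prod_def)

lemma Basis_real3: "(Basis :: (real \<times> real \<times> real) set) = {(1, 0, 0), (0, 1, 0), (0, 0, 1)}"
  by (auto simp: Basis_prod_def zero_prod_def)

lemma differentiable_pd2: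
  fixes f :: "real \<times> real \<Rightarrow> real"
  assumes "f differentiable (at x)"
  shows "(f has_derivative (\<lambda>(a, b). a * pd (1, 0) f x + b * pd (0, 1) f x)) (at x)"
  using differentiable_pd[OF assms] by (simp add: Basis_real2 case_prod_unfold inner_prod_def)

lemma differentiable_pd3:
  fixes f :: "real \<times> real \<times> real \<Rightarrow> real"
  assumes "f differentiable (at x)"
  shows "(f has_derivative
    (\<lambda>(a, b, c). a * pd (1, 0, 0) f x + b * pd (0, 1, 0) f x + c * pd (0, 0, 1) f x)) (at x)"
  using differentiable_pd[OF assms]
  by (simp add: Basis_real3 case_prod_unfold inner_prod_def add.assoc)

text \<open>The line through \<open>x\<close> stays in the open set \<open>U\<close> for small
  \<open>h\<close>, so the derivative sees only values in \<open>U\<close>. Every later identity on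
  an open set is differentiated through this.\<close>

lemma pd_cong:
  assumes "open U" "x \<in> U" "\<And>y. y \<in> U \<Longrightarrow> f y = g y"
  shows "pd b f x = pd b g x"
proof -
  have "((\<lambda>h::real. x + h *\<^sub>R b) \<longlongrightarrow> x + 0 *\<^sub>R b) (at 0)"
    by (intro tendsto_intros)
  then have "\<forall>\<^sub>F h in at 0. x + h *\<^sub>R b \<in> U"
    using assms(1,2) topological_tendstoD by fastforce
  then have "\<forall>\<^sub>F h::real in nhds 0. f (x + h *\<^sub>R b) = g (x + h *\<^sub>R b)"
    using assms unfolding eventually_at_filter
    by (auto elim!: eventually_mono)
  then show ?thesis unfolding pd_def by (rule deriv_cong_ev) simp
qed

lemma differentiable_cong_open:
  assumes "open U" "x \<in> U" "\<And>y. y \<in> U \<Longrightarrow> f y = g y" "f differentiable (at x)"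
  shows "g differentiable (at x)"
proof -
  obtain f' where "(f has_derivative f') (at x)"
    using assms(4) differentiable_def by blast
  then have "(g has_derivative f') (at x)"
    by (rule has_derivative_transform_within_open[OF _ assms(1,2)]) (use assms(3) in auto)
  then show ?thesis unfolding differentiable_def by blast
qed

text \<open>The head of the list is the outermost derivative. \<open>pds_snoc\<close> peels off the
  innermost one instead, which is what the Leibniz and chain rules act on first.\<close>

lemma pds_Nil [simp]: "pds [] f = f" and pds_Cons [simp]: "pds (b # bs) f = pd b (pds bs f)"
  and pds_snoc: "pds (bs @ [b]) f = pds bs (pd b f)"
  by (simp_all add: pds_def)

lemma pds_cong:
  assumes "open U" "x \<in> U" "\<And>y. y \<in> U \<Longrightarrow> f y = g y"
  shows "pds bs f x = pds bs g x"
  using assms(2)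
proof (induction bs arbitrary: x)
  case (Cons b bs)
  then show ?case using pd_cong[OF assms(1), of x "pds bs f" "pds bs g"] by simp
qed (simp add: assms)

lemma pd_translate:
  assumes "open U" "x \<in> U" "\<And>y. y \<in> U \<Longrightarrow> f (y + p) = f y"
  shows "pd b f (x + p) = pd b f x"
proof -
  have "pd b f (x + p) = pd b (\<lambda>y. f (y + p)) x"
    by (simp add: pd_def add_ac)
  also have "\<dots> = pd b f x" by (rule pd_cong[OF assms(1,2)]) (use assms(3) in auto)
  finally show ?thesis .
qed

lemma pds_translate:
  assumes "open U" "x \<in> U" "\<And>y. y \<in> U \<Longrightarrow> f (y + p) = f y"
  shows "pds bs f (x + p) = pds bs f x"
  using assms(2)
proof (induction bs arbitrary: x)
  case (Cons b bs)
  then show ?case using pd_translate[OF assms(1), of x "pds bs f" p] by simp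
qed (simp add: assms)

text \<open>Smoothness up to a finite order. Products and compositions bring back the
  undifferentiated functions, so their smoothness needs an induction on the order, and
  \<open>smooth_fun_on\<close> has no order to induct on.\<close>

definition diff_upto :: "nat \<Rightarrow> 'a::euclidean_space set \<Rightarrow> ('a \<Rightarrow> real) \<Rightarrow> bool" where
  "diff_upto n U f \<longleftrightarrow>
     (\<forall>bs. set bs \<subseteq> Basis \<and> length bs \<le> n \<longrightarrow> (\<forall>x\<in>U. pds bs f differentiable (at x)))"

lemma smooth_fun_on_diff_upto: "smooth_fun_on U f \<longleftrightarrow> (\<forall>n. diff_upto n U f)"
  unfolding smooth_fun_on_def diff_upto_def by blast

lemma diff_upto_0: "diff_upto 0 U f \<longleftrightarrow> (\<forall>x\<in>U. f differentiable (at x))"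
  by (auto simp: diff_upto_def)

text \<open>The recursion differentiates \<open>f\<close> first and imposes the remaining
  derivatives on \<open>pd b f\<close>; this corresponds to removing the last list element.\<close>

lemma diff_upto_Suc:
  "diff_upto (Suc n) U f \<longleftrightarrow>
     (\<forall>x\<in>U. f differentiable (at x)) \<and> (\<forall>b\<in>Basis. diff_upto n U (pd b f))"
proof (intro iffI conjI ballI)
  assume *: "diff_upto (Suc n) U f"
  { fix x assume "x \<in> U" with * show "f differentiable (at x)"
      unfolding diff_upto_def by (metis empty_set empty_subsetI le0 list.size(3) pds_Nil) }
  fix b :: 'a assume "b \<in> Basis"
  show "diff_upto n U (pd b f)" unfolding diff_upto_def
  proof (intro allI impI ballI)
    fix bs :: "'a list" and x assume "set bs \<subseteq> Basis \<and> length bs \<le> n" "x \<in> U"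
    then have "pds (bs @ [b]) f differentiable (at x)"
      using * \<open>b \<in> Basis\<close> unfolding diff_upto_def by simp
    then show "pds bs (pd b f) differentiable (at x)" by (simp add: pds_snoc)
  qed
next
  assume *: "(\<forall>x\<in>U. f differentiable (at x)) \<and> (\<forall>b\<in>Basis. diff_upto n U (pd b f))"
  show "diff_upto (Suc n) U f" unfolding diff_upto_def
  proof (intro allI impI ballI)
    fix bs :: "'a list" and x assume bs: "set bs \<subseteq> Basis \<and> length bs \<le> Suc n" and x: "x \<in> U"
    show "pds bs f differentiable (at x)"
    proof (cases bs rule: rev_cases)
      case Nil then show ?thesis using * x by simp
    next
      case (snoc cs c)
      with bs have "diff_upto n U (pd c f)" "set cs \<subseteq> Basis" "length cs \<le> n" using * by auto
      then show ?thesis using snoc x by (simp add: pds_snoc diff_upto_def)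
    qed
  qed
qed

lemma diff_upto_mono: "diff_upto n U f \<Longrightarrow> m \<le> n \<Longrightarrow> V \<subseteq> U \<Longrightarrow> diff_upto m V f"
  unfolding diff_upto_def by (meson le_trans subsetD)

lemma diff_upto_differentiable: "diff_upto n U f \<Longrightarrow> x \<in> U \<Longrightarrow> f differentiable (at x)"
  using diff_upto_mono[of n U f 0 U] by (auto simp: diff_upto_0)

lemma diff_upto_cong:
  assumes "open U" "\<And>y. y \<in> U \<Longrightarrow> f y = g y" "diff_upto n U f"
  shows "diff_upto n U g"
  unfolding diff_upto_def
proof (intro allI impI ballI)
  fix bs :: "'a list" and x assume bs: "set bs \<subseteq> Basis \<and> length bs \<le> n" and x: "x \<in> U"
  then have "pds bs f differentiable (at x)" using assms(3) by (auto simp: diff_upto_def)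
  then show "pds bs g differentiable (at x)"
    by (rule differentiable_cong_open[OF assms(1) x, rotated])
       (use pds_cong[OF assms(1) _ assms(2)] in auto)
qed

lemma pd_const [simp]: "pd b (\<lambda>_. c) = (\<lambda>_. 0)"
  by (rule ext) (simp add: pd_def)

lemma pd_add:
  assumes "f differentiable (at x)" "g differentiable (at x)"
  shows "pd b (\<lambda>x. f x + g x) x = pd b f x + pd b g x"
proof -
  obtain f' g' where *: "(f has_derivative f') (at x)" "(g has_derivative g') (at x)"
    using assms differentiable_def by blast
  show ?thesis
    unfolding pd_has_derivative[OF has_derivative_add[OF *]] pd_has_derivative[OF *(1)] pd_has_derivative[OF *(2)] ..
qed

lemma pd_mult:
  assumes "f differentiable (at x)" "g differentiable (at x)"
  shows "pd b (\<lambda>x. f x * g x) x = pd b f x * g x + f x * pd b g x"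
proof -
  obtain f' g' where *: "(f has_derivative f') (at x)" "(g has_derivative g') (at x)"
    using assms differentiable_def by blast
  show ?thesis
    unfolding pd_has_derivative[OF has_derivative_mult[OF *]] pd_has_derivative[OF *(1)] pd_has_derivative[OF *(2)]
    by (rule add.commute)
qed

lemma diff_upto_const: "diff_upto n U (\<lambda>_. c)"
  by (induction n arbitrary: c) (simp_all add: diff_upto_0 diff_upto_Suc)

lemma diff_upto_add:
  assumes "open U" "diff_upto n U f" "diff_upto n U g"
  shows "diff_upto n U (\<lambda>x. f x + g x)"
  using assms(2,3)
proof (induction n arbitrary: f g)
  case (Suc n)
  have "diff_upto n U (pd b (\<lambda>x. f x + g x))" if "b \<in> Basis" for b
    by (rule diff_upto_cong[OF assms(1) _ Suc.IH[of "pd b f" "pd b g"]])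
       (use Suc.prems that in \<open>auto simp: diff_upto_Suc pd_add\<close>)
  then show ?case using Suc.prems by (auto simp: diff_upto_Suc)
qed (auto simp: diff_upto_0)

text \<open>By the Leibniz rule the hypothesis is applied to the pairs \<open>pd b f\<close>,
  \<open>g\<close> and \<open>f\<close>, \<open>pd b g\<close>; hence both functions are
  generalised, and order \<open>n + 1\<close> must be weakened to \<open>n\<close> for the
  undifferentiated factors.\<close>

lemma diff_upto_mult:
  assumes "open U" "diff_upto n U f" "diff_upto n U g"
  shows "diff_upto n U (\<lambda>x. f x * g x)"
  using assms(2,3)
proof (induction n arbitrary: f g)
  case (Suc n)
  have fg: "diff_upto n U f" "diff_upto n U g" using Suc.prems diff_upto_mono by (metis le_SucI order_refl)+
  have "diff_upto n U (pd b (\<lambda>x. f x * g x))" if "b \<in> Basis" for b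
    by (rule diff_upto_cong[OF assms(1) _ diff_upto_add[OF assms(1) Suc.IH[of "pd b f" g] Suc.IH[of f "pd b g"]]])
       (use Suc.prems that fg in \<open>auto simp: diff_upto_Suc pd_mult\<close>)
  then show ?case using Suc.prems by (auto simp: diff_upto_Suc)
qed (auto simp: diff_upto_0)

lemma diff_upto_sum:
  assumes "open U" "\<And>i. i \<in> I \<Longrightarrow> diff_upto n U (f i)"
  shows "diff_upto n U (\<lambda>x. \<Sum>i\<in>I. f i x)"
  using assms(2) by (induction I rule: infinite_finite_induct)
    (auto simp: diff_upto_const intro!: diff_upto_add assms(1))

text \<open>The inner map is given by its real components, because \<open>pd\<close> and smoothness
  are defined for real-valued functions only.\<close>

lemma compose_has_derivative:
  fixes \<Phi> :: "'a::euclidean_space \<Rightarrow> 'b::euclidean_space"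
  assumes "\<And>c. c \<in> Basis \<Longrightarrow> (\<lambda>x. \<Phi> x \<bullet> c) differentiable (at x)" "h differentiable (at (\<Phi> x))"
  shows "((\<lambda>x. h (\<Phi> x)) has_derivative
    (\<lambda>v. \<Sum>c\<in>Basis. frechet_derivative (\<lambda>x. \<Phi> x \<bullet> c) (at x) v * pd c h (\<Phi> x))) (at x)"
proof -
  have "(\<Phi> has_derivative (\<lambda>v. \<Sum>c\<in>Basis. frechet_derivative (\<lambda>x. \<Phi> x \<bullet> c) (at x) v *\<^sub>R c)) (at x)"
    by (subst has_derivative_componentwise_within)
       (use assms(1) in \<open>auto simp: inner_sum_left_Basis simp flip: frechet_derivative_works\<close>)
  from has_derivative_compose[OF this differentiable_pd[OF assms(2)]]
  show ?thesis by simp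
qed

lemma pd_compose:
  fixes \<Phi> :: "'a::euclidean_space \<Rightarrow> 'b::euclidean_space"
  assumes "\<And>c. c \<in> Basis \<Longrightarrow> (\<lambda>x. \<Phi> x \<bullet> c) differentiable (at x)" "h differentiable (at (\<Phi> x))"
  shows "pd b (\<lambda>x. h (\<Phi> x)) x = (\<Sum>c\<in>Basis. pd b (\<lambda>x. \<Phi> x \<bullet> c) x * pd c h (\<Phi> x))"
proof -
  have "pd b (\<lambda>x. \<Phi> x \<bullet> c) x = frechet_derivative (\<lambda>x. \<Phi> x \<bullet> c) (at x) b" if "c \<in> Basis" for c
    using assms(1)[OF that] by (intro pd_has_derivative) (simp flip: frechet_derivative_works)
  then show ?thesis by (subst pd_has_derivative[OF compose_has_derivative[OF assms]]) auto
qed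

text \<open>The chain rule writes a first derivative as a sum of products of derivatives of the
  components of \<open>\<Phi>\<close> with \<open>pd c h\<close> composed with
  \<open>\<Phi>\<close>. The induction generalises \<open>h\<close> and uses closure under sums and
  products.\<close>

lemma diff_upto_compose:
  fixes \<Phi> :: "'a::euclidean_space \<Rightarrow> 'b::euclidean_space"
  assumes "open U" "\<And>c. c \<in> Basis \<Longrightarrow> diff_upto n U (\<lambda>x. \<Phi> x \<bullet> c)"
    and "\<And>x. x \<in> U \<Longrightarrow> \<Phi> x \<in> W" "diff_upto n W h"
  shows "diff_upto n U (\<lambda>x. h (\<Phi> x))"
  using assms(2,4)
proof (induction n arbitrary: h)
  case 0
  have "(\<lambda>x. h (\<Phi> x)) differentiable (at x)" if "x \<in> U" for x
    using compose_has_derivative[of \<Phi> x h] 0 assms(3) that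
    unfolding diff_upto_0 differentiable_def[of "\<lambda>x. h (\<Phi> x)"] by blast
  then show ?case by (simp add: diff_upto_0)
next
  case (Suc n)
  have \<Phi>: "(\<lambda>x. \<Phi> x \<bullet> c) differentiable (at x)" if "c \<in> Basis" "x \<in> U" for c x
    using Suc.prems that by (auto simp: diff_upto_Suc)
  have h: "h differentiable (at (\<Phi> x))" if "x \<in> U" for x
    using Suc.prems assms(3) that by (auto simp: diff_upto_Suc)
  have "(\<lambda>x. h (\<Phi> x)) differentiable (at x)" if "x \<in> U" for x
    using compose_has_derivative[of \<Phi> x h] \<Phi> h that unfolding differentiable_def by blast
  moreover have "diff_upto n U (pd b (\<lambda>x. h (\<Phi> x)))" if b: "b \<in> Basis" for b
  proof (rule diff_upto_cong[OF assms(1)])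
    show "(\<Sum>c\<in>Basis. pd b (\<lambda>x. \<Phi> x \<bullet> c) y * pd c h (\<Phi> y)) = pd b (\<lambda>x. h (\<Phi> x)) y" if "y \<in> U" for y
      using pd_compose[of \<Phi> y h b] \<Phi> h that by simp
    show "diff_upto n U (\<lambda>y. \<Sum>c\<in>Basis. pd b (\<lambda>x. \<Phi> x \<bullet> c) y * pd c h (\<Phi> y))"
    proof (rule diff_upto_sum[OF assms(1)], rule diff_upto_mult[OF assms(1)])
      fix c :: 'b assume c: "c \<in> Basis"
      show "diff_upto n U (pd b (\<lambda>x. \<Phi> x \<bullet> c))"
        using Suc.prems b c by (auto simp: diff_upto_Suc)
      have "diff_upto n U (\<lambda>x. \<Phi> x \<bullet> c')" if "c' \<in> Basis" for c'
        by (rule diff_upto_mono[OF Suc.prems(1)[OF that]]) auto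
      moreover have "diff_upto n W (pd c h)" using Suc.prems c by (auto simp: diff_upto_Suc)
      ultimately show "diff_upto n U (\<lambda>x. pd c h (\<Phi> x))" by (rule Suc.IH)
    qed
  qed
  ultimately show ?case by (simp add: diff_upto_Suc)
qed

section \<open>Closure properties of smooth functions\<close>

lemma smooth_cong:
  "open U \<Longrightarrow> (\<And>y. y \<in> U \<Longrightarrow> f y = g y) \<Longrightarrow> smooth_fun_on U f \<Longrightarrow> smooth_fun_on U g"
  unfolding smooth_fun_on_diff_upto using diff_upto_cong by blast

lemma smooth_subset: "smooth_fun_on U f \<Longrightarrow> V \<subseteq> U \<Longrightarrow> smooth_fun_on V f"
  unfolding smooth_fun_on_def by blast

lemma smooth_const: "smooth_fun_on U (\<lambda>_. c)"
  by (simp add: smooth_fun_on_diff_upto diff_upto_const)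

lemma smooth_add:
  "open U \<Longrightarrow> smooth_fun_on U f \<Longrightarrow> smooth_fun_on U g \<Longrightarrow> smooth_fun_on U (\<lambda>x. f x + g x)"
  by (simp add: smooth_fun_on_diff_upto diff_upto_add)

lemma smooth_mult:
  "open U \<Longrightarrow> smooth_fun_on U f \<Longrightarrow> smooth_fun_on U g \<Longrightarrow> smooth_fun_on U (\<lambda>x. f x * g x)"
  by (simp add: smooth_fun_on_diff_upto diff_upto_mult)

lemma smooth_uminus:
  "open U \<Longrightarrow> smooth_fun_on U f \<Longrightarrow> smooth_fun_on U (\<lambda>x. - f x)"
  using smooth_mult[of U "\<lambda>_. -1" f] by (simp add: smooth_const)

lemma smooth_diff:
  "open U \<Longrightarrow> smooth_fun_on U f \<Longrightarrow> smooth_fun_on U g \<Longrightarrow> smooth_fun_on U (\<lambda>x. f x - g x)"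
  using smooth_add[of U f "\<lambda>x. - g x"] by (simp add: smooth_uminus)

lemma smooth_sum:
  "open U \<Longrightarrow> (\<And>i. i \<in> I \<Longrightarrow> smooth_fun_on U (f i)) \<Longrightarrow> smooth_fun_on U (\<lambda>x. \<Sum>i\<in>I. f i x)"
  by (simp add: smooth_fun_on_diff_upto diff_upto_sum)

lemma smooth_compose:
  fixes \<Phi> :: "'a::euclidean_space \<Rightarrow> 'b::euclidean_space"
  assumes "open U" "\<And>c. c \<in> Basis \<Longrightarrow> smooth_fun_on U (\<lambda>x. \<Phi> x \<bullet> c)"
    and "\<And>x. x \<in> U \<Longrightarrow> \<Phi> x \<in> W" "smooth_fun_on W h"
  shows "smooth_fun_on U (\<lambda>x. h (\<Phi> x))"
  using assms diff_upto_compose[OF assms(1)] unfolding smooth_fun_on_diff_upto by blast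

lemma smooth_pd: "smooth_fun_on U f \<Longrightarrow> b \<in> Basis \<Longrightarrow> smooth_fun_on U (pd b f)"
  unfolding smooth_fun_on_diff_upto using diff_upto_Suc by blast

lemma smooth_pds: "smooth_fun_on U f \<Longrightarrow> set bs \<subseteq> Basis \<Longrightarrow> smooth_fun_on U (pds bs f)"
  by (induction bs) (auto intro: smooth_pd)

lemma smooth_differentiable: "smooth_fun_on U f \<Longrightarrow> x \<in> U \<Longrightarrow> f differentiable (at x)"
  unfolding smooth_fun_on_diff_upto using diff_upto_differentiable by blast

lemma smooth_isCont: "smooth_fun_on U f \<Longrightarrow> x \<in> U \<Longrightarrow> isCont f x"
  using smooth_differentiable differentiable_imp_continuous_within by blast

lemma smooth_continuous_on: "smooth_fun_on U f \<Longrightarrow> continuous_on U f"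
  by (simp add: continuous_at_imp_continuous_on smooth_isCont)

lemma pds_add:
  assumes "open U" "smooth_fun_on U f" "smooth_fun_on U g" "set bs \<subseteq> Basis" "x \<in> U"
  shows "pds bs (\<lambda>x. f x + g x) x = pds bs f x + pds bs g x"
  using assms(4,5)
proof (induction bs arbitrary: x)
  case (Cons b bs)
  then have "pd b (pds bs (\<lambda>x. f x + g x)) x = pd b (\<lambda>x. pds bs f x + pds bs g x) x"
    by (intro pd_cong[OF assms(1)]) auto
  then show ?case using Cons.prems assms
    by (auto simp: pd_add smooth_differentiable[OF smooth_pds])
qed simp

lemma pd_cmult:
  assumes "f differentiable (at x)"
  shows "pd b (\<lambda>x. c * f x) x = c * pd b f x"
  using pd_mult[of "\<lambda>_. c" x f b] assms by simp

lemma pds_cmult: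
  assumes "open U" "smooth_fun_on U f" "set bs \<subseteq> Basis" "x \<in> U"
  shows "pds bs (\<lambda>x. c * f x) x = c * pds bs f x"
  using assms(3,4)
proof (induction bs arbitrary: x)
  case (Cons b bs)
  then have "pd b (pds bs (\<lambda>x. c * f x)) x = pd b (\<lambda>x. c * pds bs f x) x"
    by (intro pd_cong[OF assms(1)]) auto
  then show ?case using Cons.prems assms
    by (auto simp: pd_cmult smooth_differentiable[OF smooth_pds])
qed simp

lemma smooth_linear:
  fixes f :: "'a::euclidean_space \<Rightarrow> real"
  assumes "bounded_linear f"
  shows "smooth_fun_on U f"
proof -
  have d: "(f has_derivative f) (at x)" for x
    using assms by (simp add: bounded_linear_imp_has_derivative)
  then have "pd b f = (\<lambda>_. f b)" for b using pd_has_derivative by blast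
  then have "diff_upto n U f" for n
    by (cases n) (use d in \<open>auto simp: diff_upto_0 diff_upto_Suc diff_upto_const differentiable_def\<close>)
  then show ?thesis by (simp add: smooth_fun_on_diff_upto)
qed

text \<open>The mean value theorem is applied twice: first in direction \<open>b\<close> to the
  difference of \<open>f\<close> along two parallel segments at distance \<open>h\<close> in
  direction \<open>c\<close>, then in direction \<open>c\<close> to \<open>pd b f\<close>. The
  left-hand side is symmetric in \<open>b\<close> and \<open>c\<close>.\<close>

lemma second_difference:
  fixes f :: "'a::euclidean_space \<Rightarrow> real"
  assumes "\<And>y. y \<in> ball x r \<Longrightarrow> f differentiable (at y)" "\<And>y. y \<in> ball x r \<Longrightarrow> pd b f differentiable (at y)"
    and "norm b = 1" "norm c = 1" "0 < h" "2 * h < r"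
  obtains \<xi> \<zeta> where "0 < \<xi>" "\<xi> < h" "0 < \<zeta>" "\<zeta> < h"
    "f (x + h *\<^sub>R b + h *\<^sub>R c) - f (x + h *\<^sub>R b) - f (x + h *\<^sub>R c) + f x
      = h\<^sup>2 * pd c (pd b f) (x + \<xi> *\<^sub>R b + \<zeta> *\<^sub>R c)"
proof -
  have in_ball: "x + s *\<^sub>R b + k *\<^sub>R c \<in> ball x r" if "0 \<le> s" "s \<le> h" "0 \<le> k" "k \<le> h" for s k
  proof -
    have "dist x (x + s *\<^sub>R b + k *\<^sub>R c) = norm (s *\<^sub>R b + k *\<^sub>R c)"
      by (metis add.assoc add_diff_cancel_left' dist_commute dist_norm)
    also have "\<dots> \<le> s + k"
      using norm_triangle_ineq[of "s *\<^sub>R b" "k *\<^sub>R c"] that assms(3,4) by simp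
    finally show ?thesis using that assms(6) by simp
  qed
  let ?u = "\<lambda>s. f ((x + h *\<^sub>R c) + s *\<^sub>R b) - f (x + s *\<^sub>R b)"
  have "\<exists>z>0. z < h \<and> ?u h - ?u 0 = (h - 0) * (pd b f ((x + h *\<^sub>R c) + z *\<^sub>R b) - pd b f (x + z *\<^sub>R b))"
  proof (rule MVT2[OF \<open>0 < h\<close>])
    fix s assume s: "0 \<le> s" "s \<le> h"
    have "(x + h *\<^sub>R c) + s *\<^sub>R b \<in> ball x r" "x + s *\<^sub>R b \<in> ball x r"
      using in_ball[of s h] in_ball[of s 0] s assms(5) by (simp_all add: add_ac)
    then show "(?u has_real_derivative pd b f ((x + h *\<^sub>R c) + s *\<^sub>R b) - pd b f (x + s *\<^sub>R b)) (at s)"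
      by (intro DERIV_diff pd_along assms(1))
  qed
  then obtain \<xi> where \<xi>: "0 < \<xi>" "\<xi> < h"
    "?u h - ?u 0 = h * (pd b f ((x + h *\<^sub>R c) + \<xi> *\<^sub>R b) - pd b f (x + \<xi> *\<^sub>R b))" by auto
  have "\<exists>z>0. z < h \<and> pd b f ((x + \<xi> *\<^sub>R b) + h *\<^sub>R c) - pd b f ((x + \<xi> *\<^sub>R b) + 0 *\<^sub>R c)
      = (h - 0) * pd c (pd b f) ((x + \<xi> *\<^sub>R b) + z *\<^sub>R c)"
    by (rule MVT2[OF \<open>0 < h\<close>], rule pd_along, rule assms(2)) (use in_ball[of \<xi>] \<xi> in auto)
  then obtain \<zeta> where \<zeta>: "0 < \<zeta>" "\<zeta> < h"
    "pd b f ((x + \<xi> *\<^sub>R b) + h *\<^sub>R c) - pd b f (x + \<xi> *\<^sub>R b) = h * pd c (pd b f) ((x + \<xi> *\<^sub>R b) + \<zeta> *\<^sub>R c)"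
    by auto
  show ?thesis
  proof
    have e: "x + h *\<^sub>R c + h *\<^sub>R b = x + h *\<^sub>R b + h *\<^sub>R c" "x + h *\<^sub>R c + \<xi> *\<^sub>R b = x + \<xi> *\<^sub>R b + h *\<^sub>R c"
      by (simp_all add: add_ac)
    have "f (x + h *\<^sub>R b + h *\<^sub>R c) - f (x + h *\<^sub>R b) - f (x + h *\<^sub>R c) + f x = ?u h - ?u 0"
      by (simp add: e)
    also have "\<dots> = h * (h * pd c (pd b f) ((x + \<xi> *\<^sub>R b) + \<zeta> *\<^sub>R c))"
      using \<xi>(3) \<zeta>(3) by (simp add: e)
    finally show "f (x + h *\<^sub>R b + h *\<^sub>R c) - f (x + h *\<^sub>R b) - f (x + h *\<^sub>R c) + f x
      = h\<^sup>2 * pd c (pd b f) (x + \<xi> *\<^sub>R b + \<zeta> *\<^sub>R c)" by (simp add: power2_eq_square)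
  qed (use \<xi> \<zeta> in auto)
qed

text \<open>The symmetric second difference equals \<open>h^2\<close> times either mixed derivative
  at a nearby point, and both mixed derivatives are continuous. If they differed at \<open>x\<close>
  by \<open>2 \<epsilon>\<close>, values within \<open>\<epsilon>\<close> of each could not
  agree.\<close>

lemma pd_commute:
  fixes f :: "'a::euclidean_space \<Rightarrow> real"
  assumes "open U" "x \<in> U" "smooth_fun_on U f" "b \<in> Basis" "c \<in> Basis"
  shows "pd c (pd b f) x = pd b (pd c f) x"
proof (rule ccontr)
  assume ne: "pd c (pd b f) x \<noteq> pd b (pd c f) x"
  define \<epsilon> where "\<epsilon> = \<bar>pd c (pd b f) x - pd b (pd c f) x\<bar> / 2"
  have "\<epsilon> > 0" using ne by (simp add: \<epsilon>_def)
  obtain r where r: "0 < r" "ball x r \<subseteq> U" using assms(1,2) openE by blast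
  have sm: "smooth_fun_on (ball x r) f" using assms(3) r smooth_subset by blast
  have "isCont (pd c (pd b f)) x" "isCont (pd b (pd c f)) x"
    using smooth_isCont smooth_pd sm assms(4,5) r(1) centre_in_ball by metis+
  then obtain d1 d2 where d: "0 < d1" "\<And>y. dist y x < d1 \<Longrightarrow> dist (pd c (pd b f) y) (pd c (pd b f) x) < \<epsilon>"
    "0 < d2" "\<And>y. dist y x < d2 \<Longrightarrow> dist (pd b (pd c f) y) (pd b (pd c f) x) < \<epsilon>"
    unfolding continuous_at_eps_delta using \<open>\<epsilon> > 0\<close> by metis
  define h where "h = min r (min d1 d2) / 4"
  have h: "0 < h" "2 * h < r" "2 * h < d1" "2 * h < d2" using r(1) d by (auto simp: h_def)
  have n: "norm b = 1" "norm c = 1" using assms by auto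
  have df: "f differentiable (at y)" "pd b f differentiable (at y)" "pd c f differentiable (at y)"
    if "y \<in> ball x r" for y
    using smooth_differentiable[OF sm that] smooth_differentiable[OF smooth_pd[OF sm] that] assms(4,5) by auto
  obtain \<xi> \<zeta> where 1: "0 < \<xi>" "\<xi> < h" "0 < \<zeta>" "\<zeta> < h"
    "f (x + h *\<^sub>R b + h *\<^sub>R c) - f (x + h *\<^sub>R b) - f (x + h *\<^sub>R c) + f x
      = h\<^sup>2 * pd c (pd b f) (x + \<xi> *\<^sub>R b + \<zeta> *\<^sub>R c)"
    by (rule second_difference[OF df(1,2) n h(1,2)])
  obtain \<xi>' \<zeta>' where 2: "0 < \<xi>'" "\<xi>' < h" "0 < \<zeta>'" "\<zeta>' < h"
    "f (x + h *\<^sub>R c + h *\<^sub>R b) - f (x + h *\<^sub>R c) - f (x + h *\<^sub>R b) + f x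
      = h\<^sup>2 * pd b (pd c f) (x + \<xi>' *\<^sub>R c + \<zeta>' *\<^sub>R b)"
    by (rule second_difference[OF df(1,3) n(2,1) h(1,2)])
  have near: "dist (x + s *\<^sub>R v + k *\<^sub>R v') x < 2 * h"
    if "0 < s" "s < h" "0 < k" "k < h" "norm v = 1" "norm v' = 1" for s k v v'
    using norm_triangle_ineq[of "s *\<^sub>R v" "k *\<^sub>R v'"] that by (simp add: dist_norm add.assoc)
  have "h\<^sup>2 * pd c (pd b f) (x + \<xi> *\<^sub>R b + \<zeta> *\<^sub>R c) = h\<^sup>2 * pd b (pd c f) (x + \<xi>' *\<^sub>R c + \<zeta>' *\<^sub>R b)"
    unfolding 1(5)[symmetric] 2(5)[symmetric] by (simp add: add_ac)
  then have "pd c (pd b f) (x + \<xi> *\<^sub>R b + \<zeta> *\<^sub>R c) = pd b (pd c f) (x + \<xi>' *\<^sub>R c + \<zeta>' *\<^sub>R b)"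
    using h(1) by simp
  moreover have "dist (pd c (pd b f) (x + \<xi> *\<^sub>R b + \<zeta> *\<^sub>R c)) (pd c (pd b f) x) < \<epsilon>"
    using d(2) near[OF 1(1-4) n] h by fastforce
  moreover have "dist (pd b (pd c f) (x + \<xi>' *\<^sub>R c + \<zeta>' *\<^sub>R b)) (pd b (pd c f) x) < \<epsilon>"
    using d(4) near[OF 2(1-4) n(2,1)] h by fastforce
  moreover have "2 * \<epsilon> = \<bar>pd c (pd b f) x - pd b (pd c f) x\<bar>" by (simp add: \<epsilon>_def)
  ultimately show False unfolding dist_real_def by linarith
qed

lemma pds_pd_commute:
  fixes f :: "'a::euclidean_space \<Rightarrow> real"
  assumes "open U" "x \<in> U" "smooth_fun_on U f" "set bs \<subseteq> Basis" "c \<in> Basis"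
  shows "pds bs (pd c f) x = pd c (pds bs f) x"
  using assms(2,4)
proof (induction bs arbitrary: x)
  case (Cons b bs)
  have "pd b (pds bs (pd c f)) x = pd b (pd c (pds bs f)) x"
    by (rule pd_cong[OF assms(1) Cons.prems(1)]) (use Cons in auto)
  also have "\<dots> = pd c (pd b (pds bs f)) x"
    using pd_commute[OF assms(1) Cons.prems(1) smooth_pds[OF assms(3), of bs] assms(5), of b] Cons.prems by simp
  finally show ?case by simp
qed simp

section \<open>Symbols\<close>

text \<open>Angle and phase range over the whole line, so that every bound on a strip is uniform in
  them; only the energy is small.\<close>

definition strip :: "real \<Rightarrow> (real \<times> real \<times> real) set" where
  "strip \<eta> = {0<..<\<eta>} \<times> UNIV \<times> UNIV"

lemma strip_iff [simp]: "(e, \<theta>, s) \<in> strip \<eta> \<longleftrightarrow> 0 < e \<and> e < \<eta>"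
  by (auto simp: strip_def)

lemma strip_fst: "x \<in> strip \<eta> \<longleftrightarrow> 0 < fst x \<and> fst x < \<eta>"
  by (cases x) auto

lemma open_strip: "open (strip \<eta>)"
  unfolding strip_def by (intro open_Times open_greaterThanLessThan open_UNIV)

lemma strip_mono: "\<eta> \<le> \<eta>' \<Longrightarrow> strip \<eta> \<subseteq> strip \<eta>'"
  by (auto simp: strip_fst)

text \<open>Only derivatives in the energy cost a power of \<open>e\<close>.\<close>

definition eorder :: "(real \<times> real \<times> real) list \<Rightarrow> real" where
  "eorder bs = real (count_list bs (1, 0, 0))"

text \<open>Functions conormal at \<open>e = 0\<close>, of order \<open>a\<close>. The constant and
  the strip may depend on the list of derivatives, which matches the termwise differentiable
  expansions of the assumptions.\<close>

definition symbol :: "real \<Rightarrow> (real \<times> real \<times> real \<Rightarrow> real) \<Rightarrow> bool" where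
  "symbol a f \<longleftrightarrow> (\<exists>\<eta>>0. smooth_fun_on (strip \<eta>) f) \<and>
     (\<forall>bs. set bs \<subseteq> Basis \<longrightarrow>
       (\<exists>C. \<exists>\<eta>>0. \<forall>x\<in>strip \<eta>. \<bar>pds bs f x\<bar> \<le> C * fst x powr (a - eorder bs)))"

lemma symbolI:
  assumes "\<eta> > 0" "smooth_fun_on (strip \<eta>) f"
    and "\<And>bs. set bs \<subseteq> Basis \<Longrightarrow> \<exists>C. \<exists>\<eta>>0. \<forall>x\<in>strip \<eta>. \<bar>pds bs f x\<bar> \<le> C * fst x powr (a - eorder bs)"
  shows "symbol a f"
  using assms unfolding symbol_def by blast

lemma symbol_smoothE:
  assumes "symbol a f" obtains \<eta> where "\<eta> > 0" "smooth_fun_on (strip \<eta>) f"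
  using assms unfolding symbol_def by blast

lemma symbol_smooth2E:
  assumes "symbol a f" "symbol b g"
  obtains \<eta> where "\<eta> > 0" "smooth_fun_on (strip \<eta>) f" "smooth_fun_on (strip \<eta>) g"
proof -
  obtain \<eta>1 \<eta>2 where "\<eta>1 > 0" "smooth_fun_on (strip \<eta>1) f" "\<eta>2 > 0" "smooth_fun_on (strip \<eta>2) g"
    using assms symbol_smoothE by metis
  then show ?thesis
    using that[of "min \<eta>1 \<eta>2"] smooth_subset strip_mono by (metis min.cobounded1 min.cobounded2 min_less_iff_conj)
qed

lemma symbol_pdsE:
  assumes "symbol a f" "set bs \<subseteq> Basis"
  obtains C \<eta> where "C > 0" "\<eta> > 0" "\<And>x. x \<in> strip \<eta> \<Longrightarrow> \<bar>pds bs f x\<bar> \<le> C * fst x powr (a - eorder bs)"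
proof -
  obtain C \<eta> where *: "\<eta> > 0" "\<And>x. x \<in> strip \<eta> \<Longrightarrow> \<bar>pds bs f x\<bar> \<le> C * fst x powr (a - eorder bs)"
    using assms unfolding symbol_def by blast
  show ?thesis
  proof (rule that[of "\<bar>C\<bar> + 1" \<eta>])
    fix x assume "x \<in> strip \<eta>"
    moreover have "C * fst x powr (a - eorder bs) \<le> (\<bar>C\<bar> + 1) * fst x powr (a - eorder bs)"
      by (intro mult_right_mono) auto
    ultimately show "\<bar>pds bs f x\<bar> \<le> (\<bar>C\<bar> + 1) * fst x powr (a - eorder bs)" using * by fastforce
  qed (use * in auto)
qed

lemma symbol_boundE:
  assumes "symbol a f"
  obtains C \<eta> where "C > 0" "\<eta> > 0" "\<And>x. x \<in> strip \<eta> \<Longrightarrow> \<bar>f x\<bar> \<le> C * fst x powr a"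
  using symbol_pdsE[OF assms, of "[]"] by (auto simp: eorder_def)

lemma symbol_cong:
  assumes "\<eta> > 0" "\<And>x. x \<in> strip \<eta> \<Longrightarrow> f x = g x" "symbol a f"
  shows "symbol a g"
proof -
  obtain \<eta>' where \<eta>': "\<eta>' > 0" "smooth_fun_on (strip \<eta>') f" using symbol_smoothE[OF assms(3)] .
  show ?thesis
  proof (rule symbolI[of "min \<eta> \<eta>'"])
    show "smooth_fun_on (strip (min \<eta> \<eta>')) g"
      by (rule smooth_cong[OF open_strip, of _ f])
         (use assms smooth_subset[OF \<eta>'(2) strip_mono] in \<open>auto simp: strip_fst\<close>)
    fix bs :: "(real \<times> real \<times> real) list" assume "set bs \<subseteq> Basis"
    then obtain C \<eta>'' where *: "C > 0" "\<eta>'' > 0" "\<And>x. x \<in> strip \<eta>'' \<Longrightarrow> \<bar>pds bs f x\<bar> \<le> C * fst x powr (a - eorder bs)"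
      using symbol_pdsE[OF assms(3)] by metis
    have "\<bar>pds bs g x\<bar> \<le> C * fst x powr (a - eorder bs)" if "x \<in> strip (min \<eta> \<eta>'')" for x
      using *(3)[of x] pds_cong[OF open_strip, of x \<eta> f g bs] assms(2) that by (auto simp: strip_fst)
    then show "\<exists>C. \<exists>\<eta>>0. \<forall>x\<in>strip \<eta>. \<bar>pds bs g x\<bar> \<le> C * fst x powr (a - eorder bs)"
      using * assms(1) by (intro exI[of _ C] exI[of _ "min \<eta> \<eta>''"]) auto
  qed (use assms \<eta>' in auto)
qed

lemma symbol_mono:
  assumes "symbol a f" "b \<le> a"
  shows "symbol b f"
proof -
  obtain \<eta> where "\<eta> > 0" "smooth_fun_on (strip \<eta>) f" using symbol_smoothE[OF assms(1)] .
  then show ?thesis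
  proof (rule symbolI)
    fix bs :: "(real \<times> real \<times> real) list" assume "set bs \<subseteq> Basis"
    then obtain C \<eta>'' where *: "C > 0" "\<eta>'' > 0" "\<And>x. x \<in> strip \<eta>'' \<Longrightarrow> \<bar>pds bs f x\<bar> \<le> C * fst x powr (a - eorder bs)"
      using symbol_pdsE[OF assms(1)] by metis
    \<comment> \<open>A smaller exponent gives a larger power only for energies up to 1, hence the
      cut at 1.\<close>
    have "\<bar>pds bs f x\<bar> \<le> C * fst x powr (b - eorder bs)" if "x \<in> strip (min 1 \<eta>'')" for x
    proof -
      have "fst x powr (a - eorder bs) \<le> fst x powr (b - eorder bs)"
        using that assms(2) by (intro powr_mono') (auto simp: strip_fst)
      then show ?thesis using *(3)[of x] that \<open>C > 0\<close>
        by (auto simp: strip_fst intro: order_trans mult_left_mono)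
    qed
    then show "\<exists>C. \<exists>\<eta>>0. \<forall>x\<in>strip \<eta>. \<bar>pds bs f x\<bar> \<le> C * fst x powr (b - eorder bs)"
      using * by (intro exI[of _ C] exI[of _ "min 1 \<eta>''"]) auto
  qed
qed

lemma symbol_pd:
  assumes "symbol a f" "b \<in> Basis"
  shows "symbol (a - (if b = (1, 0, 0) then 1 else 0)) (pd b f)"
proof -
  obtain \<eta> where \<eta>: "\<eta> > 0" "smooth_fun_on (strip \<eta>) f" using symbol_smoothE[OF assms(1)] .
  show ?thesis
  proof (rule symbolI[OF \<eta>(1) smooth_pd[OF \<eta>(2) assms(2)]])
    fix bs :: "(real \<times> real \<times> real) list" assume bs: "set bs \<subseteq> Basis"
    have "set (bs @ [b]) \<subseteq> Basis" using bs assms(2) by auto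
    then obtain C \<eta> where *: "C > 0" "\<eta> > 0"
      "\<And>x. x \<in> strip \<eta> \<Longrightarrow> \<bar>pds (bs @ [b]) f x\<bar> \<le> C * fst x powr (a - eorder (bs @ [b]))"
      using symbol_pdsE[OF assms(1)] by metis
    then show "\<exists>C. \<exists>\<eta>>0. \<forall>x\<in>strip \<eta>. \<bar>pds bs (pd b f) x\<bar>
        \<le> C * fst x powr (a - (if b = (1, 0, 0) then 1 else 0) - eorder bs)"
      by (intro exI[of _ C] exI[of _ \<eta>]) (auto simp: pds_snoc eorder_def diff_diff_eq add.commute)
  qed
qed

lemma symbol_pd_simps:
  assumes "symbol a f"
  shows "symbol (a - 1) (pd (1, 0, 0) f)" "symbol a (pd (0, 1, 0) f)" "symbol a (pd (0, 0, 1) f)"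
  using symbol_pd[OF assms, of "(1, 0, 0)"] symbol_pd[OF assms, of "(0, 1, 0)"] symbol_pd[OF assms, of "(0, 0, 1)"]
  by (auto simp: Basis_real3)

lemma symbol_add:
  assumes "symbol a f" "symbol a g"
  shows "symbol a (\<lambda>x. f x + g x)"
proof -
  obtain \<eta> where \<eta>: "\<eta> > 0" "smooth_fun_on (strip \<eta>) f" "smooth_fun_on (strip \<eta>) g"
    using symbol_smooth2E[OF assms] .
  show ?thesis
  proof (rule symbolI[OF \<eta>(1) smooth_add[OF open_strip \<eta>(2,3)]])
    fix bs :: "(real \<times> real \<times> real) list" assume bs: "set bs \<subseteq> Basis"
    obtain C1 \<eta>1 where 1: "C1 > 0" "\<eta>1 > 0" "\<And>x. x \<in> strip \<eta>1 \<Longrightarrow> \<bar>pds bs f x\<bar> \<le> C1 * fst x powr (a - eorder bs)"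
      by (rule symbol_pdsE[OF assms(1) bs]) blast
    obtain C2 \<eta>2 where 2: "C2 > 0" "\<eta>2 > 0" "\<And>x. x \<in> strip \<eta>2 \<Longrightarrow> \<bar>pds bs g x\<bar> \<le> C2 * fst x powr (a - eorder bs)"
      by (rule symbol_pdsE[OF assms(2) bs]) blast
    have "\<bar>pds bs (\<lambda>x. f x + g x) x\<bar> \<le> (C1 + C2) * fst x powr (a - eorder bs)" if "x \<in> strip (min \<eta> (min \<eta>1 \<eta>2))" for x
    proof -
      have "pds bs (\<lambda>x. f x + g x) x = pds bs f x + pds bs g x"
        by (rule pds_add[OF open_strip \<eta>(2,3) bs]) (use that in \<open>auto simp: strip_fst\<close>)
      moreover have "\<bar>pds bs f x\<bar> \<le> C1 * fst x powr (a - eorder bs)" "\<bar>pds bs g x\<bar> \<le> C2 * fst x powr (a - eorder bs)"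
        using that 1 2 by (auto simp: strip_fst)
      ultimately show ?thesis by (simp add: distrib_right)
    qed
    then show "\<exists>C. \<exists>\<eta>>0. \<forall>x\<in>strip \<eta>. \<bar>pds bs (\<lambda>x. f x + g x) x\<bar> \<le> C * fst x powr (a - eorder bs)"
      using 1 2 \<eta> by (intro exI[of _ "C1 + C2"] exI[of _ "min \<eta> (min \<eta>1 \<eta>2)"]) auto
  qed
qed

text \<open>Induction on the number of derivatives: the innermost one is distributed by the Leibniz
  rule, which yields two products of fewer derivatives. An energy derivative lowers the order of one
  factor by 1, which is exactly the loss allowed for the product.\<close>

lemma symbol_mult:
  assumes "symbol a f" "symbol b g"
  shows "symbol (a + b) (\<lambda>x. f x * g x)"
proof -
  obtain \<eta> where \<eta>: "\<eta> > 0" "smooth_fun_on (strip \<eta>) f" "smooth_fun_on (strip \<eta>) g"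
    using symbol_smooth2E[OF assms] .
  show ?thesis
  proof (rule symbolI[OF \<eta>(1) smooth_mult[OF open_strip \<eta>(2,3)]])
    fix bs :: "(real \<times> real \<times> real) list" assume "set bs \<subseteq> Basis"
    then show "\<exists>C. \<exists>\<eta>>0. \<forall>x\<in>strip \<eta>. \<bar>pds bs (\<lambda>x. f x * g x) x\<bar> \<le> C * fst x powr (a + b - eorder bs)"
      using assms
    proof (induction "length bs" arbitrary: bs f g a b)
      case 0
      obtain C1 \<eta>1 where 1: "C1 > 0" "\<eta>1 > 0" "\<And>x. x \<in> strip \<eta>1 \<Longrightarrow> \<bar>f x\<bar> \<le> C1 * fst x powr a"
        by (rule symbol_boundE[OF 0(3)]) blast
      obtain C2 \<eta>2 where 2: "C2 > 0" "\<eta>2 > 0" "\<And>x. x \<in> strip \<eta>2 \<Longrightarrow> \<bar>g x\<bar> \<le> C2 * fst x powr b"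
        by (rule symbol_boundE[OF 0(4)]) blast
      have "\<bar>f x * g x\<bar> \<le> (C1 * C2) * fst x powr (a + b)" if "x \<in> strip (min \<eta>1 \<eta>2)" for x
      proof -
        have "\<bar>f x\<bar> * \<bar>g x\<bar> \<le> (C1 * fst x powr a) * (C2 * fst x powr b)"
          using that 1 2 by (intro mult_mono) (auto simp: strip_fst)
        then show ?thesis by (simp add: abs_mult powr_add mult_ac)
      qed
      then show ?case using 0 1 2 by (intro exI[of _ "C1 * C2"] exI[of _ "min \<eta>1 \<eta>2"]) (auto simp: eorder_def)
    next
      case (Suc n)
      then obtain cs c where bs: "bs = cs @ [c]" "length cs = n" by (metis length_Suc_conv_rev)
      have cs: "set cs \<subseteq> Basis" "c \<in> Basis" using Suc.prems bs by auto
      define \<delta> :: real where "\<delta> = (if c = (1, 0, 0) then 1 else 0)"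
      have pf: "symbol (a - \<delta>) (pd c f)" "symbol (b - \<delta>) (pd c g)"
        using symbol_pd[OF Suc.prems(2) cs(2)] symbol_pd[OF Suc.prems(3) cs(2)] by (simp_all add: \<delta>_def)
      have ord: "a + b - eorder bs = a + b - \<delta> - eorder cs"
        by (auto simp: bs eorder_def \<delta>_def)
      obtain C1 \<eta>1 where 1: "\<eta>1 > 0" "\<And>x. x \<in> strip \<eta>1 \<Longrightarrow> \<bar>pds cs (\<lambda>x. pd c f x * g x) x\<bar> \<le> C1 * fst x powr (a + b - \<delta> - eorder cs)"
        using Suc.hyps(1)[OF bs(2)[symmetric] cs(1) pf(1) Suc.prems(3)] by (auto simp: algebra_simps)
      obtain C2 \<eta>2 where 2: "\<eta>2 > 0" "\<And>x. x \<in> strip \<eta>2 \<Longrightarrow> \<bar>pds cs (\<lambda>x. f x * pd c g x) x\<bar> \<le> C2 * fst x powr (a + b - \<delta> - eorder cs)"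
        using Suc.hyps(1)[OF bs(2)[symmetric] cs(1) Suc.prems(2) pf(2)] by (auto simp: algebra_simps)
      obtain \<eta> where \<eta>: "\<eta> > 0" "smooth_fun_on (strip \<eta>) f" "smooth_fun_on (strip \<eta>) g"
        using symbol_smooth2E[OF Suc.prems(2,3)] .
      note sm = smooth_mult[OF open_strip smooth_pd[OF \<eta>(2) cs(2)] \<eta>(3)]
        smooth_mult[OF open_strip \<eta>(2) smooth_pd[OF \<eta>(3) cs(2)]]
      have "\<bar>pds bs (\<lambda>x. f x * g x) x\<bar> \<le> (C1 + C2) * fst x powr (a + b - eorder bs)" if "x \<in> strip (min \<eta> (min \<eta>1 \<eta>2))" for x
      proof -
        have x: "x \<in> strip \<eta>" using that by (auto simp: strip_fst)
        have "pds bs (\<lambda>x. f x * g x) x = pds cs (\<lambda>x. pd c f x * g x + f x * pd c g x) x"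
          unfolding bs pds_snoc
          by (rule pds_cong[OF open_strip x]) (use \<eta> in \<open>auto intro!: pd_mult smooth_differentiable\<close>)
        also have "\<dots> = pds cs (\<lambda>x. pd c f x * g x) x + pds cs (\<lambda>x. f x * pd c g x) x"
          by (rule pds_add[OF open_strip sm cs(1) x])
        finally show ?thesis using 1(2)[of x] 2(2)[of x] that unfolding ord
          by (auto simp: strip_fst distrib_right)
      qed
      then show ?case using 1 2 \<eta> by (intro exI[of _ "C1 + C2"] exI[of _ "min \<eta> (min \<eta>1 \<eta>2)"]) auto
    qed
  qed
qed

lemma symbol_const: "symbol 0 (\<lambda>_. c)"
proof (rule symbolI[of 1])
  fix bs :: "(real \<times> real \<times> real) list"
  show "\<exists>C. \<exists>\<eta>>0. \<forall>x\<in>strip \<eta>. \<bar>pds bs (\<lambda>_. c) x\<bar> \<le> C * fst x powr (0 - eorder bs)"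
  proof (cases bs rule: rev_cases)
    case Nil
    then show ?thesis by (intro exI[of _ "\<bar>c\<bar>"] exI[of _ 1]) (auto simp: eorder_def strip_fst)
  next
    case (snoc cs b)
    have "pds cs (\<lambda>_::real \<times> real \<times> real. 0) = (\<lambda>_. 0)" by (induction cs) auto
    then show ?thesis using snoc by (intro exI[of _ 0] exI[of _ 1]) (auto simp: pds_snoc)
  qed
qed (auto simp: smooth_const)

lemma symbol_zero: "symbol a (\<lambda>_. 0)"
proof (rule symbolI[of 1])
  fix bs :: "(real \<times> real \<times> real) list"
  have "pds bs (\<lambda>_::real \<times> real \<times> real. 0) = (\<lambda>_. 0)" by (induction bs) auto
  then show "\<exists>C. \<exists>\<eta>>0. \<forall>x\<in>strip \<eta>. \<bar>pds bs (\<lambda>_. 0) x\<bar> \<le> C * fst x powr (a - eorder bs)"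
    by (intro exI[of _ 0] exI[of _ 1]) auto
qed (auto simp: smooth_const)

lemma symbol_cmult: "symbol a f \<Longrightarrow> symbol a (\<lambda>x. c * f x)"
  using symbol_mult[OF symbol_const[of c], of a f] by simp

lemma symbol_uminus: "symbol a f \<Longrightarrow> symbol a (\<lambda>x. - f x)"
  using symbol_cmult[of a f "-1"] by simp

lemma symbol_diff: "symbol a f \<Longrightarrow> symbol a g \<Longrightarrow> symbol a (\<lambda>x. f x - g x)"
  using symbol_add[OF _ symbol_uminus, of a f g] by simp

lemma symbol_sum: "(\<And>i. i \<in> I \<Longrightarrow> symbol a (f i)) \<Longrightarrow> symbol a (\<lambda>x. \<Sum>i\<in>I. f i x)"
  by (induction I rule: infinite_finite_induct) (auto intro: symbol_add symbol_zero)

lemma smooth_powr: "smooth_fun_on {0<..} (\<lambda>x::real. x powr a)"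
proof -
  have d: "((\<lambda>x::real. c * x powr a) has_derivative (\<lambda>v. c * a * x powr (a - 1) * v)) (at x)"
    if "0 < x" for x a c
    using DERIV_cmult[OF has_real_derivative_powr[OF that], of c a]
    unfolding has_field_derivative_def by (rule has_derivative_eq_rhs) auto
  \<comment> \<open>The factor \<open>c\<close> is carried along because the derivative of a power
    is a multiple of a power.\<close>
  have "diff_upto n {0<..} (\<lambda>x::real. c * x powr a)" for n c a
  proof (induction n arbitrary: c a)
    case 0
    show ?case using d unfolding diff_upto_0 differentiable_def by blast
  next
    case (Suc n)
    have "\<forall>x\<in>{0<..}. (\<lambda>x::real. c * x powr a) differentiable (at x)"
      using d unfolding differentiable_def by blast
    moreover have "diff_upto n {0<..} (pd b (\<lambda>x. c * x powr a))" for b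
      by (rule diff_upto_cong[OF _ _ Suc.IH[of "c * a * b" "a - 1"]])
         (use pd_has_derivative[OF d] in \<open>auto simp: mult_ac\<close>)
    ultimately show ?case by (simp add: diff_upto_Suc)
  qed
  from this[of _ 1] show ?thesis by (simp add: smooth_fun_on_diff_upto)
qed

lemma smooth_powr_fst: "smooth_fun_on (strip \<eta>) (\<lambda>x. fst x powr a)"
  by (rule smooth_compose[OF open_strip _ _ smooth_powr])
     (auto simp: strip_fst intro!: smooth_linear bounded_linear_fst)

lemma pd_powr_fst:
  fixes x :: "real \<times> real \<times> real"
  assumes "0 < fst x"
  shows "pd b (\<lambda>x. fst x powr a) x = fst b * a * fst x powr (a - 1)"
proof -
  have "((\<lambda>x::real \<times> real \<times> real. fst x powr a) has_derivative (\<lambda>v. fst v * (a * fst x powr (a - 1)))) (at x)"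
    using assms by (auto intro!: derivative_eq_intros simp: powr_diff)
  from pd_has_derivative[OF this] show ?thesis by simp
qed

lemma symbol_powr: "symbol a (\<lambda>x. fst x powr a)"
proof (rule symbolI[of 1])
  fix bs :: "(real \<times> real \<times> real) list" assume "set bs \<subseteq> Basis"
  then have "\<exists>C. \<forall>x\<in>strip 1. \<bar>pds bs (\<lambda>x. fst x powr a) x\<bar> \<le> C * fst x powr (a - eorder bs)"
  proof (induction bs arbitrary: a rule: rev_induct)
    case Nil
    show ?case by (intro exI[of _ 1]) (simp add: eorder_def)
  next
    case (snoc b bs)
    then have b: "b \<in> Basis" "set bs \<subseteq> Basis" by auto
    have *: "pds (bs @ [b]) (\<lambda>x. fst x powr a) x = fst b * a * pds bs (\<lambda>x. fst x powr (a - 1)) x"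
      if "x \<in> strip 1" for x
      unfolding pds_snoc
      by (subst pds_cmult[OF open_strip smooth_powr_fst b(2) that, symmetric],
          rule pds_cong[OF open_strip that]) (simp add: pd_powr_fst strip_fst)
    obtain C where C: "\<And>x. x\<in>strip 1 \<Longrightarrow> \<bar>pds bs (\<lambda>x. fst x powr (a - 1)) x\<bar> \<le> C * fst x powr (a - 1 - eorder bs)"
      using snoc.IH[OF b(2)] by blast
    show ?case
    proof (cases "b = (1, 0, 0)")
      case True
      then have ord: "a - eorder (bs @ [b]) = a - 1 - eorder bs" by (simp add: eorder_def)
      have "\<bar>pds (bs @ [b]) (\<lambda>x. fst x powr a) x\<bar> \<le> \<bar>a\<bar> * C * fst x powr (a - eorder (bs @ [b]))"
        if "x \<in> strip 1" for x
        unfolding ord *[OF that] using mult_left_mono[OF C[OF that], of "\<bar>a\<bar>"] True by (simp add: abs_mult mult.assoc)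
      then show ?thesis by blast
    next
      case False
      then have "fst b = 0" using b(1) by (auto simp: Basis_real3)
      then show ?thesis using * by (intro exI[of _ 0]) auto
    qed
  qed
  then show "\<exists>C. \<exists>\<eta>>0. \<forall>x\<in>strip \<eta>. \<bar>pds bs (\<lambda>x. fst x powr a) x\<bar> \<le> C * fst x powr (a - eorder bs)"
    by (meson zero_less_one)
qed (auto simp: smooth_powr_fst)

text \<open>The change of angle \<open>\<phi> = \<theta> + c s\<close>; with
  \<open>c = 1 / kap P\<close> it passes from the resonant angle \<open>\<theta>\<close> back to
  \<open>\<phi>\<close>.\<close>

definition shear :: "real \<Rightarrow> real \<times> real \<times> real \<Rightarrow> real \<times> real \<times> real" where
  "shear c = (\<lambda>(e, \<theta>, s). (e, \<theta> + c * s, s))"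

lemma shear_inner:
  "shear c x \<bullet> (1, 0, 0) = fst x" "shear c x \<bullet> (0, 1, 0) = fst (snd x) + c * snd (snd x)"
  "shear c x \<bullet> (0, 0, 1) = snd (snd x)"
  by (simp_all add: shear_def case_prod_unfold inner_prod_def)

lemma shear_in_strip [simp]: "shear c x \<in> strip \<eta> \<longleftrightarrow> x \<in> strip \<eta>"
  and fst_shear [simp]: "fst (shear c x) = fst x"
  by (simp_all add: shear_def case_prod_unfold strip_fst)

lemma smooth_shear_comp:
  assumes "b \<in> Basis"
  shows "smooth_fun_on U (\<lambda>x. shear c x \<bullet> b)"
proof (rule smooth_linear)
  have "linear (\<lambda>x. shear c x \<bullet> b)"
    by (rule linearI) (use assms in \<open>auto simp: Basis_real3 shear_inner algebra_simps\<close>)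
  then show "bounded_linear (\<lambda>x. shear c x \<bullet> b)" by (simp add: linear_conv_bounded_linear)
qed

lemma smooth_shear:
  assumes "smooth_fun_on (strip \<eta>) h"
  shows "smooth_fun_on (strip \<eta>) (\<lambda>x. h (shear c x))"
  by (rule smooth_compose[OF open_strip _ _ assms]) (auto simp: smooth_shear_comp)

lemma pd_shear:
  assumes "h differentiable (at (shear c x))"
  shows "pd (1, 0, 0) (\<lambda>x. h (shear c x)) x = pd (1, 0, 0) h (shear c x)"
    and "pd (0, 1, 0) (\<lambda>x. h (shear c x)) x = pd (0, 1, 0) h (shear c x)"
    and "pd (0, 0, 1) (\<lambda>x. h (shear c x)) x = c * pd (0, 1, 0) h (shear c x) + pd (0, 0, 1) h (shear c x)"
proof -
  have "(shear c has_derivative shear c) (at x)"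
    unfolding shear_def case_prod_unfold
    by (auto intro!: derivative_eq_intros)
  from has_derivative_compose[OF this differentiable_pd3[OF assms]]
  have *: "((\<lambda>x. h (shear c x)) has_derivative (\<lambda>v. fst (shear c v) * pd (1, 0, 0) h (shear c x)
    + fst (snd (shear c v)) * pd (0, 1, 0) h (shear c x) + snd (snd (shear c v)) * pd (0, 0, 1) h (shear c x))) (at x)"
    by (simp add: case_prod_unfold)
  show "pd (1, 0, 0) (\<lambda>x. h (shear c x)) x = pd (1, 0, 0) h (shear c x)"
    and "pd (0, 1, 0) (\<lambda>x. h (shear c x)) x = pd (0, 1, 0) h (shear c x)"
    and "pd (0, 0, 1) (\<lambda>x. h (shear c x)) x = c * pd (0, 1, 0) h (shear c x) + pd (0, 0, 1) h (shear c x)"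
    by (subst pd_has_derivative[OF *]; simp add: shear_def)+
qed

text \<open>The energy is untouched, so strips and powers of \<open>e\<close> stay the same; only
  the derivative in \<open>s\<close> changes, into a combination of two derivatives that cost no
  power of \<open>e\<close>.\<close>

lemma symbol_shear:
  assumes "symbol a h"
  shows "symbol a (\<lambda>x. h (shear c x))"
proof -
  obtain \<eta> where \<eta>: "\<eta> > 0" "smooth_fun_on (strip \<eta>) h" using symbol_smoothE[OF assms] .
  show ?thesis
  proof (rule symbolI[OF \<eta>(1) smooth_shear[OF \<eta>(2)]])
    fix bs :: "(real \<times> real \<times> real) list" assume "set bs \<subseteq> Basis"
    then show "\<exists>C. \<exists>\<eta>>0. \<forall>x\<in>strip \<eta>. \<bar>pds bs (\<lambda>x. h (shear c x)) x\<bar> \<le> C * fst x powr (a - eorder bs)"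
      using assms
    proof (induction bs arbitrary: a h rule: rev_induct)
      case Nil
      obtain C \<eta> where "C > 0" "\<eta> > 0" "\<And>x. x \<in> strip \<eta> \<Longrightarrow> \<bar>h x\<bar> \<le> C * fst x powr a"
        using symbol_boundE[OF Nil(2)] by metis
      then have "\<bar>h (shear c x)\<bar> \<le> C * fst x powr a" if "x \<in> strip \<eta>" for x
        by (metis that shear_in_strip fst_shear)
      with \<open>\<eta> > 0\<close> show ?case by (intro exI[of _ C] exI[of _ \<eta>]) (simp add: eorder_def)
    next
      case (snoc b bs)
      then have b: "b \<in> Basis" "set bs \<subseteq> Basis" by auto
      obtain \<eta> where \<eta>: "\<eta> > 0" "smooth_fun_on (strip \<eta>) h" using symbol_smoothE[OF snoc.prems(2)] .
      \<comment> \<open>The function whose composition with \<open>shear\<close> is the derivative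
        in direction \<open>b\<close> of the composed function.\<close>
      define h' where "h' = (if b = (0, 0, 1) then \<lambda>x. c * pd (0, 1, 0) h x + pd (0, 0, 1) h x else pd b h)"
      define \<delta> :: real where "\<delta> = (if b = (1, 0, 0) then 1 else 0)"
      have "symbol (a - \<delta>) h'"
        using symbol_pd[OF snoc.prems(2) b(1)] symbol_pd_simps[OF snoc.prems(2)]
        by (auto simp: h'_def \<delta>_def intro!: symbol_add symbol_cmult)
      from snoc.IH[OF b(2) this] obtain C \<eta>' where C: "\<eta>' > 0"
        "\<And>x. x \<in> strip \<eta>' \<Longrightarrow> \<bar>pds bs (\<lambda>x. h' (shear c x)) x\<bar> \<le> C * fst x powr (a - \<delta> - eorder bs)" by blast
      have "pds (bs @ [b]) (\<lambda>x. h (shear c x)) x = pds bs (\<lambda>x. h' (shear c x)) x" if "x \<in> strip \<eta>" for x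
        unfolding pds_snoc
      proof (rule pds_cong[OF open_strip that])
        fix y assume "y \<in> strip \<eta>"
        then have "h differentiable (at (shear c y))" by (intro smooth_differentiable[OF \<eta>(2)]) simp
        from pd_shear[OF this] b(1) show "pd b (\<lambda>x. h (shear c x)) y = h' (shear c y)"
          by (auto simp: h'_def Basis_real3)
      qed
      moreover have ord: "a - eorder (bs @ [b]) = a - \<delta> - eorder bs" by (simp add: \<delta>_def eorder_def)
      ultimately show ?case unfolding ord using C \<eta>(1)
        by - (rule exI[of _ C], rule exI[of _ "min \<eta> \<eta>'"], auto simp: strip_fst)
    qed
  qed
qed

section \<open>Periodic functions of zero mean\<close>

lemma pd_along3:
  assumes "f differentiable (at (e, \<theta>, s))"
  shows "((\<lambda>e. f (e, \<theta>, s)) has_real_derivative pd (1, 0, 0) f (e, \<theta>, s)) (at e)"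
    and "((\<lambda>\<theta>. f (e, \<theta>, s)) has_real_derivative pd (0, 1, 0) f (e, \<theta>, s)) (at \<theta>)"
    and "((\<lambda>s. f (e, \<theta>, s)) has_real_derivative pd (0, 0, 1) f (e, \<theta>, s)) (at s)"
  using pd_along[of f "(0, \<theta>, s)" e "(1, 0, 0)"] pd_along[of f "(e, 0, s)" \<theta> "(0, 1, 0)"]
    pd_along[of f "(e, \<theta>, 0)" s "(0, 0, 1)"] assms
  by simp_all

definition zero_mean :: "real \<Rightarrow> real \<Rightarrow> (real \<times> real \<times> real \<Rightarrow> real) \<Rightarrow> bool" where
  "zero_mean L \<eta> g \<longleftrightarrow> (\<forall>e \<theta>. 0 < e \<and> e < \<eta> \<longrightarrow> integral {0..L} (\<lambda>s. g (e, \<theta>, s)) = 0)"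

text \<open>For derivatives in \<open>e\<close> and \<open>\<theta>\<close> one differentiates under
  the integral sign; for the derivative in \<open>s\<close> the integral is the increment over a
  period, which vanishes.\<close>

lemma zero_mean_pd:
  assumes "smooth_fun_on (strip \<eta>) g" "\<And>x. x \<in> strip \<eta> \<Longrightarrow> g (x + (0, 0, L)) = g x" "0 \<le> L"
    "zero_mean L \<eta> g" "b \<in> Basis"
  shows "zero_mean L \<eta> (pd b g)"
  unfolding zero_mean_def
proof (intro allI impI)
  fix e \<theta> assume e: "0 < e \<and> e < \<eta>"
  have df: "g differentiable (at (e, \<theta>, s))" if "0 < e" "e < \<eta>" for e \<theta> s
    using smooth_differentiable[OF assms(1)] that by simp
  have cont: "continuous_on (strip \<eta>) g" "continuous_on (strip \<eta>) (pd b g)"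
    using assms smooth_continuous_on smooth_pd by metis+
  have int: "(\<lambda>s. g (e, \<theta>, s)) integrable_on cbox 0 L" if "0 < e" "e < \<eta>" for e \<theta>
    by (intro integrable_continuous continuous_on_compose2[OF cont(1)] continuous_intros) (use that in auto)
  have zm: "integral (cbox 0 L) (\<lambda>s. g (e, \<theta>, s)) = 0" if "0 < e" "e < \<eta>" for e \<theta>
    using assms(4) that by (simp add: zero_mean_def)
  consider "b = (1, 0, 0)" | "b = (0, 1, 0)" | "b = (0, 0, 1)"
    using assms(5) by (auto simp: Basis_real3)
  then show "integral {0..L} (\<lambda>s. pd b g (e, \<theta>, s)) = 0"
  proof cases
    case 1
    have "((\<lambda>e. integral (cbox 0 L) (\<lambda>s. g (e, \<theta>, s))) has_field_derivative
        integral (cbox 0 L) (\<lambda>s. pd b g (e, \<theta>, s))) (at e within {0<..<\<eta>})"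
    proof (rule leibniz_rule_field_derivative)
      show "continuous_on ({0<..<\<eta>} \<times> cbox 0 L) (\<lambda>(e, s). pd b g (e, \<theta>, s))"
        unfolding case_prod_unfold
        by (intro continuous_on_compose2[OF cont(2)] continuous_intros) auto
      show "((\<lambda>e. g (e, \<theta>, s)) has_real_derivative pd b g (e, \<theta>, s)) (at e within {0<..<\<eta>})"
        if "e \<in> {0<..<\<eta>}" for e s
        using DERIV_subset[OF pd_along3(1)[OF df[of e \<theta> s]] subset_UNIV] that 1 by simp
    qed (use e int in auto)
    \<comment> \<open>The same integral is identically zero on the interval of energies, so
      uniqueness of the derivative on this open interval gives the claim.\<close>
    moreover have "((\<lambda>e. integral (cbox 0 L) (\<lambda>s. g (e, \<theta>, s))) has_field_derivative 0) (at e within {0<..<\<eta>})"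
      by (rule has_field_derivative_transform_within[OF DERIV_const[of 0] zero_less_one]) (use e zm in auto)
    ultimately show ?thesis using e
      by (simp add: at_within_open[of e "{0<..<\<eta>}"] DERIV_unique)
  next
    case 2
    have "((\<lambda>\<theta>. integral (cbox 0 L) (\<lambda>s. g (e, \<theta>, s))) has_field_derivative
        integral (cbox 0 L) (\<lambda>s. pd b g (e, \<theta>, s))) (at \<theta> within UNIV)"
    proof (rule leibniz_rule_field_derivative)
      show "continuous_on (UNIV \<times> cbox 0 L) (\<lambda>(\<theta>, s). pd b g (e, \<theta>, s))"
        unfolding case_prod_unfold
        by (intro continuous_on_compose2[OF cont(2)] continuous_intros) (use e in auto)
      show "((\<lambda>\<theta>. g (e, \<theta>, s)) has_real_derivative pd b g (e, \<theta>, s)) (at \<theta> within UNIV)" for \<theta> s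
        using pd_along3(2)[OF df] e 2 by auto
    qed (use e int in auto)
    moreover have "((\<lambda>\<theta>. integral (cbox 0 L) (\<lambda>s. g (e, \<theta>, s))) has_field_derivative 0) (at \<theta> within UNIV)"
      using e zm by simp
    ultimately show ?thesis by (simp add: DERIV_unique)
  next
    case 3
    have "((\<lambda>s. pd b g (e, \<theta>, s)) has_integral g (e, \<theta>, L) - g (e, \<theta>, 0)) {0..L}"
      by (rule fundamental_theorem_of_calculus[OF assms(3)])
         (use pd_along3(3)[OF df] e 3 in \<open>auto simp: has_real_derivative_iff_has_vector_derivative
            intro: has_vector_derivative_at_within\<close>)
    then show ?thesis using assms(2)[of "(e, \<theta>, 0)"] e by (simp add: integral_unique)
  qed
qed

lemma zero_mean_pds:
  assumes "smooth_fun_on (strip \<eta>) g" "\<And>x. x \<in> strip \<eta> \<Longrightarrow> g (x + (0, 0, L)) = g x" "0 \<le> L"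
    "zero_mean L \<eta> g" "set bs \<subseteq> Basis"
  shows "zero_mean L \<eta> (pds bs g)"
  using assms(5)
proof (induction bs)
  case (Cons b bs)
  have "pds bs g (x + (0, 0, L)) = pds bs g x" if "x \<in> strip \<eta>" for x
    by (rule pds_translate[OF open_strip that]) (rule assms(2))
  then show ?case
    using zero_mean_pd[OF smooth_pds[OF assms(1)] _ assms(3), of bs b] Cons by simp
qed (simp add: assms)

lemma periodic_int:
  fixes h :: "real \<Rightarrow> 'a"
  assumes "\<And>s. h (s + L) = h s"
  shows "h (s + of_int k * L) = h s"
proof -
  have *: "h (s + of_nat k * L) = h s" for s k
  proof (induction k)
    case (Suc k)
    then show ?case using assms[of "s + of_nat k * L"] by (simp add: algebra_simps)
  qed simp
  show ?thesis
  proof (cases "k \<ge> 0")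
    case True
    then show ?thesis using *[of s "nat k"] by simp
  next
    case False
    then show ?thesis using *[of "s + of_int k * L" "nat (- k)"] by simp
  qed
qed

text \<open>A continuous function of zero mean vanishes somewhere in the period, here by the mean
  value theorem for its primitive. Reduced modulo the period, every \<open>s\<close> is at distance
  at most \<open>L\<close> from that zero.\<close>

lemma zero_mean_bound:
  fixes h :: "real \<Rightarrow> real"
  assumes "0 < L" "\<And>s. (h has_real_derivative h' s) (at s)" "\<And>s. h (s + L) = h s"
    "integral {0..L} h = 0" "\<And>s. \<bar>h' s\<bar> \<le> B"
  shows "\<bar>h s\<bar> \<le> L * B"
proof -
  have cont: "continuous_on S h" for S
    using assms(2) by (meson DERIV_isCont continuous_at_imp_continuous_on)
  have "\<exists>z\<in>{0<..<L}. integral {0..L} h - integral {0..0} h = h z * (L - 0)"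
  proof (rule mvt_simple)
    show "0 < L" by fact
    fix x assume x: "0 \<le> x" "x \<le> L"
    show "((\<lambda>x. integral {0..x} h) has_derivative (*) (h x)) (at x within {0..L})"
      using integral_has_real_derivative[OF cont, of x 0 L] x by (simp add: has_field_derivative_def)
  qed
  then obtain z where z: "0 < z" "z < L" "h z = 0" using assms(1,4) by auto
  define s' where "s' = s - of_int \<lfloor>s / L\<rfloor> * L"
  have s': "0 \<le> s'" "s' < L"
    using floor_divide_lower[OF assms(1), of s] floor_divide_upper[OF assms(1), of s] by (simp_all add: s'_def algebra_simps)
  have "h s = h s'"
    using periodic_int[of h L s' "\<lfloor>s / L\<rfloor>", OF assms(3)] by (simp add: s'_def)
  moreover have "\<bar>h s' - h z\<bar> \<le> B * \<bar>s' - z\<bar>"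
    using field_differentiable_bound[of UNIV h h' B z s'] assms(2,5) by (simp add: abs_minus_commute)
  moreover have "B * \<bar>s' - z\<bar> \<le> B * L"
    by (rule mult_left_mono) (use s' z assms(5)[of 0] in auto)
  ultimately show ?thesis using z by (simp add: mult.commute)
qed

text \<open>
  \<open>Lm\<close> absorbs the mean of \<open>R\<close>: the \<open>s\<close>-derivative of a periodic function vanishes somewhere, and there
  every derivative of \<open>Lm\<close> equals that of \<open>R\<close>.
\<close>

lemma symbol_antiderivative:
  assumes "0 < L" "0 < c" "0 < \<eta>" "smooth_fun_on (strip \<eta>) g"
    and per: "\<And>x. x \<in> strip \<eta> \<Longrightarrow> g (x + (0, 0, L)) = g x" and zm: "zero_mean L \<eta> g"
    and R: "symbol a R" and eq: "\<And>x. x \<in> strip \<eta> \<Longrightarrow> c * pd (0, 0, 1) g x = Lm x - R x"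
    and Lm: "\<And>x s. x \<in> strip \<eta> \<Longrightarrow> Lm (x + (0, 0, s)) = Lm x"
  shows "symbol a g"
proof (rule symbolI[OF assms(3,4)])
  fix bs :: "(real \<times> real \<times> real) list" assume bs: "set bs \<subseteq> Basis"
  obtain C \<eta>1 where C: "C > 0" "\<eta>1 > 0" "\<And>x. x \<in> strip \<eta>1 \<Longrightarrow> \<bar>pds bs R x\<bar> \<le> C * fst x powr (a - eorder bs)"
    using symbol_pdsE[OF R bs] by blast
  obtain \<eta>2 where \<eta>2: "\<eta>2 > 0" "smooth_fun_on (strip \<eta>2) R" using symbol_smoothE[OF R] .
  define \<eta>' where "\<eta>' = min \<eta> (min \<eta>1 \<eta>2)"
  have sub: "x \<in> strip \<eta>" "x \<in> strip \<eta>1" "x \<in> strip \<eta>2" if "x \<in> strip \<eta>'" for x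
    using that by (auto simp: strip_fst \<eta>'_def)
  let ?s = "(0, 0, 1) :: real \<times> real \<times> real"
  have sB: "?s \<in> Basis" by (simp add: Basis_real3)
  have sm: "smooth_fun_on (strip \<eta>') g" "smooth_fun_on (strip \<eta>') R"
    using smooth_subset assms(4) \<eta>2(2) sub by blast+
  define h where "h = pds bs g"
  have tr: "pds bs g (x + (0, 0, L)) = pds bs g x" "pds bs Lm (x + (0, 0, k)) = pds bs Lm x"
    if "x \<in> strip \<eta>" for x k
    by (rule pds_translate[OF open_strip that], erule per) (rule pds_translate[OF open_strip that], erule Lm)
  have key: "c * pd ?s h x = pds bs Lm x - pds bs R x" if x: "x \<in> strip \<eta>'" for x
  proof -
    \<comment> \<open>\<open>Lm\<close> is not assumed to be smooth; its derivatives are computed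
      from the function with which it agrees on the strip.\<close>
    have "pds bs Lm x = pds bs (\<lambda>x. c * pd ?s g x + R x) x"
      by (rule pds_cong[OF open_strip x]) (use eq sub in \<open>auto simp: algebra_simps\<close>)
    also have "\<dots> = pds bs (\<lambda>x. c * pd ?s g x) x + pds bs R x"
      by (intro pds_add[OF open_strip _ sm(2) bs x] smooth_mult[OF open_strip smooth_const] smooth_pd[OF sm(1) sB])
    also have "pds bs (\<lambda>x. c * pd ?s g x) x = c * pd ?s h x"
      unfolding h_def pds_pd_commute[OF open_strip x sm(1) bs sB, symmetric]
      by (rule pds_cmult[OF open_strip smooth_pd[OF sm(1) sB] bs x])
    finally show ?thesis by simp
  qed
  have "\<bar>pds bs g x\<bar> \<le> L * (2 * C / c) * fst x powr (a - eorder bs)" if x: "x \<in> strip \<eta>'" for x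
  proof -
    obtain e \<theta> s0 where xe: "x = (e, \<theta>, s0)" by (metis prod_cases3)
    have st: "(e, \<theta>, s) \<in> strip \<eta>'" for s using x xe by auto
    have der: "((\<lambda>s. h (e, \<theta>, s)) has_real_derivative pd ?s h (e, \<theta>, s)) (at s)" for s
      by (rule pd_along3(3)[OF smooth_differentiable[OF smooth_pds[OF sm(1) bs] st, folded h_def]])
    have hper: "h (e, \<theta>, s + L) = h (e, \<theta>, s)" for s
      using tr(1)[OF sub(1)[OF st[of s]]] by (simp add: h_def)
    have "\<exists>z>0. z < L \<and> h (e, \<theta>, L) - h (e, \<theta>, 0) = (L - 0) * pd ?s h (e, \<theta>, z)"
      by (rule MVT2[OF assms(1)]) (use der in auto)
    then obtain z where "pd ?s h (e, \<theta>, z) = 0" using hper[of 0] assms(1) by auto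
    then have Lz: "pds bs Lm (e, \<theta>, z) = pds bs R (e, \<theta>, z)" using key[OF st, of z] by simp
    have "\<bar>pd ?s h (e, \<theta>, s)\<bar> \<le> 2 * C / c * e powr (a - eorder bs)" for s
    proof -
      have "pds bs Lm (e, \<theta>, s) = pds bs Lm (e, \<theta>, z)"
        using tr(2)[OF sub(1)[OF st[of z]], of "s - z"] by simp
      then have "c * pd ?s h (e, \<theta>, s) = pds bs R (e, \<theta>, z) - pds bs R (e, \<theta>, s)"
        using key[OF st, of s] Lz by simp
      then have "\<bar>c * pd ?s h (e, \<theta>, s)\<bar> \<le> 2 * C * e powr (a - eorder bs)"
        using C(3)[OF sub(2)[OF st], of z] C(3)[OF sub(2)[OF st], of s] by simp
      then show ?thesis using assms(2) by (simp add: abs_mult field_simps)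
    qed
    moreover have "integral {0..L} (\<lambda>s. h (e, \<theta>, s)) = 0"
      using zero_mean_pds[OF assms(4) per _ zm bs] assms(1) sub(1)[OF st] by (auto simp: zero_mean_def h_def)
    ultimately have "\<bar>h (e, \<theta>, s0)\<bar> \<le> L * (2 * C / c * e powr (a - eorder bs))"
      by (intro zero_mean_bound[OF assms(1) der hper])
    then show ?thesis by (simp add: xe h_def mult.assoc)
  qed
  moreover have "\<eta>' > 0" using assms(3) C(2) \<eta>2 by (simp add: \<eta>'_def)
  ultimately show "\<exists>C. \<exists>\<eta>>0. \<forall>x\<in>strip \<eta>. \<bar>pds bs g x\<bar> \<le> C * fst x powr (a - eorder bs)" by blast
qed

section \<open>Coefficients of the averaging transformation\<close>

text \<open>The induction keeps vanishing on a whole neighbourhood, since vanishing at the single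
  point would not survive a differentiation.\<close>

lemma higher_deriv_eventually_zero:
  fixes h :: "real \<Rightarrow> real"
  assumes "\<forall>\<^sub>F \<tau> in nhds a. h \<tau> = 0"
  shows "(deriv ^^ i) h a = 0"
proof -
  have "\<forall>\<^sub>F \<tau> in nhds a. (deriv ^^ i) h \<tau> = 0"
  proof (induction i)
    case (Suc i)
    have "\<forall>\<^sub>F y in nhds a. \<forall>\<^sub>F \<tau> in nhds y. (deriv ^^ i) h \<tau> = 0"
      using Suc by (simp add: eventually_eventually)
    then show ?case
    proof eventually_elim
      case (elim y)
      then have "deriv ((deriv ^^ i) h) y = deriv (\<lambda>_. 0) y" by (intro deriv_cong_ev) auto
      then show ?case by simp
    qed
  qed (use assms in simp)
  then show ?thesis by (rule eventually_nhds_x_imp_x)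
qed

text \<open>At \<open>\<tau> = 0\<close> the first argument of each \<open>L j\<close> is
  \<open>e\<close>, inside the open interval, and stays there for small \<open>\<tau>\<close>. So
  the series of \<open>L j\<close> vanishes for \<open>j < n\<close>, and the first contribution is
  the constant term of \<open>L n\<close>, in degree \<open>n\<close>.\<close>

lemma averaged_rhs_nth:
  assumes "\<And>j v \<psi>. 2 \<le> j \<Longrightarrow> j < n \<Longrightarrow> v \<in> {0..D} \<Longrightarrow> L j (v, \<psi>) = 0"
    and "0 < e" "e < D" "k \<le> n" "2 \<le> n" "n \<le> J"
  shows "fps_nth (averaged_rhs L J w N u M (e, \<theta>, s)) k = (if k = n then L n (e, \<theta>) else 0)"
proof -
  let ?x = "(e, \<theta>, s)"
  define h where "h = (\<lambda>j \<tau>. L j (\<Sum>k\<le>N. \<tau> ^ k * V_co w N k ?x, \<Sum>k\<le>M. \<tau> ^ k * Psi_co u M k ?x))"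
  \<comment> \<open>Since \<open>0 ^ 0 = 1\<close>, exactly the term with index 0 survives.\<close>
  have at0: "(\<Sum>k\<le>K. 0 ^ k * c k) = c 0" for K and c :: "nat \<Rightarrow> real"
    by (simp add: power_0_left sum.atMost_shift)
  have "((\<lambda>\<tau>. \<Sum>k\<le>N. \<tau> ^ k * V_co w N k ?x) \<longlongrightarrow> (\<Sum>k\<le>N. 0 ^ k * V_co w N k ?x)) (nhds 0)"
    by (intro tendsto_intros) (simp add: filterlim_ident)
  then have "((\<lambda>\<tau>. \<Sum>k\<le>N. \<tau> ^ k * V_co w N k ?x) \<longlongrightarrow> e) (nhds 0)"
    unfolding at0 by (simp add: V_co_def near_id_co_def)
  from topological_tendstoD[OF this open_greaterThanLessThan[of 0 D]]
  have "\<forall>\<^sub>F \<tau> in nhds 0. (\<Sum>k\<le>N. \<tau> ^ k * V_co w N k ?x) \<in> {0<..<D}" using assms by auto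
  then have h0: "(deriv ^^ i) (h j) 0 = 0" if "2 \<le> j" "j < n" for i j
    by (intro higher_deriv_eventually_zero) (auto elim!: eventually_mono simp: h_def assms(1) that)
  have "fps_nth (averaged_rhs L J w N u M ?x) k
      = (\<Sum>j=2..J. if k < j then 0 else fps_nth (taylor_fps (h j)) (k - j))"
    unfolding h_def averaged_rhs_def by (simp add: fps_sum_nth fps_X_power_mult_nth)
  also have "\<dots> = (\<Sum>j=2..J. if j = n \<and> k = n then h n 0 else 0)"
  proof (rule sum.cong[OF refl])
    fix j assume "j \<in> {2..J}"
    then show "(if k < j then 0 else fps_nth (taylor_fps (h j)) (k - j)) = (if j = n \<and> k = n then h n 0 else 0)"
      using h0[of j "k - j"] assms(4) by (auto simp: taylor_fps_def)
  qed
  also have "\<dots> = (if k = n then h n 0 else 0)" using assms(5,6) by auto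
  also have "h n 0 = L n (e, \<theta>)"
    unfolding h_def at0 by (simp add: V_co_def Psi_co_def near_id_co_def)
  finally show ?thesis .
qed

text \<open>The rescaling term carries the factor \<open>\<tau>^(2q)\<close> and the explicit time
  derivative \<open>\<tau>^(2q+1)\<close>; neither is visible below degree
  \<open>2q\<close>.\<close>

lemma total_deriv_nth:
  assumes "k < 2 * qpar P"
  shows "fps_nth (total_deriv P l W x) k =
    (\<Sum>i\<le>k. scaled_F P l i x * pd (1, 0, 0) (W (k - i)) x + scaled_G P l i x * pd (0, 1, 0) (W (k - i)) x
       + S_co P i * pd (0, 0, 1) (W (k - i)) x)"
proof -
  obtain e \<theta> s where x: "x = (e, \<theta>, s)" by (metis prod_cases3)
  have 1: "fps_nth (fps_const c * fps_X ^ (2 * qpar P) * g) k = 0" for c :: real and g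
    using assms by (simp add: mult.assoc fps_X_power_mult_nth)
  have 2: "fps_nth (fps_const c * fps_X ^ (2 * qpar P + 1) * g) k = 0" for c :: real and g
    using assms by (simp only: mult.assoc fps_mult_left_const_nth fps_X_power_mult_nth) simp
  have "fps_nth (total_deriv P l W x) k =
    (\<Sum>i=0..k. scaled_F P l i x * pd (1, 0, 0) (W (k - i)) x)
    + (\<Sum>i=0..k. scaled_G P l i x * pd (0, 1, 0) (W (k - i)) x)
    + (\<Sum>i=0..k. S_co P i * pd (0, 0, 1) (W (k - i)) x)"
    unfolding total_deriv_def x prod.case distrib_right fps_add_nth fps_sub_nth 1 2
    by (simp add: fps_mult_nth)
  then show ?thesis by (simp add: sum.distrib atMost_atLeast0)
qed

lemma V_co_simps:
  "V_co w N 0 = fst" "2 \<le> k \<Longrightarrow> k \<le> N \<Longrightarrow> V_co w N k = w k"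
  "V_co w N (Suc 0) = (\<lambda>_. 0)"
  by (auto simp: V_co_def near_id_co_def fun_eq_iff)

lemma symbol_fst: "symbol 1 fst"
  by (rule symbol_cong[OF zero_less_one _ symbol_powr[of 1]]) (simp add: strip_fst)

text \<open>As \<open>F 0\<close> and \<open>G 0\<close> vanish, the coefficient of order
  \<open>k\<close> enters the \<open>k\<close>-th relation only through its
  \<open>s\<close>-derivative, with factor \<open>S 0\<close>. All else involves earlier
  coefficients, so strong induction and \<open>symbol_antiderivative\<close> apply.\<close>

lemma symbol_V_co:
  fixes F G :: "nat \<Rightarrow> real \<times> real \<times> real \<Rightarrow> real"
  assumes "0 < \<eta>" "0 < L" "0 < S 0" "n \<le> N"
    and rel: "\<And>k x. k \<le> n \<Longrightarrow> x \<in> strip \<eta> \<Longrightarrow>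
      (\<Sum>i\<le>k. F i x * pd (1, 0, 0) (V_co w N (k - i)) x + G i x * pd (0, 1, 0) (V_co w N (k - i)) x
        + S i * pd (0, 0, 1) (V_co w N (k - i)) x) = Lm k x"
    and F: "\<And>i. i \<le> n \<Longrightarrow> symbol 1 (F i)" and G: "\<And>i. i \<le> n \<Longrightarrow> symbol 0 (G i)"
    and FG0: "\<And>x. x \<in> strip \<eta> \<Longrightarrow> F 0 x = 0" "\<And>x. x \<in> strip \<eta> \<Longrightarrow> G 0 x = 0"
    and Lm: "\<And>k x s. x \<in> strip \<eta> \<Longrightarrow> Lm k (x + (0, 0, s)) = Lm k x"
    and w: "\<And>k. 2 \<le> k \<Longrightarrow> k \<le> n \<Longrightarrow> smooth_fun_on (strip \<eta>) (w k)"
      "\<And>k. 2 \<le> k \<Longrightarrow> k \<le> n \<Longrightarrow> zero_mean L \<eta> (w k)"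
      "\<And>k x. 2 \<le> k \<Longrightarrow> k \<le> n \<Longrightarrow> x \<in> strip \<eta> \<Longrightarrow> w k (x + (0, 0, L)) = w k x"
    and "k \<le> n"
  shows "symbol 1 (V_co w N k)"
  using \<open>k \<le> n\<close>
proof (induction k rule: less_induct)
  case (less k)
  consider "k = 0" | "k = 1" | "2 \<le> k" by linarith
  then show ?case
  proof cases
    case 3
    \<comment> \<open>The part of the relation with \<open>i \<ge> 1\<close>, containing only
      coefficients of index below \<open>k\<close>.\<close>
    define R where "R x = (\<Sum>i\<in>{1..k}. F i x * pd (1, 0, 0) (V_co w N (k - i)) x
      + G i x * pd (0, 1, 0) (V_co w N (k - i)) x + S i * pd (0, 0, 1) (V_co w N (k - i)) x)" for x
    have W: "V_co w N k = w k" using 3 less.prems assms(4) by (simp add: V_co_simps)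
    have "symbol 1 (\<lambda>x. F i x * pd (1, 0, 0) (V_co w N (k - i)) x
      + G i x * pd (0, 1, 0) (V_co w N (k - i)) x + S i * pd (0, 0, 1) (V_co w N (k - i)) x)"
      if "i \<in> {1..k}" for i
    proof -
      have V: "symbol 1 (V_co w N (k - i))" using that less by auto
      have "i \<le> n" using that less.prems by auto
      \<comment> \<open>The order lost by the energy derivative is restored by \<open>F i\<close>,
        of order 1; the other two products have order 1 at once.\<close>
      then show ?thesis
        using symbol_mult[OF F[of i] symbol_pd_simps(1)[OF V]] symbol_mult[OF G[of i] symbol_pd_simps(2)[OF V]]
          symbol_cmult[OF symbol_pd_simps(3)[OF V], of "S i"]
        by (auto intro!: symbol_add)
    qed
    then have R: "symbol 1 R" unfolding R_def by (rule symbol_sum)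
    have eq: "S 0 * pd (0, 0, 1) (w k) x = Lm k x - R x" if "x \<in> strip \<eta>" for x
      using rel[OF less.prems that] FG0[OF that]
      by (simp add: sum.atMost_shift W R_def sum.atLeast1_atMost_eq lessThan_Suc_atMost)
    show ?thesis unfolding W
      by (rule symbol_antiderivative[OF assms(2,3,1) w(1)[OF 3 less.prems] w(3)[OF 3 less.prems]
            w(2)[OF 3 less.prems] R eq Lm])
  qed (use symbol_zero symbol_fst in \<open>simp_all add: V_co_simps\<close>)
qed

section \<open>Action-angle variables\<close>

lemma pd_along2:
  assumes "f differentiable (at (x, y))"
  shows "((\<lambda>x. f (x, y)) has_real_derivative pd (1, 0) f (x, y)) (at x)"
    and "((\<lambda>y. f (x, y)) has_real_derivative pd (0, 1) f (x, y)) (at y)"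
  using pd_along[of f "(0, y)" x "(1, 0)"] pd_along[of f "(x, 0)" y "(0, 1)"] assms
  by simp_all

text \<open>Reducing both arguments modulo the period brings them into the interval of
  injectivity.\<close>

lemma periodic_inj:
  fixes p :: "real \<Rightarrow> 'a"
  assumes "0 < T" "\<And>t. p (t + T) = p t" "inj_on p {0..<T}" "p t1 = p t2"
  shows "\<exists>k::int. t2 = t1 + of_int k * T"
proof -
  define r where "r t = t - of_int \<lfloor>t / T\<rfloor> * T" for t
  have r: "r t \<in> {0..<T}" "p (r t) = p t" for t
    using floor_divide_lower[OF assms(1), of t] floor_divide_upper[OF assms(1), of t]
      periodic_int[of p T t "- \<lfloor>t / T\<rfloor>", OF assms(2)] by (simp_all add: r_def algebra_simps)
  then have "r t1 = r t2" using assms(3,4) unfolding inj_on_def by metis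
  then have "t2 = t1 + of_int (\<lfloor>t2 / T\<rfloor> - \<lfloor>t1 / T\<rfloor>) * T" by (simp add: r_def algebra_simps)
  then show ?thesis ..
qed

section \<open>Geometry of the limiting system\<close>

locale osc =
  fixes P :: osc_system
  assumes standing: "standing_assumptions P"
begin

abbreviation X where "X \<equiv> Xaa P"
abbreviation Y where "Y \<equiv> Yaa P"

text \<open>\<open>smooth_coefficients\<close> only asserts that a neighbourhood exists; one is
  fixed here for the whole locale.\<close>

definition Usm :: "(real \<times> real) set" where
  "Usm = (SOME U. open U \<and> cball 0 (rmax P) \<subseteq> U \<and> smooth_fun_on U (Ham0 P) \<and>
       (\<forall>k\<ge>1. smooth_fun_on {(x, y, s). (x, y) \<in> U} (Ham_co P k) \<and>
              smooth_fun_on {(x, y, s). (x, y) \<in> U} (Dis_co P k)))"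

definition U3 :: "(real \<times> real \<times> real) set" where "U3 = {(x, y, s). (x, y) \<in> Usm}"

lemma Usm: "open Usm" "cball 0 (rmax P) \<subseteq> Usm" "smooth_fun_on Usm (Ham0 P)"
  "1 \<le> k \<Longrightarrow> smooth_fun_on U3 (Ham_co P k)" "1 \<le> k \<Longrightarrow> smooth_fun_on U3 (Dis_co P k)"
proof -
  have "\<exists>U. open U \<and> cball 0 (rmax P) \<subseteq> U \<and> smooth_fun_on U (Ham0 P) \<and>
       (\<forall>k\<ge>1. smooth_fun_on {(x, y, s). (x, y) \<in> U} (Ham_co P k) \<and>
              smooth_fun_on {(x, y, s). (x, y) \<in> U} (Dis_co P k))"
    using standing unfolding standing_assumptions_def smooth_coefficients_def by blast
  from someI_ex[OF this]
  show "open Usm" "cball 0 (rmax P) \<subseteq> Usm" "smooth_fun_on Usm (Ham0 P)"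
    "1 \<le> k \<Longrightarrow> smooth_fun_on U3 (Ham_co P k)" "1 \<le> k \<Longrightarrow> smooth_fun_on U3 (Dis_co P k)"
    unfolding Usm_def[symmetric] U3_def by blast+
qed

lemma open_U3: "open U3"
proof -
  have "U3 = (\<lambda>(x, y, s). (x, y)) -` Usm" by (auto simp: U3_def)
  also have "open \<dots>"
    unfolding case_prod_unfold by (intro open_vimage Usm continuous_intros)
  finally show ?thesis .
qed

lemma standing_basic: "0 < Emax P" "0 < rmax P" "continuous_on {0..Emax P} (freq P)" "freq P 0 = 1" "1 \<le> qpar P" "1 \<le> kap P"
  "phase_co P 0 = real (kap P)" "vec_field0 P 0 = 0"
  using standing unfolding standing_assumptions_def center_def expansions_at_infinity_def resonance_def
  by auto

text \<open>The frequency is continuous, equals 1 at zero energy and never vanishes, so the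
  intermediate value theorem fixes its sign.\<close>

lemma freq_pos:
  assumes "0 \<le> E" "E \<le> Emax P" shows "0 < freq P E"
proof (rule ccontr)
  assume "\<not> 0 < freq P E"
  then have "\<exists>x\<ge>0. x \<le> E \<and> freq P x = 0"
    using assms standing_basic by (intro IVT2' continuous_on_subset[OF standing_basic(3)]) auto
  then show False using standing assms unfolding standing_assumptions_def center_def
    by (metis atLeastAtMost_iff order_trans)
qed

lemma orbit:
  assumes "0 < E" "E \<le> Emax P"
  shows "((\<lambda>t. (xper P t E, yper P t E)) has_vector_derivative vec_field0 P (xper P t E, yper P t E)) (at t)"
    and "(xper P (t + 2 * pi / freq P E) E, yper P (t + 2 * pi / freq P E) E) = (xper P t E, yper P t E)"
    and "inj_on (\<lambda>t. (xper P t E, yper P t E)) {0..<2 * pi / freq P E}"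
    and "range (\<lambda>t. (xper P t E, yper P t E)) = {z \<in> cball 0 (rmax P). Ham0 P z = E}"
  using standing assms unfolding standing_assumptions_def center_def by auto

lemma XY_eq: "(X (\<phi>, E), Y (\<phi>, E)) = (xper P (\<phi> / freq P E) E, yper P (\<phi> / freq P E) E)"
  by (simp add: Xaa_def Yaa_def)

lemma XY_periodic:
  assumes "0 < E" "E \<le> Emax P"
  shows "X (\<phi> + 2 * pi, E) = X (\<phi>, E)" "Y (\<phi> + 2 * pi, E) = Y (\<phi>, E)"
  using orbit(2)[OF assms, of "\<phi> / freq P E"] by (simp_all add: Xaa_def Yaa_def add_divide_distrib)

lemma XY_level:
  assumes "0 < E" "E \<le> Emax P"
  shows "(X (\<phi>, E), Y (\<phi>, E)) \<in> cball 0 (rmax P)" "Ham0 P (X (\<phi>, E), Y (\<phi>, E)) = E"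
  using orbit(4)[OF assms] unfolding XY_eq by auto

lemma XY_surj:
  assumes "0 < E" "E \<le> Emax P" "z \<in> cball 0 (rmax P)" "Ham0 P z = E"
  obtains \<phi> where "z = (X (\<phi>, E), Y (\<phi>, E))"
proof -
  obtain t where "z = (xper P t E, yper P t E)" using orbit(4)[OF assms(1,2)] assms(3,4) by blast
  then show ?thesis
    using that[of "t * freq P E"] freq_pos[of E] assms unfolding XY_eq by simp
qed

lemma XY_inj:
  assumes "0 < E" "E \<le> Emax P" "X (\<phi>1, E) = X (\<phi>2, E)" "Y (\<phi>1, E) = Y (\<phi>2, E)"
  shows "\<exists>k::int. \<phi>2 = \<phi>1 + of_int k * (2 * pi)"
proof -
  have \<omega>: "0 < freq P E" using freq_pos assms by simp
  have "\<exists>k::int. \<phi>2 / freq P E = \<phi>1 / freq P E + of_int k * (2 * pi / freq P E)"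
    by (rule periodic_inj[OF _ orbit(2)[OF assms(1,2)] orbit(3)[OF assms(1,2)]])
       (use \<omega> assms in \<open>auto simp: Xaa_def Yaa_def\<close>)
  then obtain k :: int where "\<phi>2 / freq P E = \<phi>1 / freq P E + of_int k * (2 * pi / freq P E)" ..
  then have "\<phi>2 = \<phi>1 + of_int k * (2 * pi)" using \<omega> by (simp add: field_simps)
  then show ?thesis ..
qed

definition dom2 :: "(real \<times> real) set" where "dom2 = UNIV \<times> {0<..<Emax P}"

lemma open_dom2: "open dom2" by (simp add: dom2_def open_Times)

lemma dom2_iff [simp]: "(\<phi>, E) \<in> dom2 \<longleftrightarrow> 0 < E \<and> E < Emax P" by (auto simp: dom2_def)

lemma smooth_XY: "smooth_fun_on dom2 X" "smooth_fun_on dom2 Y" "smooth_fun_on {0<..<Emax P} (freq P)"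
  using standing unfolding standing_assumptions_def expansions_at_zero_def dom2_def by auto

lemma XY_diff: assumes "0 < E" "E < Emax P"
  shows "X differentiable (at (\<phi>, E))" "Y differentiable (at (\<phi>, E))"
  using smooth_XY assms smooth_differentiable by (metis dom2_iff)+

lemma XY_Usm: assumes "0 < E" "E \<le> Emax P" shows "(X (\<phi>, E), Y (\<phi>, E)) \<in> Usm"
  using XY_level[OF assms] Usm(2) by blast

lemma Ham0_diff: "z \<in> Usm \<Longrightarrow> Ham0 P differentiable (at z)"
  using Usm(3) smooth_differentiable by blast

text \<open>The angle is the time of the limiting flow multiplied by the frequency, so these are the
  Hamiltonian equations after a change of time.\<close>

lemma XY_pd_phi:
  assumes "0 < E" "E < Emax P"
  shows "freq P E * pd (1, 0) X (\<phi>, E) = pd (0, 1) (Ham0 P) (X (\<phi>, E), Y (\<phi>, E))"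
    and "freq P E * pd (1, 0) Y (\<phi>, E) = - pd (1, 0) (Ham0 P) (X (\<phi>, E), Y (\<phi>, E))"
proof -
  have \<omega>: "0 < freq P E" using freq_pos assms by simp
  then have \<omega>0: "freq P E \<noteq> 0" by simp
  have v: "((\<lambda>t. (xper P t E, yper P t E)) has_vector_derivative vec_field0 P (X (\<phi>, E), Y (\<phi>, E))) (at (\<phi> / freq P E))"
    using orbit(1)[of E "\<phi> / freq P E"] assms by (simp add: XY_eq)
  have x: "((\<lambda>t. xper P t E) has_real_derivative pd (0, 1) (Ham0 P) (X (\<phi>, E), Y (\<phi>, E))) (at (\<phi> / freq P E))"
    using bounded_linear.has_vector_derivative[OF bounded_linear_fst v]
    by (simp add: vec_field0_def has_real_derivative_iff_has_vector_derivative)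
  have y: "((\<lambda>t. yper P t E) has_real_derivative - pd (1, 0) (Ham0 P) (X (\<phi>, E), Y (\<phi>, E))) (at (\<phi> / freq P E))"
    using bounded_linear.has_vector_derivative[OF bounded_linear_snd v]
    by (simp add: vec_field0_def has_real_derivative_iff_has_vector_derivative)
  have l: "((\<lambda>\<phi>. \<phi> / freq P E) has_real_derivative 1 / freq P E) (at \<phi>)"
    by (intro DERIV_cdivide DERIV_ident)
  have "((\<lambda>\<phi>. X (\<phi>, E)) has_real_derivative pd (0, 1) (Ham0 P) (X (\<phi>, E), Y (\<phi>, E)) * (1 / freq P E)) (at \<phi>)"
    using DERIV_chain2[OF x l] by (simp add: Xaa_def)
  from DERIV_unique[OF this pd_along2(1)[OF XY_diff(1)[OF assms]]]
  show "freq P E * pd (1, 0) X (\<phi>, E) = pd (0, 1) (Ham0 P) (X (\<phi>, E), Y (\<phi>, E))"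
    using \<omega>0 by (simp add: field_simps)
  have "((\<lambda>\<phi>. Y (\<phi>, E)) has_real_derivative - pd (1, 0) (Ham0 P) (X (\<phi>, E), Y (\<phi>, E)) * (1 / freq P E)) (at \<phi>)"
    using DERIV_chain2[OF y l] by (simp add: Yaa_def)
  from DERIV_unique[OF this pd_along2(1)[OF XY_diff(2)[OF assms]]]
  show "freq P E * pd (1, 0) Y (\<phi>, E) = - pd (1, 0) (Ham0 P) (X (\<phi>, E), Y (\<phi>, E))"
    using \<omega>0 by (simp add: field_simps)
qed

text \<open>Obtained by differentiating the identity \<open>Ham0 P (X, Y) = E\<close> with respect
  to \<open>E\<close>.\<close>

lemma XY_pd_E:
  assumes "0 < E" "E < Emax P"
  shows "pd (0, 1) X (\<phi>, E) * pd (1, 0) (Ham0 P) (X (\<phi>, E), Y (\<phi>, E))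
    + pd (0, 1) Y (\<phi>, E) * pd (0, 1) (Ham0 P) (X (\<phi>, E), Y (\<phi>, E)) = 1"
proof -
  have fst: "(\<lambda>x. (X x, Y x) \<bullet> (1, 0)) = X" "(\<lambda>x. (X x, Y x) \<bullet> (0, 1)) = Y"
    by (simp_all add: inner_prod_def)
  have *: "pd (0, 1) (\<lambda>x. Ham0 P (X x, Y x)) (\<phi>, E)
    = (\<Sum>c\<in>Basis. pd (0, 1) (\<lambda>x. (X x, Y x) \<bullet> c) (\<phi>, E) * pd c (Ham0 P) (X (\<phi>, E), Y (\<phi>, E)))"
    by (rule pd_compose)
       (use XY_diff[OF assms] Ham0_diff XY_Usm assms in \<open>auto simp: Basis_real2 inner_prod_def\<close>)
  have "pd (0, 1) (\<lambda>x. Ham0 P (X x, Y x)) (\<phi>, E) = pd (0, 1) snd (\<phi>, E)"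
    by (rule pd_cong[OF open_dom2]) (use assms XY_level in auto)
  also have "\<dots> = 1"
    using pd_has_derivative[OF bounded_linear_imp_has_derivative[OF bounded_linear_snd], of "(0, 1)" "(\<phi>, E)"] by simp
  finally show ?thesis using * by (simp add: Basis_real2 fst)
qed

text \<open>Insert the Hamiltonian equations \<open>XY_pd_phi\<close> into \<open>XY_pd_E\<close>.
  The action-angle map is thus area preserving up to the factor \<open>1 / freq P E\<close>, and its
  Jacobian matrix has an explicit inverse.\<close>

lemma jacobian:
  assumes "0 < E" "E < Emax P"
  shows "freq P E * (pd (1, 0) X (\<phi>, E) * pd (0, 1) Y (\<phi>, E) - pd (1, 0) Y (\<phi>, E) * pd (0, 1) X (\<phi>, E)) = 1"
  using XY_pd_E[OF assms, of \<phi>] XY_pd_phi[OF assms, of \<phi>]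
  by (simp add: right_diff_distrib flip: mult.assoc) (simp add: algebra_simps)

text \<open>A local inverse of the action-angle map: injectivity on a strip of width \<open>2\<pi>\<close> suffices.\<close>

lemma action_angle_inverse:
  assumes "0 < E" "E < Emax P"
  obtains g T where "open T" "(X (\<phi>, E), Y (\<phi>, E)) \<in> T" "g (X (\<phi>, E), Y (\<phi>, E)) = (\<phi>, E)"
    "\<And>z. z \<in> T \<Longrightarrow> g z \<in> dom2 \<and> (X (g z), Y (g z)) = z"
    "(g has_derivative (\<lambda>(a, b). (freq P E * (pd (0, 1) Y (\<phi>, E) * a - pd (0, 1) X (\<phi>, E) * b),
        freq P E * (- pd (1, 0) Y (\<phi>, E) * a + pd (1, 0) X (\<phi>, E) * b)))) (at (X (\<phi>, E), Y (\<phi>, E)))"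
proof -
  define f where "f x = (X x, Y x)" for x
  define S where "S = {\<phi> - pi <..< \<phi> + pi} \<times> {0<..<Emax P}"
  have S: "open S" "(\<phi>, E) \<in> S" "S \<subseteq> dom2"
    using assms by (auto simp: S_def dom2_def intro!: open_Times)
  have f_der: "(f has_derivative (\<lambda>(a, b). (a * pd (1, 0) X (\<phi>, E) + b * pd (0, 1) X (\<phi>, E),
      a * pd (1, 0) Y (\<phi>, E) + b * pd (0, 1) Y (\<phi>, E)))) (at (\<phi>, E))"
    using has_derivative_Pair[OF differentiable_pd2[OF XY_diff(1)[OF assms, of \<phi>]]
        differentiable_pd2[OF XY_diff(2)[OF assms, of \<phi>]]]
    by (simp add: f_def[abs_def] case_prod_unfold)
  have contf: "continuous_on S f"
    unfolding f_def using smooth_continuous_on smooth_XY S(3)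
    by (intro continuous_on_Pair continuous_on_subset[OF _ S(3)]) blast+
  \<comment> \<open>The energy is recovered as the value of \<open>Ham0 P\<close>; the angles then
    differ by a multiple of \<open>2 pi\<close>, and less than \<open>2 pi\<close> leaves only
    zero.\<close>
  have inj: "inj_on f S"
  proof (rule inj_onI)
    fix a b assume a: "a \<in> S" and b: "b \<in> S" and eq: "f a = f b"
    obtain \<phi>1 E1 \<phi>2 E2 where ab: "a = (\<phi>1, E1)" "b = (\<phi>2, E2)" by (metis prod.exhaust)
    have E12: "0 < E1" "E1 < Emax P" "0 < E2" "E2 < Emax P" using a b by (auto simp: ab S_def)
    have "E1 = E2"
      using XY_level(2)[of E1 \<phi>1] XY_level(2)[of E2 \<phi>2] eq E12 by (simp add: f_def ab)
    then obtain k :: int where k: "\<phi>2 = \<phi>1 + of_int k * (2 * pi)"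
      using XY_inj[of E1 \<phi>1 \<phi>2] eq E12 by (auto simp: f_def ab)
    moreover have "\<bar>\<phi>2 - \<phi>1\<bar> < 2 * pi" using a b by (auto simp: ab S_def)
    ultimately have "\<bar>of_int k\<bar> * (2 * pi) < 1 * (2 * pi)" by (simp add: abs_mult)
    then have "\<bar>real_of_int k\<bar> < 1" by (subst (asm) mult_less_cancel_right_pos) auto
    then have "k = 0" by linarith
    then show "a = b" using k \<open>E1 = E2\<close> ab by simp
  qed
  define g where "g = inv_into S f"
  define G where "G = (\<lambda>(a, b). (freq P E * (pd (0, 1) Y (\<phi>, E) * a - pd (0, 1) X (\<phi>, E) * b),
        freq P E * (- pd (1, 0) Y (\<phi>, E) * a + pd (1, 0) X (\<phi>, E) * b)))"
  have J: "freq P E * pd (1, 0) X (\<phi>, E) * pd (0, 1) Y (\<phi>, E)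
      = 1 + freq P E * pd (1, 0) Y (\<phi>, E) * pd (0, 1) X (\<phi>, E)"
    using jacobian[OF assms, of \<phi>] by (simp add: algebra_simps)
  have id: "(\<lambda>(a, b). (a * pd (1, 0) X (\<phi>, E) + b * pd (0, 1) X (\<phi>, E),
      a * pd (1, 0) Y (\<phi>, E) + b * pd (0, 1) Y (\<phi>, E))) \<circ> G = id"
  proof (rule ext, clarsimp simp: G_def, intro conjI)
    fix a b
    let ?w = "freq P E" and ?xp = "pd (1, 0) X (\<phi>, E)" and ?yp = "pd (1, 0) Y (\<phi>, E)"
      and ?xe = "pd (0, 1) X (\<phi>, E)" and ?ye = "pd (0, 1) Y (\<phi>, E)"
    have "?w * (?ye * a - ?xe * b) * ?xp + ?w * (?xp * b - ?yp * a) * ?xe = (?w * ?xp * ?ye - ?w * ?yp * ?xe) * a"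
      by (simp add: algebra_simps)
    then show "?w * (?ye * a - ?xe * b) * ?xp + ?w * (?xp * b - ?yp * a) * ?xe = a" using J by simp
    have "?w * (?ye * a - ?xe * b) * ?yp + ?w * (?xp * b - ?yp * a) * ?ye = (?w * ?xp * ?ye - ?w * ?yp * ?xe) * b"
      by (simp add: algebra_simps)
    then show "?w * (?ye * a - ?xe * b) * ?yp + ?w * (?xp * b - ?yp * a) * ?ye = b" using J by simp
  qed
  have gder: "(g has_derivative G) (at (f (\<phi>, E)))"
    by (rule has_derivative_inverse_strong[OF S(1,2) contf _ f_der id])
       (simp add: g_def inv_into_f_f[OF inj])
  have linG: "bounded_linear G" using gder has_derivative_bounded_linear by blast
  \<comment> \<open>The inverse is needed on a full neighbourhood of the point, since a solution may
    leave it in any direction; invertibility of the derivative makes the image a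
    neighbourhood.\<close>
  have int: "f (\<phi>, E) \<in> interior (f ` S)"
    by (rule sussmann_open_mapping[OF S(1) contf S(2) f_der linG id subset_refl])
       (simp add: interior_open S)
  show ?thesis
  proof (rule that[of "interior (f ` S)" g])
    show "open (interior (f ` S))" by simp
    show "(X (\<phi>, E), Y (\<phi>, E)) \<in> interior (f ` S)" using int by (simp add: f_def)
    show "g (X (\<phi>, E), Y (\<phi>, E)) = (\<phi>, E)"
      using inv_into_f_f[OF inj S(2)] by (simp add: g_def f_def)
    fix z assume "z \<in> interior (f ` S)"
    then have "z \<in> f ` S" using interior_subset by blast
    then show "g z \<in> dom2 \<and> (X (g z), Y (g z)) = z"
      using inv_into_into[of z f S] f_inv_into_f[of z f S] S(3) by (auto simp: g_def f_def)
  qed (use gder in \<open>simp add: f_def G_def\<close>)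
qed

end

section \<open>Remainders of the asymptotic expansions\<close>

lemma pd_eq_deriv2:
  "((\<lambda>x. f (x, y)) has_real_derivative D) (at x) \<Longrightarrow> pd (1, 0) f (x, y) = D"
  "((\<lambda>y. f (x, y)) has_real_derivative D) (at y) \<Longrightarrow> pd (0, 1) f (x, y) = D"
  using DERIV_shift[of "\<lambda>x. f (x, y)" D 0 x] DERIV_shift[of "\<lambda>y. f (x, y)" D 0 y]
  by (auto simp: pd_def intro!: DERIV_imp_deriv simp: add.commute)

lemma pd_eq_deriv3:
  "((\<lambda>x. f (x, y, s)) has_real_derivative D) (at x) \<Longrightarrow> pd (1, 0, 0) f (x, y, s) = D"
  "((\<lambda>y. f (x, y, s)) has_real_derivative D) (at y) \<Longrightarrow> pd (0, 1, 0) f (x, y, s) = D"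
  using DERIV_shift[of "\<lambda>x. f (x, y, s)" D 0 x] DERIV_shift[of "\<lambda>y. f (x, y, s)" D 0 y]
  by (auto simp: pd_def intro!: DERIV_imp_deriv simp: add.commute)

lemma chain3:
  assumes "h differentiable (at (x t, y t, s t))"
    and "(x has_real_derivative x') (at t within I)" "(y has_real_derivative y') (at t within I)"
    and "(s has_real_derivative s') (at t within I)"
  shows "((\<lambda>t. h (x t, y t, s t)) has_real_derivative
    pd (1, 0, 0) h (x t, y t, s t) * x' + pd (0, 1, 0) h (x t, y t, s t) * y' + pd (0, 0, 1) h (x t, y t, s t) * s')
    (at t within I)"
proof -
  have "((\<lambda>t. (x t, y t, s t)) has_derivative (\<lambda>v. (x' * v, y' * v, s' * v))) (at t within I)"
    using assms(2-4) unfolding has_field_derivative_def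
    by (intro has_derivative_Pair)
  from has_derivative_compose[OF this differentiable_pd3[OF assms(1)]]
  have "((\<lambda>t. h (x t, y t, s t)) has_derivative (\<lambda>v. (x' * v) * pd (1, 0, 0) h (x t, y t, s t)
     + (y' * v) * pd (0, 1, 0) h (x t, y t, s t) + (s' * v) * pd (0, 0, 1) h (x t, y t, s t))) (at t within I)"
    by simp
  then show ?thesis unfolding has_field_derivative_def
    by (rule has_derivative_eq_rhs) (auto simp: algebra_simps)
qed

text \<open>Mean value theorem along the ray from the origin at fixed \<open>t\<close>; the ray
  stays in the ball.\<close>

lemma linear_bound_of_pd_bound:
  fixes u :: "real \<times> real \<times> real \<Rightarrow> real"
  assumes "\<And>x y. (x, y) \<in> cball 0 r \<Longrightarrow> u differentiable (at (x, y, t))"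
    "\<And>x y. (x, y) \<in> cball 0 r \<Longrightarrow> \<bar>pd (1, 0, 0) u (x, y, t)\<bar> \<le> B \<and> \<bar>pd (0, 1, 0) u (x, y, t)\<bar> \<le> B"
    "u (0, 0, t) = 0" and xy: "(x, y) \<in> cball 0 r"
  shows "\<bar>u (x, y, t)\<bar> \<le> 2 * B * norm (x, y)"
proof -
  have in_ball: "(s * x, s * y) \<in> cball 0 r" if "0 \<le> s" "s \<le> 1" for s
  proof -
    have "norm (s *\<^sub>R (x, y)) \<le> 1 * norm (x, y)"
      unfolding norm_scaleR using that by (intro mult_right_mono) auto
    then show ?thesis using xy by simp
  qed
  have "\<exists>z>0. z < 1 \<and> u (1 * x, 1 * y, t) - u (0 * x, 0 * y, t) = (1 - 0) *
     (pd (1, 0, 0) u (z * x, z * y, t) * x + pd (0, 1, 0) u (z * x, z * y, t) * y + pd (0, 0, 1) u (z * x, z * y, t) * 0)"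
  proof (rule MVT2)
    fix s :: real assume s: "0 \<le> s" "s \<le> 1"
    show "((\<lambda>s. u (s * x, s * y, t)) has_real_derivative
     (pd (1, 0, 0) u (s * x, s * y, t) * x + pd (0, 1, 0) u (s * x, s * y, t) * y + pd (0, 0, 1) u (s * x, s * y, t) * 0)) (at s)"
    proof (rule chain3[where h = u and x = "\<lambda>s. s * x" and y = "\<lambda>s. s * y" and s = "\<lambda>_. t"])
      show "u differentiable (at (s * x, s * y, t))" by (rule assms(1)[OF in_ball[OF s]])
      show "((\<lambda>s. s * x) has_real_derivative x) (at s)" "((\<lambda>s. s * y) has_real_derivative y) (at s)"
        using DERIV_cmult_right[OF DERIV_ident[of "at s"], of x] DERIV_cmult_right[OF DERIV_ident[of "at s"], of y] by simp_all
    qed simp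
  qed auto
  then obtain z where z: "0 < z" "z < 1" "u (x, y, t) = pd (1, 0, 0) u (z * x, z * y, t) * x + pd (0, 1, 0) u (z * x, z * y, t) * y"
    by (auto simp: assms(3))
  have b: "\<bar>pd (1, 0, 0) u (z * x, z * y, t)\<bar> \<le> B" "\<bar>pd (0, 1, 0) u (z * x, z * y, t)\<bar> \<le> B"
    using assms(2)[OF in_ball[of z]] z by auto
  have "\<bar>u (x, y, t)\<bar> \<le> \<bar>pd (1, 0, 0) u (z * x, z * y, t)\<bar> * \<bar>x\<bar> + \<bar>pd (0, 1, 0) u (z * x, z * y, t)\<bar> * \<bar>y\<bar>"
    unfolding z(3) abs_mult[symmetric] by (rule abs_triangle_ineq)
  also have "\<dots> \<le> B * norm (x, y) + B * norm (x, y)"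
    using b norm_fst_le[of x y] norm_snd_le[of y x] by (intro add_mono mult_mono) (simp_all add: order_trans[OF abs_ge_zero b(1)])
  finally show ?thesis by simp
qed

lemma deriv_zero_of_quadratic_bound:
  fixes h :: "real \<Rightarrow> real"
  assumes "0 < \<rho>" "\<And>x. \<bar>x\<bar> < \<rho> \<Longrightarrow> \<bar>h x\<bar> \<le> C * x\<^sup>2" "(h has_real_derivative D) (at 0)"
  shows "D = 0"
proof -
  have h0: "h 0 = 0" using assms(2)[of 0] assms(1) by simp
  have "((\<lambda>k. h k / k) \<longlongrightarrow> D) (at 0)" using assms(3) h0 by (simp add: has_field_derivative_iff)
  moreover have "((\<lambda>k. h k / k) \<longlongrightarrow> 0) (at 0)"
  proof (rule Lim_null_comparison)
    show "\<forall>\<^sub>F k in at 0. norm (h k / k) \<le> C * \<bar>k\<bar>"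
      unfolding eventually_at
    proof (intro exI[of _ \<rho>] conjI ballI impI assms(1))
      fix k :: real assume k: "k \<noteq> 0 \<and> dist k 0 < \<rho>"
      then have "\<bar>h k\<bar> \<le> (C * \<bar>k\<bar>) * \<bar>k\<bar>" using assms(2)[of k] by (simp add: power2_eq_square mult.assoc)
      then show "norm (h k / k) \<le> C * \<bar>k\<bar>" using k by (simp add: abs_divide pos_divide_le_eq)
    qed
    show "((\<lambda>k. C * \<bar>k\<bar>) \<longlongrightarrow> 0) (at 0)" by (auto intro!: tendsto_eq_intros)
  qed
  ultimately show ?thesis using tendsto_unique by (metis at_neq_bot)
qed

section \<open>Remainders of \<open>H\<close> and \<open>F\<close> near the origin\<close>

context osc begin

lemma act_rate_eq:
  assumes "0 < E" "E < Emax P" "h differentiable (at (X (\<phi>, E), Y (\<phi>, E), s))"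
  shows "act_rate P h d (E, \<phi>, s) = - freq P E *
    (pd (1, 0, 0) h (X (\<phi>, E), Y (\<phi>, E), s) * pd (1, 0) X (\<phi>, E) + pd (0, 1, 0) h (X (\<phi>, E), Y (\<phi>, E), s) * pd (1, 0) Y (\<phi>, E)
     - d (X (\<phi>, E), Y (\<phi>, E), s) * pd (1, 0) X (\<phi>, E))"
proof -
  note XY = XY_diff[OF assms(1,2), of \<phi>]
  show ?thesis
    using DERIV_imp_deriv[OF chain3[OF assms(3) pd_along2(1)[OF XY(1)] pd_along2(1)[OF XY(2)] DERIV_const]]
      DERIV_imp_deriv[OF pd_along2(1)[OF XY(1)]]
    by (simp add: act_rate_def)
qed

lemma ang_rate_eq:
  assumes "0 < E" "E < Emax P" "h differentiable (at (X (\<phi>, E), Y (\<phi>, E), s))"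
  shows "ang_rate P h d (E, \<phi>, s) = freq P E *
    (pd (1, 0, 0) h (X (\<phi>, E), Y (\<phi>, E), s) * pd (0, 1) X (\<phi>, E) + pd (0, 1, 0) h (X (\<phi>, E), Y (\<phi>, E), s) * pd (0, 1) Y (\<phi>, E)
     - d (X (\<phi>, E), Y (\<phi>, E), s) * pd (0, 1) X (\<phi>, E))"
proof -
  note XY = XY_diff[OF assms(1,2), of \<phi>]
  show ?thesis
    using DERIV_imp_deriv[OF chain3[OF assms(3) pd_along2(2)[OF XY(1)] pd_along2(2)[OF XY(2)] DERIV_const]]
      DERIV_imp_deriv[OF pd_along2(2)[OF XY(1)]]
    by (simp add: ang_rate_def)
qed

definition UT :: "(real \<times> real \<times> real) set" where "UT = {(x, y, t). (x, y) \<in> Usm \<and> 0 < t}"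

lemma open_UT: "open UT"
proof -
  have "UT = U3 \<inter> (\<lambda>(x, y, t). t) -` {0<..}" by (auto simp: U3_def UT_def)
  also have "open \<dots>"
    unfolding case_prod_unfold by (intro open_Int open_U3 open_vimage open_greaterThan continuous_intros)
  finally show ?thesis .
qed

text \<open>Written as one function of \<open>(x, y, t)\<close>, literally as in
  \<open>expansions_at_infinity\<close>, so that the bounds assumed for all its derivatives apply
  directly.\<close>

definition RH :: "nat \<Rightarrow> real \<times> real \<times> real \<Rightarrow> real" where
  "RH K = (\<lambda>(x, y, t). Ham P (x, y, t) - Ham0 P (x, y)
     - (\<Sum>k=1..K. t powr (- real k / real (qpar P)) * Ham_co P k (x, y, phase P t)))"

definition RD :: "nat \<Rightarrow> real \<times> real \<times> real \<Rightarrow> real" where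
  "RD K = (\<lambda>(x, y, t). Dis P (x, y, t)
     - (\<Sum>k=1..K. t powr (- real k / real (qpar P)) * Dis_co P k (x, y, phase P t)))"

lemma perturbation:
  "smooth_fun_on {(x, y, t). 0 < t} (Ham P)" "smooth_fun_on {(x, y, t). 0 < t} (Dis P)"
  "0 < t \<Longrightarrow> pd (1, 0, 0) (Ham P) (0, 0, t) = 0" "0 < t \<Longrightarrow> pd (0, 1, 0) (Ham P) (0, 0, t) = 0"
  "0 < t \<Longrightarrow> Dis P (0, 0, t) = 0"
  using standing unfolding standing_assumptions_def convergent_perturbation_def by auto

lemma smooth_co_phase:
  assumes "smooth_fun_on U3 h"
  shows "smooth_fun_on UT (\<lambda>(x, y, t). h (x, y, phase P t))"
proof -
  have "smooth_fun_on {0<..} (phase P)"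
    using standing unfolding standing_assumptions_def expansions_at_infinity_def by blast
  then have ph: "smooth_fun_on UT (\<lambda>x. phase P (snd (snd x)))"
    by (rule smooth_compose[OF open_UT, rotated 2])
       (auto simp: UT_def intro!: smooth_linear bounded_linear_snd_comp bounded_linear_snd)
  have "smooth_fun_on UT (\<lambda>x. h (fst x, fst (snd x), phase P (snd (snd x))))"
  proof (rule smooth_compose[OF open_UT _ _ assms])
    have "smooth_fun_on UT fst" "smooth_fun_on UT (\<lambda>x. fst (snd x))"
      by (intro smooth_linear bounded_linear_fst bounded_linear_fst_comp bounded_linear_snd)+
    then show "smooth_fun_on UT (\<lambda>x. (fst x, fst (snd x), phase P (snd (snd x))) \<bullet> c)" if "c \<in> Basis" for c
      using ph that by (auto simp: Basis_real3 inner_prod_def)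
  qed (auto simp: UT_def U3_def)
  then show ?thesis by (simp add: case_prod_unfold)
qed

lemma smooth_t_powr: "smooth_fun_on UT (\<lambda>(x, y, t). t powr a)"
  unfolding case_prod_unfold
  by (rule smooth_compose[OF open_UT _ _ smooth_powr])
     (auto simp: UT_def intro!: smooth_linear bounded_linear_snd_comp bounded_linear_snd)

lemma smooth_RH: "smooth_fun_on UT (RH K)"
proof -
  have sub: "UT \<subseteq> {(x, y, t). 0 < t}" by (auto simp: UT_def)
  have H0: "smooth_fun_on UT (\<lambda>(x, y, t). Ham0 P (x, y))"
    unfolding case_prod_unfold
    by (rule smooth_compose[OF open_UT _ _ Usm(3)])
       (auto simp: UT_def Basis_real2 inner_prod_def intro!: smooth_linear bounded_linear_fst bounded_linear_fst_comp bounded_linear_snd)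
  have "smooth_fun_on UT (\<lambda>x. Ham P x - (\<lambda>(x, y, t). Ham0 P (x, y)) x
    - (\<Sum>k\<in>{1..K}. (\<lambda>(x, y, t). t powr (- real k / real (qpar P))) x * (\<lambda>(x, y, t). Ham_co P k (x, y, phase P t)) x))"
    by (intro smooth_diff smooth_sum smooth_mult open_UT smooth_subset[OF perturbation(1) sub] H0 smooth_t_powr smooth_co_phase Usm(4)) auto
  then show ?thesis by (simp add: RH_def case_prod_unfold)
qed

lemma smooth_RD: "smooth_fun_on UT (RD K)"
proof -
  have sub: "UT \<subseteq> {(x, y, t). 0 < t}" by (auto simp: UT_def)
  have "smooth_fun_on UT (\<lambda>x. Dis P x
    - (\<Sum>k\<in>{1..K}. (\<lambda>(x, y, t). t powr (- real k / real (qpar P))) x * (\<lambda>(x, y, t). Dis_co P k (x, y, phase P t)) x))"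
    by (intro smooth_diff smooth_sum smooth_mult open_UT smooth_subset[OF perturbation(2) sub] smooth_t_powr smooth_co_phase Usm(5)) auto
  then show ?thesis by (simp add: RD_def case_prod_unfold)
qed

lemma Ham_diff: "0 < t \<Longrightarrow> Ham P differentiable (at (x, y, t))"
  using perturbation(1) smooth_differentiable by blast

lemma Ham_co_diff: "1 \<le> k \<Longrightarrow> (x, y) \<in> Usm \<Longrightarrow> Ham_co P k differentiable (at (x, y, s))"
  using smooth_differentiable[OF Usm(4)] by (simp add: U3_def)

lemma RH_pd:
  assumes "(x, y) \<in> Usm" "0 < t"
  shows "pd (1, 0, 0) (RH K) (x, y, t) = pd (1, 0, 0) (Ham P) (x, y, t) - pd (1, 0) (Ham0 P) (x, y)
      - (\<Sum>k=1..K. t powr (- real k / real (qpar P)) * pd (1, 0, 0) (Ham_co P k) (x, y, phase P t))"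
    and "pd (0, 1, 0) (RH K) (x, y, t) = pd (0, 1, 0) (Ham P) (x, y, t) - pd (0, 1) (Ham0 P) (x, y)
      - (\<Sum>k=1..K. t powr (- real k / real (qpar P)) * pd (0, 1, 0) (Ham_co P k) (x, y, phase P t))"
proof -
  note d = pd_along3[OF Ham_diff[OF assms(2), of x y]] pd_along2[OF Ham0_diff[OF assms(1)]]
    pd_along3[OF Ham_co_diff[OF _ assms(1)]]
  show "pd (1, 0, 0) (RH K) (x, y, t) = pd (1, 0, 0) (Ham P) (x, y, t) - pd (1, 0) (Ham0 P) (x, y)
      - (\<Sum>k=1..K. t powr (- real k / real (qpar P)) * pd (1, 0, 0) (Ham_co P k) (x, y, phase P t))"
    unfolding RH_def by (rule pd_eq_deriv3, simp only: prod.case, intro DERIV_diff DERIV_sum DERIV_cmult d) auto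
  show "pd (0, 1, 0) (RH K) (x, y, t) = pd (0, 1, 0) (Ham P) (x, y, t) - pd (0, 1) (Ham0 P) (x, y)
      - (\<Sum>k=1..K. t powr (- real k / real (qpar P)) * pd (0, 1, 0) (Ham_co P k) (x, y, phase P t))"
    unfolding RH_def by (rule pd_eq_deriv3, simp only: prod.case, intro DERIV_diff DERIV_sum DERIV_cmult d) auto
qed

lemma origin: "(0, 0) \<in> Usm" "(0, 0) \<in> cball 0 (rmax P)"
  using Usm(2) standing_basic(2) by (auto simp flip: zero_prod_def)

lemma co_quadratic:
  assumes "1 \<le> k"
  shows "\<exists>C. \<exists>\<rho>>0. \<forall>x y s. norm (x, y) < \<rho> \<longrightarrow>
        \<bar>Ham_co P k (x, y, s)\<bar> \<le> C * (norm (x, y))\<^sup>2 \<and> \<bar>Dis_co P k (x, y, s)\<bar> \<le> C * norm (x, y)"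
proof -
  have "\<forall>k\<ge>1. \<exists>C. \<exists>\<rho>>0. \<forall>x y s. norm (x, y) < \<rho> \<longrightarrow>
        \<bar>Ham_co P k (x, y, s)\<bar> \<le> C * (norm (x, y))\<^sup>2 \<and> \<bar>Dis_co P k (x, y, s)\<bar> \<le> C * norm (x, y)"
    using standing unfolding standing_assumptions_def expansions_at_infinity_def by (elim conjE)
  with assms show ?thesis by simp
qed

text \<open>A function bounded by \<open>C x^2\<close> has zero derivative at 0; this is applied
  along each axis.\<close>

lemma co_origin:
  assumes "1 \<le> k"
  shows "pd (1, 0, 0) (Ham_co P k) (0, 0, s) = 0" "pd (0, 1, 0) (Ham_co P k) (0, 0, s) = 0" "Dis_co P k (0, 0, s) = 0"
proof -
  obtain C \<rho> where \<rho>: "\<rho> > 0" and C: "\<And>x y s. norm (x, y) < \<rho> \<Longrightarrow>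
        \<bar>Ham_co P k (x, y, s)\<bar> \<le> C * (norm (x, y))\<^sup>2 \<and> \<bar>Dis_co P k (x, y, s)\<bar> \<le> C * norm (x, y)"
    using co_quadratic[OF assms] by (elim exE conjE) blast
  note d = pd_along3[OF Ham_co_diff[OF assms origin(1)], of s]
  have n: "norm (x, 0::real) = \<bar>x\<bar>" "norm (0::real, x) = \<bar>x\<bar>" for x :: real by (simp_all add: norm_prod_def)
  show "pd (1, 0, 0) (Ham_co P k) (0, 0, s) = 0"
  proof (rule deriv_zero_of_quadratic_bound[OF \<rho> _ d(1)])
    fix x assume "\<bar>x\<bar> < \<rho>"
    then show "\<bar>Ham_co P k (x, 0, s)\<bar> \<le> C * x\<^sup>2" using C[of x 0 s] by (simp only: n power2_abs)
  qed
  show "pd (0, 1, 0) (Ham_co P k) (0, 0, s) = 0"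
  proof (rule deriv_zero_of_quadratic_bound[OF \<rho> _ d(2)])
    fix x assume "\<bar>x\<bar> < \<rho>"
    then show "\<bar>Ham_co P k (0, x, s)\<bar> \<le> C * x\<^sup>2" using C[of 0 x s] by (simp only: n power2_abs)
  qed
  show "Dis_co P k (0, 0, s) = 0" using C[of 0 0 s] \<rho> by (simp only: n) simp
qed

text \<open>Each ingredient vanishes separately: the gradient of \<open>Ham P\<close> by assumption,
  that of \<open>Ham0 P\<close> since the origin is a fixed point, and those of the coefficients
  since they are quadratically small; similarly for \<open>Dis P\<close>.\<close>

lemma remainder_origin:
  assumes "0 < t"
  shows "pd (1, 0, 0) (RH K) (0, 0, t) = 0" "pd (0, 1, 0) (RH K) (0, 0, t) = 0" "RD K (0, 0, t) = 0"
  using RH_pd[OF origin(1) assms, of K] perturbation(3-5)[OF assms] co_origin standing_basic(8)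
  by (auto simp: RD_def vec_field0_def zero_prod_def)

lemma remainder_pds:
  assumes "set bs \<subseteq> Basis"
  shows "\<exists>C. \<forall>\<^sub>F t in at_top. \<forall>x y. (x, y) \<in> cball 0 (rmax P) \<longrightarrow>
      \<bar>pds bs (RH K) (x, y, t)\<bar> \<le> C * t powr (- real (K + 1) / real (qpar P))"
    and "\<exists>C. \<forall>\<^sub>F t in at_top. \<forall>x y. (x, y) \<in> cball 0 (rmax P) \<longrightarrow>
      \<bar>pds bs (RD K) (x, y, t)\<bar> \<le> C * t powr (- real (K + 1) / real (qpar P))"
  using standing assms unfolding standing_assumptions_def expansions_at_infinity_def RH_def RD_def
    eventually_at_top_linorder by blast+

text \<open>The expansion estimates are uniform in the disc but do not improve near the origin.
  Vanishing at the origin together with an estimate for one more derivative yields the factor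
  \<open>norm (x, y)\<close>.\<close>

lemma linear_remainder:
  fixes u :: "real \<times> real \<times> real \<Rightarrow> real"
  assumes sm: "smooth_fun_on UT u" and u0: "\<And>t. 0 < t \<Longrightarrow> u (0, 0, t) = 0"
    and b: "\<And>b. b \<in> Basis \<Longrightarrow> \<exists>C. \<forall>\<^sub>F t in at_top. \<forall>x y. (x, y) \<in> cball 0 (rmax P) \<longrightarrow>
      \<bar>pd b u (x, y, t)\<bar> \<le> C * t powr a"
  shows "\<exists>C. \<forall>\<^sub>F t in at_top. \<forall>x y. (x, y) \<in> cball 0 (rmax P) \<longrightarrow> \<bar>u (x, y, t)\<bar> \<le> C * t powr a * norm (x, y)"
proof -
  obtain C1 where C1: "\<forall>\<^sub>F t in at_top. \<forall>x y. (x, y) \<in> cball 0 (rmax P) \<longrightarrow>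
      \<bar>pd (1, 0, 0) u (x, y, t)\<bar> \<le> C1 * t powr a" using b[of "(1, 0, 0)"] by (auto simp: Basis_real3)
  obtain C2 where C2: "\<forall>\<^sub>F t in at_top. \<forall>x y. (x, y) \<in> cball 0 (rmax P) \<longrightarrow>
      \<bar>pd (0, 1, 0) u (x, y, t)\<bar> \<le> C2 * t powr a" using b[of "(0, 1, 0)"] by (auto simp: Basis_real3)
  have "\<forall>\<^sub>F t in at_top. \<forall>x y. (x, y) \<in> cball 0 (rmax P) \<longrightarrow>
      \<bar>u (x, y, t)\<bar> \<le> (2 * max C1 C2) * t powr a * norm (x, y)"
    using C1 C2 eventually_gt_at_top[of 0]
  proof eventually_elim
    case (elim t)
    show ?case
    proof (intro allI impI)
      fix x y :: real assume xy: "(x, y) \<in> cball 0 (rmax P)"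
      have m: "C1 * t powr a \<le> max C1 C2 * t powr a" "C2 * t powr a \<le> max C1 C2 * t powr a"
        by (intro mult_right_mono; simp)+
      have "\<bar>u (x, y, t)\<bar> \<le> 2 * (max C1 C2 * t powr a) * norm (x, y)"
      proof (rule linear_bound_of_pd_bound[where u = u and t = t, OF _ _ u0[OF elim(3)] xy])
        fix x y :: real assume xy: "(x, y) \<in> cball 0 (rmax P)"
        then have "(x, y, t) \<in> UT" using Usm(2) elim(3) by (auto simp: UT_def)
        then show "u differentiable (at (x, y, t))" by (rule smooth_differentiable[OF sm])
        have "\<bar>pd (1, 0, 0) u (x, y, t)\<bar> \<le> C1 * t powr a" "\<bar>pd (0, 1, 0) u (x, y, t)\<bar> \<le> C2 * t powr a"
          using elim xy by blast+
        then show "\<bar>pd (1, 0, 0) u (x, y, t)\<bar> \<le> max C1 C2 * t powr a \<and> \<bar>pd (0, 1, 0) u (x, y, t)\<bar> \<le> max C1 C2 * t powr a"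
          using m by linarith
      qed
      then show "\<bar>u (x, y, t)\<bar> \<le> (2 * max C1 C2) * t powr a * norm (x, y)" by (simp add: mult.assoc)
    qed
  qed
  then show ?thesis ..
qed

text \<open>The factor \<open>norm (x, y)\<close> is of size \<open>sqrt E\<close>. Multiplied by a
  derivative of \<open>X\<close> or \<open>Y\<close> in the angle, also of size
  \<open>sqrt E\<close>, it produces the factor \<open>E\<close> required of the action
  rate.\<close>

lemma remainder_bound:
  obtains C where "C > 0" "\<forall>\<^sub>F t in at_top. \<forall>x y. (x, y) \<in> cball 0 (rmax P) \<longrightarrow>
      \<bar>pd (1, 0, 0) (RH K) (x, y, t)\<bar> \<le> C * t powr (- real (K + 1) / real (qpar P)) * norm (x, y) \<and>
      \<bar>pd (0, 1, 0) (RH K) (x, y, t)\<bar> \<le> C * t powr (- real (K + 1) / real (qpar P)) * norm (x, y) \<and>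
      \<bar>RD K (x, y, t)\<bar> \<le> C * t powr (- real (K + 1) / real (qpar P)) * norm (x, y)"
proof -
  let ?a = "- real (K + 1) / real (qpar P)"
  have B: "(1, 0, 0) \<in> (Basis :: (real \<times> real \<times> real) set)" "(0, 1, 0) \<in> (Basis :: (real \<times> real \<times> real) set)"
    by (auto simp: Basis_real3)
  have "\<exists>C. \<forall>\<^sub>F t in at_top. \<forall>x y. (x, y) \<in> cball 0 (rmax P) \<longrightarrow>
      \<bar>pd (1, 0, 0) (RH K) (x, y, t)\<bar> \<le> C * t powr ?a * norm (x, y)"
    by (rule linear_remainder[OF smooth_pd[OF smooth_RH B(1)] remainder_origin(1)])
       (use remainder_pds(1)[of "[b, (1, 0, 0)]" K for b] B in simp_all)
  then obtain C1 where C1: "\<forall>\<^sub>F t in at_top. \<forall>x y. (x, y) \<in> cball 0 (rmax P) \<longrightarrow>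
      \<bar>pd (1, 0, 0) (RH K) (x, y, t)\<bar> \<le> C1 * t powr ?a * norm (x, y)" ..
  have "\<exists>C. \<forall>\<^sub>F t in at_top. \<forall>x y. (x, y) \<in> cball 0 (rmax P) \<longrightarrow>
      \<bar>pd (0, 1, 0) (RH K) (x, y, t)\<bar> \<le> C * t powr ?a * norm (x, y)"
    by (rule linear_remainder[OF smooth_pd[OF smooth_RH B(2)] remainder_origin(2)])
       (use remainder_pds(1)[of "[b, (0, 1, 0)]" K for b] B in simp_all)
  then obtain C2 where C2: "\<forall>\<^sub>F t in at_top. \<forall>x y. (x, y) \<in> cball 0 (rmax P) \<longrightarrow>
      \<bar>pd (0, 1, 0) (RH K) (x, y, t)\<bar> \<le> C2 * t powr ?a * norm (x, y)" ..
  have "\<exists>C. \<forall>\<^sub>F t in at_top. \<forall>x y. (x, y) \<in> cball 0 (rmax P) \<longrightarrow>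
      \<bar>RD K (x, y, t)\<bar> \<le> C * t powr ?a * norm (x, y)"
    by (rule linear_remainder[OF smooth_RD remainder_origin(3)])
       (use remainder_pds(2)[of "[b]" K for b] in simp_all)
  then obtain C3 where C3: "\<forall>\<^sub>F t in at_top. \<forall>x y. (x, y) \<in> cball 0 (rmax P) \<longrightarrow>
      \<bar>RD K (x, y, t)\<bar> \<le> C3 * t powr ?a * norm (x, y)" ..
  define C where "C = \<bar>C1\<bar> + \<bar>C2\<bar> + \<bar>C3\<bar> + 1"
  have le: "c * t powr ?a * norm (x, y) \<le> C * t powr ?a * norm (x, y)" if "c \<le> C" for c t x y
    using that by (intro mult_right_mono) auto
  have "C1 \<le> C" "C2 \<le> C" "C3 \<le> C" by (auto simp: C_def)
  note le' = this[THEN le]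
  show ?thesis
  proof (rule that[of C])
    show "\<forall>\<^sub>F t in at_top. \<forall>x y. (x, y) \<in> cball 0 (rmax P) \<longrightarrow>
      \<bar>pd (1, 0, 0) (RH K) (x, y, t)\<bar> \<le> C * t powr ?a * norm (x, y) \<and>
      \<bar>pd (0, 1, 0) (RH K) (x, y, t)\<bar> \<le> C * t powr ?a * norm (x, y) \<and>
      \<bar>RD K (x, y, t)\<bar> \<le> C * t powr ?a * norm (x, y)"
      using C1 C2 C3
    proof eventually_elim
      case (elim t)
      show ?case
      proof (intro allI impI)
        fix x y :: real assume xy: "(x, y) \<in> cball 0 (rmax P)"
        then show "\<bar>pd (1, 0, 0) (RH K) (x, y, t)\<bar> \<le> C * t powr ?a * norm (x, y) \<and>
          \<bar>pd (0, 1, 0) (RH K) (x, y, t)\<bar> \<le> C * t powr ?a * norm (x, y) \<and>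
          \<bar>RD K (x, y, t)\<bar> \<le> C * t powr ?a * norm (x, y)"
          using elim[rule_format, OF xy] le'(1)[of t x y] le'(2)[of t x y] le'(3)[of t x y] by linarith
      qed
    qed
  qed (simp add: C_def)
qed

end

text \<open>A function without energy dependence has zero energy derivatives, so boundedness of all
  its derivatives is all that order 0 requires.\<close>

lemma symbol_lift:
  assumes "smooth_fun_on UNIV h" "\<And>bs. set bs \<subseteq> Basis \<Longrightarrow> \<exists>C. \<forall>x. \<bar>pds bs h x\<bar> \<le> C"
  shows "symbol 0 (\<lambda>(e :: real, x :: real \<times> real). h x)"
proof -
  define lift :: "(real \<times> real \<Rightarrow> real) \<Rightarrow> real \<times> real \<times> real \<Rightarrow> real"
    where "lift h x = h (snd x)" for h x
  have lift_pd: "pd (c, b) (lift h) x = pd b h (snd x)" if "h differentiable (at (snd x))"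
    for c :: real and b h and x :: "real \<times> real \<times> real"
    using pd_has_derivative[OF has_derivative_compose[OF bounded_linear_imp_has_derivative[OF bounded_linear_snd]
        that[unfolded frechet_derivative_works]], of "(c, b)"]
      pd_has_derivative[OF that[unfolded frechet_derivative_works]]
    by (simp add: lift_def[abs_def])
  have "\<exists>C. \<forall>x\<in>strip 1. \<bar>pds bs (lift h) x\<bar> \<le> C * fst x powr (0 - eorder bs)" if "set bs \<subseteq> Basis" for bs
    using that assms
  proof (induction bs arbitrary: h rule: rev_induct)
    case Nil
    then obtain C where "\<And>x. \<bar>h x\<bar> \<le> C" using Nil(3)[of "[]"] by auto
    then show ?case by (intro exI[of _ C]) (simp add: lift_def eorder_def strip_fst)
  next
    case (snoc b bs)
    have bs: "set bs \<subseteq> Basis" and "b \<in> Basis" using snoc.prems by auto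
    obtain c b' where b: "b = (c, b')" by (metis prod.exhaust)
    have pd: "pd b (lift h) = lift (pd b' h)"
    proof
      fix x :: "real \<times> real \<times> real"
      have "h differentiable (at (snd x))" using smooth_differentiable[OF snoc.prems(2)] by simp
      then show "pd b (lift h) x = lift (pd b' h) x" using lift_pd[of h x c b'] by (simp add: b lift_def)
    qed
    show ?case
    proof (cases "b' \<in> Basis")
      case True
      then have "eorder (bs @ [b]) = eorder bs" by (auto simp: eorder_def b Basis_real2)
      moreover have "\<exists>C. \<forall>x. \<bar>pds cs (pd b' h) x\<bar> \<le> C" if "set cs \<subseteq> Basis" for cs
        using snoc.prems(3)[of "cs @ [b']"] that True by (simp add: pds_snoc)
      ultimately show ?thesis
        using snoc.IH[OF bs smooth_pd[OF snoc.prems(2) True]] by (simp add: pds_snoc pd)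
    next
      case False
      then have "b' = 0" using \<open>b \<in> Basis\<close> by (auto simp: b Basis_real3 Basis_real2 zero_prod_def)
      then have "pd b' h = (\<lambda>_. 0)" by (auto simp: pd_def fun_eq_iff)
      then have "pd b (lift h) = (\<lambda>_. 0)" by (simp add: pd lift_def fun_eq_iff)
      moreover have "pds bs (\<lambda>_::real \<times> real \<times> real. 0) = (\<lambda>_. 0)" by (induction bs) auto
      ultimately show ?thesis by (intro exI[of _ 0]) (simp add: pds_snoc)
    qed
  qed
  moreover have "smooth_fun_on (strip 1) (lift h)"
    unfolding lift_def[abs_def]
    by (rule smooth_compose[OF open_strip _ _ assms(1)])
       (auto simp: Basis_real2 inner_prod_def intro!: smooth_linear bounded_linear_fst_comp bounded_linear_snd bounded_linear_snd_comp)
  ultimately have "symbol 0 (lift h)"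
    by (intro symbolI[OF zero_less_one]) (blast intro: zero_less_one)+
  then show ?thesis by (simp add: lift_def[abs_def] case_prod_unfold)
qed

lemma periodic_bounded:
  fixes h :: "real \<times> real \<Rightarrow> real"
  assumes "continuous_on UNIV h" "0 < L" "\<And>x y. h (x + L, y) = h (x, y)" "\<And>x y. h (x, y + L) = h (x, y)"
  shows "\<exists>C. \<forall>x. \<bar>h x\<bar> \<le> C"
proof -
  obtain C where C: "\<And>x. x \<in> {0..L} \<times> {0..L} \<Longrightarrow> norm (h x) \<le> C"
    using continuous_on_compact_bound[OF compact_Times[OF compact_Icc compact_Icc] continuous_on_subset[OF assms(1) subset_UNIV]]
    by blast
  have "\<bar>h (x, y)\<bar> \<le> C" for x y
  proof -
    define r where "r s = s - of_int \<lfloor>s / L\<rfloor> * L" for s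
    have r: "r s \<in> {0..L}" for s
      using floor_divide_lower[OF assms(2), of s] floor_divide_upper[OF assms(2), of s] by (simp add: r_def algebra_simps)
    have "h (x, y) = h (r x, y)"
      using periodic_int[of "\<lambda>x. h (x, y)" L "r x" "\<lfloor>x / L\<rfloor>", OF assms(3)] by (simp add: r_def)
    also have "\<dots> = h (r x, r y)"
      using periodic_int[of "\<lambda>y. h (r x, y)" L "r y" "\<lfloor>y / L\<rfloor>", OF assms(4)] by (simp add: r_def)
    finally show ?thesis using C[of "(r x, r y)"] r by simp
  qed
  then show ?thesis by (intro exI[of _ C]) auto
qed

section \<open>The action-angle map at small energy\<close>

context osc begin

text \<open>The leading terms behave like \<open>sqrt E\<close>, and like \<open>1 / sqrt E\<close>
  after an energy derivative. The remainders are of size \<open>E\<close>, respectively 1, and are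
  dominated by them for \<open>E < 1\<close>.\<close>

lemma XY_bounds:
  obtains C \<eta> where "0 < C" "0 < \<eta>" "\<eta> \<le> 1" "\<eta> \<le> Emax P"
    "\<And>E \<phi>. 0 < E \<Longrightarrow> E < \<eta> \<Longrightarrow> \<bar>pd (1, 0) X (\<phi>, E)\<bar> \<le> C * sqrt E \<and> \<bar>pd (1, 0) Y (\<phi>, E)\<bar> \<le> C * sqrt E \<and>
      \<bar>pd (0, 1) X (\<phi>, E)\<bar> \<le> C / sqrt E \<and> \<bar>pd (0, 1) Y (\<phi>, E)\<bar> \<le> C / sqrt E \<and>
      norm (X (\<phi>, E), Y (\<phi>, E)) \<le> C * sqrt E \<and> freq P E \<le> C"
proof -
  define fX where "fX = (\<lambda>(\<phi>, E). X (\<phi>, E) - sqrt (2 * E) * cos \<phi>)"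
  define fY where "fY = (\<lambda>(\<phi>, E). Y (\<phi>, E) + sqrt (2 * E) * sin \<phi>)"
  have ex: "\<exists>C. \<exists>\<eta>>0. \<forall>E\<in>{0<..<\<eta>}. \<forall>\<phi>.
           \<bar>pds bs fX (\<phi>, E)\<bar> \<le> C * E powr (1 - real (count_list bs (0, 1))) \<and>
           \<bar>pds bs fY (\<phi>, E)\<bar> \<le> C * E powr (1 - real (count_list bs (0, 1)))" if "set bs \<subseteq> Basis" for bs
    using standing that unfolding standing_assumptions_def expansions_at_zero_def fX_def fY_def by blast
  have ex': "\<exists>C \<eta>. \<eta> > 0 \<and> (\<forall>E \<phi>. 0 < E \<longrightarrow> E < \<eta> \<longrightarrow>
           \<bar>pds bs fX (\<phi>, E)\<bar> \<le> C * E powr (1 - real (count_list bs (0, 1))) \<and>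
           \<bar>pds bs fY (\<phi>, E)\<bar> \<le> C * E powr (1 - real (count_list bs (0, 1))))" if "set bs \<subseteq> Basis" for bs
    using ex[OF that] by (metis greaterThanLessThan_iff)
  obtain C0 \<eta>0 where 0: "\<eta>0 > 0" "\<And>E \<phi>. 0 < E \<Longrightarrow> E < \<eta>0 \<Longrightarrow>
      \<bar>pds [] fX (\<phi>, E)\<bar> \<le> C0 * E powr (1 - real (count_list [] (0 :: real, 1 :: real))) \<and>
      \<bar>pds [] fY (\<phi>, E)\<bar> \<le> C0 * E powr (1 - real (count_list [] (0 :: real, 1 :: real)))"
    using ex'[of "[]"] by auto
  obtain C1 \<eta>1 where 1: "\<eta>1 > 0" "\<And>E \<phi>. 0 < E \<Longrightarrow> E < \<eta>1 \<Longrightarrow>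
      \<bar>pds [(1, 0)] fX (\<phi>, E)\<bar> \<le> C1 * E powr (1 - real (count_list [(1, 0)] (0 :: real, 1 :: real))) \<and>
      \<bar>pds [(1, 0)] fY (\<phi>, E)\<bar> \<le> C1 * E powr (1 - real (count_list [(1, 0)] (0 :: real, 1 :: real)))"
    using ex'[of "[(1, 0)]"] by (auto simp: Basis_real2)
  obtain C2 \<eta>2 where 2: "\<eta>2 > 0" "\<And>E \<phi>. 0 < E \<Longrightarrow> E < \<eta>2 \<Longrightarrow>
      \<bar>pds [(0, 1)] fX (\<phi>, E)\<bar> \<le> C2 * E powr (1 - real (count_list [(0, 1)] (0 :: real, 1 :: real))) \<and>
      \<bar>pds [(0, 1)] fY (\<phi>, E)\<bar> \<le> C2 * E powr (1 - real (count_list [(0, 1)] (0 :: real, 1 :: real)))"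
    using ex'[of "[(0, 1)]"] by (auto simp: Basis_real2)
  obtain M where M: "M \<ge> 0" "\<And>E. E \<in> {0..Emax P} \<Longrightarrow> norm (freq P E) \<le> M"
    using continuous_on_compact_bound[OF _ standing_basic(3)] by (metis compact_Icc)
  \<comment> \<open>Chosen to dominate \<open>\<bar>C1\<bar> + 2\<close>,
    \<open>\<bar>C2\<bar> + 1\<close>, \<open>2 \<bar>C0\<bar> + 4\<close> and \<open>M\<close>, the
    constants for the angle derivatives, the energy derivatives, the norm and the frequency.\<close>
  define C where "C = 2 * \<bar>C0\<bar> + \<bar>C1\<bar> + \<bar>C2\<bar> + M + 4"
  define \<eta> where "\<eta> = min (min \<eta>0 \<eta>1) (min \<eta>2 (min 1 (Emax P)))"
  show ?thesis
  proof (rule that[of C \<eta>])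
    show "0 < C" using M by (simp add: C_def)
    show "0 < \<eta>" "\<eta> \<le> 1" "\<eta> \<le> Emax P" using 0 1 2 standing_basic(1) by (auto simp: \<eta>_def)
    fix E \<phi> assume E: "0 < E" "E < \<eta>"
    then have E': "E < \<eta>0" "E < \<eta>1" "E < \<eta>2" "E < 1" "E < Emax P" by (auto simp: \<eta>_def)
    have s: "0 < sqrt E" "sqrt E \<le> 1" "E \<le> sqrt E" "1 \<le> 1 / sqrt E"
      using E E' by (auto simp: real_le_rsqrt power2_eq_square mult_left_le_one_le)
    have s2: "sqrt (2 * E) \<le> 2 * sqrt E" "1 / sqrt (2 * E) \<le> 1 / sqrt E"
      using E sqrt2_less_2 by (auto simp: real_sqrt_mult intro!: divide_left_mono mult_right_mono)
    note d = XY_diff[OF E(1) E'(5), of \<phi>]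
    have b0: "\<bar>X (\<phi>, E) - sqrt (2 * E) * cos \<phi>\<bar> \<le> C0 * E" "\<bar>Y (\<phi>, E) + sqrt (2 * E) * sin \<phi>\<bar> \<le> C0 * E"
      using 0(2)[OF E(1) E'(1), of \<phi>] E(1) by (simp_all add: fX_def fY_def)
    have b1: "\<bar>pd (1, 0) fX (\<phi>, E)\<bar> \<le> C1 * E" "\<bar>pd (1, 0) fY (\<phi>, E)\<bar> \<le> C1 * E"
      using 1(2)[OF E(1) E'(2), of \<phi>] E(1) by simp_all
    have b2: "\<bar>pd (0, 1) fX (\<phi>, E)\<bar> \<le> C2" "\<bar>pd (0, 1) fY (\<phi>, E)\<bar> \<le> C2"
      using 2(2)[OF E(1) E'(3), of \<phi>] E(1) by simp_all
    have Xp: "pd (1, 0) fX (\<phi>, E) = pd (1, 0) X (\<phi>, E) + sqrt (2 * E) * sin \<phi>"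
      unfolding fX_def by (rule pd_eq_deriv2) (auto intro!: derivative_eq_intros pd_along2(1)[OF d(1)])
    have Yp: "pd (1, 0) fY (\<phi>, E) = pd (1, 0) Y (\<phi>, E) + sqrt (2 * E) * cos \<phi>"
      unfolding fY_def by (rule pd_eq_deriv2) (auto intro!: derivative_eq_intros pd_along2(1)[OF d(2)])
    have ds: "((\<lambda>E. sqrt (2 * E)) has_real_derivative 1 / sqrt (2 * E)) (at E)"
      using DERIV_chain2[OF DERIV_real_sqrt[of "2 * E"] DERIV_cmult_Id[of 2 E]] E by (simp add: inverse_eq_divide)
    have Xe: "pd (0, 1) fX (\<phi>, E) = pd (0, 1) X (\<phi>, E) - 1 / sqrt (2 * E) * cos \<phi>"
      unfolding fX_def by (rule pd_eq_deriv2) (simp only: prod.case, intro DERIV_diff pd_along2(2)[OF d(1)] DERIV_cmult_right[OF ds])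
    have Ye: "pd (0, 1) fY (\<phi>, E) = pd (0, 1) Y (\<phi>, E) + 1 / sqrt (2 * E) * sin \<phi>"
      unfolding fY_def by (rule pd_eq_deriv2) (simp only: prod.case, intro DERIV_add pd_along2(2)[OF d(2)] DERIV_cmult_right[OF ds])
    have tr: "\<bar>sqrt (2 * E) * sin \<phi>\<bar> \<le> 2 * sqrt E" "\<bar>sqrt (2 * E) * cos \<phi>\<bar> \<le> 2 * sqrt E"
      "\<bar>1 / sqrt (2 * E) * sin \<phi>\<bar> \<le> 1 / sqrt E" "\<bar>1 / sqrt (2 * E) * cos \<phi>\<bar> \<le> 1 / sqrt E"
      using mult_mono[OF s2(1) abs_sin_le_one[of \<phi>]] mult_mono[OF s2(1) abs_cos_le_one[of \<phi>]]
        mult_mono[OF s2(2) abs_sin_le_one[of \<phi>]] mult_mono[OF s2(2) abs_cos_le_one[of \<phi>]] E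
      by (simp_all add: abs_mult)
    have c: "c * E \<le> \<bar>c\<bar> * sqrt E" "c \<le> \<bar>c\<bar> * (1 / sqrt E)" for c
    proof -
      have "c * E \<le> \<bar>c\<bar> * E" using E by (intro mult_right_mono) auto
      also have "\<dots> \<le> \<bar>c\<bar> * sqrt E" using s by (intro mult_left_mono) auto
      finally show "c * E \<le> \<bar>c\<bar> * sqrt E" .
      have "c \<le> \<bar>c\<bar> * 1" by simp
      also have "\<dots> \<le> \<bar>c\<bar> * (1 / sqrt E)" using s(4) by (intro mult_left_mono) auto
      finally show "c \<le> \<bar>c\<bar> * (1 / sqrt E)" .
    qed
    have CC: "(\<bar>C1\<bar> + 2) * sqrt E \<le> C * sqrt E" "(\<bar>C2\<bar> + 1) * (1 / sqrt E) \<le> C * (1 / sqrt E)"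
      "(2 * \<bar>C0\<bar> + 4) * sqrt E \<le> C * sqrt E"
      using s M(1) by (intro mult_right_mono; simp add: C_def)+
    have a: "\<bar>a\<bar> \<le> m" if "\<bar>a + b\<bar> \<le> c \<or> \<bar>a - b\<bar> \<le> c" "\<bar>b\<bar> \<le> d" "c \<le> c'" "c' + d \<le> m" for a b c c' d m :: real
      using that by linarith
    note CC' = CC[unfolded distrib_right]
    have "\<bar>pd (1, 0) X (\<phi>, E)\<bar> \<le> C * sqrt E" "\<bar>pd (1, 0) Y (\<phi>, E)\<bar> \<le> C * sqrt E"
      by (rule a[OF _ tr(1) c(1)[of C1] CC'(1)]; use b1 Xp in simp; fail)
         (rule a[OF _ tr(2) c(1)[of C1] CC'(1)]; use b1 Yp in simp; fail)
    moreover have "\<bar>pd (0, 1) X (\<phi>, E)\<bar> \<le> C * (1 / sqrt E)" "\<bar>pd (0, 1) Y (\<phi>, E)\<bar> \<le> C * (1 / sqrt E)"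
      by (rule a[OF _ tr(4) c(2)[of C2]]; use b2 Xe CC'(2) in simp; fail)
         (rule a[OF _ tr(3) c(2)[of C2]]; use b2 Ye CC'(2) in simp; fail)
    moreover have "\<bar>X (\<phi>, E)\<bar> \<le> \<bar>C0\<bar> * sqrt E + 2 * sqrt E" "\<bar>Y (\<phi>, E)\<bar> \<le> \<bar>C0\<bar> * sqrt E + 2 * sqrt E"
      by (rule a[OF _ tr(2) c(1)[of C0]]; use b0 in simp; fail)
         (rule a[OF _ tr(1) c(1)[of C0]]; use b0 in simp; fail)
    then have "norm (X (\<phi>, E), Y (\<phi>, E)) \<le> C * sqrt E"
    proof -
      assume XY: "\<bar>X (\<phi>, E)\<bar> \<le> \<bar>C0\<bar> * sqrt E + 2 * sqrt E" "\<bar>Y (\<phi>, E)\<bar> \<le> \<bar>C0\<bar> * sqrt E + 2 * sqrt E"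
      have "norm (X (\<phi>, E), Y (\<phi>, E)) \<le> \<bar>X (\<phi>, E)\<bar> + \<bar>Y (\<phi>, E)\<bar>"
        using norm_Pair_le[of "X (\<phi>, E)" "Y (\<phi>, E)"] by simp
      also have "\<dots> \<le> (2 * \<bar>C0\<bar> + 4) * sqrt E" using add_mono[OF XY] by (simp add: distrib_right)
      finally show ?thesis using CC(3) by (rule order_trans)
    qed
    moreover have "freq P E \<le> C"
    proof -
      have "freq P E \<le> M" using M(2)[of E] E(1) E'(5) by (simp add: abs_le_iff)
      also have "M \<le> C" unfolding C_def using abs_ge_zero[of C0] abs_ge_zero[of C1] abs_ge_zero[of C2] by (simp del: abs_ge_zero)
      finally show ?thesis .
    qed
    ultimately show "\<bar>pd (1, 0) X (\<phi>, E)\<bar> \<le> C * sqrt E \<and> \<bar>pd (1, 0) Y (\<phi>, E)\<bar> \<le> C * sqrt E \<and>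
      \<bar>pd (0, 1) X (\<phi>, E)\<bar> \<le> C / sqrt E \<and> \<bar>pd (0, 1) Y (\<phi>, E)\<bar> \<le> C / sqrt E \<and>
      norm (X (\<phi>, E), Y (\<phi>, E)) \<le> C * sqrt E \<and> freq P E \<le> C" by simp
  qed
qed

text \<open>The rate is linear in the pair of functions, and the contribution of
  \<open>Ham0 P\<close> is zero because the orbit stays on a level line
  (\<open>XY_pd_phi\<close>).\<close>

lemma act_rate_remainder:
  assumes "0 < E" "E < Emax P" "0 < t"
  shows "act_rate P (Ham P) (Dis P) (E, \<phi>, t)
      - (\<Sum>k=1..K. t powr (- real k / real (qpar P)) * f_co P k (E, \<phi>, phase P t))
    = - freq P E * (pd (1, 0, 0) (RH K) (X (\<phi>, E), Y (\<phi>, E), t) * pd (1, 0) X (\<phi>, E)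
       + pd (0, 1, 0) (RH K) (X (\<phi>, E), Y (\<phi>, E), t) * pd (1, 0) Y (\<phi>, E)
       - RD K (X (\<phi>, E), Y (\<phi>, E), t) * pd (1, 0) X (\<phi>, E))"
proof -
  let ?x = "X (\<phi>, E)" and ?y = "Y (\<phi>, E)"
  have U: "(?x, ?y) \<in> Usm" using XY_Usm assms by simp
  have f: "(\<Sum>k=1..K. t powr (- real k / real (qpar P)) * f_co P k (E, \<phi>, phase P t))
    = (\<Sum>k=1..K. t powr (- real k / real (qpar P)) * (- freq P E *
    (pd (1, 0, 0) (Ham_co P k) (?x, ?y, phase P t) * pd (1, 0) X (\<phi>, E) + pd (0, 1, 0) (Ham_co P k) (?x, ?y, phase P t) * pd (1, 0) Y (\<phi>, E)
     - Dis_co P k (?x, ?y, phase P t) * pd (1, 0) X (\<phi>, E))))"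
    using act_rate_eq[OF assms(1,2) Ham_co_diff[OF _ U]] by (intro sum.cong) (auto simp: f_co_def)
  have 0: "freq P E * pd (1, 0) X (\<phi>, E) = pd (0, 1) (Ham0 P) (?x, ?y)"
    "freq P E * pd (1, 0) Y (\<phi>, E) = - pd (1, 0) (Ham0 P) (?x, ?y)"
    using XY_pd_phi[OF assms(1,2)] by auto
  have "freq P E * (pd (1, 0) (Ham0 P) (?x, ?y) * pd (1, 0) X (\<phi>, E) + pd (0, 1) (Ham0 P) (?x, ?y) * pd (1, 0) Y (\<phi>, E))
     = pd (1, 0) (Ham0 P) (?x, ?y) * (freq P E * pd (1, 0) X (\<phi>, E)) + pd (0, 1) (Ham0 P) (?x, ?y) * (freq P E * pd (1, 0) Y (\<phi>, E))"
    by (simp add: algebra_simps)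
  also have "\<dots> = 0" unfolding 0 by simp
  finally have z: "freq P E * (pd (1, 0) (Ham0 P) (?x, ?y) * pd (1, 0) X (\<phi>, E) + pd (0, 1) (Ham0 P) (?x, ?y) * pd (1, 0) Y (\<phi>, E)) = 0" .
  show ?thesis
    unfolding f act_rate_eq[OF assms(1,2) Ham_diff[OF assms(3)]] RH_pd[OF U assms(3)] RD_def prod.case
    using z by (simp add: algebra_simps sum.distrib sum_subtractf sum_distrib_left sum_distrib_right sum_negf)
qed

text \<open>Again by linearity; here \<open>Ham0 P\<close> contributes exactly
  \<open>freq P E\<close>, by \<open>XY_pd_E\<close>.\<close>

lemma ang_rate_remainder:
  assumes "0 < E" "E < Emax P" "0 < t"
  shows "ang_rate P (Ham P) (Dis P) (E, \<phi>, t) - freq P E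
      - (\<Sum>k=1..K. t powr (- real k / real (qpar P)) * g_co P k (E, \<phi>, phase P t))
    = freq P E * (pd (1, 0, 0) (RH K) (X (\<phi>, E), Y (\<phi>, E), t) * pd (0, 1) X (\<phi>, E)
       + pd (0, 1, 0) (RH K) (X (\<phi>, E), Y (\<phi>, E), t) * pd (0, 1) Y (\<phi>, E)
       - RD K (X (\<phi>, E), Y (\<phi>, E), t) * pd (0, 1) X (\<phi>, E))"
proof -
  let ?x = "X (\<phi>, E)" and ?y = "Y (\<phi>, E)"
  have U: "(?x, ?y) \<in> Usm" using XY_Usm assms by simp
  have f: "(\<Sum>k=1..K. t powr (- real k / real (qpar P)) * g_co P k (E, \<phi>, phase P t))
    = (\<Sum>k=1..K. t powr (- real k / real (qpar P)) * (freq P E *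
    (pd (1, 0, 0) (Ham_co P k) (?x, ?y, phase P t) * pd (0, 1) X (\<phi>, E) + pd (0, 1, 0) (Ham_co P k) (?x, ?y, phase P t) * pd (0, 1) Y (\<phi>, E)
     - Dis_co P k (?x, ?y, phase P t) * pd (0, 1) X (\<phi>, E))))"
    using ang_rate_eq[OF assms(1,2) Ham_co_diff[OF _ U]] by (intro sum.cong) (auto simp: g_co_def)
  have z: "freq P E * (pd (0, 1) X (\<phi>, E) * pd (1, 0) (Ham0 P) (?x, ?y) + pd (0, 1) Y (\<phi>, E) * pd (0, 1) (Ham0 P) (?x, ?y)) = freq P E"
    using XY_pd_E[OF assms(1,2)] by simp
  show ?thesis
    unfolding f ang_rate_eq[OF assms(1,2) Ham_diff[OF assms(3)]] RH_pd[OF U assms(3)] RD_def prod.case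
    using z by (simp add: algebra_simps sum.distrib sum_subtractf sum_distrib_left sum_distrib_right)
qed

text \<open>Gradients of the remainder are of size \<open>sqrt E\<close>. They meet angle
  derivatives of size \<open>sqrt E\<close> in the action rate and energy derivatives of size
  \<open>1 / sqrt E\<close> in the angle rate: the errors carry \<open>E\<close> and 1
  respectively.\<close>

lemma rate_expansions:
  obtains C \<eta> T where "0 < C" "0 < \<eta>" "\<eta> \<le> Emax P" "1 \<le> T"
    "\<And>E \<phi> t. 0 < E \<Longrightarrow> E < \<eta> \<Longrightarrow> T \<le> t \<Longrightarrow>
      \<bar>act_rate P (Ham P) (Dis P) (E, \<phi>, t)
        - (\<Sum>k=1..K. t powr (- real k / real (qpar P)) * f_co P k (E, \<phi>, phase P t))\<bar>
      \<le> C * E * t powr (- real (K + 1) / real (qpar P))"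
    "\<And>E \<phi> t. 0 < E \<Longrightarrow> E < \<eta> \<Longrightarrow> T \<le> t \<Longrightarrow>
      \<bar>ang_rate P (Ham P) (Dis P) (E, \<phi>, t) - freq P E
        - (\<Sum>k=1..K. t powr (- real k / real (qpar P)) * g_co P k (E, \<phi>, phase P t))\<bar>
      \<le> C * t powr (- real (K + 1) / real (qpar P))"
proof -
  obtain C \<eta> where C: "0 < C" "0 < \<eta>" "\<eta> \<le> 1" "\<eta> \<le> Emax P"
    "\<And>E \<phi>. 0 < E \<Longrightarrow> E < \<eta> \<Longrightarrow> \<bar>pd (1, 0) X (\<phi>, E)\<bar> \<le> C * sqrt E \<and> \<bar>pd (1, 0) Y (\<phi>, E)\<bar> \<le> C * sqrt E \<and>
      \<bar>pd (0, 1) X (\<phi>, E)\<bar> \<le> C / sqrt E \<and> \<bar>pd (0, 1) Y (\<phi>, E)\<bar> \<le> C / sqrt E \<and>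
      norm (X (\<phi>, E), Y (\<phi>, E)) \<le> C * sqrt E \<and> freq P E \<le> C"
    by (rule XY_bounds) blast
  let ?a = "- real (K + 1) / real (qpar P)"
  obtain D where D: "D > 0" "\<forall>\<^sub>F t in at_top. \<forall>x y. (x, y) \<in> cball 0 (rmax P) \<longrightarrow>
      \<bar>pd (1, 0, 0) (RH K) (x, y, t)\<bar> \<le> D * t powr ?a * norm (x, y) \<and>
      \<bar>pd (0, 1, 0) (RH K) (x, y, t)\<bar> \<le> D * t powr ?a * norm (x, y) \<and>
      \<bar>RD K (x, y, t)\<bar> \<le> D * t powr ?a * norm (x, y)"
    by (rule remainder_bound)
  obtain T where "\<forall>t\<ge>T. \<forall>x y. (x, y) \<in> cball 0 (rmax P) \<longrightarrow>
      \<bar>pd (1, 0, 0) (RH K) (x, y, t)\<bar> \<le> D * t powr ?a * norm (x, y) \<and>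
      \<bar>pd (0, 1, 0) (RH K) (x, y, t)\<bar> \<le> D * t powr ?a * norm (x, y) \<and>
      \<bar>RD K (x, y, t)\<bar> \<le> D * t powr ?a * norm (x, y)"
    using D(2) unfolding eventually_at_top_linorder by blast
  note T = this[rule_format]
  have main: "\<bar>w * (a * p + b * r - c * p)\<bar> \<le> C * (3 * (D * t powr ?a * (C * sqrt E)) * B)"
    if "0 < w" "w \<le> C" "\<bar>a\<bar> \<le> D * t powr ?a * n" "\<bar>b\<bar> \<le> D * t powr ?a * n" "\<bar>c\<bar> \<le> D * t powr ?a * n"
      "n \<le> C * sqrt E" "\<bar>p\<bar> \<le> B" "\<bar>r\<bar> \<le> B" "0 \<le> B" for w a b c p r B n t E
  proof -
    let ?m = "D * t powr ?a * (C * sqrt E)"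
    have "D * t powr ?a * n \<le> ?m" using that D(1) by (intro mult_left_mono) auto
    note * = order_trans[OF that(3) this] order_trans[OF that(4) this] order_trans[OF that(5) this]
    have m0: "0 \<le> ?m" using order_trans[OF abs_ge_zero *(1)] .
    have "\<bar>a * p + b * r - c * p\<bar> \<le> \<bar>a\<bar> * \<bar>p\<bar> + \<bar>b\<bar> * \<bar>r\<bar> + \<bar>c\<bar> * \<bar>p\<bar>"
      unfolding abs_mult[symmetric] by (meson abs_triangle_ineq abs_triangle_ineq4 add_mono order_refl order_trans)
    also have "\<dots> \<le> ?m * B + ?m * B + ?m * B"
      using * that(7-9) m0 by (intro add_mono mult_mono abs_ge_zero)
    also have "\<dots> = 3 * ?m * B" by simp
    finally have **: "\<bar>a * p + b * r - c * p\<bar> \<le> 3 * ?m * B" .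
    show ?thesis unfolding abs_mult[of w] using that(1,2)
      by (intro mult_mono[OF _ **]) auto
  qed
  show ?thesis
  proof (rule that[of "3 * C * C * C * D" \<eta> "max 1 T"])
    fix E \<phi> t assume *: "0 < E" "E < \<eta>" "max 1 T \<le> t"
    then have E: "0 < E" "E < Emax P" "0 < t" "T \<le> t" using C by auto
    have sB: "0 \<le> C * sqrt E" "0 \<le> C / sqrt E" using C(1) E(1) by auto
    note R = T[OF E(4) XY_level(1)[OF E(1) less_imp_le[OF E(2)]], of \<phi>] and B = C(5)[OF *(1,2), of \<phi>]
    have w: "0 < freq P E" using freq_pos E by simp
    have q1: "C * (3 * (D * \<tau> * (C * q)) * (C * q)) = 3 * C * C * C * D * (q * q) * \<tau>" for \<tau> q
      by (simp add: mult_ac)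
    have q2: "C * (3 * (D * \<tau> * (C * q)) * (C / q)) = 3 * C * C * C * D * (q * (1 / q)) * \<tau>" for \<tau> q
      by (simp add: mult_ac divide_inverse)
    have "\<bar>freq P E * (pd (1, 0, 0) (RH K) (X (\<phi>, E), Y (\<phi>, E), t) * pd (1, 0) X (\<phi>, E)
       + pd (0, 1, 0) (RH K) (X (\<phi>, E), Y (\<phi>, E), t) * pd (1, 0) Y (\<phi>, E)
       - RD K (X (\<phi>, E), Y (\<phi>, E), t) * pd (1, 0) X (\<phi>, E))\<bar> \<le> C * (3 * (D * t powr ?a * (C * sqrt E)) * (C * sqrt E))"
      by (rule main[OF w, where n = "norm (X (\<phi>, E), Y (\<phi>, E))"]) (use R B sB in blast)+
    then show "\<bar>act_rate P (Ham P) (Dis P) (E, \<phi>, t)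
        - (\<Sum>k=1..K. t powr (- real k / real (qpar P)) * f_co P k (E, \<phi>, phase P t))\<bar>
      \<le> 3 * C * C * C * D * E * t powr ?a"
      unfolding act_rate_remainder[OF E(1-3)] q1 using E(1) by simp
    have "\<bar>freq P E * (pd (1, 0, 0) (RH K) (X (\<phi>, E), Y (\<phi>, E), t) * pd (0, 1) X (\<phi>, E)
       + pd (0, 1, 0) (RH K) (X (\<phi>, E), Y (\<phi>, E), t) * pd (0, 1) Y (\<phi>, E)
       - RD K (X (\<phi>, E), Y (\<phi>, E), t) * pd (0, 1) X (\<phi>, E))\<bar> \<le> C * (3 * (D * t powr ?a * (C * sqrt E)) * (C / sqrt E))"
      by (rule main[OF w, where n = "norm (X (\<phi>, E), Y (\<phi>, E))"]) (use R B sB in blast)+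
    then show "\<bar>ang_rate P (Ham P) (Dis P) (E, \<phi>, t) - freq P E
        - (\<Sum>k=1..K. t powr (- real k / real (qpar P)) * g_co P k (E, \<phi>, phase P t))\<bar>
      \<le> 3 * C * C * C * D * t powr ?a"
      unfolding ang_rate_remainder[OF E(1-3)] q2 using E(1) by simp
  qed (use C D in auto)
qed

section \<open>The scaled system\<close>

lemma smooth_aa:
  assumes "smooth_fun_on dom2 u"
  shows "smooth_fun_on (strip (Emax P)) (\<lambda>x. u (fst (snd x), fst x))"
  by (rule smooth_compose[OF open_strip _ _ assms])
     (auto simp: strip_fst Basis_real2 inner_prod_def intro!: smooth_linear bounded_linear_fst_comp bounded_linear_snd bounded_linear_fst)

lemma smooth_aa3:
  assumes "smooth_fun_on U3 h"
  shows "smooth_fun_on (strip (Emax P)) (\<lambda>x. h (X (fst (snd x), fst x), Y (fst (snd x), fst x), snd (snd x)))"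
proof (rule smooth_compose[OF open_strip _ _ assms])
  have "smooth_fun_on (strip (Emax P)) (\<lambda>x. snd (snd x))"
    by (intro smooth_linear bounded_linear_snd_comp bounded_linear_snd)
  then show "smooth_fun_on (strip (Emax P)) (\<lambda>x. (X (fst (snd x), fst x), Y (fst (snd x), fst x), snd (snd x)) \<bullet> c)"
    if "c \<in> Basis" for c
    using smooth_aa[OF smooth_XY(1)] smooth_aa[OF smooth_XY(2)] that by (auto simp: Basis_real3 inner_prod_def)
  show "(X (fst (snd x), fst x), Y (fst (snd x), fst x), snd (snd x)) \<in> U3" if "x \<in> strip (Emax P)" for x
    using that XY_Usm by (auto simp: strip_fst U3_def)
qed

lemma smooth_freq: "smooth_fun_on (strip (Emax P)) (\<lambda>x. freq P (fst x))"
  by (rule smooth_compose[OF open_strip _ _ smooth_XY(3)])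
     (auto simp: strip_fst intro!: smooth_linear bounded_linear_fst)

lemma smooth_fg_co:
  assumes "1 \<le> k"
  shows "smooth_fun_on (strip (Emax P)) (f_co P k)" "smooth_fun_on (strip (Emax P)) (g_co P k)"
proof -
  have B: "(1, 0) \<in> (Basis :: (real \<times> real) set)" "(0, 1) \<in> (Basis :: (real \<times> real) set)"
    "(1, 0, 0) \<in> (Basis :: (real \<times> real \<times> real) set)" "(0, 1, 0) \<in> (Basis :: (real \<times> real \<times> real) set)"
    by (auto simp: Basis_real2 Basis_real3)
  let ?S = "strip (Emax P)"
  let ?XY = "\<lambda>x. (X (fst (snd x), fst x), Y (fst (snd x), fst x), snd (snd x))"
  note sm = smooth_freq smooth_aa3[OF smooth_pd[OF Usm(4)[OF assms] B(3)]] smooth_aa3[OF smooth_pd[OF Usm(4)[OF assms] B(4)]]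
    smooth_aa3[OF Usm(5)[OF assms]] smooth_aa[OF smooth_pd[OF smooth_XY(1) B(1)]] smooth_aa[OF smooth_pd[OF smooth_XY(1) B(2)]]
    smooth_aa[OF smooth_pd[OF smooth_XY(2) B(1)]] smooth_aa[OF smooth_pd[OF smooth_XY(2) B(2)]]
  have 1: "smooth_fun_on ?S (\<lambda>x. - freq P (fst x) * (pd (1, 0, 0) (Ham_co P k) (?XY x) * pd (1, 0) X (fst (snd x), fst x)
      + pd (0, 1, 0) (Ham_co P k) (?XY x) * pd (1, 0) Y (fst (snd x), fst x) - Dis_co P k (?XY x) * pd (1, 0) X (fst (snd x), fst x)))"
    by (intro smooth_mult smooth_add smooth_diff smooth_uminus open_strip sm)
  show "smooth_fun_on ?S (f_co P k)"
    by (rule smooth_cong[OF open_strip _ 1])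
       (use act_rate_eq[OF _ _ Ham_co_diff[OF assms XY_Usm]] in \<open>auto simp: f_co_def\<close>)
  have 2: "smooth_fun_on ?S (\<lambda>x. freq P (fst x) * (pd (1, 0, 0) (Ham_co P k) (?XY x) * pd (0, 1) X (fst (snd x), fst x)
      + pd (0, 1, 0) (Ham_co P k) (?XY x) * pd (0, 1) Y (fst (snd x), fst x) - Dis_co P k (?XY x) * pd (0, 1) X (fst (snd x), fst x)))"
    by (intro smooth_mult smooth_add smooth_diff open_strip sm)
  show "smooth_fun_on ?S (g_co P k)"
    by (rule smooth_cong[OF open_strip _ 2])
       (use ang_rate_eq[OF _ _ Ham_co_diff[OF assms XY_Usm]] in \<open>auto simp: g_co_def\<close>)
qed

section \<open>The coefficients of the scaled system as symbols\<close>

definition act_term :: "nat \<Rightarrow> nat \<Rightarrow> real \<times> real \<times> real \<Rightarrow> real" where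
  "act_term k j = (\<lambda>(E, x). E powr (real j / 2) * act_co P k j x)"

definition ang_term :: "nat \<Rightarrow> nat \<Rightarrow> real \<times> real \<times> real \<Rightarrow> real" where
  "ang_term k j = (\<lambda>(E, x). E powr (real j / 2) * ang_co P k j x)"

lemma smooth_co:
  assumes "1 \<le> k"
  shows "smooth_fun_on UNIV (act_co P k j)" "smooth_fun_on UNIV (ang_co P k j)"
  using standing assms unfolding standing_assumptions_def expansions_at_zero_def by auto

lemma smooth_snd:
  assumes "smooth_fun_on UNIV h"
  shows "smooth_fun_on (strip \<eta>) (\<lambda>x. h (snd x))"
  by (rule smooth_compose[OF open_strip _ _ assms])
     (auto simp: Basis_real2 inner_prod_def intro!: smooth_linear bounded_linear_fst_comp bounded_linear_snd bounded_linear_snd_comp)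

lemma smooth_terms:
  assumes "1 \<le> k"
  shows "smooth_fun_on (strip \<eta>) (act_term k j)" "smooth_fun_on (strip \<eta>) (ang_term k j)"
  unfolding act_term_def ang_term_def case_prod_unfold
  by (intro smooth_mult open_strip smooth_powr_fst smooth_snd smooth_co assms)+

lemma f_remainder_symbol:
  assumes "1 \<le> k" "1 \<le> J"
  shows "symbol (real (J + 1) / 2) (\<lambda>x. f_co P k x - (\<Sum>j=2..J. act_term k j x))"
proof (rule symbolI[OF standing_basic(1)])
  show "smooth_fun_on (strip (Emax P)) (\<lambda>x. f_co P k x - (\<Sum>j=2..J. act_term k j x))"
    by (intro smooth_diff smooth_sum open_strip smooth_fg_co smooth_terms assms)
  fix bs :: "(real \<times> real \<times> real) list" assume bs: "set bs \<subseteq> Basis"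
  have "\<forall>k\<ge>1. \<forall>J\<ge>1. \<forall>bs. set bs \<subseteq> Basis \<longrightarrow>
        (\<exists>C. \<exists>\<eta>>0. \<forall>E\<in>{0<..<\<eta>}. \<forall>\<phi> s.
           \<bar>pds bs (\<lambda>(E, \<phi>, s). f_co P k (E, \<phi>, s)
               - (\<Sum>j=2..J. E powr (real j / 2) * act_co P k j (\<phi>, s))) (E, \<phi>, s)\<bar>
             \<le> C * E powr (real (J + 1) / 2 - real (count_list bs (1, 0, 0))))"
    using standing unfolding standing_assumptions_def expansions_at_zero_def by (elim conjE)
  from this[rule_format, OF assms bs]
  show "\<exists>C. \<exists>\<eta>>0. \<forall>x\<in>strip \<eta>. \<bar>pds bs (\<lambda>x. f_co P k x - (\<Sum>j=2..J. act_term k j x)) x\<bar>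
      \<le> C * fst x powr (real (J + 1) / 2 - eorder bs)"
    unfolding act_term_def eorder_def case_prod_unfold by (simp add: strip_def Ball_def)
qed

lemma g_remainder_symbol:
  assumes "1 \<le> k"
  shows "symbol (real (J + 1) / 2) (\<lambda>x. g_co P k x - (\<Sum>j\<le>J. ang_term k j x))"
proof (rule symbolI[OF standing_basic(1)])
  show "smooth_fun_on (strip (Emax P)) (\<lambda>x. g_co P k x - (\<Sum>j\<le>J. ang_term k j x))"
    by (intro smooth_diff smooth_sum open_strip smooth_fg_co smooth_terms assms)
  fix bs :: "(real \<times> real \<times> real) list" assume bs: "set bs \<subseteq> Basis"
  have "\<forall>k\<ge>1. \<forall>J. \<forall>bs. set bs \<subseteq> Basis \<longrightarrow>
        (\<exists>C. \<exists>\<eta>>0. \<forall>E\<in>{0<..<\<eta>}. \<forall>\<phi> s.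
           \<bar>pds bs (\<lambda>(E, \<phi>, s). g_co P k (E, \<phi>, s)
               - (\<Sum>j\<le>J. E powr (real j / 2) * ang_co P k j (\<phi>, s))) (E, \<phi>, s)\<bar>
             \<le> C * E powr (real (J + 1) / 2 - real (count_list bs (1, 0, 0))))"
    using standing unfolding standing_assumptions_def expansions_at_zero_def by (elim conjE)
  from this[rule_format, OF assms bs]
  show "\<exists>C. \<exists>\<eta>>0. \<forall>x\<in>strip \<eta>. \<bar>pds bs (\<lambda>x. g_co P k x - (\<Sum>j\<le>J. ang_term k j x)) x\<bar>
      \<le> C * fst x powr (real (J + 1) / 2 - eorder bs)"
    unfolding ang_term_def eorder_def case_prod_unfold by (simp add: strip_def Ball_def)
qed

text \<open>For \<open>J = 1\<close> the sum over \<open>{2..1}\<close> is empty and the remainder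
  is \<open>f_co P k\<close> itself.\<close>

lemma symbol_f_co: "1 \<le> k \<Longrightarrow> symbol 1 (f_co P k)"
  using f_remainder_symbol[of k 1] by simp

text \<open>No bound on \<open>act_co P k j\<close> is assumed, but a single term is the difference
  of two consecutive remainders, both of order at least \<open>j / 2\<close>.\<close>

lemma symbol_act_term:
  assumes "1 \<le> k" "2 \<le> j"
  shows "symbol (real j / 2) (act_term k j)"
proof -
  have "symbol (real j / 2) (\<lambda>x. f_co P k x - (\<Sum>j=2..j - 1. act_term k j x))"
    using f_remainder_symbol[of k "j - 1"] assms by simp
  moreover have "symbol (real j / 2) (\<lambda>x. f_co P k x - (\<Sum>j=2..j. act_term k j x))"
    by (rule symbol_mono[OF f_remainder_symbol]) (use assms in auto)
  ultimately have "symbol (real j / 2) (\<lambda>x. (f_co P k x - (\<Sum>j=2..j - 1. act_term k j x))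
      - (f_co P k x - (\<Sum>j=2..j. act_term k j x)))" by (rule symbol_diff)
  moreover have "(f_co P k x - (\<Sum>j=2..j - 1. act_term k j x)) - (f_co P k x - (\<Sum>j=2..j. act_term k j x)) = act_term k j x" for x
    using assms(2) sum.nat_ivl_Suc'[of 2 "j - 1" "\<lambda>j. act_term k j x"] by (cases j) auto
  ultimately show ?thesis by simp
qed

lemma g_co_periodic:
  assumes "1 \<le> k" "0 < E" "E < Emax P"
  shows "g_co P k (E, \<phi> + 2 * pi, s) = g_co P k (E, \<phi>, s)" "g_co P k (E, \<phi>, s + 2 * pi) = g_co P k (E, \<phi>, s)"
proof -
  have ev: "\<forall>\<^sub>F E in nhds E. 0 < E \<and> E < Emax P"
    using assms eventually_nhds_in_open[of "{0<..<Emax P}" E] by auto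
  have "\<forall>k\<ge>1. \<forall>x y s. (x, y) \<in> cball 0 (rmax P) \<longrightarrow>
        Ham_co P k (x, y, s + 2 * pi) = Ham_co P k (x, y, s) \<and>
        Dis_co P k (x, y, s + 2 * pi) = Dis_co P k (x, y, s)"
    using standing unfolding standing_assumptions_def expansions_at_infinity_def by (elim conjE)
  note per = this[rule_format, OF assms(1)]
  have "deriv (\<lambda>E. Ham_co P k (X (\<phi> + 2 * pi, E), Y (\<phi> + 2 * pi, E), s)) E = deriv (\<lambda>E. Ham_co P k (X (\<phi>, E), Y (\<phi>, E), s)) E"
    "deriv (\<lambda>E. X (\<phi> + 2 * pi, E)) E = deriv (\<lambda>E. X (\<phi>, E)) E"
    by (rule deriv_cong_ev[OF eventually_mono[OF ev]]; simp add: XY_periodic)+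
  then show "g_co P k (E, \<phi> + 2 * pi, s) = g_co P k (E, \<phi>, s)"
    using assms by (simp add: g_co_def ang_rate_def XY_periodic)
  have "deriv (\<lambda>E. Ham_co P k (X (\<phi>, E), Y (\<phi>, E), s + 2 * pi)) E = deriv (\<lambda>E. Ham_co P k (X (\<phi>, E), Y (\<phi>, E), s)) E"
    by (rule deriv_cong_ev[OF eventually_mono[OF ev]]; use per XY_level(1) in auto)
  then show "g_co P k (E, \<phi>, s + 2 * pi) = g_co P k (E, \<phi>, s)"
    using assms per XY_level(1)[of E \<phi>] by (simp add: g_co_def ang_rate_def)
qed

text \<open>Unlike the higher terms, this one is no difference of two remainders: the expansion of
  \<open>g_co\<close> starts with it, and no bound on \<open>g_co\<close> is known beforehand.
  Instead, the coefficient is the limit of \<open>g_co\<close> at zero energy, hence periodic in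
  both variables, so it and its derivatives are bounded.\<close>

lemma symbol_ang_term0:
  assumes "1 \<le> k"
  shows "symbol 0 (ang_term k 0)"
proof -
  let ?a = "ang_co P k 0"
  obtain C \<eta> where C: "0 < \<eta>" "\<And>x. x \<in> strip \<eta> \<Longrightarrow> \<bar>g_co P k x - (\<Sum>j\<le>0. ang_term k j x)\<bar> \<le> C * fst x powr (real (0 + 1) / 2)"
    by (rule symbol_boundE[OF g_remainder_symbol[OF assms]]) blast
  \<comment> \<open>The remainder after this term is of size \<open>sqrt E\<close>, hence pointwise
    convergence.\<close>
  have lim: "((\<lambda>E. g_co P k (E, x)) \<longlongrightarrow> ?a x) (at_right 0)" for x
  proof (rule Lim_transform[OF tendsto_const], rule Lim_null_comparison)
    show "\<forall>\<^sub>F E in at_right 0. norm (g_co P k (E, x) - ?a x) \<le> C * E powr (1 / 2)"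
      unfolding eventually_at_right_field
    proof (intro exI[of _ \<eta>] conjI allI impI C(1))
      fix E assume "0 < E" "E < \<eta>"
      then show "norm (g_co P k (E, x) - ?a x) \<le> C * E powr (1 / 2)"
        using C(2)[of "(E, x)"] by (simp add: strip_fst ang_term_def)
    qed
    show "((\<lambda>E. C * E powr (1 / 2)) \<longlongrightarrow> 0) (at_right 0)"
      by (auto intro!: tendsto_eq_intros eventually_mono[OF eventually_at_right_less[of 0]])
  qed
  have ev: "\<forall>\<^sub>F E in at_right 0. 0 < E \<and> E < Emax P"
    unfolding eventually_at_right_field using standing_basic(1) by blast
  have "?a (\<phi> + 2 * pi, s) = ?a (\<phi>, s)" for \<phi> s
    by (rule tendsto_unique[OF _ lim Lim_transform_eventually[OF lim]])
       (use ev in \<open>auto elim!: eventually_mono simp: g_co_periodic[OF assms]\<close>)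
  moreover have "?a (\<phi>, s + 2 * pi) = ?a (\<phi>, s)" for \<phi> s
    by (rule tendsto_unique[OF _ lim Lim_transform_eventually[OF lim]])
       (use ev in \<open>auto elim!: eventually_mono simp: g_co_periodic[OF assms]\<close>)
  ultimately have per: "?a (x + (2 * pi, 0)) = ?a x" "?a (x + (0, 2 * pi)) = ?a x" for x
    by (cases x; simp)+
  have "symbol 0 (\<lambda>(e, x). ?a x)"
  proof (rule symbol_lift[OF smooth_co(2)[OF assms]])
    fix bs :: "(real \<times> real) list" assume "set bs \<subseteq> Basis"
    then have "continuous_on UNIV (pds bs ?a)"
      by (intro smooth_continuous_on smooth_pds smooth_co assms)
    then show "\<exists>C. \<forall>x. \<bar>pds bs ?a x\<bar> \<le> C"
    proof (rule periodic_bounded[where L = "2 * pi"])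
      show "pds bs ?a (x + 2 * pi, y) = pds bs ?a (x, y)" for x y
        using pds_translate[OF open_UNIV UNIV_I, of ?a "(2 * pi, 0)" bs "(x, y)"] per(1) by simp
      show "pds bs ?a (x, y + 2 * pi) = pds bs ?a (x, y)" for x y
        using pds_translate[OF open_UNIV UNIV_I, of ?a "(0, 2 * pi)" bs "(x, y)"] per(2) by simp
    qed simp
  qed
  then show ?thesis
    by (rule symbol_cong[OF zero_less_one, rotated]) (auto simp: ang_term_def)
qed

lemma symbol_ang_term:
  assumes "1 \<le> k"
  shows "symbol (real j / 2) (ang_term k j)"
proof (cases j)
  case (Suc i)
  have "symbol (real j / 2) (\<lambda>x. g_co P k x - (\<Sum>j\<le>i. ang_term k j x))"
    using g_remainder_symbol[OF assms, of i] Suc by simp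
  moreover have "symbol (real j / 2) (\<lambda>x. g_co P k x - (\<Sum>j\<le>j. ang_term k j x))"
    by (rule symbol_mono[OF g_remainder_symbol]) (use assms in auto)
  ultimately have "symbol (real j / 2) (\<lambda>x. (g_co P k x - (\<Sum>j\<le>i. ang_term k j x))
      - (g_co P k x - (\<Sum>j\<le>j. ang_term k j x)))" by (rule symbol_diff)
  then show ?thesis by (simp add: Suc)
qed (use symbol_ang_term0[OF assms] in simp)

lemma symbol_g_co: assumes "1 \<le> k" shows "symbol 0 (g_co P k)"
proof -
  have "symbol 0 (\<lambda>x. g_co P k x - (\<Sum>j\<le>0. ang_term k j x))"
    by (rule symbol_mono[OF g_remainder_symbol[OF assms]]) simp
  from symbol_add[OF this symbol_ang_term0[OF assms]] show ?thesis by simp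
qed

definition \<kappa>i :: real where "\<kappa>i = 1 / real (kap P)"

lemma scaled_F_eq:
  "scaled_F P l p = (if l = 0 then (if even p \<and> 2 \<le> p then \<lambda>x. f_co P (p div 2) (shear \<kappa>i x) else (\<lambda>_. 0))
     else (\<lambda>x. \<Sum>i\<in>{(k, j). k \<in> {1..p} \<and> j \<in> {2..p + 2} \<and> 2 * k + l * (j - 2) = p}.
       act_term (fst i) (snd i) (shear \<kappa>i x)))"
  by (auto simp: scaled_F_def fun_eq_iff shear_def act_term_def case_prod_unfold \<kappa>i_def)

lemma scaled_G_eq:
  "scaled_G P l p = (\<lambda>x. (if l = 0 then (if p = 0 then freq P (fst x) else 0)
       + (if even p \<and> 2 \<le> p then g_co P (p div 2) (shear \<kappa>i x) else 0)
     else (\<Sum>j \<in> {j. j \<le> p \<and> 2 * l * j = p}. freq_co P j * fst x ^ j)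
      + (\<Sum>i\<in>{(k, j). k \<in> {1..p} \<and> j \<in> {0..p} \<and> 2 * k + l * j = p}. ang_term (fst i) (snd i) (shear \<kappa>i x)))
      - S_co P p * \<kappa>i)"
  by (auto simp: scaled_G_def fun_eq_iff shear_def ang_term_def case_prod_unfold \<kappa>i_def)

lemma symbol_scaled_F: "symbol 1 (scaled_F P l p)"
proof -
  have "symbol 1 (\<lambda>x. \<Sum>i\<in>{(k, j). k \<in> {1..p} \<and> j \<in> {2..p + 2} \<and> 2 * k + l * (j - 2) = p}.
       act_term (fst i) (snd i) (shear \<kappa>i x))"
    by (intro symbol_sum symbol_shear) (auto intro: symbol_mono[OF symbol_act_term])
  moreover have "even p \<Longrightarrow> 2 \<le> p \<Longrightarrow> symbol 1 (\<lambda>x. f_co P (p div 2) (shear \<kappa>i x))"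
    by (intro symbol_shear symbol_f_co) auto
  ultimately show ?thesis unfolding scaled_F_eq by (auto intro: symbol_zero)
qed

text \<open>The resonance condition, with frequency 1 at zero energy.\<close>

lemma S_co_0: "S_co P 0 * \<kappa>i = 1" "0 < S_co P 0"
  using standing_basic(5,6,7) by (auto simp: S_co_def \<kappa>i_def)

lemma freq_expansion:
  obtains C \<eta> where "0 < \<eta>" "\<And>E. 0 < E \<Longrightarrow> E < \<eta> \<Longrightarrow> \<bar>freq P E - (\<Sum>j\<le>J. freq_co P j * E ^ j)\<bar> \<le> C * E powr real (J + 1)"
proof -
  have "\<forall>J i. \<exists>C. \<exists>\<eta>>0. \<forall>E\<in>{0<..<\<eta>}.
        \<bar>(deriv ^^ i) (\<lambda>E. freq P E - (\<Sum>j\<le>J. freq_co P j * E ^ j)) E\<bar>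
          \<le> C * E powr (real (J + 1) - real i)"
    using standing unfolding standing_assumptions_def expansions_at_zero_def by (elim conjE)
  from this[THEN spec, of J, THEN spec, of 0] obtain C \<eta> where "0 < \<eta>"
    "\<And>E. 0 < E \<Longrightarrow> E < \<eta> \<Longrightarrow> \<bar>freq P E - (\<Sum>j\<le>J. freq_co P j * E ^ j)\<bar> \<le> C * E powr real (J + 1)"
    by (auto simp: Ball_def)
  then show ?thesis by (rule that)
qed

lemma freq_co_0: "freq_co P 0 = 1"
proof -
  obtain C \<eta> where C: "0 < \<eta>" "\<And>E. 0 < E \<Longrightarrow> E < \<eta> \<Longrightarrow> \<bar>freq P E - (\<Sum>j\<le>0. freq_co P j * E ^ j)\<bar> \<le> C * E powr real (0 + 1)"
    by (rule freq_expansion) blast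
  have "(freq P \<longlongrightarrow> freq P 0) (at 0 within {0..Emax P})"
    using standing_basic(3,1) by (auto simp: continuous_on_def)
  then have "(freq P \<longlongrightarrow> 1) (at_right 0)"
    using standing_basic(1,4) by (auto simp: at_within_Icc_at_right)
  moreover have "(freq P \<longlongrightarrow> freq_co P 0) (at_right 0)"
  proof (rule Lim_transform[OF tendsto_const], rule Lim_null_comparison)
    show "\<forall>\<^sub>F E in at_right 0. norm (freq P E - freq_co P 0) \<le> C * E"
      unfolding eventually_at_right_field
    proof (intro exI[of _ \<eta>] conjI allI impI C(1))
      fix E assume "0 < E" "E < \<eta>"
      then show "norm (freq P E - freq_co P 0) \<le> C * E"
        using C(2)[of E] by simp
    qed
    show "((\<lambda>E. C * E) \<longlongrightarrow> 0) (at_right 0)" by (auto intro!: tendsto_eq_intros)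
  qed
  ultimately show ?thesis using tendsto_unique trivial_limit_at_right_real by blast
qed

lemma freq_const:
  assumes "scaling_exponent P 0" "0 \<le> E" "E \<le> Emax P" shows "freq P E = 1"
  using assms standing_basic(1,4) by (force simp: scaling_exponent_def split: if_splits)

lemma scaled_F_0: "scaled_F P l 0 x = 0"
  by (simp add: scaled_F_eq)

text \<open>The resonance: the constant term of the frequency cancels the leading term of the phase
  speed divided by \<open>kap P\<close>. For \<open>l = 0\<close> this requires the whole frequency
  to be constant, and hence energies up to \<open>Emax P\<close>.\<close>

lemma scaled_G_0:
  assumes "scaling_exponent P l" "0 < fst x" "fst x \<le> Emax P"
  shows "scaled_G P l 0 x = 0"
proof (cases "l = 0")
  case True
  then show ?thesis using freq_const[of "fst x"] assms S_co_0 by (simp add: scaled_G_eq)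
next
  case False
  have "{j::nat. j \<le> 0 \<and> 2 * l * j = 0} = {0}" by auto
  with False show ?thesis using S_co_0(1) freq_co_0 by (simp add: scaled_G_eq)
qed

text \<open>Degree 0 is separated because for \<open>l = 0\<close> it contains
  \<open>freq P\<close>, handled by the cancellation in \<open>scaled_G_0\<close>. In all other
  degrees the terms are symbols of nonnegative order.\<close>

lemma symbol_scaled_G:
  assumes "scaling_exponent P l"
  shows "symbol 0 (scaled_G P l p)"
proof (cases "p = 0")
  case True
  show ?thesis unfolding True
    by (rule symbol_cong[OF standing_basic(1) _ symbol_zero]) (simp add: scaled_G_0[OF assms] strip_fst)
next
  case False
  have "symbol 0 (\<lambda>x. fst x ^ j)" for j
  proof (rule symbol_cong[OF zero_less_one])
    show "symbol 0 (\<lambda>x. fst x powr real j)" by (rule symbol_mono[OF symbol_powr]) simp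
  qed (simp add: strip_fst powr_realpow)
  then have 1: "symbol 0 (\<lambda>x. \<Sum>j \<in> {j. j \<le> p \<and> 2 * l * j = p}. freq_co P j * fst x ^ j)"
    by (intro symbol_sum symbol_cmult)
  have 2: "symbol 0 (\<lambda>x. \<Sum>i\<in>{(k, j). k \<in> {1..p} \<and> j \<in> {0..p} \<and> 2 * k + l * j = p}. ang_term (fst i) (snd i) (shear \<kappa>i x))"
    by (intro symbol_sum symbol_shear) (auto intro: symbol_mono[OF symbol_ang_term])
  have 3: "even p \<Longrightarrow> 2 \<le> p \<Longrightarrow> symbol 0 (\<lambda>x. g_co P (p div 2) (shear \<kappa>i x))"
    by (intro symbol_shear symbol_g_co) auto
  have 4: "symbol 0 (\<lambda>x. if l = 0 then if even p \<and> 2 \<le> p then g_co P (p div 2) (shear \<kappa>i x) else 0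
     else (\<Sum>j \<in> {j. j \<le> p \<and> 2 * l * j = p}. freq_co P j * fst x ^ j)
      + (\<Sum>i\<in>{(k, j). k \<in> {1..p} \<and> j \<in> {0..p} \<and> 2 * k + l * j = p}. ang_term (fst i) (snd i) (shear \<kappa>i x)))"
  proof (cases "l = 0")
    case True
    then show ?thesis using 3 symbol_zero by (cases "even p \<and> 2 \<le> p") auto
  next
    case False
    show ?thesis using symbol_add[OF 1 2] by (simp only: False if_False)
  qed
  show ?thesis unfolding scaled_G_eq
    using symbol_diff[OF 4 symbol_const[of "S_co P p * \<kappa>i"]] False by (simp cong: if_cong)
qed

end

section \<open>Expansion in powers of \<open>\<tau>\<close>\<close>

text \<open>Grouping by exponent leaves exactly the terms with \<open>d i > n\<close>, each at most
  \<open>\<tau>^(n+1)\<close> times its coefficient. This one estimate serves every truncation: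
  expansions in \<open>k\<close>, in \<open>k\<close> and \<open>j\<close>, and products of
  expansions.\<close>

lemma truncate_power_sum:
  fixes \<tau> :: real and d :: "'i \<Rightarrow> nat"
  assumes "finite I" "0 \<le> \<tau>" "\<tau> \<le> 1"
  shows "\<bar>(\<Sum>i\<in>I. \<tau> ^ d i * a i) - (\<Sum>p\<le>n. \<tau> ^ p * (\<Sum>i | i \<in> I \<and> d i = p. a i))\<bar>
    \<le> \<tau> ^ (n + 1) * (\<Sum>i\<in>I. \<bar>a i\<bar>)"
proof -
  let ?J = "{i \<in> I. d i \<le> n}"
  have "(\<Sum>p\<le>n. \<tau> ^ p * (\<Sum>i | i \<in> I \<and> d i = p. a i)) = (\<Sum>p\<le>n. \<Sum>i | i \<in> ?J \<and> d i = p. \<tau> ^ d i * a i)"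
    unfolding sum_distrib_left by (intro sum.cong refl) auto
  also have "\<dots> = (\<Sum>i\<in>?J. \<tau> ^ d i * a i)"
    by (rule sum.group) (use assms(1) in auto)
  finally have "(\<Sum>i\<in>I. \<tau> ^ d i * a i) - (\<Sum>p\<le>n. \<tau> ^ p * (\<Sum>i | i \<in> I \<and> d i = p. a i))
      = (\<Sum>i\<in>I - ?J. \<tau> ^ d i * a i)"
    using assms(1) by (simp add: sum_diff)
  also have "\<bar>\<dots>\<bar> \<le> (\<Sum>i\<in>I - ?J. \<bar>\<tau> ^ d i * a i\<bar>)" by (rule sum_abs)
  also have "\<dots> \<le> (\<Sum>i\<in>I - ?J. \<tau> ^ (n + 1) * \<bar>a i\<bar>)"
  proof (rule sum_mono)
    fix i assume "i \<in> I - ?J"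
    then have "n + 1 \<le> d i" by auto
    then have "\<tau> ^ d i \<le> \<tau> ^ (n + 1)" using assms by (intro power_decreasing) auto
    then show "\<bar>\<tau> ^ d i * a i\<bar> \<le> \<tau> ^ (n + 1) * \<bar>a i\<bar>"
      using assms by (simp add: abs_mult mult_right_mono)
  qed
  also have "\<dots> \<le> (\<Sum>i\<in>I. \<tau> ^ (n + 1) * \<bar>a i\<bar>)"
    using assms by (intro sum_mono2) auto
  finally show ?thesis by (simp add: sum_distrib_left)
qed

lemma finite_common_bound:
  fixes f :: "'i \<Rightarrow> real \<times> real \<times> real \<Rightarrow> real"
  assumes "finite I" "\<And>i. i \<in> I \<Longrightarrow> symbol a (f i)"
  shows "\<exists>C \<eta>. 0 < C \<and> 0 < \<eta> \<and> (\<forall>i\<in>I. \<forall>x\<in>strip \<eta>. \<bar>f i x\<bar> \<le> C * fst x powr a)"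
  using assms
proof (induction I rule: finite_induct)
  case empty
  show ?case by (intro exI[of _ 1]) auto
next
  case (insert i I)
  obtain C1 \<eta>1 where 1: "0 < C1" "0 < \<eta>1" "\<forall>i\<in>I. \<forall>x\<in>strip \<eta>1. \<bar>f i x\<bar> \<le> C1 * fst x powr a"
    using insert by auto
  obtain C2 \<eta>2 where 2: "C2 > 0" "\<eta>2 > 0" "\<And>x. x \<in> strip \<eta>2 \<Longrightarrow> \<bar>f i x\<bar> \<le> C2 * fst x powr a"
    by (rule symbol_boundE[of a "f i"]) (use insert in auto)
  have le: "c * fst x powr a \<le> (C1 + C2) * fst x powr a" if "c \<le> C1 + C2" for c and x :: "real \<times> real \<times> real"
    using that by (intro mult_right_mono) auto
  have "\<bar>f j x\<bar> \<le> (C1 + C2) * fst x powr a" if "j \<in> insert i I" "x \<in> strip (min \<eta>1 \<eta>2)" for j x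
  proof -
    have x: "x \<in> strip \<eta>1" "x \<in> strip \<eta>2" using that by (auto simp: strip_fst)
    show ?thesis
    proof (cases "j = i")
      case True
      have "\<bar>f i x\<bar> \<le> C2 * fst x powr a" by (rule 2(3)[OF x(2)])
      also have "\<dots> \<le> (C1 + C2) * fst x powr a" using 1(1) by (intro le) simp
      finally show ?thesis by (simp add: True)
    next
      case False
      then have "\<bar>f j x\<bar> \<le> C1 * fst x powr a" using 1(3) that x by blast
      also have "\<dots> \<le> (C1 + C2) * fst x powr a" using 2(1) by (intro le) simp
      finally show ?thesis .
    qed
  qed
  then show ?case using 1(1,2) 2(1,2)
    by (intro exI[of _ "C1 + C2"] exI[of _ "min \<eta>1 \<eta>2"]) auto
qed

context osc begin

definition \<tau> :: "real \<Rightarrow> real" where "\<tau> t = t powr (- 1 / real (2 * qpar P))"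

lemma tau_power: "0 < t \<Longrightarrow> \<tau> t ^ k = t powr (- real k / real (2 * qpar P))"
  by (simp add: \<tau>_def powr_realpow[symmetric] powr_powr)

lemma tau_even: "0 < t \<Longrightarrow> t powr (- real k / real (qpar P)) = \<tau> t ^ (2 * k)"
  by (simp add: tau_power)

lemma tau_bounds: "1 \<le> t \<Longrightarrow> 0 < \<tau> t \<and> \<tau> t \<le> 1"
  using powr_mono[of "- 1 / real (2 * qpar P)" 0 t] by (simp add: \<tau>_def)

lemma tau_l: "0 < t \<Longrightarrow> t powr (real l / real (qpar P)) * \<tau> t ^ (2 * l) = 1"
  by (simp add: tau_even[symmetric] powr_add[symmetric])

lemma tau_pow_le: "1 \<le> t \<Longrightarrow> n \<le> k \<Longrightarrow> \<tau> t ^ k \<le> \<tau> t ^ n"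
  using tau_bounds by (intro power_decreasing) (auto simp: less_imp_le)

text \<open>The energy \<open>E = t^(-l/q) e\<close> belonging to the scaled energy
  \<open>e\<close>, written in powers of \<open>\<tau>\<close>.\<close>

definition unscale :: "nat \<Rightarrow> real \<Rightarrow> real \<Rightarrow> real" where "unscale l t e = \<tau> t ^ (2 * l) * e"

lemma unscale_bounds:
  assumes "1 \<le> t" "0 < e" shows "0 < unscale l t e" "unscale l t e \<le> e"
proof -
  show "0 < unscale l t e" using tau_bounds[OF assms(1)] assms(2) by (simp add: unscale_def)
  have "\<tau> t ^ (2 * l) \<le> 1" using tau_bounds[OF assms(1)] by (intro power_le_one) auto
  then show "unscale l t e \<le> e" using assms(2) by (simp add: unscale_def mult_left_le_one_le tau_bounds[OF assms(1)] less_imp_le)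
qed

lemma unscale_powr:
  assumes "1 \<le> t" "0 < e"
  shows "unscale l t e powr (real j / 2) = \<tau> t ^ (l * j) * e powr (real j / 2)"
proof -
  have "0 < \<tau> t" using tau_bounds[OF assms(1)] by simp
  then have "(\<tau> t ^ (2 * l)) powr (real j / 2) = \<tau> t ^ (l * j)"
    by (simp add: powr_realpow[symmetric] powr_powr)
  then show ?thesis using \<open>0 < \<tau> t\<close> assms(2) by (simp add: unscale_def powr_mult)
qed

text \<open>The case \<open>l = 0\<close>. Only even powers of \<open>\<tau>\<close> occur, so
  indices up to \<open>n div 2\<close> reach degree \<open>n\<close>; below degree 2 the coefficient
  is set to zero, since \<open>k\<close> starts at 1.\<close>

lemma expansion_unscaled:
  fixes co :: "nat \<Rightarrow> real \<times> real \<times> real \<Rightarrow> real"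
  assumes "\<And>k. 1 \<le> k \<Longrightarrow> symbol a (co k)"
  shows "\<exists>C \<eta>. 0 < C \<and> 0 < \<eta> \<and> (\<forall>x\<in>strip \<eta>. \<forall>t\<ge>1.
    \<bar>(\<Sum>k=1..n div 2. \<tau> t ^ (2 * k) * co k (shear \<kappa>i x))
      - (\<Sum>p\<le>n. \<tau> t ^ p * (if even p \<and> 2 \<le> p then co (p div 2) (shear \<kappa>i x) else 0))\<bar>
      \<le> C * fst x powr a * \<tau> t ^ (n + 1))"
proof -
  let ?I = "{1..n div 2}"
  obtain C \<eta> where C: "0 < C" "0 < \<eta>" "\<And>k x. k \<in> ?I \<Longrightarrow> x \<in> strip \<eta> \<Longrightarrow> \<bar>co k (shear \<kappa>i x)\<bar> \<le> C * fst x powr a"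
    using finite_common_bound[of ?I a "\<lambda>k x. co k (shear \<kappa>i x)"] symbol_shear assms
    by (metis atLeastAtMost_iff finite_atLeastAtMost)
  have "\<bar>(\<Sum>k\<in>?I. \<tau> t ^ (2 * k) * co k (shear \<kappa>i x))
      - (\<Sum>p\<le>n. \<tau> t ^ p * (if even p \<and> 2 \<le> p then co (p div 2) (shear \<kappa>i x) else 0))\<bar>
      \<le> (real (card ?I) * C + 1) * fst x powr a * \<tau> t ^ (n + 1)" if x: "x \<in> strip \<eta>" and t: "1 \<le> t" for x t
  proof -
    note \<tau> = tau_bounds[OF t]
    have eq: "(\<Sum>i | i \<in> ?I \<and> 2 * i = p. co i (shear \<kappa>i x)) = (if even p \<and> 2 \<le> p then co (p div 2) (shear \<kappa>i x) else 0)"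
      if "p \<in> {..n}" for p
    proof (cases "even p \<and> 2 \<le> p")
      case True
      then have "{i. i \<in> ?I \<and> 2 * i = p} = {p div 2}" using that by (auto intro!: div_le_mono)
      then show ?thesis unfolding \<open>{i. i \<in> ?I \<and> 2 * i = p} = {p div 2}\<close> using True by simp
    next
      case False
      then have "{i. i \<in> ?I \<and> 2 * i = p} = {}" by auto
      then show ?thesis unfolding \<open>{i. i \<in> ?I \<and> 2 * i = p} = {}\<close> using False by auto
    qed
    have "\<bar>(\<Sum>k\<in>?I. \<tau> t ^ (2 * k) * co k (shear \<kappa>i x))
      - (\<Sum>p\<le>n. \<tau> t ^ p * (if even p \<and> 2 \<le> p then co (p div 2) (shear \<kappa>i x) else 0))\<bar>
      \<le> \<tau> t ^ (n + 1) * (\<Sum>k\<in>?I. \<bar>co k (shear \<kappa>i x)\<bar>)"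
      using truncate_power_sum[of ?I "\<tau> t" "\<lambda>k. 2 * k" "\<lambda>k. co k (shear \<kappa>i x)" n] \<tau> eq
      by (simp add: less_imp_le)
    also have "(\<Sum>k\<in>?I. \<bar>co k (shear \<kappa>i x)\<bar>) \<le> real (card ?I) * (C * fst x powr a)"
      by (rule sum_bounded_above) (use C(3) x in auto)
    also have "\<dots> \<le> (real (card ?I) * C + 1) * fst x powr a" by (simp add: distrib_right)
    finally show ?thesis using \<tau> by (simp add: mult_ac)
  qed
  then show ?thesis using C
    by (intro exI[of _ "real (card ?I) * C + 1"] exI[of _ \<eta>]) (simp add: add_nonneg_pos)
qed

text \<open>Covers both rates: \<open>m = 2\<close> for the action and \<open>m = 0\<close> for the
  angle. A term of index \<open>j\<close> contributes \<open>\<tau>^(l j)\<close>; the common factor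
  \<open>\<tau>^(l m)\<close> is kept outside, since for the action it cancels the factor
  \<open>t^(l/q)\<close>.\<close>

lemma expansion_scaled:
  fixes co :: "nat \<Rightarrow> real \<times> real \<times> real \<Rightarrow> real" and tm :: "nat \<Rightarrow> nat \<Rightarrow> real \<times> real \<times> real \<Rightarrow> real"
  assumes l: "1 \<le> l"
    and rem: "\<And>k. 1 \<le> k \<Longrightarrow> symbol (real (m + n + 1) / 2) (\<lambda>x. co k x - (\<Sum>j=m..m + n. tm k j x))"
    and tm: "\<And>k j. 1 \<le> k \<Longrightarrow> m \<le> j \<Longrightarrow> symbol (real m / 2) (tm k j)"
    and scale: "\<And>k j e \<theta> s t. 1 \<le> t \<Longrightarrow> 0 < e \<Longrightarrow>
      tm k j (shear \<kappa>i (unscale l t e, \<theta>, s)) = \<tau> t ^ (l * j) * tm k j (shear \<kappa>i (e, \<theta>, s))"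
  shows "\<exists>C \<eta>. 0 < C \<and> 0 < \<eta> \<and> (\<forall>e \<theta> s t. 0 < e \<longrightarrow> e < \<eta> \<longrightarrow> 1 \<le> t \<longrightarrow>
    \<bar>(\<Sum>k=1..n div 2. \<tau> t ^ (2 * k) * co k (shear \<kappa>i (unscale l t e, \<theta>, s)))
      - \<tau> t ^ (l * m) * (\<Sum>p\<le>n. \<tau> t ^ p * (\<Sum>i\<in>{(k, j). k \<in> {1..p} \<and> j \<in> {m..p + m} \<and> 2 * k + l * (j - m) = p}.
          tm (fst i) (snd i) (shear \<kappa>i (e, \<theta>, s))))\<bar>
      \<le> C * \<tau> t ^ (l * m) * e powr (real m / 2) * \<tau> t ^ (n + 1))"
proof -
  let ?K = "{1..n div 2}" and ?J = "{m..m + n}"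
  let ?I = "?K \<times> ?J"
  obtain C1 \<eta>1 where C1: "0 < C1" "0 < \<eta>1" "\<forall>k\<in>?K. \<forall>x\<in>strip \<eta>1.
      \<bar>co k x - (\<Sum>j\<in>?J. tm k j x)\<bar> \<le> C1 * fst x powr (real (m + n + 1) / 2)"
    using finite_common_bound[of ?K "real (m + n + 1) / 2" "\<lambda>k x. co k x - (\<Sum>j\<in>?J. tm k j x)"] rem by auto
  obtain C2 \<eta>2 where C2: "0 < C2" "0 < \<eta>2" "\<forall>i\<in>?I. \<forall>x\<in>strip \<eta>2.
      \<bar>tm (fst i) (snd i) (shear \<kappa>i x)\<bar> \<le> C2 * fst x powr (real m / 2)"
    using finite_common_bound[of ?I "real m / 2" "\<lambda>i x. tm (fst i) (snd i) (shear \<kappa>i x)"] symbol_shear[OF tm] by auto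
  define C where "C = real (card ?K) * C1 + real (card ?I) * C2 + 1"
  define \<eta> where "\<eta> = min (min \<eta>1 \<eta>2) 1"
  have "\<bar>(\<Sum>k\<in>?K. \<tau> t ^ (2 * k) * co k (shear \<kappa>i (unscale l t e, \<theta>, s)))
      - \<tau> t ^ (l * m) * (\<Sum>p\<le>n. \<tau> t ^ p * (\<Sum>i\<in>{(k, j). k \<in> {1..p} \<and> j \<in> {m..p + m} \<and> 2 * k + l * (j - m) = p}.
          tm (fst i) (snd i) (shear \<kappa>i (e, \<theta>, s))))\<bar>
      \<le> C * \<tau> t ^ (l * m) * e powr (real m / 2) * \<tau> t ^ (n + 1)"
    if e: "0 < e" "e < \<eta>" and t: "1 \<le> t" for e \<theta> s t
  proof -
    have \<tau>: "0 < \<tau> t" "\<tau> t \<le> 1" using tau_bounds[OF t] by auto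
    have e': "e < \<eta>1" "e < \<eta>2" "e < 1" using e by (auto simp: \<eta>_def)
    let ?x = "shear \<kappa>i (unscale l t e, \<theta>, s)" and ?y = "shear \<kappa>i (e, \<theta>, s)"
    let ?R = "\<lambda>k. co k ?x - (\<Sum>j\<in>?J. tm k j ?x)"
    let ?A = "\<lambda>i. tm (fst i) (snd i) ?y" and ?d = "\<lambda>i. 2 * fst i + l * (snd i - m)"
    let ?M = "\<tau> t ^ (l * m) * e powr (real m / 2) * \<tau> t ^ (n + 1)"
    have M: "0 < ?M" using \<tau> e by simp
    have us: "?x \<in> strip \<eta>1" using unscale_bounds[OF t e(1), of l] e' by (simp add: strip_fst)
    \<comment> \<open>The double sum of terms gets the exponent \<open>2 k + l (j - m)\<close> after
      extracting \<open>\<tau>^(l m)\<close>; what is left are the remainders at energy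
      zero.\<close>
    have split: "(\<Sum>k\<in>?K. \<tau> t ^ (2 * k) * co k ?x)
        = (\<Sum>k\<in>?K. \<tau> t ^ (2 * k) * ?R k) + \<tau> t ^ (l * m) * (\<Sum>i\<in>?I. \<tau> t ^ ?d i * ?A i)"
    proof -
      have "\<tau> t ^ (2 * k) * tm k j ?x = \<tau> t ^ (l * m) * (\<tau> t ^ (2 * k + l * (j - m)) * tm k j ?y)" if "j \<in> ?J" for k j
      proof -
        have "l * j = l * m + l * (j - m)" using that by (simp flip: distrib_left)
        then show ?thesis using scale[OF t e(1)] by (simp add: power_add mult_ac)
      qed
      then have "(\<Sum>k\<in>?K. \<tau> t ^ (2 * k) * (\<Sum>j\<in>?J. tm k j ?x))
          = (\<Sum>k\<in>?K. \<Sum>j\<in>?J. \<tau> t ^ (l * m) * (\<tau> t ^ (2 * k + l * (j - m)) * tm k j ?y))"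
        unfolding sum_distrib_left by (intro sum.cong refl) auto
      also have "\<dots> = \<tau> t ^ (l * m) * (\<Sum>i\<in>?I. \<tau> t ^ ?d i * ?A i)"
        unfolding sum_distrib_left sum.cartesian_product by (simp add: case_prod_unfold)
      finally show ?thesis by (simp add: right_diff_distrib sum_subtractf)
    qed
    have "\<bar>\<Sum>k\<in>?K. \<tau> t ^ (2 * k) * ?R k\<bar> \<le> (\<Sum>k\<in>?K. \<bar>\<tau> t ^ (2 * k) * ?R k\<bar>)" by (rule sum_abs)
    also have "\<dots> \<le> real (card ?K) * (C1 * ?M)"
    proof (rule sum_bounded_above)
      fix k assume k: "k \<in> ?K"
      have "\<bar>?R k\<bar> \<le> C1 * fst ?x powr (real (m + n + 1) / 2)" using C1(3) k us by blast
      also have "fst ?x powr (real (m + n + 1) / 2) = \<tau> t ^ (l * (m + n + 1)) * e powr (real (m + n + 1) / 2)"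
        using unscale_powr[OF t e(1), of l "m + n + 1"] by simp
      also have "\<dots> \<le> \<tau> t ^ (l * m + (n + 1)) * e powr (real m / 2)"
      proof (rule mult_mono)
        \<comment> \<open>Here \<open>l \<ge> 1\<close> is decisive: each further half power of the
          energy brings at least one power of \<open>\<tau>\<close>, so \<open>n + 1\<close> terms
          beyond \<open>m\<close> suffice.\<close>
        have "l * m + (n + 1) \<le> l * (m + n + 1)" using mult_le_mono1[OF l, of "n + 1"] by (simp add: distrib_left)
        then show "\<tau> t ^ (l * (m + n + 1)) \<le> \<tau> t ^ (l * m + (n + 1))" by (rule tau_pow_le[OF t])
        show "e powr (real (m + n + 1) / 2) \<le> e powr (real m / 2)" using e e' by (intro powr_mono') auto
      qed (use \<tau> in auto)
      finally have R: "\<bar>?R k\<bar> \<le> C1 * ?M" using C1(1) by (simp add: power_add mult_ac)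
      have "\<bar>\<tau> t ^ (2 * k) * ?R k\<bar> \<le> 1 * \<bar>?R k\<bar>"
        unfolding abs_mult using \<tau> by (intro mult_right_mono) (auto intro: power_le_one)
      with R show "\<bar>\<tau> t ^ (2 * k) * ?R k\<bar> \<le> C1 * ?M" by simp
    qed
    finally have 1: "\<bar>\<Sum>k\<in>?K. \<tau> t ^ (2 * k) * ?R k\<bar> \<le> real (card ?K) * C1 * ?M" by simp
    \<comment> \<open>For \<open>p \<le> n\<close> and \<open>l \<ge> 1\<close> the equation for the
      exponent already forces \<open>k \<le> n div 2\<close> and \<open>j \<le> m + n\<close>, so
      the index set in the definition of the coefficient is not cut by the truncation.\<close>
    have A: "{i. i \<in> ?I \<and> ?d i = p} = {(k, j). k \<in> {1..p} \<and> j \<in> {m..p + m} \<and> 2 * k + l * (j - m) = p}"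
      if "p \<in> {..n}" for p
    proof -
      have "k \<le> n div 2 \<and> k \<le> p \<and> j \<le> m + n \<and> j \<le> p + m" if kj: "2 * k + l * (j - m) = p" for k j
      proof -
        define X where "X = l * (j - m)"
        have "j - m \<le> X" using l by (simp add: X_def)
        moreover have "2 * k + X = p" "p \<le> n" using kj \<open>p \<in> {..n}\<close> by (auto simp: X_def)
        ultimately show ?thesis by presburger
      qed
      then show ?thesis by fastforce
    qed
    have "\<bar>(\<Sum>i\<in>?I. \<tau> t ^ ?d i * ?A i) - (\<Sum>p\<le>n. \<tau> t ^ p * (\<Sum>i\<in>{(k, j). k \<in> {1..p} \<and> j \<in> {m..p + m} \<and> 2 * k + l * (j - m) = p}. ?A i))\<bar>
      \<le> \<tau> t ^ (n + 1) * (\<Sum>i\<in>?I. \<bar>?A i\<bar>)"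
    proof -
      have "(\<Sum>p\<le>n. \<tau> t ^ p * (\<Sum>i\<in>{(k, j). k \<in> {1..p} \<and> j \<in> {m..p + m} \<and> 2 * k + l * (j - m) = p}. ?A i))
        = (\<Sum>p\<le>n. \<tau> t ^ p * (\<Sum>i | i \<in> ?I \<and> ?d i = p. ?A i))"
        by (rule sum.cong[OF refl]) (simp only: A)
      then show ?thesis
        using truncate_power_sum[of ?I "\<tau> t" ?d ?A n, OF _ less_imp_le[OF \<tau>(1)] \<tau>(2)] by simp
    qed
    also have "(\<Sum>i\<in>?I. \<bar>?A i\<bar>) \<le> real (card ?I) * (C2 * e powr (real m / 2))"
    proof (rule sum_bounded_above)
      fix i assume "i \<in> ?I"
      then show "\<bar>?A i\<bar> \<le> C2 * e powr (real m / 2)"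
        using C2(3)[rule_format, of i "(e, \<theta>, s)"] e e' by simp
    qed
    finally have 2: "\<bar>(\<Sum>i\<in>?I. \<tau> t ^ ?d i * ?A i) - (\<Sum>p\<le>n. \<tau> t ^ p * (\<Sum>i\<in>{(k, j). k \<in> {1..p} \<and> j \<in> {m..p + m} \<and> 2 * k + l * (j - m) = p}. ?A i))\<bar>
      \<le> real (card ?I) * C2 * (e powr (real m / 2) * \<tau> t ^ (n + 1))" using \<tau> by (simp add: mult_ac)
    define u1 where "u1 = (\<Sum>k\<in>?K. \<tau> t ^ (2 * k) * ?R k)"
    define u2 where "u2 = (\<Sum>i\<in>?I. \<tau> t ^ ?d i * ?A i)"
    define u3 where "u3 = (\<Sum>p\<le>n. \<tau> t ^ p * (\<Sum>i\<in>{(k, j). k \<in> {1..p} \<and> j \<in> {m..p + m} \<and> 2 * k + l * (j - m) = p}. ?A i))"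
    have "\<bar>u1 + \<tau> t ^ (l * m) * u2 - \<tau> t ^ (l * m) * u3\<bar> \<le> \<bar>u1\<bar> + \<bar>\<tau> t ^ (l * m) * (u2 - u3)\<bar>"
      using abs_triangle_ineq[of u1 "\<tau> t ^ (l * m) * (u2 - u3)"] by (simp add: algebra_simps)
    also have "\<bar>\<tau> t ^ (l * m) * (u2 - u3)\<bar> \<le> \<tau> t ^ (l * m) * (real (card ?I) * C2 * (e powr (real m / 2) * \<tau> t ^ (n + 1)))"
      unfolding abs_mult using \<tau> 2[folded u2_def u3_def] by (intro mult_mono) auto
    also note 1[folded u1_def]
    also have "real (card ?K) * C1 * ?M + \<tau> t ^ (l * m) * (real (card ?I) * C2 * (e powr (real m / 2) * \<tau> t ^ (n + 1)))
      = (C - 1) * ?M" by (simp add: C_def algebra_simps)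
    also have "\<dots> \<le> C * ?M" using M by (intro mult_right_mono) auto
    finally show ?thesis unfolding split u1_def[symmetric] u2_def[symmetric] u3_def[symmetric]
      by (simp add: mult.assoc)
  qed
  moreover have "0 < C" "0 < \<eta>" using C1 C2 by (auto simp: C_def \<eta>_def intro!: add_nonneg_pos)
  ultimately show ?thesis by blast
qed

text \<open>For \<open>l \<ge> 1\<close> the prefactor \<open>t^(l/q)\<close> is the inverse of
  \<open>\<tau>^(2l)\<close>, the factor extracted with \<open>m = 2\<close>. The error keeps the
  factor \<open>e\<close>.\<close>

lemma F_expansion:
  "\<exists>C \<eta>. 0 < C \<and> 0 < \<eta> \<and> (\<forall>e \<theta> s t. 0 < e \<longrightarrow> e < \<eta> \<longrightarrow> 1 \<le> t \<longrightarrow>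
    \<bar>t powr (real l / real (qpar P)) * (\<Sum>k=1..n div 2. \<tau> t ^ (2 * k) * f_co P k (shear \<kappa>i (unscale l t e, \<theta>, s)))
      - (\<Sum>p\<le>n. \<tau> t ^ p * scaled_F P l p (e, \<theta>, s))\<bar> \<le> C * e * \<tau> t ^ (n + 1))"
proof (cases "l = 0")
  case True
  obtain C \<eta> where C: "0 < C" "0 < \<eta>" "\<forall>x\<in>strip \<eta>. \<forall>t\<ge>1.
    \<bar>(\<Sum>k=1..n div 2. \<tau> t ^ (2 * k) * f_co P k (shear \<kappa>i x))
      - (\<Sum>p\<le>n. \<tau> t ^ p * (if even p \<and> 2 \<le> p then f_co P (p div 2) (shear \<kappa>i x) else 0))\<bar>
      \<le> C * fst x powr 1 * \<tau> t ^ (n + 1)"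
    using expansion_unscaled[of 1 "f_co P" n] symbol_f_co by auto
  show ?thesis
  proof (rule exI[of _ C], rule exI[of _ \<eta>], intro conjI allI impI C(1,2))
    fix e \<theta> s t :: real assume "0 < e" "e < \<eta>" "1 \<le> t"
    then show "\<bar>t powr (real l / real (qpar P)) * (\<Sum>k=1..n div 2. \<tau> t ^ (2 * k) * f_co P k (shear \<kappa>i (unscale l t e, \<theta>, s)))
      - (\<Sum>p\<le>n. \<tau> t ^ p * scaled_F P l p (e, \<theta>, s))\<bar> \<le> C * e * \<tau> t ^ (n + 1)"
      using C(3)[rule_format, of "(e, \<theta>, s)" t] True
      by (simp add: scaled_F_eq unscale_def if_distrib if_distribR cong: if_cong)
  qed
next
  case False
  have 1: "1 \<le> l" using False by simp
  have 2: "symbol (real (2 + n + 1) / 2) (\<lambda>x. f_co P k x - (\<Sum>j=2..2 + n. act_term k j x))" if "1 \<le> k" for k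
    using f_remainder_symbol[OF that, of "2 + n"] by simp
  have 3: "symbol (real 2 / 2) (act_term k j)" if "1 \<le> k" "2 \<le> j" for k j
    by (rule symbol_mono[OF symbol_act_term[OF that]]) (use that in simp)
  have 4: "act_term k j (shear \<kappa>i (unscale l t e, \<theta>, s)) = \<tau> t ^ (l * j) * act_term k j (shear \<kappa>i (e, \<theta>, s))"
    if "1 \<le> t" "0 < e" for k j e \<theta> s t
    using unscale_powr[OF that, of l j] by (simp add: act_term_def shear_def)
  have ex: "\<exists>C \<eta>. 0 < C \<and> 0 < \<eta> \<and> (\<forall>e \<theta> s t. 0 < e \<longrightarrow> e < \<eta> \<longrightarrow> 1 \<le> t \<longrightarrow>
    \<bar>(\<Sum>k=1..n div 2. \<tau> t ^ (2 * k) * f_co P k (shear \<kappa>i (unscale l t e, \<theta>, s)))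
      - \<tau> t ^ (l * 2) * (\<Sum>p\<le>n. \<tau> t ^ p * (\<Sum>i\<in>{(k, j). k \<in> {1..p} \<and> j \<in> {2..p + 2} \<and> 2 * k + l * (j - 2) = p}.
          act_term (fst i) (snd i) (shear \<kappa>i (e, \<theta>, s))))\<bar>
      \<le> C * \<tau> t ^ (l * 2) * e powr (real 2 / 2) * \<tau> t ^ (n + 1))"
    by (rule expansion_scaled[OF 1 2 3 4])
  obtain C \<eta> where C: "0 < C" "0 < \<eta>" "\<forall>e \<theta> s t. 0 < e \<longrightarrow> e < \<eta> \<longrightarrow> 1 \<le> t \<longrightarrow>
    \<bar>(\<Sum>k=1..n div 2. \<tau> t ^ (2 * k) * f_co P k (shear \<kappa>i (unscale l t e, \<theta>, s)))
      - \<tau> t ^ (l * 2) * (\<Sum>p\<le>n. \<tau> t ^ p * (\<Sum>i\<in>{(k, j). k \<in> {1..p} \<and> j \<in> {2..p + 2} \<and> 2 * k + l * (j - 2) = p}.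
          act_term (fst i) (snd i) (shear \<kappa>i (e, \<theta>, s))))\<bar>
      \<le> C * \<tau> t ^ (l * 2) * e powr (real 2 / 2) * \<tau> t ^ (n + 1)"
    using ex by (elim exE conjE)
  show ?thesis
  proof (rule exI[of _ C], rule exI[of _ \<eta>], intro conjI allI impI C(1,2))
    fix e \<theta> s t :: real assume e: "0 < e" "e < \<eta>" "1 \<le> t"
    let ?T = "t powr (real l / real (qpar P))"
    have T: "?T * \<tau> t ^ (l * 2) = 1" using tau_l[of t l] e by (simp add: mult.commute)
    define u where "u = (\<Sum>k=1..n div 2. \<tau> t ^ (2 * k) * f_co P k (shear \<kappa>i (unscale l t e, \<theta>, s)))"
    define v where "v = (\<Sum>p\<le>n. \<tau> t ^ p * scaled_F P l p (e, \<theta>, s))"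
    have "\<bar>u - \<tau> t ^ (l * 2) * v\<bar> \<le> C * \<tau> t ^ (l * 2) * e * \<tau> t ^ (n + 1)"
      using C(3)[rule_format, OF e, of \<theta> s] False e(1) unfolding u_def v_def scaled_F_eq by simp
    then have "?T * \<bar>u - \<tau> t ^ (l * 2) * v\<bar> \<le> ?T * (C * \<tau> t ^ (l * 2) * e * \<tau> t ^ (n + 1))"
      by (intro mult_left_mono) auto
    also have "\<dots> = (?T * \<tau> t ^ (l * 2)) * (C * e * \<tau> t ^ (n + 1))" by (simp add: mult_ac)
    also have "?T * \<bar>u - \<tau> t ^ (l * 2) * v\<bar> = \<bar>?T * u - (?T * \<tau> t ^ (l * 2)) * v\<bar>"
      by (simp add: abs_mult[of ?T, symmetric, simplified] right_diff_distrib mult.assoc)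
    finally show "\<bar>?T * u - v\<bar> \<le> C * e * \<tau> t ^ (n + 1)" unfolding T by simp
  qed
qed

text \<open>The termwise differentiated expansion of the phase has an error of size
  \<open>t^(-1/q - 1) = \<tau>^(2q+2)\<close>, below \<open>\<tau>^(n+1)\<close> since
  \<open>n < 2q\<close>.\<close>

lemma phase_expansion:
  assumes "n < 2 * qpar P"
  obtains C T where "0 < C" "1 \<le> T" "\<And>t. T \<le> t \<Longrightarrow> \<bar>deriv (phase P) t - (\<Sum>p\<le>n. \<tau> t ^ p * S_co P p)\<bar> \<le> C * \<tau> t ^ (n + 1)"
proof -
  let ?q = "qpar P"
  \<comment> \<open>The coefficient of \<open>\<tau>^(2k)\<close> in the phase speed; index
    \<open>q\<close> comes from the logarithm.\<close>
  define c where "c k = (if k < ?q then (1 - real k / real ?q) * phase_co P k else phase_co P ?q)" for k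
  have "\<forall>i. \<exists>C T. \<forall>t\<ge>T.
        \<bar>(deriv ^^ i) (\<lambda>t. phase P t
             - (\<Sum>k<?q. phase_co P k * t powr (1 - real k / real ?q))
             - phase_co P ?q * ln t) t\<bar> \<le> C * t powr (- 1 / real ?q - real i)"
    using standing unfolding standing_assumptions_def expansions_at_infinity_def by (elim conjE)
  from this[THEN spec, of 1] obtain C T where CT: "\<forall>t\<ge>T. \<bar>deriv (\<lambda>t. phase P t
             - (\<Sum>k<?q. phase_co P k * t powr (1 - real k / real ?q))
             - phase_co P ?q * ln t) t\<bar> \<le> C * t powr (- 1 / real ?q - 1)" by auto
  have q: "real ?q > 0" using standing_basic(5) by simp
  have ph: "smooth_fun_on {0<..} (phase P)"
    using standing unfolding standing_assumptions_def expansions_at_infinity_def by blast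
  have main: "\<bar>deriv (phase P) t - (\<Sum>p\<le>n. \<tau> t ^ p * S_co P p)\<bar> \<le> (\<bar>C\<bar> + (\<Sum>k\<le>?q. \<bar>c k\<bar>) + 1) * \<tau> t ^ (n + 1)"
    if t: "max 1 T \<le> t" for t
  proof -
    have t1: "1 \<le> t" "0 < t" "T \<le> t" using t by auto
    have \<tau>: "0 < \<tau> t" "\<tau> t \<le> 1" using tau_bounds[OF t1(1)] by auto
    have dph: "(phase P has_real_derivative deriv (phase P) t) (at t)"
    proof -
      have *: "(phase P has_real_derivative pd 1 (phase P) t) (at t)"
        using pd_along[of "phase P" 0 t 1] smooth_differentiable[OF ph, of t] t1 by simp
      then show ?thesis using DERIV_imp_deriv[OF *] by simp
    qed
    have "((\<lambda>t. phase P t - (\<Sum>k<?q. phase_co P k * t powr (1 - real k / real ?q)) - phase_co P ?q * ln t)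
      has_real_derivative deriv (phase P) t - (\<Sum>k<?q. phase_co P k * ((1 - real k / real ?q) * t powr ((1 - real k / real ?q) - 1)))
        - phase_co P ?q * (1 / t)) (at t)"
      using DERIV_ln_divide[OF t1(2)]
      by (intro DERIV_diff dph DERIV_sum DERIV_cmult has_real_derivative_powr t1(2)) auto
    then have "deriv (\<lambda>t. phase P t - (\<Sum>k<?q. phase_co P k * t powr (1 - real k / real ?q)) - phase_co P ?q * ln t) t
      = deriv (phase P) t - (\<Sum>k<?q. phase_co P k * ((1 - real k / real ?q) * t powr ((1 - real k / real ?q) - 1)))
        - phase_co P ?q * (1 / t)" by (rule DERIV_imp_deriv)
    also have "(\<Sum>k<?q. phase_co P k * ((1 - real k / real ?q) * t powr ((1 - real k / real ?q) - 1)))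
        = (\<Sum>k<?q. \<tau> t ^ (2 * k) * c k)"
    proof (intro sum.cong refl)
      fix k assume "k \<in> {..<?q}"
      moreover have "t powr ((1 - real k / real ?q) - 1) = \<tau> t ^ (2 * k)"
        using tau_even[OF t1(2), of k] by simp
      ultimately show "phase_co P k * ((1 - real k / real ?q) * t powr ((1 - real k / real ?q) - 1)) = \<tau> t ^ (2 * k) * c k"
        by (simp only: c_def lessThan_iff if_True mult_ac)
    qed
    also have "phase_co P ?q * (1 / t) = \<tau> t ^ (2 * ?q) * c ?q"
      using q t1 by (simp add: c_def tau_even[OF t1(2), symmetric] powr_minus_divide)
    finally have dd: "deriv (\<lambda>t. phase P t - (\<Sum>k<?q. phase_co P k * t powr (1 - real k / real ?q)) - phase_co P ?q * ln t) t
      = deriv (phase P) t - (\<Sum>k\<le>?q. \<tau> t ^ (2 * k) * c k)"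
      by (simp flip: lessThan_Suc_atMost)
    have "\<bar>deriv (phase P) t - (\<Sum>k\<le>?q. \<tau> t ^ (2 * k) * c k)\<bar> \<le> C * t powr (- 1 / real ?q - 1)"
      using CT[rule_format, OF t1(3)] unfolding dd .
    also have "t powr (- 1 / real ?q - 1) = \<tau> t ^ (2 * ?q + 2)"
      unfolding tau_power[OF t1(2)] using q by (intro arg_cong[of _ _ "\<lambda>x. t powr x"]) (simp add: field_simps)
    also have "C * \<tau> t ^ (2 * ?q + 2) \<le> \<bar>C\<bar> * \<tau> t ^ (n + 1)"
      using tau_pow_le[OF t1(1), of "n + 1" "2 * ?q + 2"] assms \<tau> by (intro mult_mono) auto
    finally have 1: "\<bar>deriv (phase P) t - (\<Sum>k\<le>?q. \<tau> t ^ (2 * k) * c k)\<bar> \<le> \<bar>C\<bar> * \<tau> t ^ (n + 1)" .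
    have eq: "(\<Sum>i | i \<in> {..?q} \<and> 2 * i = p. c i) = S_co P p" if "p \<in> {..n}" for p
    proof (cases "even p")
      case True
      then have *: "{i. i \<in> {..?q} \<and> 2 * i = p} = {p div 2}" using that assms by auto
      show ?thesis unfolding * using True that assms by (auto simp: c_def S_co_def)
    next
      case False
      then have *: "{i. i \<in> {..?q} \<and> 2 * i = p} = {}" by auto
      show ?thesis unfolding * using False by (auto simp: S_co_def)
    qed
    have 2: "\<bar>(\<Sum>k\<le>?q. \<tau> t ^ (2 * k) * c k) - (\<Sum>p\<le>n. \<tau> t ^ p * S_co P p)\<bar> \<le> \<tau> t ^ (n + 1) * (\<Sum>k\<le>?q. \<bar>c k\<bar>)"
      using truncate_power_sum[of "{..?q}" "\<tau> t" "\<lambda>k. 2 * k" c n] \<tau> eq by simp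
    have "0 \<le> \<tau> t ^ (n + 1)" using \<tau> by simp
    moreover have "\<bar>x - z\<bar> \<le> A * T + T * B \<Longrightarrow> 0 \<le> T \<Longrightarrow> \<bar>x - z\<bar> \<le> (A + B + 1) * T" for x z A B T :: real
      by (simp add: algebra_simps)
    moreover have "\<bar>x - z\<bar> \<le> a + b" if "\<bar>x - y\<bar> \<le> a" "\<bar>y - z\<bar> \<le> b" for x y z a b :: real
      using that by linarith
    ultimately show ?thesis using 1 2 by blast
  qed
  show ?thesis
  proof (rule that[of "\<bar>C\<bar> + (\<Sum>k\<le>?q. \<bar>c k\<bar>) + 1" "max 1 T"])
    show "0 < \<bar>C\<bar> + (\<Sum>k\<le>?q. \<bar>c k\<bar>) + 1" by (intro add_nonneg_pos add_nonneg_nonneg sum_nonneg) auto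
  qed (use main in auto)
qed

text \<open>The phase part of \<open>scaled_G\<close> is added back, leaving frequency and
  \<open>g\<close> alone; the actual phase speed is compared with its series separately by
  \<open>phase_expansion\<close>.\<close>

lemma G_expansion:
  assumes sc: "scaling_exponent P l"
  shows "\<exists>C \<eta>. 0 < C \<and> 0 < \<eta> \<and> (\<forall>e \<theta> s t. 0 < e \<longrightarrow> e < \<eta> \<longrightarrow> 1 \<le> t \<longrightarrow>
    \<bar>(freq P (unscale l t e) + (\<Sum>k=1..n div 2. \<tau> t ^ (2 * k) * g_co P k (shear \<kappa>i (unscale l t e, \<theta>, s))))
      - (\<Sum>p\<le>n. \<tau> t ^ p * (scaled_G P l p (e, \<theta>, s) + S_co P p * \<kappa>i))\<bar> \<le> C * \<tau> t ^ (n + 1))"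
proof (cases "l = 0")
  case True
  obtain C \<eta> where C: "0 < C" "0 < \<eta>" "\<forall>x\<in>strip \<eta>. \<forall>t\<ge>1.
    \<bar>(\<Sum>k=1..n div 2. \<tau> t ^ (2 * k) * g_co P k (shear \<kappa>i x))
      - (\<Sum>p\<le>n. \<tau> t ^ p * (if even p \<and> 2 \<le> p then g_co P (p div 2) (shear \<kappa>i x) else 0))\<bar>
      \<le> C * fst x powr 0 * \<tau> t ^ (n + 1)"
    using expansion_unscaled[of 0 "g_co P" n] symbol_g_co by auto
  show ?thesis
  proof (rule exI[of _ C], rule exI[of _ \<eta>], intro conjI allI impI C(1,2))
    fix e \<theta> s t :: real assume e: "0 < e" "e < \<eta>" "1 \<le> t"
    have "(\<Sum>p\<le>n. \<tau> t ^ p * (scaled_G P l p (e, \<theta>, s) + S_co P p * \<kappa>i))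
      = (\<Sum>p\<le>n. (if p = 0 then freq P e else 0) + \<tau> t ^ p * (if even p \<and> 2 \<le> p then g_co P (p div 2) (shear \<kappa>i (e, \<theta>, s)) else 0))"
      using True by (intro sum.cong refl) (simp add: scaled_G_eq)
    also have "\<dots> = freq P e + (\<Sum>p\<le>n. \<tau> t ^ p * (if even p \<and> 2 \<le> p then g_co P (p div 2) (shear \<kappa>i (e, \<theta>, s)) else 0))"
      unfolding sum.distrib by simp
    finally show "\<bar>(freq P (unscale l t e) + (\<Sum>k=1..n div 2. \<tau> t ^ (2 * k) * g_co P k (shear \<kappa>i (unscale l t e, \<theta>, s))))
      - (\<Sum>p\<le>n. \<tau> t ^ p * (scaled_G P l p (e, \<theta>, s) + S_co P p * \<kappa>i))\<bar> \<le> C * \<tau> t ^ (n + 1)"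
      using C(3)[rule_format, of "(e, \<theta>, s)" t] True e by (simp add: unscale_def)
  qed
next
  case False
  have 1: "1 \<le> l" using False by simp
  have 2: "symbol (real (0 + n + 1) / 2) (\<lambda>x. g_co P k x - (\<Sum>j=0..0 + n. ang_term k j x))" if "1 \<le> k" for k
    using g_remainder_symbol[OF that, of n] by (simp add: atMost_atLeast0)
  have 3: "symbol (real 0 / 2) (ang_term k j)" if "1 \<le> k" "0 \<le> j" for k j
    by (rule symbol_mono[OF symbol_ang_term[OF that(1)]]) simp
  have 4: "ang_term k j (shear \<kappa>i (unscale l t e, \<theta>, s)) = \<tau> t ^ (l * j) * ang_term k j (shear \<kappa>i (e, \<theta>, s))"
    if "1 \<le> t" "0 < e" for k j e \<theta> s t
    using unscale_powr[OF that, of l j] by (simp add: ang_term_def shear_def)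
  have ex: "\<exists>C \<eta>. 0 < C \<and> 0 < \<eta> \<and> (\<forall>e \<theta> s t. 0 < e \<longrightarrow> e < \<eta> \<longrightarrow> 1 \<le> t \<longrightarrow>
    \<bar>(\<Sum>k=1..n div 2. \<tau> t ^ (2 * k) * g_co P k (shear \<kappa>i (unscale l t e, \<theta>, s)))
      - \<tau> t ^ (l * 0) * (\<Sum>p\<le>n. \<tau> t ^ p * (\<Sum>i\<in>{(k, j). k \<in> {1..p} \<and> j \<in> {0..p + 0} \<and> 2 * k + l * (j - 0) = p}.
          ang_term (fst i) (snd i) (shear \<kappa>i (e, \<theta>, s))))\<bar>
      \<le> C * \<tau> t ^ (l * 0) * e powr (real 0 / 2) * \<tau> t ^ (n + 1))"
    by (rule expansion_scaled[OF 1 2 3 4])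
  obtain C \<eta>1 where C: "0 < C" "0 < \<eta>1" "\<forall>e \<theta> s t. 0 < e \<longrightarrow> e < \<eta>1 \<longrightarrow> 1 \<le> t \<longrightarrow>
    \<bar>(\<Sum>k=1..n div 2. \<tau> t ^ (2 * k) * g_co P k (shear \<kappa>i (unscale l t e, \<theta>, s)))
      - \<tau> t ^ (l * 0) * (\<Sum>p\<le>n. \<tau> t ^ p * (\<Sum>i\<in>{(k, j). k \<in> {1..p} \<and> j \<in> {0..p + 0} \<and> 2 * k + l * (j - 0) = p}.
          ang_term (fst i) (snd i) (shear \<kappa>i (e, \<theta>, s))))\<bar>
      \<le> C * \<tau> t ^ (l * 0) * e powr (real 0 / 2) * \<tau> t ^ (n + 1)"
    using ex by (elim exE conjE)
  obtain D \<eta>2 where D: "0 < \<eta>2" "\<And>E. 0 < E \<Longrightarrow> E < \<eta>2 \<Longrightarrow> \<bar>freq P E - (\<Sum>j\<le>n. freq_co P j * E ^ j)\<bar> \<le> D * E powr real (n + 1)"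
    by (rule freq_expansion) blast
  define M where "M = C + \<bar>D\<bar> + (\<Sum>j\<le>n. \<bar>freq_co P j\<bar>)"
  show ?thesis
  proof (rule exI[of _ M], rule exI[of _ "min (min \<eta>1 \<eta>2) 1"], intro conjI allI impI)
    show "0 < M" using C(1) by (auto simp: M_def intro!: add_pos_nonneg sum_nonneg)
    show "0 < min (min \<eta>1 \<eta>2) 1" using C D by simp
    fix e \<theta> s t :: real assume e: "0 < e" "e < min (min \<eta>1 \<eta>2) 1" and t: "1 \<le> t"
    then have e': "e < \<eta>1" "e < \<eta>2" "e < 1" by auto
    note \<tau> = tau_bounds[OF t]
    let ?E = "unscale l t e"
    let ?A = "\<lambda>p. \<Sum>i\<in>{(k, j). k \<in> {1..p} \<and> j \<in> {0..p} \<and> 2 * k + l * j = p}. ang_term (fst i) (snd i) (shear \<kappa>i (e, \<theta>, s))"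
    let ?w = "\<lambda>p. \<Sum>j \<in> {j. j \<le> p \<and> 2 * l * j = p}. freq_co P j * e ^ j"
    have g: "\<bar>(\<Sum>k=1..n div 2. \<tau> t ^ (2 * k) * g_co P k (shear \<kappa>i (?E, \<theta>, s))) - (\<Sum>p\<le>n. \<tau> t ^ p * ?A p)\<bar> \<le> C * \<tau> t ^ (n + 1)"
      using C(3)[rule_format, OF e(1) e'(1) t, of \<theta> s] e(1) by simp
    have "\<bar>freq P ?E - (\<Sum>j\<le>n. freq_co P j * ?E ^ j)\<bar> \<le> D * ?E powr real (n + 1)"
      by (rule D(2)) (use unscale_bounds[OF t e(1), of l] e' in auto)
    \<comment> \<open>For \<open>l \<ge> 1\<close> and \<open>e < 1\<close> the unscaled energy is
      at most \<open>\<tau>\<close>, so its power \<open>n + 1\<close> has the required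
      size.\<close>
    also have "\<dots> \<le> \<bar>D\<bar> * \<tau> t ^ (n + 1)"
    proof (rule mult_mono)
      have "?E powr real (n + 1) = ?E ^ (n + 1)" using unscale_bounds[OF t e(1), of l] by (simp add: powr_realpow del: of_nat_add of_nat_Suc)
      also have "\<dots> \<le> \<tau> t ^ (n + 1)"
      proof (rule power_mono)
        have "\<tau> t ^ (2 * l) * e \<le> \<tau> t ^ 1 * 1" using tau_pow_le[OF t, of 1 "2 * l"] 1 e e' \<tau> by (intro mult_mono) auto
        then show "?E \<le> \<tau> t" by (simp add: unscale_def)
      qed (use unscale_bounds[OF t e(1), of l] in auto)
      finally show "?E powr real (n + 1) \<le> \<tau> t ^ (n + 1)" .
    qed auto
    finally have f1: "\<bar>freq P ?E - (\<Sum>j\<le>n. freq_co P j * ?E ^ j)\<bar> \<le> \<bar>D\<bar> * \<tau> t ^ (n + 1)" .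
    have f2: "(\<Sum>j\<le>n. freq_co P j * ?E ^ j) = (\<Sum>j\<le>n. \<tau> t ^ (2 * l * j) * (freq_co P j * e ^ j))"
      by (simp add: unscale_def power_mult_distrib mult.left_commute flip: power_mult)
    have set: "{j. j \<in> {..n} \<and> 2 * l * j = p} = {j. j \<le> p \<and> 2 * l * j = p}" if "p \<in> {..n}" for p
    proof -
      have "j \<le> p \<and> j \<in> {..n}" if "2 * l * j = p" for j
      proof -
        have "1 * j \<le> (2 * l) * j" using 1 by (intro mult_le_mono1) simp
        then show ?thesis using that \<open>p \<in> {..n}\<close> by simp
      qed
      then show ?thesis by blast
    qed
    have "\<bar>(\<Sum>j\<le>n. \<tau> t ^ (2 * l * j) * (freq_co P j * e ^ j)) - (\<Sum>p\<le>n. \<tau> t ^ p * ?w p)\<bar>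
      \<le> \<tau> t ^ (n + 1) * (\<Sum>j\<le>n. \<bar>freq_co P j * e ^ j\<bar>)"
    proof -
      have "(\<Sum>p\<le>n. \<tau> t ^ p * ?w p) = (\<Sum>p\<le>n. \<tau> t ^ p * (\<Sum>j | j \<in> {..n} \<and> 2 * l * j = p. freq_co P j * e ^ j))"
        by (rule sum.cong[OF refl]) (simp only: set)
      then show ?thesis
        using truncate_power_sum[of "{..n}" "\<tau> t" "\<lambda>j. 2 * l * j" "\<lambda>j. freq_co P j * e ^ j" n] \<tau> by (simp only: less_imp_le finite_atMost)
    qed
    also have "(\<Sum>j\<le>n. \<bar>freq_co P j * e ^ j\<bar>) \<le> (\<Sum>j\<le>n. \<bar>freq_co P j\<bar>)"
      using e e' by (intro sum_mono) (auto simp: abs_mult intro!: mult_left_le power_le_one)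
    finally have f3: "\<bar>(\<Sum>j\<le>n. \<tau> t ^ (2 * l * j) * (freq_co P j * e ^ j)) - (\<Sum>p\<le>n. \<tau> t ^ p * ?w p)\<bar>
      \<le> \<tau> t ^ (n + 1) * (\<Sum>j\<le>n. \<bar>freq_co P j\<bar>)" using \<tau> by (simp add: mult_left_mono)
    have G: "(\<Sum>p\<le>n. \<tau> t ^ p * (scaled_G P l p (e, \<theta>, s) + S_co P p * \<kappa>i)) = (\<Sum>p\<le>n. \<tau> t ^ p * ?w p) + (\<Sum>p\<le>n. \<tau> t ^ p * ?A p)"
      using False by (simp add: scaled_G_eq distrib_left sum.distrib)
    have tri: "\<bar>(a + b) - (c + d)\<bar> \<le> M1 + M2 + M3" if "\<bar>a - a'\<bar> \<le> M2" "\<bar>a' - c\<bar> \<le> M3" "\<bar>b - d\<bar> \<le> M1" for a a' b c d M1 M2 M3 :: real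
      using that by linarith
    show "\<bar>(freq P ?E + (\<Sum>k=1..n div 2. \<tau> t ^ (2 * k) * g_co P k (shear \<kappa>i (?E, \<theta>, s))))
      - (\<Sum>p\<le>n. \<tau> t ^ p * (scaled_G P l p (e, \<theta>, s) + S_co P p * \<kappa>i))\<bar> \<le> M * \<tau> t ^ (n + 1)"
      unfolding G using tri[OF f1[unfolded f2] f3 g] unfolding M_def distrib_right
      by (simp only: mult.commute[of "\<tau> t ^ (n + 1)" "\<Sum>j\<le>n. \<bar>freq_co P j\<bar>"])
  qed
qed

end

lemma abs_sum3_le:
  fixes a b c :: real
  assumes "\<bar>a\<bar> \<le> x" "\<bar>b\<bar> \<le> y" "\<bar>c\<bar> \<le> z"
  shows "\<bar>a + b + c\<bar> \<le> x + y + z"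
  using assms by linarith

lemma abs_mult_le:
  fixes a b :: real
  assumes "\<bar>a\<bar> \<le> x" "\<bar>b\<bar> \<le> y"
  shows "\<bar>a * b\<bar> \<le> x * y"
proof -
  have "0 \<le> x" using assms(1) by linarith
  then show ?thesis unfolding abs_mult using assms by (intro mult_mono) auto
qed

section \<open>Derivative of the truncated near-identity transformation\<close>

context osc begin

text \<open>\<open>e'\<close>, \<open>\<theta>'\<close>, \<open>s'\<close> stand for the true rates,
  known only up to \<open>\<tau>^(n+1)\<close>. Every product in the chain rule is of size
  \<open>e\<close>: the energy derivative of \<open>W k\<close> is bounded and multiplies a rate of
  size \<open>e\<close>, while the other derivatives are themselves of size \<open>e\<close>. So all
  errors carry the factor \<open>e\<close>.\<close>

lemma V_estimate:
  assumes sc: "scaling_exponent P l" and n: "n < 2 * qpar P" and "0 < \<eta>0"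
    and W: "\<And>k. k \<le> n \<Longrightarrow> symbol 1 (W k)"
    and rel: "\<And>k x. k \<le> n \<Longrightarrow> x \<in> strip \<eta>0 \<Longrightarrow>
      (\<Sum>i\<le>k. scaled_F P l i x * pd (1, 0, 0) (W (k - i)) x + scaled_G P l i x * pd (0, 1, 0) (W (k - i)) x
        + S_co P i * pd (0, 0, 1) (W (k - i)) x) = (if k = n then Lm x else 0)"
  obtains C \<eta> where "0 < C" "0 < \<eta>" "\<And>x t e' \<theta>' s' C0. x \<in> strip \<eta> \<Longrightarrow> 1 \<le> t \<Longrightarrow> 0 \<le> C0 \<Longrightarrow>
      \<bar>e' - (\<Sum>p\<le>n. \<tau> t ^ p * scaled_F P l p x)\<bar> \<le> C0 * fst x * \<tau> t ^ (n + 1) \<Longrightarrow>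
      \<bar>\<theta>' - (\<Sum>p\<le>n. \<tau> t ^ p * scaled_G P l p x)\<bar> \<le> C0 * \<tau> t ^ (n + 1) \<Longrightarrow>
      \<bar>s' - (\<Sum>p\<le>n. \<tau> t ^ p * S_co P p)\<bar> \<le> C0 * \<tau> t ^ (n + 1) \<Longrightarrow>
      \<bar>(\<Sum>k\<le>n. \<tau> t ^ k * (pd (1, 0, 0) (W k) x * e' + pd (0, 1, 0) (W k) x * \<theta>' + pd (0, 0, 1) (W k) x * s')
          - real k / real (2 * qpar P) * \<tau> t ^ k / t * W k x) - \<tau> t ^ n * Lm x\<bar>
        \<le> C * (1 + C0) * fst x * \<tau> t ^ (n + 1)"
proof -
  have ex: "\<exists>C \<eta>. 0 < C \<and> 0 < \<eta> \<and> (\<forall>k\<in>{..n}. \<forall>x\<in>strip \<eta>. \<bar>f k x\<bar> \<le> C * fst x powr a)"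
    if "\<And>k. k \<le> n \<Longrightarrow> symbol a (f k)" for f :: "nat \<Rightarrow> real \<times> real \<times> real \<Rightarrow> real" and a
    by (rule finite_common_bound) (use that in auto)
  obtain D0 \<eta>0' where D0: "0 < D0" "0 < \<eta>0'" "\<forall>k\<in>{..n}. \<forall>x\<in>strip \<eta>0'. \<bar>W k x\<bar> \<le> D0 * fst x powr 1"
    using ex[of 1 W, OF W] by auto
  obtain D1 \<eta>1 where D1: "0 < D1" "0 < \<eta>1" "\<forall>k\<in>{..n}. \<forall>x\<in>strip \<eta>1. \<bar>pd (1, 0, 0) (W k) x\<bar> \<le> D1 * fst x powr 0"
    using ex[of 0 "\<lambda>k. pd (1, 0, 0) (W k)"] symbol_pd_simps(1)[OF W] by auto
  obtain D2 \<eta>2 where D2: "0 < D2" "0 < \<eta>2" "\<forall>k\<in>{..n}. \<forall>x\<in>strip \<eta>2. \<bar>pd (0, 1, 0) (W k) x\<bar> \<le> D2 * fst x powr 1"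
    using ex[of 1 "\<lambda>k. pd (0, 1, 0) (W k)"] symbol_pd_simps(2)[OF W] by auto
  obtain D3 \<eta>3 where D3: "0 < D3" "0 < \<eta>3" "\<forall>k\<in>{..n}. \<forall>x\<in>strip \<eta>3. \<bar>pd (0, 0, 1) (W k) x\<bar> \<le> D3 * fst x powr 1"
    using ex[of 1 "\<lambda>k. pd (0, 0, 1) (W k)"] symbol_pd_simps(3)[OF W] by auto
  obtain D4 \<eta>4 where D4: "0 < D4" "0 < \<eta>4" "\<forall>k\<in>{..n}. \<forall>x\<in>strip \<eta>4. \<bar>scaled_F P l k x\<bar> \<le> D4 * fst x powr 1"
    using ex[of 1 "scaled_F P l"] symbol_scaled_F by auto
  obtain D5 \<eta>5 where D5: "0 < D5" "0 < \<eta>5" "\<forall>k\<in>{..n}. \<forall>x\<in>strip \<eta>5. \<bar>scaled_G P l k x\<bar> \<le> D5 * fst x powr 0"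
    using ex[of 0 "scaled_G P l"] symbol_scaled_G[OF sc] by auto
  define D6 where "D6 = (\<Sum>k\<le>n. \<bar>S_co P k\<bar>)"
  have D6: "\<bar>S_co P k\<bar> \<le> D6" if "k \<le> n" for k unfolding D6_def by (rule member_le_sum) (use that in auto)
  have D60: "0 \<le> D6" by (simp add: D6_def sum_nonneg)
  define D where "D = D0 + D1 + D2 + D3 + D4 + D5 + D6"
  have le: "D0 \<le> D" "D1 \<le> D" "D2 \<le> D" "D3 \<le> D" "D4 \<le> D" "D5 \<le> D" "D6 \<le> D" "0 < D"
    using D0 D1 D2 D3 D4 D5 D60 by (simp_all add: D_def)
  define \<eta> where "\<eta> = Min {\<eta>0, \<eta>0', \<eta>1, \<eta>2, \<eta>3, \<eta>4, \<eta>5}"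
  have sub: "x \<in> strip \<eta>0" "x \<in> strip \<eta>0'" "x \<in> strip \<eta>1" "x \<in> strip \<eta>2" "x \<in> strip \<eta>3" "x \<in> strip \<eta>4" "x \<in> strip \<eta>5"
    if "x \<in> strip \<eta>" for x using that by (auto simp: \<eta>_def strip_fst)
  have bd: "\<bar>W k x\<bar> \<le> D * fst x" "\<bar>pd (1, 0, 0) (W k) x\<bar> \<le> D" "\<bar>pd (0, 1, 0) (W k) x\<bar> \<le> D * fst x"
    "\<bar>pd (0, 0, 1) (W k) x\<bar> \<le> D * fst x" "\<bar>scaled_F P l k x\<bar> \<le> D * fst x" "\<bar>scaled_G P l k x\<bar> \<le> D" "\<bar>S_co P k\<bar> \<le> D"
    if "x \<in> strip \<eta>" "k \<le> n" for x k
  proof -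
    have k: "k \<in> {..n}" and e: "0 < fst x" using that by (auto simp: strip_fst)
    have m: "c * fst x \<le> D * fst x" if "c \<le> D" for c using that e by (intro mult_right_mono) auto
    note s = sub[OF that(1)]
    show "\<bar>W k x\<bar> \<le> D * fst x" by (rule order_trans[OF _ m[OF le(1)]]) (use D0(3)[rule_format, OF k s(2)] e in simp)
    show "\<bar>pd (1, 0, 0) (W k) x\<bar> \<le> D" using D1(3)[rule_format, OF k s(3)] le(2) e by simp
    show "\<bar>pd (0, 1, 0) (W k) x\<bar> \<le> D * fst x" by (rule order_trans[OF _ m[OF le(3)]]) (use D2(3)[rule_format, OF k s(4)] e in simp)
    show "\<bar>pd (0, 0, 1) (W k) x\<bar> \<le> D * fst x" by (rule order_trans[OF _ m[OF le(4)]]) (use D3(3)[rule_format, OF k s(5)] e in simp)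
    show "\<bar>scaled_F P l k x\<bar> \<le> D * fst x" by (rule order_trans[OF _ m[OF le(5)]]) (use D4(3)[rule_format, OF k s(6)] e in simp)
    show "\<bar>scaled_G P l k x\<bar> \<le> D" using D5(3)[rule_format, OF k s(7)] le(6) e by simp
    show "\<bar>S_co P k\<bar> \<le> D" using D6[OF that(2)] le(7) by simp
  qed
  define N where "N = real (n + 1)"
  have N: "0 < N" "real n \<le> N" by (auto simp: N_def)
  define C where "C = N * N * (3 * D * D) + N * (3 * D) + N * (N * D)"
  show ?thesis
  proof (rule that[of C \<eta>])
    show "0 < C" using N le(8) by (auto simp: C_def intro!: add_pos_pos mult_pos_pos)
    show "0 < \<eta>" using D0 D1 D2 D3 D4 D5 assms(3) by (simp add: \<eta>_def)
    fix x t e' \<theta>' s' C0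
    assume x: "x \<in> strip \<eta>" and t: "1 \<le> t" and C0: "0 \<le> C0"
      and e': "\<bar>e' - (\<Sum>p\<le>n. \<tau> t ^ p * scaled_F P l p x)\<bar> \<le> C0 * fst x * \<tau> t ^ (n + 1)"
      and \<theta>': "\<bar>\<theta>' - (\<Sum>p\<le>n. \<tau> t ^ p * scaled_G P l p x)\<bar> \<le> C0 * \<tau> t ^ (n + 1)"
      and s': "\<bar>s' - (\<Sum>p\<le>n. \<tau> t ^ p * S_co P p)\<bar> \<le> C0 * \<tau> t ^ (n + 1)"
    note \<tau> = tau_bounds[OF t] and bd = bd[OF x]
    define T where "T = \<tau> t ^ (n + 1)"
    have T: "0 < T" using \<tau> by (simp add: T_def)
    have e: "0 < fst x" using x by (simp add: strip_fst)
    have \<tau>1: "\<bar>\<tau> t ^ k\<bar> \<le> 1" for k using \<tau> by (simp add: power_le_one)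
    let ?F = "\<lambda>p. scaled_F P l p x" and ?G = "\<lambda>p. scaled_G P l p x" and ?S = "\<lambda>p. S_co P p"
    let ?e = "\<lambda>k. pd (1, 0, 0) (W k) x" and ?t = "\<lambda>k. pd (0, 1, 0) (W k) x" and ?s = "\<lambda>k. pd (0, 0, 1) (W k) x"
    define A where "A = (\<Sum>p\<le>n. \<tau> t ^ p * ?F p)"
    define B where "B = (\<Sum>p\<le>n. \<tau> t ^ p * ?G p)"
    define S where "S = (\<Sum>p\<le>n. \<tau> t ^ p * ?S p)"
    \<comment> \<open>The coefficient belonging to degree \<open>fst i\<close> of the fields and
      degree \<open>snd i\<close> of the transformation.\<close>
    define c where "c i = ?F (fst i) * ?e (snd i) + ?G (fst i) * ?t (snd i) + ?S (fst i) * ?s (snd i)" for i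
    let ?I = "{..n} \<times> {..n}"
    have main: "(\<Sum>k\<le>n. \<tau> t ^ k * (?e k * A + ?t k * B + ?s k * S)) = (\<Sum>i\<in>?I. \<tau> t ^ (fst i + snd i) * c i)"
    proof -
      have "(\<Sum>i\<in>?I. \<tau> t ^ (fst i + snd i) * c i) = (\<Sum>i\<le>n. \<Sum>k\<le>n. \<tau> t ^ (i + k) * c (i, k))"
        unfolding sum.cartesian_product by (simp add: case_prod_unfold)
      also have "\<dots> = (\<Sum>k\<le>n. \<Sum>i\<le>n. \<tau> t ^ (i + k) * c (i, k))" by (rule sum.swap)
      also have "\<dots> = (\<Sum>k\<le>n. \<tau> t ^ k * (?e k * A + ?t k * B + ?s k * S))"
        by (intro sum.cong refl)
           (simp add: A_def B_def S_def c_def sum_distrib_left sum.distrib power_add algebra_simps)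
      finally show ?thesis by simp
    qed
    \<comment> \<open>Collecting the pairs of total degree \<open>p\<close> reproduces the left-hand
      side of the \<open>p\<close>-th averaging relation.\<close>
    have diag: "(\<Sum>p\<le>n. \<tau> t ^ p * (\<Sum>i | i \<in> ?I \<and> fst i + snd i = p. c i)) = \<tau> t ^ n * Lm x"
    proof -
      have "(\<Sum>i | i \<in> ?I \<and> fst i + snd i = p. c i) = (if p = n then Lm x else 0)" if "p \<le> n" for p
      proof -
        have "(\<Sum>i | i \<in> ?I \<and> fst i + snd i = p. c i) = (\<Sum>i\<le>p. c (i, p - i))"
          by (rule sum.reindex_bij_witness[of _ "\<lambda>i. (i, p - i)" fst]) (use that in auto)
        also have "\<dots> = (if p = n then Lm x else 0)"
          using rel[OF that sub(1)[OF x]] by (simp add: c_def)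
        finally show ?thesis .
      qed
      then have "(\<Sum>p\<le>n. \<tau> t ^ p * (\<Sum>i | i \<in> ?I \<and> fst i + snd i = p. c i)) = (\<Sum>p\<le>n. \<tau> t ^ p * (if p = n then Lm x else 0))"
        by (intro sum.cong refl) simp
      also have "\<dots> = (\<Sum>p\<le>n. if p = n then \<tau> t ^ p * Lm x else 0)" by (intro sum.cong refl) simp
      finally show ?thesis by simp
    qed
    have cardI: "real (card ?I) = N * N" by (simp add: N_def card_cartesian_product algebra_simps)
    have "\<bar>(\<Sum>i\<in>?I. \<tau> t ^ (fst i + snd i) * c i) - \<tau> t ^ n * Lm x\<bar> \<le> T * (\<Sum>i\<in>?I. \<bar>c i\<bar>)"
      using truncate_power_sum[of ?I "\<tau> t" "\<lambda>i. fst i + snd i" c n] \<tau> unfolding diag T_def by simp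
    moreover have "(\<Sum>i\<in>?I. \<bar>c i\<bar>) \<le> real (card ?I) * (3 * D * D * fst x)"
    proof (rule sum_bounded_above)
      fix i assume "i \<in> ?I"
      then have i: "fst i \<le> n" "snd i \<le> n" by auto
      have "\<bar>c i\<bar> \<le> (D * fst x) * D + D * (D * fst x) + D * (D * fst x)"
        unfolding c_def by (intro abs_sum3_le abs_mult_le bd i)
      then show "\<bar>c i\<bar> \<le> 3 * D * D * fst x" by (simp add: algebra_simps)
    qed
    then have "T * (\<Sum>i\<in>?I. \<bar>c i\<bar>) \<le> T * (N * N * (3 * D * D * fst x))"
      using T unfolding cardI by (intro mult_left_mono) simp_all
    ultimately have 1: "\<bar>(\<Sum>k\<le>n. \<tau> t ^ k * (?e k * A + ?t k * B + ?s k * S)) - \<tau> t ^ n * Lm x\<bar>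
        \<le> N * N * (3 * D * D) * (fst x * T)" unfolding main by (simp add: mult_ac)
    \<comment> \<open>Effect of replacing the true rates by their truncated series; this is the only
      contribution involving \<open>C0\<close>.\<close>
    have "\<bar>\<Sum>k\<le>n. \<tau> t ^ k * (?e k * (e' - A) + ?t k * (\<theta>' - B) + ?s k * (s' - S))\<bar> \<le> real (card {..n}) * (3 * D * C0 * (fst x * T))"
    proof (rule order_trans[OF sum_abs sum_bounded_above])
      fix k assume k: "k \<in> {..n}"
      have "\<bar>\<tau> t ^ k * (?e k * (e' - A) + ?t k * (\<theta>' - B) + ?s k * (s' - S))\<bar>
          \<le> 1 * (D * (C0 * fst x * T) + D * fst x * (C0 * T) + D * fst x * (C0 * T))"
        by (intro abs_mult_le[OF \<tau>1] abs_sum3_le abs_mult_le bd e'[folded A_def T_def] \<theta>'[folded B_def T_def] s'[folded S_def T_def])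
           (use k in auto)
      then show "\<bar>\<tau> t ^ k * (?e k * (e' - A) + ?t k * (\<theta>' - B) + ?s k * (s' - S))\<bar> \<le> 3 * D * C0 * (fst x * T)"
        by (simp add: algebra_simps)
    qed
    then have 2: "\<bar>\<Sum>k\<le>n. \<tau> t ^ k * (?e k * (e' - A) + ?t k * (\<theta>' - B) + ?s k * (s' - S))\<bar> \<le> N * (3 * D) * C0 * (fst x * T)"
      by (simp add: N_def mult_ac)
    \<comment> \<open>The explicit time derivative of the powers of \<open>\<tau>\<close> brings a
      factor \<open>1 / t = \<tau>^(2q)\<close>, absorbed in the error because
      \<open>n + 1 \<le> 2q\<close>.\<close>
    have tinv: "1 / t = \<tau> t ^ (2 * qpar P)"
      using tau_power[of t "2 * qpar P"] t standing_basic(5) by (simp add: powr_minus_divide)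
    have tT: "\<bar>1 / t\<bar> \<le> T" unfolding tinv T_def using tau_pow_le[OF t, of "n + 1" "2 * qpar P"] n \<tau> by simp
    have "\<bar>\<Sum>k\<le>n. real k / real (2 * qpar P) * \<tau> t ^ k / t * W k x\<bar> \<le> real (card {..n}) * (N * D * (fst x * T))"
    proof (rule order_trans[OF sum_abs sum_bounded_above])
      fix k assume k: "k \<in> {..n}"
      have q: "\<bar>real k / real (2 * qpar P)\<bar> \<le> N"
      proof -
        have "real k / real (2 * qpar P) \<le> real k / 1" using standing_basic(5) by (intro divide_left_mono) auto
        then show ?thesis using k by (simp add: N_def)
      qed
      have "\<bar>real k / real (2 * qpar P) * \<tau> t ^ k * (1 / t) * W k x\<bar> \<le> N * 1 * T * (D * fst x)"
        by (intro abs_mult_le q \<tau>1 tT bd) (use k in auto)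
      then show "\<bar>real k / real (2 * qpar P) * \<tau> t ^ k / t * W k x\<bar> \<le> N * D * (fst x * T)"
        by (simp add: mult_ac)
    qed
    then have 3: "\<bar>\<Sum>k\<le>n. real k / real (2 * qpar P) * \<tau> t ^ k / t * W k x\<bar> \<le> N * (N * D) * (fst x * T)"
      by (simp add: N_def mult_ac)
    have split: "(\<Sum>k\<le>n. \<tau> t ^ k * (?e k * e' + ?t k * \<theta>' + ?s k * s') - real k / real (2 * qpar P) * \<tau> t ^ k / t * W k x) - \<tau> t ^ n * Lm x
      = ((\<Sum>k\<le>n. \<tau> t ^ k * (?e k * A + ?t k * B + ?s k * S)) - \<tau> t ^ n * Lm x)
        + (\<Sum>k\<le>n. \<tau> t ^ k * (?e k * (e' - A) + ?t k * (\<theta>' - B) + ?s k * (s' - S)))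
        + - (\<Sum>k\<le>n. real k / real (2 * qpar P) * \<tau> t ^ k / t * W k x)"
    proof -
      have "(\<Sum>k\<le>n. \<tau> t ^ k * (?e k * e' + ?t k * \<theta>' + ?s k * s')) =
        (\<Sum>k\<le>n. \<tau> t ^ k * (?e k * A + ?t k * B + ?s k * S)) + (\<Sum>k\<le>n. \<tau> t ^ k * (?e k * (e' - A) + ?t k * (\<theta>' - B) + ?s k * (s' - S)))"
        unfolding sum.distrib[symmetric] by (intro sum.cong refl) (simp add: algebra_simps)
      then show ?thesis by (simp add: sum_subtractf)
    qed
    have "\<bar>(\<Sum>k\<le>n. \<tau> t ^ k * (?e k * e' + ?t k * \<theta>' + ?s k * s') - real k / real (2 * qpar P) * \<tau> t ^ k / t * W k x) - \<tau> t ^ n * Lm x\<bar>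
      \<le> N * N * (3 * D * D) * (fst x * T) + N * (3 * D) * C0 * (fst x * T) + N * (N * D) * (fst x * T)"
      unfolding split by (rule abs_sum3_le[OF 1 2]) (use 3 in simp)
    also have "\<dots> = (N * N * (3 * D * D) + N * (3 * D) * C0 + N * (N * D)) * (fst x * T)" by (simp add: algebra_simps)
    also have "\<dots> \<le> (C * (1 + C0)) * (fst x * T)"
    proof (rule mult_right_mono)
      have "0 \<le> N * N * (3 * D * D)" "0 \<le> N * (3 * D)" "0 \<le> N * (N * D)" using N le(8) by auto
      then have "0 \<le> N * N * (3 * D * D) * C0" "0 \<le> N * (N * D) * C0" "0 \<le> N * (3 * D)" using C0 by auto
      then show "N * N * (3 * D * D) + N * (3 * D) * C0 + N * (N * D) \<le> C * (1 + C0)"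
        by (simp add: C_def algebra_simps)
    qed (use e T in auto)
    finally show "\<bar>(\<Sum>k\<le>n. \<tau> t ^ k * (?e k * e' + ?t k * \<theta>' + ?s k * s') - real k / real (2 * qpar P) * \<tau> t ^ k / t * W k x) - \<tau> t ^ n * Lm x\<bar>
        \<le> C * (1 + C0) * fst x * \<tau> t ^ (n + 1)" by (simp add: T_def mult_ac)
  qed
qed

end

section \<open>The averaged energy along solutions\<close>

lemma close_to_half:
  fixes a b :: real
  assumes "\<bar>a - b\<bar> \<le> b / 2"
  shows "\<bar>a\<bar> \<le> 2 * b" "b \<le> 2 * a"
proof -
  have "a - b \<le> b / 2" "- (a - b) \<le> b / 2" using assms by (simp_all only: abs_le_iff)
  then show "\<bar>a\<bar> \<le> 2 * b" "b \<le> 2 * a" by (simp_all add: abs_le_iff)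
qed

text \<open>Together with \<open>right_open\<close>, the continuity half of the continuation
  arguments: strict inequalities pass weakly to the limit from the left and persist near a
  point.\<close>

lemma left_closure:
  fixes h :: "real \<Rightarrow> real"
  assumes "continuous (at t within I) h" "T < t" "{T..<t} \<subseteq> I" "\<And>s. T \<le> s \<Longrightarrow> s < t \<Longrightarrow> h s < 0"
  shows "h t \<le> 0"
proof (rule tendsto_upperbound)
  show "(h \<longlongrightarrow> h t) (at t within {T..<t})"
    using tendsto_within_subset[OF _ assms(3)] assms(1) by (auto simp: continuous_within)
  show "\<forall>\<^sub>F s in at t within {T..<t}. h s \<le> 0"
    using assms(4) by (auto simp: eventually_at intro!: exI[of _ 1] less_imp_le)
  show "at t within {T..<t} \<noteq> bot"
    using assms(2) by (simp add: trivial_limit_within islimpt_Ico)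
qed

lemma right_open:
  fixes h :: "real \<Rightarrow> real"
  assumes "continuous (at t within I) h" "h t < 0"
  shows "\<exists>d>0. \<forall>s\<in>I. \<bar>s - t\<bar> < d \<longrightarrow> h s < 0"
proof -
  obtain d where d: "d > 0" "\<And>s. s \<in> I \<Longrightarrow> dist s t < d \<Longrightarrow> dist (h s) (h t) < - h t"
    using assms unfolding continuous_within_eps_delta by (metis neg_0_less_iff_less)
  have "h s < 0" if "s \<in> I" "\<bar>s - t\<bar> < d" for s
    using d(2)[OF that(1)] that(2) by (simp add: dist_real_def abs_less_iff)
  then show ?thesis using d(1) by blast
qed

section \<open>Energy and angle along solutions\<close>

context osc begin

text \<open>The angle is arbitrary at the origin, which \<open>averaged_energy\<close> treats separately.\<close>

definition angle_of :: "real \<times> real \<Rightarrow> real" where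
  "angle_of z = (SOME \<phi>. z = (X (\<phi>, Ham0 P z), Y (\<phi>, Ham0 P z)))"

definition escaled :: "nat \<Rightarrow> real \<Rightarrow> real \<times> real \<Rightarrow> real" where
  "escaled l t z = t powr (real l / real (qpar P)) * Ham0 P z"

definition scaled_coords :: "nat \<Rightarrow> real \<Rightarrow> real \<times> real \<Rightarrow> real \<times> real \<times> real" where
  "scaled_coords l t z = (escaled l t z, angle_of z - \<kappa>i * phase P t, phase P t)"

definition averaged_energy :: "nat \<Rightarrow> nat \<Rightarrow> (nat \<Rightarrow> real \<times> real \<times> real \<Rightarrow> real) \<Rightarrow> real \<Rightarrow> real \<times> real \<Rightarrow> real" where
  "averaged_energy l n W t z = (if z = 0 then 0 else \<Sum>k\<le>n. \<tau> t ^ k * W k (scaled_coords l t z))"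

text \<open>The energy differs from \<open>r^2 / 2\<close> by at most \<open>c r^3\<close>, which is
  below \<open>r^2 / 4\<close> for small \<open>r\<close>.\<close>

lemma energy_bounds:
  obtains r0 where "0 < r0" "r0 \<le> rmax P"
    "\<And>z. z \<noteq> 0 \<Longrightarrow> norm z < r0 \<Longrightarrow> (norm z)\<^sup>2 / 4 \<le> Ham0 P z \<and> Ham0 P z \<le> (norm z)\<^sup>2 \<and> 0 < Ham0 P z \<and> Ham0 P z < Emax P"
proof -
  have "(\<lambda>z. Ham0 P z - (norm z)\<^sup>2 / 2) \<in> O[at 0](\<lambda>z. norm z ^ 3)"
    using standing unfolding standing_assumptions_def center_def by blast
  then obtain c where "c > 0" "\<forall>\<^sub>F z in at 0. norm (Ham0 P z - (norm z)\<^sup>2 / 2) \<le> c * norm (norm z ^ 3)"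
    by (rule landau_o.bigE)
  then obtain d where d: "d > 0" "\<And>z. z \<noteq> 0 \<Longrightarrow> norm z < d \<Longrightarrow> \<bar>Ham0 P z - (norm z)\<^sup>2 / 2\<bar> \<le> c * norm z ^ 3"
    unfolding eventually_at by (auto simp: dist_norm)
  \<comment> \<open>\<open>1 / (4 c)\<close> makes the cubic error at most \<open>r^2 / 4\<close>;
    \<open>sqrt (Emax P) / 2\<close> keeps \<open>r^2\<close>, and so the energy, below
    \<open>Emax P\<close>.\<close>
  define r0 where "r0 = min (min d (rmax P)) (min (1 / (4 * c)) (sqrt (Emax P) / 2))"
  show ?thesis
  proof (rule that[of r0])
    show "0 < r0" "r0 \<le> rmax P" using d(1) standing_basic(1,2) \<open>c > 0\<close> by (auto simp: r0_def)
    fix z :: "real \<times> real" assume z: "z \<noteq> 0" "norm z < r0"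
    then have z': "0 < norm z" "norm z < d" "norm z < 1 / (4 * c)" "norm z < sqrt (Emax P) / 2" by (auto simp: r0_def)
    have "c * norm z \<le> 1 / 4" using z'(3) \<open>c > 0\<close> by (simp add: field_simps)
    then have "(c * norm z) * (norm z)\<^sup>2 \<le> 1 / 4 * (norm z)\<^sup>2" by (intro mult_right_mono) auto
    then have "\<bar>Ham0 P z - (norm z)\<^sup>2 / 2\<bar> \<le> (norm z)\<^sup>2 / 4"
      using d(2)[OF z(1) z'(2)] by (simp add: power3_eq_cube power2_eq_square mult_ac)
    then have 1: "(norm z)\<^sup>2 / 4 \<le> Ham0 P z" "Ham0 P z \<le> (norm z)\<^sup>2"
      using zero_le_power2[of "norm z"] by linarith+
    have "(norm z)\<^sup>2 < (sqrt (Emax P))\<^sup>2"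
    proof (rule power_strict_mono)
      have "0 < sqrt (Emax P)" using standing_basic(1) by simp
      then show "norm z < sqrt (Emax P)" using z'(4) by linarith
    qed auto
    then have "(norm z)\<^sup>2 < Emax P" using standing_basic(1) by simp
    moreover have "0 < (norm z)\<^sup>2" using z' by simp
    ultimately show "(norm z)\<^sup>2 / 4 \<le> Ham0 P z \<and> Ham0 P z \<le> (norm z)\<^sup>2 \<and> 0 < Ham0 P z \<and> Ham0 P z < Emax P"
      using 1 by (intro conjI) linarith+
  qed
qed

lemma angle_of:
  assumes "0 < Ham0 P z" "Ham0 P z < Emax P" "norm z \<le> rmax P"
  shows "z = (X (angle_of z, Ham0 P z), Y (angle_of z, Ham0 P z))"
proof -
  have "\<exists>\<phi>. z = (X (\<phi>, Ham0 P z), Y (\<phi>, Ham0 P z))"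
    using XY_surj[of "Ham0 P z" z] assms by auto
  then show ?thesis unfolding angle_of_def by (rule someI_ex)
qed

text \<open>Any two angles of a point differ by a multiple of \<open>2 pi\<close>, and the
  \<open>W k\<close> are \<open>2 pi\<close>-periodic; so the arbitrary choice in
  \<open>angle_of\<close> may be replaced by any other angle.\<close>

lemma averaged_energy_eq:
  assumes "z \<noteq> 0" "0 < E" "E < Emax P" "z = (X (\<phi>, E), Y (\<phi>, E))"
    and per: "\<And>k e \<theta> s. k \<le> n \<Longrightarrow> 0 < e \<Longrightarrow> e < R \<Longrightarrow> W k (e, \<theta> + 2 * pi, s) = W k (e, \<theta>, s)"
    and "0 < t" "t powr (real l / real (qpar P)) * E < R"
  shows "averaged_energy l n W t z = (\<Sum>k\<le>n. \<tau> t ^ k * W k (t powr (real l / real (qpar P)) * E, \<phi> - \<kappa>i * phase P t, phase P t))"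
proof -
  have H: "Ham0 P z = E" "norm z \<le> rmax P" using XY_level[of E \<phi>] assms(2-4) by auto
  then have "(X (angle_of z, E), Y (angle_of z, E)) = (X (\<phi>, E), Y (\<phi>, E))" using angle_of[of z] assms(2-4) by simp
  then obtain j :: int where j: "angle_of z = \<phi> + of_int j * (2 * pi)"
    using XY_inj[of E \<phi> "angle_of z"] assms(2,3) by auto
  let ?e = "t powr (real l / real (qpar P)) * E"
  have "W k (?e, angle_of z - \<kappa>i * phase P t, phase P t) = W k (?e, \<phi> - \<kappa>i * phase P t, phase P t)" if "k \<le> n" for k
    using periodic_int[of "\<lambda>\<theta>. W k (?e, \<theta>, phase P t)" "2 * pi" "\<phi> - \<kappa>i * phase P t" j] per[OF that] assms(2,6,7)
    by (simp add: j add_diff_eq algebra_simps)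
  then show ?thesis using assms(1) by (simp add: averaged_energy_def scaled_coords_def escaled_def H)
qed

text \<open>\<open>angle_of\<close> jumps along a solution and cannot be differentiated. Near the
  given time the energy and angle are taken from a local inverse of the action-angle map, and by
  periodicity the resulting sum is the averaged energy there.\<close>

lemma V_derivative:
  assumes sol: "(z has_vector_derivative vec_field P t (z t)) (at t within I)" and t: "t \<in> I" "I \<subseteq> {0<..}"
    and z: "z t \<noteq> 0" "0 < Ham0 P (z t)" "Ham0 P (z t) < Emax P" "norm (z t) \<le> rmax P"
    and e: "escaled l t (z t) < R"
    and W: "\<And>k. k \<le> n \<Longrightarrow> smooth_fun_on (strip R) (W k)"
    and per: "\<And>k e \<theta> s. k \<le> n \<Longrightarrow> 0 < e \<Longrightarrow> e < R \<Longrightarrow> W k (e, \<theta> + 2 * pi, s) = W k (e, \<theta>, s)"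
  defines "x \<equiv> scaled_coords l t (z t)" and "E \<equiv> Ham0 P (z t)"
  defines "e' \<equiv> t powr (real l / real (qpar P)) * act_rate P (Ham P) (Dis P) (E, angle_of (z t), t) + real l / real (qpar P) * fst x / t"
    and "\<theta>' \<equiv> ang_rate P (Ham P) (Dis P) (E, angle_of (z t), t) - \<kappa>i * deriv (phase P) t"
    and "s' \<equiv> deriv (phase P) t"
  shows "((\<lambda>u. averaged_energy l n W u (z u)) has_real_derivative
      (\<Sum>k\<le>n. \<tau> t ^ k * (pd (1, 0, 0) (W k) x * e' + pd (0, 1, 0) (W k) x * \<theta>' + pd (0, 0, 1) (W k) x * s')
          - real k / real (2 * qpar P) * \<tau> t ^ k / t * W k x)) (at t within I)"
proof -
  have t0: "0 < t" using t by auto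
  let ?q = "real (qpar P)"
  define \<phi>0 where "\<phi>0 = angle_of (z t)"
  have zt: "z t = (X (\<phi>0, E), Y (\<phi>0, E))" using angle_of[OF z(2-4)] unfolding E_def \<phi>0_def .
  have E: "0 < E" "E < Emax P" using z by (auto simp: E_def)
  obtain g T where g: "open T" "(X (\<phi>0, E), Y (\<phi>0, E)) \<in> T" "g (X (\<phi>0, E), Y (\<phi>0, E)) = (\<phi>0, E)"
    "\<And>z. z \<in> T \<Longrightarrow> g z \<in> dom2 \<and> (X (g z), Y (g z)) = z"
    "(g has_derivative (\<lambda>(a, b). (freq P E * (pd (0, 1) Y (\<phi>0, E) * a - pd (0, 1) X (\<phi>0, E) * b),
        freq P E * (- pd (1, 0) Y (\<phi>0, E) * a + pd (1, 0) X (\<phi>0, E) * b)))) (at (X (\<phi>0, E), Y (\<phi>0, E)))"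
    by (rule action_angle_inverse[OF E, of \<phi>0]) blast
  \<comment> \<open>A differentiable angle and energy along the solution, equal to the chosen ones
    at time \<open>t\<close>.\<close>
  define \<phi>u where "\<phi>u u = fst (g (z u))" for u
  define Eu where "Eu u = snd (g (z u))" for u
  have at_t: "\<phi>u t = \<phi>0" "Eu t = E" using g(3) by (simp_all add: \<phi>u_def Eu_def zt[symmetric])
  have Hd: "Ham P differentiable (at (X (\<phi>0, E), Y (\<phi>0, E), t))" by (rule Ham_diff[OF t0])
  have vf: "vec_field P t (z t) = (pd (0, 1, 0) (Ham P) (X (\<phi>0, E), Y (\<phi>0, E), t),
      - pd (1, 0, 0) (Ham P) (X (\<phi>0, E), Y (\<phi>0, E), t) + Dis P (X (\<phi>0, E), Y (\<phi>0, E), t))"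
    unfolding zt[symmetric] vec_field_def case_prod_unfold by (simp add: zt)
  \<comment> \<open>The inverse Jacobian matrix applied to the perturbed field gives precisely the
    angle and action rates.\<close>
  have gz: "((g \<circ> z) has_vector_derivative
      (ang_rate P (Ham P) (Dis P) (E, \<phi>0, t), act_rate P (Ham P) (Dis P) (E, \<phi>0, t))) (at t within I)"
    using vector_derivative_diff_chain_within[OF sol has_derivative_at_withinI[OF g(5)[folded zt]]]
    unfolding vf act_rate_eq[OF E Hd] ang_rate_eq[OF E Hd] by (simp add: algebra_simps)
  have d\<phi>: "(\<phi>u has_real_derivative ang_rate P (Ham P) (Dis P) (E, \<phi>0, t)) (at t within I)"
    using bounded_linear.has_vector_derivative[OF bounded_linear_fst gz]
    by (simp add: \<phi>u_def[abs_def] o_def has_real_derivative_iff_has_vector_derivative)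
  have dE: "(Eu has_real_derivative act_rate P (Ham P) (Dis P) (E, \<phi>0, t)) (at t within I)"
    using bounded_linear.has_vector_derivative[OF bounded_linear_snd gz]
    by (simp add: Eu_def[abs_def] o_def has_real_derivative_iff_has_vector_derivative)
  have dpow: "((\<lambda>u. u powr a) has_real_derivative a * t powr (a - 1)) (at t within I)" for a
    by (rule has_field_derivative_at_within[OF has_real_derivative_powr[OF t0]])
  define eu where "eu u = u powr (real l / ?q) * Eu u" for u
  have ds: "(phase P has_real_derivative s') (at t within I)"
  proof -
    have "smooth_fun_on {0<..} (phase P)"
      using standing unfolding standing_assumptions_def expansions_at_infinity_def by blast
    then have *: "(phase P has_real_derivative pd 1 (phase P) t) (at t)"
      using pd_along[of "phase P" 0 t 1] smooth_differentiable[of "{0<..}" "phase P" t] t0 by simp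
    show ?thesis using DERIV_imp_deriv[OF *] has_field_derivative_at_within[OF *] by (simp add: s'_def)
  qed
  have xt: "fst x = t powr (real l / ?q) * E" by (simp add: x_def scaled_coords_def escaled_def E_def)
  have de: "(eu has_real_derivative e') (at t within I)"
  proof -
    have "(eu has_real_derivative real l / ?q * t powr (real l / ?q - 1) * Eu t + act_rate P (Ham P) (Dis P) (E, \<phi>0, t) * t powr (real l / ?q)) (at t within I)"
      unfolding eu_def by (rule DERIV_mult[OF dpow dE])
    moreover have "t powr (real l / ?q - 1) = t powr (real l / ?q) / t" using t0 by (simp add: powr_diff)
    ultimately show ?thesis by (simp add: e'_def at_t xt \<phi>0_def algebra_simps)
  qed
  have d\<theta>: "((\<lambda>u. \<phi>u u - \<kappa>i * phase P u) has_real_derivative \<theta>') (at t within I)"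
    unfolding \<theta>'_def \<phi>0_def[symmetric] by (intro DERIV_diff d\<phi> DERIV_cmult ds[unfolded s'_def])
  have x: "x = (eu t, \<phi>u t - \<kappa>i * phase P t, phase P t)"
    by (simp add: x_def scaled_coords_def eu_def at_t escaled_def \<phi>0_def) (simp add: E_def)
  have xs: "x \<in> strip R" using e E t0 by (simp add: x_def scaled_coords_def escaled_def E_def)
  have dW: "((\<lambda>u. u powr (- real k / real (2 * qpar P)) * W k (eu u, \<phi>u u - \<kappa>i * phase P u, phase P u)) has_real_derivative
      \<tau> t ^ k * (pd (1, 0, 0) (W k) x * e' + pd (0, 1, 0) (W k) x * \<theta>' + pd (0, 0, 1) (W k) x * s')
          - real k / real (2 * qpar P) * \<tau> t ^ k / t * W k x) (at t within I)" if k: "k \<le> n" for k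
  proof -
    have "W k differentiable (at (eu t, \<phi>u t - \<kappa>i * phase P t, phase P t))"
      using smooth_differentiable[OF W[OF k] xs] by (simp add: x)
    note c = chain3[where h = "W k" and x = eu and y = "\<lambda>u. \<phi>u u - \<kappa>i * phase P u" and s = "phase P", OF this de d\<theta> ds]
    have p: "t powr (- real k / real (2 * qpar P) - 1) = \<tau> t ^ k / t" "t powr (- real k / real (2 * qpar P)) = \<tau> t ^ k"
      using t0 by (simp_all add: tau_power powr_diff)
    show ?thesis
      using DERIV_mult[OF dpow[of "- real k / real (2 * qpar P)"] c] unfolding p x[symmetric]
      by (simp add: algebra_simps)
  qed
  have dsum: "((\<lambda>u. \<Sum>k\<le>n. u powr (- real k / real (2 * qpar P)) * W k (eu u, \<phi>u u - \<kappa>i * phase P u, phase P u)) has_real_derivative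
      (\<Sum>k\<le>n. \<tau> t ^ k * (pd (1, 0, 0) (W k) x * e' + pd (0, 1, 0) (W k) x * \<theta>' + pd (0, 0, 1) (W k) x * s')
          - real k / real (2 * qpar P) * \<tau> t ^ k / t * W k x)) (at t within I)"
    by (intro DERIV_sum dW) auto
  have contz: "(z \<longlongrightarrow> z t) (at t within I)"
    using has_vector_derivative_continuous[OF sol] by (simp add: continuous_within)
  have conte: "(eu \<longlongrightarrow> eu t) (at t within I)"
    using DERIV_continuous[OF de] by (simp add: continuous_within)
  have zT: "z t \<in> T" by (subst zt) (rule g(2))
  have eR: "eu t < R" using e by (simp add: eu_def at_t escaled_def E_def)
  have ev: "\<forall>\<^sub>F u in at t within I. z u \<in> T" "\<forall>\<^sub>F u in at t within I. z u \<noteq> 0" "\<forall>\<^sub>F u in at t within I. eu u < R"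
    by (rule topological_tendstoD[OF contz g(1) zT], rule tendsto_imp_eventually_ne[OF contz z(1)],
        rule order_tendstoD(2)[OF conte eR])
  have "\<forall>\<^sub>F u in at t within I. z u \<in> T \<and> z u \<noteq> 0 \<and> eu u < R"
    by (intro eventually_conj ev)
  then obtain d where d: "d > 0" "\<And>u. u \<in> I \<Longrightarrow> u \<noteq> t \<Longrightarrow> dist u t < d \<Longrightarrow> z u \<in> T \<and> z u \<noteq> 0 \<and> eu u < R"
    unfolding eventually_at by blast
  \<comment> \<open>Only a neighbourhood of \<open>t\<close> relative to \<open>I\<close> matters,
    where the solution lies in the domain of the local inverse, off the origin, and in the energy
    range of periodicity.\<close>
  have eqV: "(\<Sum>k\<le>n. u powr (- real k / real (2 * qpar P)) * W k (eu u, \<phi>u u - \<kappa>i * phase P u, phase P u)) = averaged_energy l n W u (z u)"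
    if "u \<in> I" "dist u t < d" for u
  proof -
    have u: "z u \<in> T" "z u \<noteq> 0" "eu u < R"
      using d(2)[OF that(1) _ that(2)] zT z(1) eR by (cases "u = t"; blast)+
    have u0: "0 < u" using that t by auto
    have gu: "(\<phi>u u, Eu u) \<in> dom2" "(X (\<phi>u u, Eu u), Y (\<phi>u u, Eu u)) = z u"
      using g(4)[OF u(1)] by (simp_all add: \<phi>u_def Eu_def)
    have "averaged_energy l n W u (z u) = (\<Sum>k\<le>n. \<tau> u ^ k * W k (u powr (real l / ?q) * Eu u, \<phi>u u - \<kappa>i * phase P u, phase P u))"
      by (rule averaged_energy_eq[OF u(2) _ _ gu(2)[symmetric] per u0]) (use gu(1) u(3) in \<open>auto simp: eu_def\<close>)
    then show ?thesis using u0 by (simp add: eu_def tau_power)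
  qed
  show ?thesis
    by (rule has_field_derivative_transform_within[OF dsum d(1) t(1) eqV])
qed

lemma tau_tendsto: "(\<tau> \<longlongrightarrow> 0) at_top"
  unfolding \<tau>_def using standing_basic(5) by (intro tendsto_neg_powr filterlim_ident) auto

text \<open>Assembles the expansions. The two conclusions used later are the comparison of the
  averaged with the scaled energy within a factor 2, and a differential inequality in which the
  error carries one more power of \<open>\<tau>\<close> than the damping.\<close>

lemma averaged_dynamics:
  assumes sc: "scaling_exponent P l" and n: "n < 2 * qpar P" and R: "0 < R"
    and W: "\<And>k. k \<le> n \<Longrightarrow> symbol 1 (W k)" "W 0 = fst"
      "\<And>k. k \<le> n \<Longrightarrow> smooth_fun_on (strip R) (W k)"
      "\<And>k e \<theta> s. k \<le> n \<Longrightarrow> 0 < e \<Longrightarrow> e < R \<Longrightarrow> W k (e, \<theta> + 2 * pi, s) = W k (e, \<theta>, s)"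
    and rel: "\<And>k x. k \<le> n \<Longrightarrow> x \<in> strip R \<Longrightarrow>
      (\<Sum>i\<le>k. scaled_F P l i x * pd (1, 0, 0) (W (k - i)) x + scaled_G P l i x * pd (0, 1, 0) (W (k - i)) x
        + S_co P i * pd (0, 0, 1) (W (k - i)) x) = (if k = n then Lm x else 0)"
    and Lm: "0 < c" "0 < \<eta>L" "\<And>x. x \<in> strip \<eta>L \<Longrightarrow> Lm x \<le> - c * fst x powr \<beta>"
  obtains C \<eta> T r where "0 < C" "0 < \<eta>" "1 \<le> T" "0 < r" "r \<le> rmax P"
    "\<And>z. norm z < r \<Longrightarrow> z \<noteq> 0 \<Longrightarrow> (norm z)\<^sup>2 / 4 \<le> Ham0 P z \<and> Ham0 P z \<le> (norm z)\<^sup>2 \<and> 0 < Ham0 P z"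
    "\<And>t z. T \<le> t \<Longrightarrow> z \<noteq> 0 \<Longrightarrow> norm z < r \<Longrightarrow> escaled l t z < \<eta> \<Longrightarrow> \<bar>averaged_energy l n W t z - escaled l t z\<bar> \<le> escaled l t z / 2"
    "\<And>t z I. T \<le> t \<Longrightarrow> t \<in> I \<Longrightarrow> I \<subseteq> {0<..} \<Longrightarrow> (z has_vector_derivative vec_field P t (z t)) (at t within I) \<Longrightarrow>
      z t \<noteq> 0 \<Longrightarrow> norm (z t) < r \<Longrightarrow> escaled l t (z t) < \<eta> \<Longrightarrow>
      \<exists>D. ((\<lambda>u. averaged_energy l n W u (z u)) has_real_derivative D) (at t within I) \<and>
        D \<le> - c * \<tau> t ^ n * escaled l t (z t) powr \<beta> + C * escaled l t (z t) * \<tau> t ^ (n + 1)"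
proof -
  obtain r0 where r0: "0 < r0" "r0 \<le> rmax P"
    "\<And>z. z \<noteq> 0 \<Longrightarrow> norm z < r0 \<Longrightarrow> (norm z)\<^sup>2 / 4 \<le> Ham0 P z \<and> Ham0 P z \<le> (norm z)\<^sup>2 \<and> 0 < Ham0 P z \<and> Ham0 P z < Emax P"
    by (rule energy_bounds) (rule that)
  obtain C1 \<eta>1 T1 where 1: "0 < C1" "0 < \<eta>1" "\<eta>1 \<le> Emax P" "1 \<le> T1"
    "\<And>E \<phi> t. 0 < E \<Longrightarrow> E < \<eta>1 \<Longrightarrow> T1 \<le> t \<Longrightarrow>
      \<bar>act_rate P (Ham P) (Dis P) (E, \<phi>, t)
        - (\<Sum>k=1..n div 2. t powr (- real k / real (qpar P)) * f_co P k (E, \<phi>, phase P t))\<bar>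
      \<le> C1 * E * t powr (- real (n div 2 + 1) / real (qpar P))"
    "\<And>E \<phi> t. 0 < E \<Longrightarrow> E < \<eta>1 \<Longrightarrow> T1 \<le> t \<Longrightarrow>
      \<bar>ang_rate P (Ham P) (Dis P) (E, \<phi>, t) - freq P E
        - (\<Sum>k=1..n div 2. t powr (- real k / real (qpar P)) * g_co P k (E, \<phi>, phase P t))\<bar>
      \<le> C1 * t powr (- real (n div 2 + 1) / real (qpar P))"
    by (rule rate_expansions[where K = "n div 2"]) (rule that)
  obtain C2 \<eta>2 where 2: "0 < C2" "0 < \<eta>2" "\<forall>e \<theta> s t. 0 < e \<longrightarrow> e < \<eta>2 \<longrightarrow> 1 \<le> t \<longrightarrow>
    \<bar>t powr (real l / real (qpar P)) * (\<Sum>k=1..n div 2. \<tau> t ^ (2 * k) * f_co P k (shear \<kappa>i (unscale l t e, \<theta>, s)))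
      - (\<Sum>p\<le>n. \<tau> t ^ p * scaled_F P l p (e, \<theta>, s))\<bar> \<le> C2 * e * \<tau> t ^ (n + 1)"
    using F_expansion[of l n] by (elim exE conjE)
  obtain C3 \<eta>3 where 3: "0 < C3" "0 < \<eta>3" "\<forall>e \<theta> s t. 0 < e \<longrightarrow> e < \<eta>3 \<longrightarrow> 1 \<le> t \<longrightarrow>
    \<bar>(freq P (unscale l t e) + (\<Sum>k=1..n div 2. \<tau> t ^ (2 * k) * g_co P k (shear \<kappa>i (unscale l t e, \<theta>, s))))
      - (\<Sum>p\<le>n. \<tau> t ^ p * (scaled_G P l p (e, \<theta>, s) + S_co P p * \<kappa>i))\<bar> \<le> C3 * \<tau> t ^ (n + 1)"
    using G_expansion[OF sc, of n] by (elim exE conjE)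
  obtain C4 T4 where 4: "0 < C4" "1 \<le> T4" "\<And>t. T4 \<le> t \<Longrightarrow> \<bar>deriv (phase P) t - (\<Sum>p\<le>n. \<tau> t ^ p * S_co P p)\<bar> \<le> C4 * \<tau> t ^ (n + 1)"
    by (rule phase_expansion[OF n]) (rule that)
  obtain C5 \<eta>5 where 5: "0 < C5" "0 < \<eta>5" "\<And>x t e' \<theta>' s' C0. x \<in> strip \<eta>5 \<Longrightarrow> 1 \<le> t \<Longrightarrow> 0 \<le> C0 \<Longrightarrow>
      \<bar>e' - (\<Sum>p\<le>n. \<tau> t ^ p * scaled_F P l p x)\<bar> \<le> C0 * fst x * \<tau> t ^ (n + 1) \<Longrightarrow>
      \<bar>\<theta>' - (\<Sum>p\<le>n. \<tau> t ^ p * scaled_G P l p x)\<bar> \<le> C0 * \<tau> t ^ (n + 1) \<Longrightarrow>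
      \<bar>s' - (\<Sum>p\<le>n. \<tau> t ^ p * S_co P p)\<bar> \<le> C0 * \<tau> t ^ (n + 1) \<Longrightarrow>
      \<bar>(\<Sum>k\<le>n. \<tau> t ^ k * (pd (1, 0, 0) (W k) x * e' + pd (0, 1, 0) (W k) x * \<theta>' + pd (0, 0, 1) (W k) x * s')
          - real k / real (2 * qpar P) * \<tau> t ^ k / t * W k x) - \<tau> t ^ n * Lm x\<bar>
        \<le> C5 * (1 + C0) * fst x * \<tau> t ^ (n + 1)"
    by (rule V_estimate[OF sc n R W(1) rel]) (assumption+, rule that)
  obtain C6 \<eta>6 where 6: "0 < C6" "0 < \<eta>6" "\<forall>k\<in>{1..n}. \<forall>x\<in>strip \<eta>6. \<bar>W k x\<bar> \<le> C6 * fst x powr 1"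
  proof -
    have "\<exists>C \<eta>. 0 < C \<and> 0 < \<eta> \<and> (\<forall>k\<in>{1..n}. \<forall>x\<in>strip \<eta>. \<bar>W k x\<bar> \<le> C * fst x powr 1)"
      by (rule finite_common_bound) (use W(1) in simp_all)
    then show thesis using that by (elim exE conjE)
  qed
  \<comment> \<open>The corrections of positive index sum to at most
    \<open>(n + 1) C6 \<tau> e\<close>; this threshold for \<open>\<tau>\<close> makes them at most
    \<open>e / 2\<close>.\<close>
  have "0 < 1 / (2 * (real n + 1) * C6)" using 6(1) by simp
  then have "\<forall>\<^sub>F t in at_top. \<tau> t < 1 / (2 * (real n + 1) * C6)"
    by (rule order_tendstoD(2)[OF tau_tendsto])
  then obtain T6 where T6: "\<And>t. T6 \<le> t \<Longrightarrow> \<tau> t < 1 / (2 * (real n + 1) * C6)"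
    unfolding eventually_at_top_linorder by blast
  define \<eta> where "\<eta> = Min {\<eta>1, \<eta>2, \<eta>3, \<eta>5, \<eta>6, \<eta>L, R}"
  define T where "T = Max {T1, T4, T6}"
  \<comment> \<open>Dominates \<open>C1 + C2 + l\<close> for the energy rate (\<open>l\<close> from
    the rescaling term), \<open>C1 + C3 + C4\<close> for the angle rate and \<open>C4\<close> for
    the phase speed.\<close>
  define C0 where "C0 = C1 + C2 + C3 + C4 + real l"
  define C where "C = C5 * (1 + C0)"
  have \<eta>: "\<eta> \<le> \<eta>1" "\<eta> \<le> \<eta>2" "\<eta> \<le> \<eta>3" "\<eta> \<le> \<eta>5" "\<eta> \<le> \<eta>6" "\<eta> \<le> \<eta>L" "\<eta> \<le> R"
    unfolding \<eta>_def by (rule Min_le; simp)+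
  have T: "T1 \<le> T" "T4 \<le> T" "T6 \<le> T"
    unfolding T_def by (rule Max_ge; simp)+
  show ?thesis
  proof (rule that[of C \<eta> T r0])
    show "0 < C" using 1(1) 2(1) 3(1) 4(1) 5(1) by (auto simp: C_def C0_def intro!: mult_pos_pos add_pos_nonneg)
    show "0 < \<eta>" using 1(2) 2(2) 3(2) 5(2) 6(2) Lm(2) R by (simp add: \<eta>_def)
    show "1 \<le> T" using 1(4) T(1) by simp
    show "(norm z)\<^sup>2 / 4 \<le> Ham0 P z \<and> Ham0 P z \<le> (norm z)\<^sup>2 \<and> 0 < Ham0 P z" if "norm z < r0" "z \<noteq> 0" for z
      using r0(3)[OF that(2,1)] by simp
  next
    fix t z assume t: "T \<le> t" and z: "z \<noteq> 0" "norm z < r0" and e: "escaled l t z < \<eta>"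
    have t1: "1 \<le> t" using t T 1(4) by simp
    have e0: "0 < escaled l t z" using r0(3)[OF z] t1 by (simp add: escaled_def)
    note \<tau> = tau_bounds[OF t1]
    let ?x = "scaled_coords l t z"
    have x: "?x \<in> strip \<eta>6" "fst ?x = escaled l t z" using e e0 \<eta>(5) by (auto simp: scaled_coords_def)
    have "{..n} = insert 0 {1..n}" by auto
    then have "averaged_energy l n W t z = (\<Sum>k\<in>insert 0 {1..n}. \<tau> t ^ k * W k ?x)"
      using z by (simp only: averaged_energy_def if_False)
    also have "\<dots> = escaled l t z + (\<Sum>k=1..n. \<tau> t ^ k * W k ?x)" by (simp add: W(2) x)
    finally have "averaged_energy l n W t z - escaled l t z = (\<Sum>k=1..n. \<tau> t ^ k * W k ?x)" by simp
    also have "\<bar>\<dots>\<bar> \<le> real (card {1..n}) * (\<tau> t * (C6 * escaled l t z))"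
    proof (rule order_trans[OF sum_abs sum_bounded_above])
      fix k assume k: "k \<in> {1..n}"
      have "\<bar>\<tau> t ^ k\<bar> \<le> \<tau> t" using tau_pow_le[OF t1, of 1 k] \<tau> k by simp
      moreover have "\<bar>W k ?x\<bar> \<le> C6 * escaled l t z" using 6(3)[rule_format, OF k x(1)] x(2) e0 by simp
      ultimately show "\<bar>\<tau> t ^ k * W k ?x\<bar> \<le> \<tau> t * (C6 * escaled l t z)" by (rule abs_mult_le)
    qed
    also have "\<dots> \<le> (real n + 1) * (\<tau> t * (C6 * escaled l t z))"
      using \<tau> 6(1) e0 by (intro mult_right_mono) auto
    also have "\<dots> = ((real n + 1) * C6 * \<tau> t) * escaled l t z" by simp
    also have "\<dots> \<le> (1 / 2) * escaled l t z"
    proof (rule mult_right_mono)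
      have "\<tau> t * (2 * (real n + 1) * C6) < 1"
      proof -
        have "\<tau> t < 1 / (2 * (real n + 1) * C6)" using T6[of t] t T(3) by simp
        moreover have "0 < 2 * (real n + 1) * C6" using 6(1) by simp
        ultimately show ?thesis by (simp add: pos_less_divide_eq)
      qed
      moreover have "\<tau> t * (2 * (real n + 1) * C6) = 2 * ((real n + 1) * C6 * \<tau> t)" by (simp only: mult_ac)
      ultimately show "(real n + 1) * C6 * \<tau> t \<le> 1 / 2" by linarith
    qed (use e0 in simp)
    finally show "\<bar>averaged_energy l n W t z - escaled l t z\<bar> \<le> escaled l t z / 2" by simp
  next
    fix t z I assume t: "T \<le> t" "t \<in> I" "I \<subseteq> {0<..}" and sol: "(z has_vector_derivative vec_field P t (z t)) (at t within I)"
      and z: "z t \<noteq> 0" "norm (z t) < r0" and e: "escaled l t (z t) < \<eta>"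
    have t1: "1 \<le> t" using t T 1(4) by simp
    then have t0: "0 < t" by simp
    note \<tau> = tau_bounds[OF t1]
    let ?q = "real (qpar P)"
    define E where "E = Ham0 P (z t)"
    define ee where "ee = escaled l t (z t)"
    define Tl where "Tl = t powr (real l / ?q)"
    define M where "M = \<tau> t ^ (n + 1)"
    define \<phi> where "\<phi> = angle_of (z t)"
    define s where "s = phase P t"
    define x where "x = scaled_coords l t (z t)"
    have E: "0 < E" "E < Emax P" using r0(3)[OF z] by (auto simp: E_def)
    have ee: "ee = Tl * E" by (simp add: ee_def escaled_def E_def Tl_def)
    have e0: "0 < ee" using E t0 by (simp add: ee Tl_def)
    have xx: "x = (ee, \<phi> - \<kappa>i * s, s)" by (simp add: x_def scaled_coords_def ee_def \<phi>_def s_def)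
    \<comment> \<open>Unscaling the scaled energy returns \<open>E\<close>, so the expansions at
      \<open>unscale l t ee\<close> describe the rates at the actual energy.\<close>
    have un: "unscale l t ee = E" using tau_l[OF t0, of l] by (simp add: unscale_def ee Tl_def mult_ac flip: mult.assoc)
    have E\<eta>: "E < \<eta>1" using unscale_bounds(2)[OF t1 e0, of l] e \<eta>(1) unfolding un by (simp add: ee_def)
    have sh: "shear \<kappa>i (E, \<phi> - \<kappa>i * s, s) = (E, \<phi>, s)" by (simp add: shear_def)
    have M: "0 < M" using \<tau> by (simp add: M_def)
    \<comment> \<open>Twice \<open>n div 2 + 1\<close> is at least \<open>n + 1\<close>, for either
      parity of \<open>n\<close>.\<close>
    have KM: "t powr (- real (n div 2 + 1) / ?q) \<le> M"
      unfolding tau_even[OF t0] M_def by (rule tau_pow_le[OF t1]) simp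
    define f where "f = (\<Sum>k=1..n div 2. \<tau> t ^ (2 * k) * f_co P k (E, \<phi>, s))"
    define gg where "gg = (\<Sum>k=1..n div 2. \<tau> t ^ (2 * k) * g_co P k (E, \<phi>, s))"
    define act where "act = act_rate P (Ham P) (Dis P) (E, \<phi>, t)"
    define anr where "anr = ang_rate P (Ham P) (Dis P) (E, \<phi>, t)"
    define SF where "SF = (\<Sum>p\<le>n. \<tau> t ^ p * scaled_F P l p x)"
    define SG where "SG = (\<Sum>p\<le>n. \<tau> t ^ p * scaled_G P l p x)"
    define SS where "SS = (\<Sum>p\<le>n. \<tau> t ^ p * S_co P p)"
    define s' where "s' = deriv (phase P) t"
    have tT: "T1 \<le> t" "T4 \<le> t" using t(1) T by auto
    have a1: "\<bar>act - f\<bar> \<le> C1 * E * M"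
      using order_trans[OF 1(5)[OF E(1) E\<eta> tT(1), of \<phi>] mult_left_mono[OF KM, of "C1 * E"]] 1(1) E(1)
      unfolding act_def f_def tau_even[OF t0] s_def by simp
    have Tl: "0 < Tl" using t0 by (simp add: Tl_def)
    have a2: "\<bar>Tl * act - Tl * f\<bar> \<le> C1 * ee * M"
      using mult_left_mono[OF a1, of Tl] Tl unfolding ee by (simp add: abs_mult mult_ac flip: right_diff_distrib)
    have a3: "\<bar>Tl * f - SF\<bar> \<le> C2 * ee * M"
      using 2(3)[rule_format, OF e0 _ t1, of "\<phi> - \<kappa>i * s" s] e[folded ee_def] \<eta>(2)
      unfolding un sh SF_def f_def xx M_def Tl_def by simp
    have tinv: "1 / t = \<tau> t ^ (2 * qpar P)"
      using tau_power[of t "2 * qpar P"] t0 standing_basic(5) by (simp add: powr_minus_divide)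
    have "1 / t \<le> M" unfolding tinv M_def using n by (intro tau_pow_le[OF t1]) simp
    moreover have "real l / ?q \<le> real l / 1" using standing_basic(5) by (intro divide_left_mono) auto
    ultimately have a4: "\<bar>real l / ?q * ee / t\<bar> \<le> real l * ee * M"
      using abs_mult_le[OF abs_mult_le[of "real l / ?q" "real l" ee ee], of "1 / t" M] e0 t0 by simp
    have b1: "\<bar>anr - freq P E - gg\<bar> \<le> C1 * M"
      using order_trans[OF 1(6)[OF E(1) E\<eta> tT(1), of \<phi>] mult_left_mono[OF KM, of C1]] 1(1)
      unfolding anr_def gg_def tau_even[OF t0] s_def by simp
    have b2: "\<bar>(freq P E + gg) - (SG + SS * \<kappa>i)\<bar> \<le> C3 * M"
      using 3(3)[rule_format, OF e0 _ t1, of "\<phi> - \<kappa>i * s" s] e[folded ee_def] \<eta>(3)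
      unfolding un sh SG_def SS_def gg_def xx M_def by (simp add: distrib_left sum.distrib sum_distrib_right mult.assoc)
    have b3: "\<bar>s' - SS\<bar> \<le> C4 * M" using 4(3)[OF tT(2)] by (simp add: s'_def SS_def M_def)
    have \<kappa>: "0 \<le> \<kappa>i" "\<kappa>i \<le> 1" using standing_basic(6) by (auto simp: \<kappa>i_def)
    have b4: "\<bar>\<kappa>i * (s' - SS)\<bar> \<le> 1 * (C4 * M)" by (rule abs_mult_le[OF _ b3]) (use \<kappa> in simp)
    have C0: "0 \<le> C0" using 1(1) 2(1) 3(1) 4(1) by (simp add: C0_def)
    define e' where "e' = Tl * act + real l / ?q * ee / t"
    define \<theta>' where "\<theta>' = anr - \<kappa>i * s'"
    have "e' - SF = (Tl * act - Tl * f) + (Tl * f - SF) + real l / ?q * ee / t" by (simp add: e'_def)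
    then have "\<bar>e' - SF\<bar> \<le> C1 * ee * M + C2 * ee * M + real l * ee * M"
      using abs_sum3_le[OF a2 a3 a4] by simp
    also have "\<dots> = (C1 + C2 + real l) * (ee * M)" by (simp add: algebra_simps)
    also have "\<dots> \<le> C0 * (ee * M)" using 3(1) 4(1) e0 M by (intro mult_right_mono) (auto simp: C0_def)
    finally have e1: "\<bar>e' - SF\<bar> \<le> C0 * ee * M" by (simp add: mult.assoc)
    have "\<theta>' - SG = (anr - freq P E - gg) + ((freq P E + gg) - (SG + SS * \<kappa>i)) + - (\<kappa>i * (s' - SS))"
      by (simp add: \<theta>'_def algebra_simps)
    also have "\<bar>\<dots>\<bar> \<le> C1 * M + C3 * M + 1 * (C4 * M)"
      by (rule abs_sum3_le[OF b1 b2]) (use b4 in simp)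
    finally have "\<bar>\<theta>' - SG\<bar> \<le> C1 * M + C3 * M + 1 * (C4 * M)" .
    also have "\<dots> = (C1 + C3 + C4) * M" by (simp add: algebra_simps)
    also have "\<dots> \<le> C0 * M" using 2(1) M by (intro mult_right_mono) (auto simp: C0_def)
    finally have e2: "\<bar>\<theta>' - SG\<bar> \<le> C0 * M" .
    have "C4 * M \<le> C0 * M" using 1(1) 2(1) 3(1) M by (intro mult_right_mono) (auto simp: C0_def)
    with b3 have e3: "\<bar>s' - SS\<bar> \<le> C0 * M" by simp
    have xs: "x \<in> strip \<eta>5" "x \<in> strip \<eta>L" "fst x = ee" using e0 e \<eta> by (auto simp: xx ee_def)
    define D where "D = (\<Sum>k\<le>n. \<tau> t ^ k * (pd (1, 0, 0) (W k) x * e' + pd (0, 1, 0) (W k) x * \<theta>' + pd (0, 0, 1) (W k) x * s')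
          - real k / real (2 * qpar P) * \<tau> t ^ k / t * W k x)"
    have "\<bar>D - \<tau> t ^ n * Lm x\<bar> \<le> C5 * (1 + C0) * fst x * \<tau> t ^ (n + 1)"
      unfolding D_def
      by (rule 5(3)[OF xs(1) t1 C0]) (use e1 e2 e3 xs(3) in \<open>simp_all add: SF_def SG_def SS_def M_def\<close>)
    then have "D \<le> \<tau> t ^ n * Lm x + C * ee * \<tau> t ^ (n + 1)" by (simp add: C_def xs(3) abs_le_iff)
    also have "\<tau> t ^ n * Lm x \<le> \<tau> t ^ n * (- c * ee powr \<beta>)"
      using Lm(3)[OF xs(2)] \<tau> xs(3) by (intro mult_left_mono) auto
    finally have D: "D \<le> - c * \<tau> t ^ n * ee powr \<beta> + C * ee * \<tau> t ^ (n + 1)" by (simp add: mult_ac)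
    have "((\<lambda>u. averaged_energy l n W u (z u)) has_real_derivative D) (at t within I)"
    proof -
      have "escaled l t (z t) < R" using e \<eta>(7) by simp
      from V_derivative[OF sol t(2,3) z(1) _ _ _ this W(3) W(4)]
      show ?thesis using E r0(2) z(2)
        unfolding D_def e'_def \<theta>'_def s'_def act_def anr_def x_def[symmetric] E_def[symmetric] \<phi>_def[symmetric] Tl_def xs(3)
        by (simp add: E_def[symmetric] xs(3))
    qed
    with D show "\<exists>D. ((\<lambda>u. averaged_energy l n W u (z u)) has_real_derivative D) (at t within I) \<and>
        D \<le> - c * \<tau> t ^ n * escaled l t (z t) powr \<beta> + C * escaled l t (z t) * \<tau> t ^ (n + 1)"
      unfolding ee_def by blast
  qed (use r0 in auto)
qed

end

section \<open>Existence of solutions\<close>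

text \<open>The Picard operator contracts on the whole interval at once when functions are measured
  relative to the weight \<open>exp (2 L (t - a))\<close>; here the fixed point is sought for the
  quotient of the solution by the weight.\<close>

lemma picard_lindeloef:
  fixes f :: "real \<Rightarrow> 'a::euclidean_space \<Rightarrow> 'a"
  assumes ab: "a \<le> b" and L: "0 < L" and cont: "continuous_on ({a..b} \<times> UNIV) (\<lambda>(t, x). f t x)"
    and lip: "\<And>t x y. t \<in> {a..b} \<Longrightarrow> norm (f t x - f t y) \<le> L * norm (x - y)"
  obtains z where "z a = z0" "\<And>t. t \<in> {a..b} \<Longrightarrow> (z has_vector_derivative f t (z t)) (at t within {a..b})"
proof -
  \<comment> \<open>Clamping to the interval extends functions to bounded continuous ones on the
    line, a complete metric space.\<close>
  define cl where "cl t = max a (min b t)" for t :: real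
  have cl: "cl t \<in> {a..b}" for t using ab by (auto simp: cl_def)
  have cl_id: "cl t = t" if "t \<in> {a..b}" for t using that by (auto simp: cl_def)
  have cl_cont: "continuous_on S cl" for S unfolding cl_def by (intro continuous_intros)
  \<comment> \<open>The rate \<open>2 L\<close> makes the contraction constant
    \<open>L / (2 L) = 1 / 2\<close>.\<close>
  define w where "w t = exp (2 * L * (t - a))" for t
  have w_cont: "continuous_on S w" for S unfolding w_def by (intro continuous_intros)
  have w_pos: "0 < w t" and w_ne: "w t \<noteq> 0" for t by (simp_all add: w_def)
  define h where "h u s = f s (w s *\<^sub>R apply_bcontfun u s)" for u :: "real \<Rightarrow>\<^sub>C 'a" and s
  have h_cont: "continuous_on {a..b} (h u)" for u
    unfolding h_def
    by (rule continuous_on_compose2[OF cont, of _ "\<lambda>s. (s, w s *\<^sub>R apply_bcontfun u s)", simplified])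
       (auto intro!: continuous_intros w_cont)
  have h_int: "h u integrable_on {a..t}" if "t \<in> {a..b}" for u t
    by (rule integrable_continuous_interval, rule continuous_on_subset[OF h_cont]) (use that in auto)
  define G where "G u t = (1 / w t) *\<^sub>R (z0 + integral {a..t} (h u))" for u t
  have G_cont: "continuous_on {a..b} (G u)" for u
    unfolding G_def
    by (intro continuous_intros w_cont indefinite_integral_continuous_1 h_int) (use w_ne ab in auto)
  have G_bc: "(\<lambda>t. G u (cl t)) \<in> bcontfun" for u
  proof -
    obtain B where "\<And>t. t \<in> {a..b} \<Longrightarrow> norm (G u t) \<le> B"
      using continuous_on_compact_bound[OF compact_Icc G_cont] by metis
    then have "norm (G u (cl t)) \<le> B" for t using cl by blast
    moreover have "continuous_on UNIV (\<lambda>t. G u (cl t))"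
      by (rule continuous_on_compose2[OF G_cont cl_cont]) (use cl in auto)
    ultimately show ?thesis by (intro bcontfun_normI)
  qed
  define F where "F u = Bcontfun (\<lambda>t. G u (cl t))" for u
  have F: "apply_bcontfun (F u) t = G u (cl t)" for u t
    unfolding F_def by (simp add: Bcontfun_inverse[OF G_bc])
  have contr: "dist (F u) (F v) \<le> 1 / 2 * dist u v" for u v
  proof (rule dist_bound)
    fix t
    define s where "s = cl t"
    have s: "s \<in> {a..b}" using cl by (simp add: s_def)
    \<comment> \<open>As the weight has derivative \<open>2 L w\<close>, the integral of
      \<open>L w\<close> is half its increment.\<close>
    have "((\<lambda>r. L * dist u v * w r) has_integral (dist u v / 2 * w s - dist u v / 2 * w a)) {a..s}"
    proof (rule fundamental_theorem_of_calculus)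
      fix r assume "r \<in> {a..s}"
      have "((\<lambda>r. dist u v / 2 * w r) has_real_derivative L * dist u v * w r) (at r)"
        unfolding w_def by (auto intro!: derivative_eq_intros)
      then show "((\<lambda>r. dist u v / 2 * w r) has_vector_derivative L * dist u v * w r) (at r within {a..s})"
        by (simp add: has_real_derivative_iff_has_vector_derivative has_vector_derivative_at_within)
    qed (use s in auto)
    note hi = this
    have "norm (integral {a..s} (h u) - integral {a..s} (h v)) = norm (integral {a..s} (\<lambda>r. h u r - h v r))"
      by (simp add: integral_diff[OF h_int[OF s] h_int[OF s]])
    also have "\<dots> \<le> integral {a..s} (\<lambda>r. L * dist u v * w r)"
    proof (rule integral_norm_bound_integral)
      show "(\<lambda>r. h u r - h v r) integrable_on {a..s}" by (intro integrable_diff h_int s)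
      show "(\<lambda>r. L * dist u v * w r) integrable_on {a..s}" using hi by blast
      fix r assume r: "r \<in> {a..s}"
      have "norm (h u r - h v r) \<le> L * norm (w r *\<^sub>R apply_bcontfun u r - w r *\<^sub>R apply_bcontfun v r)"
        unfolding h_def by (rule lip) (use r s in auto)
      also have "norm (w r *\<^sub>R apply_bcontfun u r - w r *\<^sub>R apply_bcontfun v r) = w r * dist (apply_bcontfun u r) (apply_bcontfun v r)"
        using w_pos[of r] by (simp add: dist_norm flip: scaleR_diff_right)
      also have "L * \<dots> \<le> L * (w r * dist u v)"
        using L w_pos[of r] by (intro mult_left_mono dist_bounded) auto
      finally show "norm (h u r - h v r) \<le> L * dist u v * w r" by (simp add: mult_ac)
    qed
    also have "\<dots> = dist u v / 2 * w s - dist u v / 2 * w a" using hi by (rule integral_unique)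
    also have "\<dots> \<le> dist u v / 2 * w s" using w_pos[of a] by simp
    finally have "norm (integral {a..s} (h u) - integral {a..s} (h v)) \<le> dist u v / 2 * w s" .
    moreover have "dist (G u s) (G v s) = 1 / w s * norm (integral {a..s} (h u) - integral {a..s} (h v))"
      using w_pos[of s] by (simp add: G_def dist_norm flip: scaleR_diff_right)
    ultimately have "dist (G u s) (G v s) \<le> 1 / w s * (dist u v / 2 * w s)"
      using w_pos[of s] by (simp only:) (rule mult_left_mono, auto)
    then show "dist (apply_bcontfun (F u) t) (apply_bcontfun (F v) t) \<le> 1 / 2 * dist u v"
      using w_ne[of s] by (simp add: F s_def[symmetric])
  qed
  obtain u where u: "F u = u"
    using banach_fix_type[of "1 / 2" F] contr by auto
  define z where "z t = z0 + integral {a..t} (h u)" for t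
  have zu: "w t *\<^sub>R apply_bcontfun u t = z t" if "t \<in> {a..b}" for t
    using F[of u t] w_pos[of t] by (simp add: u cl_id[OF that] G_def z_def)
  show ?thesis
  proof (rule that[of z])
    show "z a = z0" by (simp add: z_def)
    fix t assume t: "t \<in> {a..b}"
    have "((\<lambda>t. integral {a..t} (h u)) has_vector_derivative h u t) (at t within {a..b})"
      by (rule integral_has_vector_derivative[OF h_cont t])
    then show "(z has_vector_derivative f t (z t)) (at t within {a..b})"
      unfolding z_def[abs_def] using zu[OF t] by (auto simp: h_def z_def intro!: derivative_eq_intros)
  qed
qed

text \<open>The squared norm times \<open>exp (- 2 L (s - a))\<close> has nonpositive derivative, by
  the Cauchy-Schwarz inequality; the square avoids the zeros of the norm.\<close>

lemma gronwall_norm: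
  fixes z :: "real \<Rightarrow> 'a::real_inner"
  assumes "a \<le> t" "\<And>s. s \<in> {a..t} \<Longrightarrow> (z has_vector_derivative v s) (at s within {a..t})"
    and "\<And>s. s \<in> {a..t} \<Longrightarrow> norm (v s) \<le> L * norm (z s)"
  shows "norm (z t) \<le> norm (z a) * exp (L * (t - a))"
proof (cases "a = t")
  case False
  then have at: "a < t" using assms(1) by simp
  define h where "h s = (z s \<bullet> z s) * exp (- (2 * L * (s - a)))" for s
  define h' where "h' s = (2 * (z s \<bullet> v s) - 2 * L * (z s \<bullet> z s)) * exp (- (2 * L * (s - a)))" for s
  have "\<exists>x\<in>{a<..<t}. h t - h a = (\<lambda>y. y * h' x) (t - a)"
  proof (rule mvt_simple[OF at])
    fix x assume "a \<le> x" "x \<le> t"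
    then have z: "(z has_derivative (\<lambda>y. y *\<^sub>R v x)) (at x within {a..t})"
      using assms(2)[of x] by (simp add: has_vector_derivative_def)
    show "(h has_derivative (\<lambda>y. y * h' x)) (at x within {a..t})"
      unfolding h_def
      by (auto intro!: derivative_eq_intros z simp: h'_def algebra_simps inner_commute)
  qed
  then obtain x where x: "x \<in> {a<..<t}" "h t - h a = (t - a) * h' x" by auto
  have "z x \<bullet> v x \<le> norm (z x) * norm (v x)" by (rule norm_cauchy_schwarz)
  also have "\<dots> \<le> norm (z x) * (L * norm (z x))" using x assms(3)[of x] by (intro mult_left_mono) auto
  also have "\<dots> = L * (z x \<bullet> z x)" by (simp add: dot_square_norm power2_eq_square)
  finally have "h' x \<le> 0" by (simp add: h'_def mult_le_0_iff)
  then have "h t \<le> h a" using x at by (simp add: mult_le_0_iff) (smt (verit) mult_nonneg_nonpos)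
  then have "(norm (z t))\<^sup>2 * exp (- (2 * L * (t - a))) \<le> (norm (z a))\<^sup>2"
    by (simp add: h_def dot_square_norm)
  then have "(norm (z t))\<^sup>2 * exp (- (2 * L * (t - a))) * exp (2 * L * (t - a)) \<le> (norm (z a))\<^sup>2 * exp (2 * L * (t - a))"
    by (rule mult_right_mono) simp
  then have "(norm (z t))\<^sup>2 \<le> (norm (z a))\<^sup>2 * exp (2 * L * (t - a))"
    by (simp add: mult.assoc flip: exp_add)
  also have "\<dots> = (norm (z a) * exp (L * (t - a)))\<^sup>2"
    by (simp add: power_mult_distrib mult.assoc flip: exp_double)
  finally show ?thesis by (rule power2_le_imp_le) simp
qed simp

section \<open>The perturbed vector field and its solutions\<close>

context osc begin

abbreviation "Tpos \<equiv> {(x :: real, y :: real, t :: real). 0 < t}"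

text \<open>The spatial derivatives are bounded on a compact product of a time interval and a ball;
  convexity of the ball turns this into a Lipschitz bound.\<close>

lemma lipschitz_slice:
  assumes sm: "smooth_fun_on Tpos u" and "0 < a"
  shows "\<exists>L. \<forall>t\<in>{a..b}. \<forall>z\<in>cball 0 r. \<forall>z'\<in>cball 0 r.
    \<bar>u (fst z, snd z, t) - u (fst z', snd z', t)\<bar> \<le> L * norm (z - z')"
proof -
  let ?Q = "{a..b} \<times> cball (0 :: real \<times> real) r"
  have B: "(1, 0, 0) \<in> (Basis :: (real \<times> real \<times> real) set)" "(0, 1, 0) \<in> (Basis :: (real \<times> real \<times> real) set)"
    by (auto simp: Basis_real3)
  have bd: "\<exists>M. \<forall>t\<in>{a..b}. \<forall>z\<in>cball 0 r. \<bar>pd c u (fst z, snd z, t)\<bar> \<le> M" if "c \<in> Basis" for c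
  proof -
    have "continuous_on ?Q (\<lambda>p. pd c u (fst (snd p), snd (snd p), fst p))"
      by (rule continuous_on_compose2[OF smooth_continuous_on[OF smooth_pd[OF sm that]]])
         (use assms(2) in \<open>auto intro!: continuous_intros\<close>)
    from continuous_on_compact_bound[OF compact_Times[OF compact_Icc compact_cball] this]
    obtain M where M: "\<And>p. p \<in> ?Q \<Longrightarrow> norm (pd c u (fst (snd p), snd (snd p), fst p)) \<le> M" by blast
    show ?thesis
    proof (rule exI[of _ M], intro ballI)
      fix t and z :: "real \<times> real" assume "t \<in> {a..b}" "z \<in> cball 0 r"
      then show "\<bar>pd c u (fst z, snd z, t)\<bar> \<le> M" using M[of "(t, z)"] by simp
    qed
  qed
  obtain M1 where M1: "\<forall>t\<in>{a..b}. \<forall>z\<in>cball 0 r. \<bar>pd (1, 0, 0) u (fst z, snd z, t)\<bar> \<le> M1" using bd[OF B(1)] ..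
  obtain M2 where M2: "\<forall>t\<in>{a..b}. \<forall>z\<in>cball 0 r. \<bar>pd (0, 1, 0) u (fst z, snd z, t)\<bar> \<le> M2" using bd[OF B(2)] ..
  show ?thesis
  proof (intro exI[of _ "M1 + M2"] ballI)
    fix t and z z' :: "real \<times> real" assume t: "t \<in> {a..b}" and z: "z \<in> cball 0 r" "z' \<in> cball 0 r"
    have "norm (u (fst z, snd z, t) - u (fst z', snd z', t)) \<le> (M1 + M2) * norm (z - z')"
    proof (rule differentiable_bound[OF convex_cball])
      fix y :: "real \<times> real" assume y: "y \<in> cball 0 r"
      have "u differentiable (at (fst y, snd y, t))"
        by (rule smooth_differentiable[OF sm]) (use t assms(2) in auto)
      note du = differentiable_pd3[OF this]
      have d: "((\<lambda>z. (fst z, snd z, t)) has_derivative (\<lambda>v. (fst v, snd v, 0))) (at y within cball 0 r)"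
        by (auto intro!: derivative_eq_intros)
      show "((\<lambda>z. u (fst z, snd z, t)) has_derivative (\<lambda>v. fst v * pd (1, 0, 0) u (fst y, snd y, t) + snd v * pd (0, 1, 0) u (fst y, snd y, t))) (at y within cball 0 r)"
        using has_derivative_compose[where f = "\<lambda>z. (fst z, snd z, t)" and g = u, OF d du] by simp
      have m: "\<bar>pd (1, 0, 0) u (fst y, snd y, t)\<bar> \<le> M1" "\<bar>pd (0, 1, 0) u (fst y, snd y, t)\<bar> \<le> M2"
        using M1 M2 t y by blast+
      have M0: "0 \<le> M1" "0 \<le> M2" using order_trans[OF abs_ge_zero m(1)] order_trans[OF abs_ge_zero m(2)] .
      show "onorm (\<lambda>v. fst v * pd (1, 0, 0) u (fst y, snd y, t) + snd v * pd (0, 1, 0) u (fst y, snd y, t)) \<le> M1 + M2"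
      proof (rule onorm_bound)
        fix v :: "real \<times> real"
        have "norm (fst v * pd (1, 0, 0) u (fst y, snd y, t) + snd v * pd (0, 1, 0) u (fst y, snd y, t))
          \<le> \<bar>fst v * pd (1, 0, 0) u (fst y, snd y, t)\<bar> + \<bar>snd v * pd (0, 1, 0) u (fst y, snd y, t)\<bar>"
          by simp
        also have "\<dots> \<le> norm v * M1 + norm v * M2"
          using norm_fst_le[of "fst v" "snd v"] norm_snd_le[of "snd v" "fst v"]
          unfolding abs_mult by (intro add_mono mult_mono m) auto
        finally show "norm (fst v * pd (1, 0, 0) u (fst y, snd y, t) + snd v * pd (0, 1, 0) u (fst y, snd y, t)) \<le> (M1 + M2) * norm v"
          by (simp add: algebra_simps)
      qed (use M0 in simp)
    qed (use z in auto)
    then show "\<bar>u (fst z, snd z, t) - u (fst z', snd z', t)\<bar> \<le> (M1 + M2) * norm (z - z')" by simp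
  qed
qed

lemma field_components:
  "smooth_fun_on Tpos (pd (0, 1, 0) (Ham P))" "smooth_fun_on Tpos (\<lambda>p. - pd (1, 0, 0) (Ham P) p + Dis P p)"
proof -
  have o: "open Tpos"
  proof -
    have "Tpos = (\<lambda>(x, y, t). t) -` {0<..}" by auto
    also have "open \<dots>" unfolding case_prod_unfold by (intro open_vimage open_greaterThan continuous_intros)
    finally show ?thesis .
  qed
  show "smooth_fun_on Tpos (pd (0, 1, 0) (Ham P))" by (rule smooth_pd[OF perturbation(1)]) (simp add: Basis_real3)
  show "smooth_fun_on Tpos (\<lambda>p. - pd (1, 0, 0) (Ham P) p + Dis P p)"
    by (intro smooth_add smooth_uminus o smooth_pd perturbation) (simp add: Basis_real3)
qed

lemma vec_field_eq: "vec_field P t z = (pd (0, 1, 0) (Ham P) (fst z, snd z, t),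
    (\<lambda>p. - pd (1, 0, 0) (Ham P) p + Dis P p) (fst z, snd z, t))"
  by (simp add: vec_field_def case_prod_unfold)

lemma vec_field_lipschitz:
  assumes "0 < a"
  obtains L where "0 < L" "\<And>t z z'. t \<in> {a..b} \<Longrightarrow> z \<in> cball 0 r \<Longrightarrow> z' \<in> cball 0 r \<Longrightarrow>
    norm (vec_field P t z - vec_field P t z') \<le> L * norm (z - z')"
proof -
  let ?u = "pd (0, 1, 0) (Ham P)" and ?v = "\<lambda>p. - pd (1, 0, 0) (Ham P) p + Dis P p"
  obtain L1 where L1: "\<forall>t\<in>{a..b}. \<forall>z\<in>cball 0 r. \<forall>z'\<in>cball 0 r.
    \<bar>?u (fst z, snd z, t) - ?u (fst z', snd z', t)\<bar> \<le> L1 * norm (z - z')"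
    using lipschitz_slice[OF field_components(1) assms] by blast
  obtain L2 where L2: "\<forall>t\<in>{a..b}. \<forall>z\<in>cball 0 r. \<forall>z'\<in>cball 0 r.
    \<bar>?v (fst z, snd z, t) - ?v (fst z', snd z', t)\<bar> \<le> L2 * norm (z - z')"
    using lipschitz_slice[OF field_components(2) assms] by blast
  show ?thesis
  proof (rule that[of "\<bar>L1\<bar> + \<bar>L2\<bar> + 1"])
    fix t and z z' :: "real \<times> real" assume *: "t \<in> {a..b}" "z \<in> cball 0 r" "z' \<in> cball (0 :: real \<times> real) r"
    have "norm (vec_field P t z - vec_field P t z') \<le> \<bar>?u (fst z, snd z, t) - ?u (fst z', snd z', t)\<bar> + \<bar>?v (fst z, snd z, t) - ?v (fst z', snd z', t)\<bar>"
      unfolding vec_field_eq diff_Pair using norm_Pair_le by (metis real_norm_def)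
    also have "\<dots> \<le> L1 * norm (z - z') + L2 * norm (z - z')"
      using L1 L2 * by (intro add_mono) blast+
    also have "\<dots> = (L1 + L2) * norm (z - z')" by (simp add: algebra_simps)
    also have "\<dots> \<le> (\<bar>L1\<bar> + \<bar>L2\<bar> + 1) * norm (z - z')" by (intro mult_right_mono) auto
    finally show "norm (vec_field P t z - vec_field P t z') \<le> (\<bar>L1\<bar> + \<bar>L2\<bar> + 1) * norm (z - z')" .
  qed simp
qed

lemma vec_field_0: "0 < t \<Longrightarrow> vec_field P t 0 = 0"
  using perturbation(3-5)[of t] by (simp add: vec_field_def zero_prod_def)

lemma vec_field_continuous: "continuous_on ({0<..} \<times> UNIV) (\<lambda>(t, z). vec_field P t z)"
  unfolding vec_field_eq case_prod_unfold
  by (intro continuous_on_Pair continuous_on_compose2[OF smooth_continuous_on[OF field_components(1)]]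
      continuous_on_compose2[OF smooth_continuous_on[OF field_components(2)]] continuous_intros) auto

lemma solves_on_subset: "solves_on P I z \<Longrightarrow> J \<subseteq> I \<Longrightarrow> solves_on P J z"
  unfolding solves_on_def using has_vector_derivative_within_subset by blast

text \<open>Both solutions stay in a fixed ball, on which the field is Lipschitz; the Gronwall
  estimate is applied to their difference.\<close>

lemma solution_unique:
  assumes "0 < t1" "t1 \<le> b" "solves_on P {t1..b} z" "solves_on P {t1..b} y" "z t1 = y t1"
    "\<And>t. t \<in> {t1..b} \<Longrightarrow> norm (z t) \<le> r \<and> norm (y t) \<le> r"
  shows "z b = y b"
proof -
  obtain L where L: "0 < L" "\<And>t z z'. t \<in> {t1..b} \<Longrightarrow> z \<in> cball 0 r \<Longrightarrow> z' \<in> cball 0 r \<Longrightarrow>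
    norm (vec_field P t z - vec_field P t z') \<le> L * norm (z - z')"
    using vec_field_lipschitz[OF assms(1), of b r] by metis
  have "norm (z b - y b) \<le> norm (z t1 - y t1) * exp (L * (b - t1))"
  proof (rule gronwall_norm[of t1 b "\<lambda>t. z t - y t" "\<lambda>t. vec_field P t (z t) - vec_field P t (y t)"])
    fix s assume s: "s \<in> {t1..b}"
    show "((\<lambda>t. z t - y t) has_vector_derivative vec_field P s (z s) - vec_field P s (y s)) (at s within {t1..b})"
      using assms(3,4) s by (auto simp: solves_on_def intro!: has_vector_derivative_diff)
    show "norm (vec_field P s (z s) - vec_field P s (y s)) \<le> L * norm (z s - y s)"
      by (rule L(2)[OF s]) (use assms(6)[OF s] in auto)
  qed fact
  then show ?thesis using assms(5) by simp
qed

text \<open>The field is only locally Lipschitz, so it is first altered outside a ball to be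
  globally Lipschitz. The a priori bound \<open>\<epsilon>\<close> keeps the solution inside the
  larger radius \<open>2 \<epsilon>\<close>, where nothing was altered.\<close>

lemma solution_exists:
  assumes t1: "0 < t1" and \<epsilon>: "0 < \<epsilon>" and z0: "norm z0 < \<epsilon>"
    and apriori: "\<And>T z. t1 < T \<Longrightarrow> solves_on P {t1..<T} z \<Longrightarrow> z t1 = z0 \<Longrightarrow> \<forall>t\<in>{t1..<T}. norm (z t) < \<epsilon>"
  shows "\<exists>z. solves_on P {t1..} z \<and> z t1 = z0"
proof -
  have fin: "\<exists>z. solves_on P {t1..b} z \<and> z t1 = z0 \<and> (\<forall>t\<in>{t1..b}. norm (z t) \<le> 2 * \<epsilon>)" if b: "t1 < b" for b
  proof -
    let ?B = "cball (0 :: real \<times> real) (2 * \<epsilon>)"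
    obtain L where L: "0 < L" "\<And>t z z'. t \<in> {t1..b} \<Longrightarrow> z \<in> ?B \<Longrightarrow> z' \<in> ?B \<Longrightarrow>
      norm (vec_field P t z - vec_field P t z') \<le> L * norm (z - z')"
      using vec_field_lipschitz[OF t1, of b "2 * \<epsilon>"] by metis
    have B: "closed ?B" "convex ?B" "?B \<noteq> {}" using \<epsilon> by auto
    \<comment> \<open>Projection to the ball does not increase distances, so the altered field has
      the Lipschitz constant of the ball everywhere.\<close>
    define f where "f t z = vec_field P t (closest_point ?B z)" for t z
    have cp: "closest_point ?B z \<in> ?B" for z using closest_point_in_set[OF B(1,3)] .
    obtain z where z: "z t1 = z0" "\<And>t. t \<in> {t1..b} \<Longrightarrow> (z has_vector_derivative f t (z t)) (at t within {t1..b})"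
    proof (rule picard_lindeloef[of t1 b L f z0])
      show "continuous_on ({t1..b} \<times> UNIV) (\<lambda>(t, x). f t x)"
        unfolding f_def case_prod_unfold
        by (rule continuous_on_compose2[OF vec_field_continuous[unfolded case_prod_unfold], of _ "\<lambda>p. (fst p, closest_point ?B (snd p))", simplified])
           (use t1 in \<open>auto intro!: continuous_intros continuous_on_compose2[OF continuous_on_closest_point[OF B(2,1,3)]]\<close>)
      show "norm (f t x - f t y) \<le> L * norm (x - y)" if "t \<in> {t1..b}" for t x y
      proof -
        have "norm (f t x - f t y) \<le> L * norm (closest_point ?B x - closest_point ?B y)"
          unfolding f_def by (rule L(2)[OF that cp cp])
        also have "\<dots> \<le> L * norm (x - y)"
          using closest_point_lipschitz[OF B(2,1,3), of x y] L(1) by (intro mult_left_mono) (auto simp: dist_norm)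
        finally show ?thesis .
      qed
    qed (use b L in auto)
    have zc: "continuous_on {t1..b} z"
      unfolding continuous_on_eq_continuous_within using has_vector_derivative_continuous[OF z(2)] by blast
    have sol: "solves_on P J z" if "J \<subseteq> {t1..b}" "\<And>t. t \<in> J \<Longrightarrow> norm (z t) \<le> 2 * \<epsilon>" for J
      unfolding solves_on_def
    proof
      fix t assume t: "t \<in> J"
      have "closest_point ?B (z t) = z t" using that(2)[OF t] by (intro closest_point_self) auto
      then show "(z has_vector_derivative vec_field P t (z t)) (at t within J)"
        using has_vector_derivative_within_subset[OF z(2) that(1), of t] t that(1) by (auto simp: f_def)
    qed
    \<comment> \<open>At the first time with norm at least \<open>2 \<epsilon>\<close> the function
      has solved the true system so far; the a priori bound and continuity then give norm at most
      \<open>\<epsilon>\<close>, a contradiction.\<close>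
    have "norm (z t) \<le> 2 * \<epsilon>" if t: "t \<in> {t1..b}" for t
    proof (rule ccontr)
      assume "\<not> norm (z t) \<le> 2 * \<epsilon>"
      define S where "S = {s \<in> {t1..b}. 2 * \<epsilon> \<le> norm (z s)}"
      have "closed S"
        unfolding S_def using continuous_closed_preimage[OF continuous_on_norm[OF zc] closed_atLeastAtMost closed_atLeast[of "2 * \<epsilon>"]]
        by (simp add: vimage_def Int_def)
      moreover have "S \<noteq> {}" "bdd_below S" using t \<open>\<not> norm (z t) \<le> 2 * \<epsilon>\<close> by (auto simp: S_def intro!: bdd_belowI[of _ t1])
      ultimately have "Inf S \<in> S" using closed_contains_Inf by blast
      define s where "s = Inf S"
      have s: "s \<in> {t1..b}" "2 * \<epsilon> \<le> norm (z s)" using \<open>Inf S \<in> S\<close> by (auto simp: S_def s_def)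
      have before: "norm (z r) < 2 * \<epsilon>" if "r \<in> {t1..<s}" for r
        using cInf_lower[OF _ \<open>bdd_below S\<close>, of r] that s by (force simp: S_def s_def)
      have "s \<noteq> t1" using s(2) z0 z(1) \<epsilon> by auto
      then have ts: "t1 < s" using s by simp
      have "solves_on P {t1..<s} z" using before s by (intro sol) (auto intro: less_imp_le)
      then have ap: "\<forall>r\<in>{t1..<s}. norm (z r) < \<epsilon>" using apriori[of s z, OF ts _ z(1)] by blast
      have "((\<lambda>r. norm (z r)) \<longlongrightarrow> norm (z s)) (at s within {t1..<s})"
      proof (rule tendsto_norm[OF tendsto_within_subset])
        show "(z \<longlongrightarrow> z s) (at s within {t1..b})" using zc s by (auto simp: continuous_on_def)
      qed (use s in auto)
      moreover have "\<forall>\<^sub>F r in at s within {t1..<s}. norm (z r) \<le> \<epsilon>"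
        using ap by (auto simp: eventually_at intro!: exI[of _ 1] less_imp_le)
      moreover have "at s within {t1..<s} \<noteq> bot" using ts by (simp add: trivial_limit_within islimpt_Ico)
      ultimately have "norm (z s) \<le> \<epsilon>" by (rule tendsto_upperbound)
      then show False using s(2) \<epsilon> by simp
    qed
    then show ?thesis using z(1) sol[of "{t1..b}"] by blast
  qed
  define Z where "Z b = (SOME z. solves_on P {t1..b} z \<and> z t1 = z0 \<and> (\<forall>t\<in>{t1..b}. norm (z t) \<le> 2 * \<epsilon>))" for b
  have Z: "solves_on P {t1..b} (Z b)" "Z b t1 = z0" "\<And>t. t \<in> {t1..b} \<Longrightarrow> norm (Z b t) \<le> 2 * \<epsilon>" if "t1 < b" for b
    using someI_ex[OF fin[OF that]] unfolding Z_def[symmetric] by auto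
  \<comment> \<open>Solutions on bounded intervals agree by uniqueness. Using the one up to
    \<open>t + 1\<close> keeps \<open>t\<close> away from the right end point.\<close>
  define z where "z t = Z (t + 1) t" for t
  have eq: "z s = Z b s" if "t1 \<le> s" "s \<le> b" "t1 < b" for s b
  proof -
    have s1: "t1 < s + 1" using that by simp
    show ?thesis unfolding z_def
    proof (rule solution_unique[where z = "Z (s + 1)" and y = "Z b" and r = "2 * \<epsilon>", OF t1 that(1)])
      show "solves_on P {t1..s} (Z (s + 1))" by (rule solves_on_subset[OF Z(1)[OF s1]]) auto
      show "solves_on P {t1..s} (Z b)" by (rule solves_on_subset[OF Z(1)[OF that(3)]]) (use that in auto)
      show "norm (Z (s + 1) t) \<le> 2 * \<epsilon> \<and> norm (Z b t) \<le> 2 * \<epsilon>" if "t \<in> {t1..s}" for t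
        using Z(3)[OF s1, of t] Z(3)[OF \<open>t1 < b\<close>, of t] that \<open>s \<le> b\<close> by simp
    qed (use Z(2)[OF s1] Z(2)[OF that(3)] in simp)
  qed
  have "solves_on P {t1..} z" unfolding solves_on_def
  proof
    fix t assume "t \<in> {t1..}"
    then have t: "t1 \<le> t" "t1 < t + 1" by auto
    have "(Z (t + 1) has_vector_derivative vec_field P t (Z (t + 1) t)) (at t within {t1..t + 1})"
      using Z(1)[OF t(2)] t by (simp add: solves_on_def)
    \<comment> \<open>As \<open>t < t + 1\<close>, the one-sided end point is invisible near
      \<open>t\<close> and the derivative is the one within the half-line.\<close>
    moreover have "at t within {t1..t + 1} = at t within {t1..}"
      by (rule at_within_nhd[of _ "{..<t + 1}"]) auto
    ultimately have "(Z (t + 1) has_vector_derivative vec_field P t (z t)) (at t within {t1..})"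
      by (simp add: z_def)
    then show "(z has_vector_derivative vec_field P t (z t)) (at t within {t1..})"
      by (rule has_vector_derivative_transform_within[OF _ zero_less_one])
         (use t eq[of _ "t + 1"] in \<open>auto simp: dist_real_def\<close>)
  qed
  moreover have "z t1 = z0" using Z(2)[of "t1 + 1"] by (simp add: z_def)
  ultimately show ?thesis by blast
qed

end

section \<open>Polynomial decay\<close>

text \<open>Induction along an interval: at the infimum of the failures the property holds by the
  left condition, and the right condition extends it beyond, contradicting the infimum.\<close>

lemma interval_induct:
  fixes Q :: "real \<Rightarrow> bool"
  assumes "Q a"
    and right: "\<And>t. a \<le> t \<Longrightarrow> t < b \<Longrightarrow> Q t \<Longrightarrow> \<exists>d>0. \<forall>s\<in>{a..<b}. \<bar>s - t\<bar> < d \<longrightarrow> Q s"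
    and left: "\<And>t. a < t \<Longrightarrow> t < b \<Longrightarrow> (\<And>s. a \<le> s \<Longrightarrow> s < t \<Longrightarrow> Q s) \<Longrightarrow> Q t"
    and t: "a \<le> t" "t < b"
  shows "Q t"
proof (rule ccontr)
  assume nQ: "\<not> Q t"
  define S where "S = {s \<in> {a..t}. \<not> Q s}"
  have S: "S \<noteq> {}" "bdd_below S" using t nQ by (auto simp: S_def intro!: bdd_belowI[of _ a])
  define m where "m = Inf S"
  have m: "a \<le> m" "m \<le> t"
    unfolding m_def using cInf_greatest[OF S(1), of a] cInf_lower[OF _ S(2), of t] t nQ by (auto simp: S_def)
  have before: "Q s" if "a \<le> s" "s < m" for s
    using cInf_lower[OF _ S(2), of s] that m by (force simp: S_def m_def)
  have "Q m" using left[of m] before m t(2) assms(1) by (cases "a = m") auto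
  then obtain d where d: "d > 0" "\<forall>s\<in>{a..<b}. \<bar>s - m\<bar> < d \<longrightarrow> Q s" using right[of m] m t by auto
  obtain s where s: "s \<in> S" "s < m + d" using cInf_lessD[OF S(1), of "m + d"] d(1) by (auto simp: m_def)
  moreover have "m \<le> s" using cInf_lower[OF s(1) S(2)] by (simp add: m_def)
  ultimately show False using d t(2) by (auto simp: S_def)
qed

section \<open>The barrier and its consequences\<close>

context osc begin

text \<open>The bounds near the centre concern nonzero points only; the value at the origin follows
  by continuity.\<close>

lemma Ham0_origin: "Ham0 P 0 = 0"
proof -
  obtain r0 where r0: "0 < r0"
    "\<And>z. z \<noteq> 0 \<Longrightarrow> norm z < r0 \<Longrightarrow> (norm z)\<^sup>2 / 4 \<le> Ham0 P z \<and> Ham0 P z \<le> (norm z)\<^sup>2 \<and> 0 < Ham0 P z \<and> Ham0 P z < Emax P"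
    by (rule energy_bounds) (rule that)
  have "(Ham0 P \<longlongrightarrow> Ham0 P 0) (at 0)"
    using differentiable_imp_continuous_within[OF Ham0_diff[OF origin(1)]] by (simp add: continuous_within zero_prod_def)
  moreover have "(Ham0 P \<longlongrightarrow> 0) (at 0)"
  proof (rule Lim_null_comparison)
    show "\<forall>\<^sub>F z in at 0. norm (Ham0 P z) \<le> (norm z)\<^sup>2"
      unfolding eventually_at
    proof (intro exI[of _ r0] conjI ballI impI r0(1))
      fix z :: "real \<times> real" assume "z \<noteq> 0 \<and> dist z 0 < r0"
      then show "norm (Ham0 P z) \<le> (norm z)\<^sup>2" using r0(2)[of z] by (simp add: dist_norm)
    qed
    show "((\<lambda>z :: real \<times> real. (norm z)\<^sup>2) \<longlongrightarrow> 0) (at 0)" by (auto intro!: tendsto_eq_intros)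
  qed
  ultimately show ?thesis using tendsto_unique at_neq_bot by blast
qed

lemma escaled_continuous:
  assumes "continuous (at t within I) z" "0 < t" "norm (z t) \<le> rmax P"
  shows "continuous (at t within I) (\<lambda>u. escaled l u (z u))"
proof -
  have "isCont (Ham0 P) (z t)"
    using differentiable_imp_continuous_within[OF Ham0_diff, of "z t"] Usm(2) assms(3) by auto
  then have "continuous (at t within I) (\<lambda>u. Ham0 P (z u))"
    using continuous_within_compose3[OF _ assms(1)] by blast
  moreover have "continuous (at t within I) (\<lambda>u. u powr (real l / real (qpar P)))"
    using assms(2) by (intro continuous_intros) auto
  ultimately show ?thesis unfolding escaled_def by (intro continuous_mult)
qed

text \<open>The solution is continued as long as three strict inequalities hold: small norm, small
  scaled energy, averaged energy below the barrier. The barrier itself implies the first two with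
  room to spare, and contact with it is excluded by comparing derivatives.\<close>

lemma solution_decay:
  assumes sc: "scaling_exponent P l" and n: "n < 2 * qpar P" and R: "0 < R"
    and W: "\<And>k. k \<le> n \<Longrightarrow> symbol 1 (W k)" "W 0 = fst"
      "\<And>k. k \<le> n \<Longrightarrow> smooth_fun_on (strip R) (W k)"
      "\<And>k e \<theta> s. k \<le> n \<Longrightarrow> 0 < e \<Longrightarrow> e < R \<Longrightarrow> W k (e, \<theta> + 2 * pi, s) = W k (e, \<theta>, s)"
    and rel: "\<And>k x. k \<le> n \<Longrightarrow> x \<in> strip R \<Longrightarrow>
      (\<Sum>i\<le>k. scaled_F P l i x * pd (1, 0, 0) (W (k - i)) x + scaled_G P l i x * pd (0, 1, 0) (W (k - i)) x
        + S_co P i * pd (0, 0, 1) (W (k - i)) x) = (if k = n then Lm x else 0)"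
    and Lm: "0 < c" "0 < \<eta>L" "\<And>x. x \<in> strip \<eta>L \<Longrightarrow> Lm x \<le> - c * fst x powr \<beta>"
    and \<beta>: "1 < \<beta>"
  obtains a T0 where "0 < a" "1 \<le> T0"
    "\<And>T. T0 \<le> T \<Longrightarrow> \<exists>\<delta>>0. \<forall>T' z. solves_on P {T..<T'} z \<and> norm (z T) < \<delta> \<longrightarrow>
      (\<forall>t\<in>{T..<T'}. (norm (z t))\<^sup>2 \<le> 8 * t powr - a)"
proof -
  obtain C \<eta> T1 r where C: "0 < C" "0 < \<eta>" "1 \<le> T1" "0 < r" "r \<le> rmax P"
    and en: "\<And>z. norm z < r \<Longrightarrow> z \<noteq> 0 \<Longrightarrow> (norm z)\<^sup>2 / 4 \<le> Ham0 P z \<and> Ham0 P z \<le> (norm z)\<^sup>2 \<and> 0 < Ham0 P z"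
    and Ve: "\<And>t z. T1 \<le> t \<Longrightarrow> z \<noteq> 0 \<Longrightarrow> norm z < r \<Longrightarrow> escaled l t z < \<eta> \<Longrightarrow> \<bar>averaged_energy l n W t z - escaled l t z\<bar> \<le> escaled l t z / 2"
    and dyn: "\<And>t z I. T1 \<le> t \<Longrightarrow> t \<in> I \<Longrightarrow> I \<subseteq> {0<..} \<Longrightarrow> (z has_vector_derivative vec_field P t (z t)) (at t within I) \<Longrightarrow>
      z t \<noteq> 0 \<Longrightarrow> norm (z t) < r \<Longrightarrow> escaled l t (z t) < \<eta> \<Longrightarrow>
      \<exists>D. ((\<lambda>u. averaged_energy l n W u (z u)) has_real_derivative D) (at t within I) \<and>
        D \<le> - c * \<tau> t ^ n * escaled l t (z t) powr \<beta> + C * escaled l t (z t) * \<tau> t ^ (n + 1)"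
    by (rule averaged_dynamics[OF sc n R W rel Lm]) (assumption+, rule that)
  \<comment> \<open>For \<open>B = t\<^sup>-\<^sup>a\<close> this gives \<open>B powr \<beta> = B * \<rho> t\<close> with \<open>\<rho>\<^sup>2 = \<tau>\<close>, so \<open>\<tau>\<^sup>n B\<^sup>\<beta>\<close> dominates \<open>\<tau>\<^bsup>n+1\<^esup> B\<close>.\<close>
  define a where "a = 1 / (4 * real (qpar P) * (\<beta> - 1))"
  have q: "0 < real (qpar P)" using standing_basic(5) by simp
  have a: "0 < a" "a * (\<beta> - 1) = 1 / (4 * real (qpar P))" using \<beta> q by (auto simp: a_def)
  define \<rho> where "\<rho> t = t powr (- 1 / (4 * real (qpar P)))" for t
  have \<rho>lim: "(\<rho> \<longlongrightarrow> 0) at_top" unfolding \<rho>_def using q by (intro tendsto_neg_powr filterlim_ident) auto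
  have alim: "((\<lambda>t. 8 * t powr - a) \<longlongrightarrow> 8 * 0) at_top" using a(1) by (intro tendsto_intros tendsto_neg_powr filterlim_ident) auto
  \<comment> \<open>Once the bounds by \<open>8 t^(-a)\<close> drop below \<open>m\<close>, energy
    and norm lie strictly within their halved ranges again.\<close>
  define m where "m = min (\<eta> / 2) ((r / 2)\<^sup>2)"
  have m: "0 < m" "m \<le> \<eta> / 2" "m \<le> (r / 2)\<^sup>2" using C by (auto simp: m_def)
  \<comment> \<open>\<open>2 powr - \<beta>\<close> comes from \<open>e \<ge> B / 2\<close> in the
    damping, \<open>2 C\<close> from \<open>e \<le> 2 B\<close> in the error, and \<open>a\<close>
    from the slope of the barrier.\<close>
  have "0 < c * 2 powr - \<beta> / (2 * C + a)" using Lm(1) C(1) a(1) by simp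
  then have "\<forall>\<^sub>F t in at_top. \<rho> t < c * 2 powr - \<beta> / (2 * C + a)" by (rule order_tendstoD(2)[OF \<rho>lim])
  moreover have "\<forall>\<^sub>F t in at_top. 8 * t powr - a < m" using order_tendstoD(2)[OF alim] m(1) by simp
  ultimately have "\<forall>\<^sub>F t in at_top. \<rho> t < c * 2 powr - \<beta> / (2 * C + a) \<and> 8 * t powr - a < m \<and> T1 \<le> t"
    using eventually_ge_at_top[of T1] by (intro eventually_conj)
  then obtain T0' where T0': "\<And>t. T0' \<le> t \<Longrightarrow> \<rho> t < c * 2 powr - \<beta> / (2 * C + a) \<and> 8 * t powr - a < m \<and> T1 \<le> t"
    unfolding eventually_at_top_linorder by blast
  have barrier: "- c * \<tau> t ^ n * e powr \<beta> + C * e * \<tau> t ^ (n + 1) < - a * t powr (- a - 1)"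
    if t: "max 1 T0' \<le> t" and e: "t powr - a / 2 \<le> e" "e \<le> 2 * t powr - a" for t e
  proof -
    have t1: "1 \<le> t" "0 < t" "T0' \<le> t" using t by auto
    define B where "B = t powr - a"
    have B: "0 < B" using t1 by (simp add: B_def)
    note \<tau> = tau_bounds[OF t1(1)]
    have \<rho>: "0 < \<rho> t" using t1 by (simp add: \<rho>_def)
    have \<tau>\<rho>: "\<tau> t = \<rho> t * \<rho> t" by (simp add: \<tau>_def \<rho>_def powr_add[symmetric])
    have B\<beta>: "B powr \<beta> = B * \<rho> t"
    proof -
      have "B powr \<beta> = B powr 1 * B powr (\<beta> - 1)" using powr_add[of B 1 "\<beta> - 1"] by simp
      also have "B powr (\<beta> - 1) = \<rho> t" using a(2) by (simp add: B_def \<rho>_def powr_powr)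
      finally show ?thesis using B by simp
    qed
    have "\<rho> t * (2 * C + a) < c * 2 powr - \<beta>"
      using T0'[OF t1(3)] C(1) a(1) by (simp add: pos_less_divide_eq)
    then have "(\<rho> t * (2 * C + a)) * (\<rho> t * B * \<tau> t ^ n) < (c * 2 powr - \<beta>) * (\<rho> t * B * \<tau> t ^ n)"
      using \<rho> B \<tau> by (intro mult_strict_right_mono) auto
    then have 1: "(2 * C + a) * B * \<tau> t ^ (n + 1) < c * \<tau> t ^ n * (2 powr - \<beta> * B powr \<beta>)"
      unfolding B\<beta> by (simp add: \<tau>\<rho> mult_ac)
    have "2 powr - \<beta> * B powr \<beta> = (B / 2) powr \<beta>"
      using B by (simp add: powr_divide powr_minus_divide)
    also have "\<dots> \<le> e powr \<beta>" using e(1) B \<beta> by (intro powr_mono2) (auto simp: B_def)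
    finally have 2: "c * \<tau> t ^ n * (2 powr - \<beta> * B powr \<beta>) \<le> c * \<tau> t ^ n * e powr \<beta>"
      using Lm(1) \<tau> by (intro mult_left_mono) auto
    have 3: "C * e * \<tau> t ^ (n + 1) \<le> 2 * C * B * \<tau> t ^ (n + 1)"
      using e(2) C(1) \<tau> by (intro mult_right_mono) (auto simp: B_def)
    have "1 / t = \<tau> t ^ (2 * qpar P)"
      using tau_power[of t "2 * qpar P"] t1 standing_basic(5) by (simp add: powr_minus_divide)
    also have "\<dots> \<le> \<tau> t ^ (n + 1)" using n by (intro tau_pow_le[OF t1(1)]) simp
    finally have "a * B * (1 / t) \<le> a * B * \<tau> t ^ (n + 1)" using a(1) B by (intro mult_left_mono) auto
    moreover have "t powr (- a - 1) = B * (1 / t)" using t1 by (simp add: B_def powr_diff)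
    ultimately have 4: "a * t powr (- a - 1) \<le> a * B * \<tau> t ^ (n + 1)" by (simp add: mult.assoc)
    have "(2 * C + a) * B * \<tau> t ^ (n + 1) = 2 * C * B * \<tau> t ^ (n + 1) + a * B * \<tau> t ^ (n + 1)" by (simp add: algebra_simps)
    with 1 2 3 4 show ?thesis by simp
  qed
  show ?thesis
  proof (rule that[of a "max 1 T0'"])
    fix T assume T: "max 1 T0' \<le> T"
    have T1: "1 \<le> T" "T0' \<le> T" using T by auto
    define K0 where "K0 = T powr (real l / real (qpar P))"
    have K0: "0 < K0" using T1 by (simp add: K0_def)
    \<comment> \<open>Initial scaled energy below \<open>m0\<close> puts the averaged energy, at
      most twice as large, below the barrier at time \<open>T\<close>; \<open>\<delta>\<close>
      guarantees this since the scaled energy is at most \<open>K0\<close> times the squared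
      norm.\<close>
    define m0 where "m0 = min (\<eta> / 2) (T powr - a / 2)"
    have m0: "0 < m0" "m0 \<le> \<eta> / 2" "m0 \<le> T powr - a / 2" using C T1 by (auto simp: m0_def)
    define \<delta> where "\<delta> = min (r / 2) (sqrt (m0 / K0))"
    have \<delta>: "0 < \<delta>" using C m0 K0 by (simp add: \<delta>_def)
    have main: "(norm (z t))\<^sup>2 \<le> 8 * t powr - a"
      if sol: "solves_on P {T..<T'} z" and z0: "norm (z T) < \<delta>" and t: "t \<in> {T..<T'}" for T' z t
    proof -
      let ?I = "{T..<T'}"
      let ?e = "\<lambda>u. escaled l u (z u)" and ?V = "\<lambda>u. averaged_energy l n W u (z u)"
      \<comment> \<open>Strict inequalities with halved radii: they persist to the right, and their
        weak limits from the left still allow the estimates, which need only the full radii.\<close>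
      define Q where "Q u \<longleftrightarrow> norm (z u) < r / 2 \<and> ?e u < \<eta> / 2 \<and> ?V u < u powr - a" for u
      have I0: "?I \<subseteq> {0<..}" using T1 by auto
      have d: "(z has_vector_derivative vec_field P u (z u)) (at u within ?I)" if "u \<in> ?I" for u
        using sol that by (simp add: solves_on_def)
      have cz: "continuous (at u within ?I) z" if "u \<in> ?I" for u
        using has_vector_derivative_continuous[OF d[OF that]] .
      have ce: "continuous (at u within ?I) ?e" if "u \<in> ?I" "norm (z u) < r" for u
        using escaled_continuous[OF cz[OF that(1)]] that C(5) T1 by simp
      have e0: "?e u = 0" if "z u = 0" for u using that by (simp add: escaled_def Ham0_origin)
      have epos: "0 < ?e u" if "u \<in> ?I" "z u \<noteq> 0" "norm (z u) < r" for u
        using en[OF that(3,2)] that(1) T1 by (simp add: escaled_def)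
      have V0: "?V u = 0" if "z u = 0" for u using that by (simp add: averaged_energy_def)
      have uT: "T1 \<le> u" "max 1 T0' \<le> u" if "u \<in> ?I" for u using that T T0'[of u] by auto
      have cV: "continuous (at u within ?I) ?V" if u: "u \<in> ?I" "norm (z u) < r" "?e u < \<eta>" for u
      proof (cases "z u = 0")
        case False
        then show ?thesis using dyn[OF uT(1)[OF u(1)] u(1) I0 d[OF u(1)] _ u(2,3)] DERIV_continuous by blast
      next
        case True
        have le: "(?e \<longlongrightarrow> 0) (at u within ?I)" using ce[OF u(1,2)] e0[OF True] by (simp add: continuous_within)
        have lz: "(z \<longlongrightarrow> 0) (at u within ?I)" using cz[OF u(1)] True by (simp add: continuous_within)
        have "\<forall>\<^sub>F s in at u within ?I. norm (z s) < r"
          using order_tendstoD(2)[OF tendsto_norm[OF lz], of r] C(4) by simp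
        moreover have "\<forall>\<^sub>F s in at u within ?I. ?e s < \<eta>" using order_tendstoD(2)[OF le] C(2) by simp
        moreover have "\<forall>\<^sub>F s in at u within ?I. s \<in> ?I" by (auto simp: eventually_at intro: zero_less_one)
        ultimately have "\<forall>\<^sub>F s in at u within ?I. norm (?V s) \<le> 2 * ?e s"
        proof eventually_elim
          case (elim s)
          show ?case
          proof (cases "z s = 0")
            case False
            from close_to_half(1)[OF Ve[OF uT(1)[OF elim(3)] False elim(1,2)]] show ?thesis by simp
          qed (use V0[of s] e0[of s] in simp)
        qed
        then have "(?V \<longlongrightarrow> 0) (at u within ?I)"
          by (rule Lim_null_comparison) (use tendsto_mult_left[OF le, of 2] in simp)
        then show ?thesis using V0[OF True] by (simp add: continuous_within)
      qed
      have cB: "continuous (at u within ?I) (\<lambda>u. u powr - a)" if "u \<in> ?I" for u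
        using that T1 by (intro continuous_intros) auto
      \<comment> \<open>The constant 8 is 2 from comparing the averaged with the scaled energy,
        times 4 from comparing the energy with the squared norm.\<close>
      have bound: "?e u \<le> 2 * u powr - a \<and> (norm (z u))\<^sup>2 \<le> 8 * u powr - a"
        if u: "u \<in> ?I" "norm (z u) < r" "?e u < \<eta>" "?V u \<le> u powr - a" for u
      proof (cases "z u = 0")
        case False
        have 1: "?e u \<le> 2 * u powr - a" using close_to_half(2)[OF Ve[OF uT(1)[OF u(1)] False u(2,3)]] u(4) by simp
        have u1: "1 \<le> u" using u(1) T1 by simp
        have "1 * Ham0 P (z u) \<le> u powr (real l / real (qpar P)) * Ham0 P (z u)"
          using en[OF u(2) False] u1 by (intro mult_right_mono ge_one_powr_ge_zero) auto
        then have "Ham0 P (z u) \<le> ?e u" by (simp add: escaled_def)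
        then show ?thesis using en[OF u(2) False] 1 by simp
      qed (use e0[of u] in auto)
      have "Q t"
      proof (rule interval_induct[where a = T and b = T'])
        show "Q T"
        proof -
          have TI: "T \<in> ?I" using t by auto
          have z: "norm (z T) < r / 2" "norm (z T) < sqrt (m0 / K0)" using z0 by (auto simp: \<delta>_def)
          have zr: "norm (z T) < r" using z(1) C(4) by simp
          have "(norm (z T))\<^sup>2 < (sqrt (m0 / K0))\<^sup>2" using z(2) by (intro power_strict_mono) auto
          then have "K0 * (norm (z T))\<^sup>2 < m0" using m0(1) K0 by (simp add: pos_less_divide_eq mult.commute)
          moreover have "?e T \<le> K0 * (norm (z T))\<^sup>2"
          proof (cases "z T = 0")
            case False
            then show ?thesis using en[OF zr False] K0 by (simp add: escaled_def K0_def)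
          qed (use e0[of T] in simp)
          ultimately have e: "?e T < m0" by simp
          then have "?V T < T powr - a"
          proof (cases "z T = 0")
            case False
            have "?e T < \<eta>" using e m0(2) C(2) by simp
            from abs_le_D1[OF close_to_half(1)[OF Ve[OF uT(1)[OF TI] False zr this]]] show ?thesis using e m0(3) by simp
          qed (use V0[of T] T1 in simp)
          then show ?thesis using z(1) e m0(2) by (simp add: Q_def)
        qed
      next
        fix u assume "T \<le> u" "u < T'" and Q: "Q u"
        then have u: "u \<in> ?I" by simp
        have zu: "norm (z u) < r" "?e u < \<eta>" using Q C(2,4) by (auto simp: Q_def)
        have "continuous (at u within ?I) (\<lambda>u. norm (z u) - r / 2)" "continuous (at u within ?I) (\<lambda>u. ?e u - \<eta> / 2)"
          "continuous (at u within ?I) (\<lambda>u. ?V u - u powr - a)"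
          by (intro continuous_intros cz[OF u] ce[OF u zu(1)] cV[OF u zu] cB[OF u])+
        note op = this[THEN right_open]
        obtain d1 d2 d3 where d: "d1 > 0" "\<forall>s\<in>?I. \<bar>s - u\<bar> < d1 \<longrightarrow> norm (z s) - r / 2 < 0"
          "d2 > 0" "\<forall>s\<in>?I. \<bar>s - u\<bar> < d2 \<longrightarrow> ?e s - \<eta> / 2 < 0"
          "d3 > 0" "\<forall>s\<in>?I. \<bar>s - u\<bar> < d3 \<longrightarrow> ?V s - s powr - a < 0"
          using op Q by (simp add: Q_def) blast
        then show "\<exists>d>0. \<forall>s\<in>?I. \<bar>s - u\<bar> < d \<longrightarrow> Q s"
          by (intro exI[of _ "min d1 (min d2 d3)"]) (auto simp: Q_def)
      next
        fix u assume u': "T < u" "u < T'" and before: "\<And>s. T \<le> s \<Longrightarrow> s < u \<Longrightarrow> Q s"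
        then have u: "u \<in> ?I" and sub: "{T..<u} \<subseteq> ?I" by auto
        have "norm (z u) - r / 2 \<le> 0"
          by (rule left_closure[OF _ u'(1) sub]) (use before cz[OF u] in \<open>auto simp: Q_def intro!: continuous_intros\<close>)
        then have zr: "norm (z u) < r" using C(4) by simp
        have "?e u - \<eta> / 2 \<le> 0"
          by (rule left_closure[OF _ u'(1) sub]) (use before ce[OF u zr] in \<open>auto simp: Q_def intro!: continuous_intros\<close>)
        then have e: "?e u < \<eta>" using C(2) by simp
        have "?V u - u powr - a \<le> 0"
          by (rule left_closure[OF _ u'(1) sub]) (use before cV[OF u zr e] cB[OF u] in \<open>auto simp: Q_def intro!: continuous_intros\<close>)
        then have V: "?V u \<le> u powr - a" by simp
        note b = bound[OF u zr e V]
        have small: "8 * u powr - a < m" using T0'[of u] uT(2)[OF u] by simp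
        have pos: "0 < u powr - a" using u T1 by simp
        have "?e u < \<eta> / 2" using b small m(2) pos by linarith
        moreover have "norm (z u) < r / 2"
        proof -
          have "(norm (z u))\<^sup>2 < (r / 2)\<^sup>2" using b small m(3) by linarith
          then show ?thesis by (rule power2_less_imp_less) (use C(4) in simp)
        qed
        \<comment> \<open>At a contact the difference from the barrier is zero with negative
          derivative, so it would be positive just before, where the barrier was not yet
          reached.\<close>
        moreover have "?V u < u powr - a"
        proof (rule ccontr)
          assume "\<not> ?V u < u powr - a"
          then have Veq: "?V u = u powr - a" using V by simp
          then have z: "z u \<noteq> 0" using V0[of u] pos by auto
          obtain D where D: "(?V has_real_derivative D) (at u within ?I)"
            "D \<le> - c * \<tau> u ^ n * ?e u powr \<beta> + C * ?e u * \<tau> u ^ (n + 1)"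
            using dyn[OF uT(1)[OF u] u I0 d[OF u] z zr e] by blast
          have "u powr - a / 2 \<le> ?e u" using abs_le_D1[OF close_to_half(1)[OF Ve[OF uT(1)[OF u] z zr e]]] unfolding Veq by simp
          from barrier[OF uT(2)[OF u] this] b D(2) have "D - - a * u powr (- a - 1) < 0" by simp
          moreover have "((\<lambda>s. ?V s - s powr - a) has_real_derivative D - - a * u powr (- a - 1)) (at u within ?I)"
            by (rule DERIV_diff[OF D(1) has_field_derivative_at_within[OF has_real_derivative_powr]]) (use u T1 in auto)
          ultimately obtain d where d: "d > 0" "\<And>h. 0 < h \<Longrightarrow> u - h \<in> ?I \<Longrightarrow> h < d \<Longrightarrow> ?V u - u powr - a < ?V (u - h) - (u - h) powr - a"
            using has_real_derivative_neg_dec_left by blast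
          define h where "h = min d (u - T) / 2"
          have h: "0 < h" "h < d" "T \<le> u - h" "u - h < u" using d(1) u'(1) by (auto simp: h_def min_def field_simps)
          have "?V (u - h) < (u - h) powr - a" using before[OF h(3,4)] by (simp add: Q_def)
          then show False using d(2)[of h] h u' Veq by auto
        qed
        ultimately show "Q u" by (simp add: Q_def)
      qed (use t in auto)
      then show ?thesis using bound[of t] t C(2,4) by (auto simp: Q_def)
    qed
    show "\<exists>\<delta>>0. \<forall>T' z. solves_on P {T..<T'} z \<and> norm (z T) < \<delta> \<longrightarrow> (\<forall>t\<in>{T..<T'}. (norm (z t))\<^sup>2 \<le> 8 * t powr - a)"
      using \<delta> main by blast
  qed (use a in auto)
qed

text \<open>The origin is an equilibrium, so inside the ball the field is at most \<open>L\<close>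
  times the norm and solutions grow at most like \<open>exp (L (t - t1))\<close>;
  \<open>\<delta>\<close> compensates this growth up to time \<open>T\<close>.\<close>

lemma short_time_bound:
  assumes "0 < t1" "t1 \<le> T" "0 < \<epsilon>"
  obtains \<delta> where "0 < \<delta>" "\<delta> \<le> \<epsilon>"
    "\<And>T' z t. solves_on P {t1..<T'} z \<Longrightarrow> norm (z t1) < \<delta> \<Longrightarrow> t \<in> {t1..<T'} \<Longrightarrow> t \<le> T \<Longrightarrow> norm (z t) < \<epsilon>"
proof -
  obtain L where L: "0 < L" "\<And>t z z'. t \<in> {t1..T} \<Longrightarrow> z \<in> cball 0 \<epsilon> \<Longrightarrow> z' \<in> cball 0 \<epsilon> \<Longrightarrow>
    norm (vec_field P t z - vec_field P t z') \<le> L * norm (z - z')"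
    by (rule vec_field_lipschitz[OF assms(1), of T \<epsilon>]) (rule that)
  define \<delta> where "\<delta> = \<epsilon> * exp (- (L * (T - t1)))"
  have \<delta>: "0 < \<delta>" "\<delta> \<le> \<epsilon>" using assms L(1) by (auto simp: \<delta>_def)
  show ?thesis
  proof (rule that[OF \<delta>])
    fix T' z t assume sol: "solves_on P {t1..<T'} z" and z: "norm (z t1) < \<delta>" and t: "t \<in> {t1..<T'}" "t \<le> T"
    have d: "(z has_vector_derivative vec_field P s (z s)) (at s within J)" if "s \<in> J" "J \<subseteq> {t1..<T'}" for s J
      using solves_on_subset[OF sol that(2)] that(1) by (simp add: solves_on_def)
    show "norm (z t) < \<epsilon>"
    proof (rule interval_induct[where a = t1 and b = T' and Q = "\<lambda>s. s \<le> T \<longrightarrow> norm (z s) < \<epsilon>", THEN mp])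
      show "t1 \<le> T \<longrightarrow> norm (z t1) < \<epsilon>" using z \<delta> by simp
    next
      fix s assume s: "t1 \<le> s" "s < T'" "s \<le> T \<longrightarrow> norm (z s) < \<epsilon>"
      show "\<exists>d>0. \<forall>r\<in>{t1..<T'}. \<bar>r - s\<bar> < d \<longrightarrow> r \<le> T \<longrightarrow> norm (z r) < \<epsilon>"
      proof (cases "s \<le> T")
        case True
        have "continuous (at s within {t1..<T'}) (\<lambda>s. norm (z s) - \<epsilon>)"
          using has_vector_derivative_continuous[OF d[of s "{t1..<T'}"]] s by (auto intro!: continuous_intros)
        from right_open[OF this] show ?thesis using s(3) True by auto
      next
        case False
        then show ?thesis by (intro exI[of _ "s - T"]) auto
      qed
    next
      fix s assume s: "t1 < s" "s < T'" and before: "\<And>r. t1 \<le> r \<Longrightarrow> r < s \<Longrightarrow> r \<le> T \<longrightarrow> norm (z r) < \<epsilon>"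
      show "s \<le> T \<longrightarrow> norm (z s) < \<epsilon>"
      proof
        assume sT: "s \<le> T"
        have "norm (z s) - \<epsilon> \<le> 0"
          by (rule left_closure[of s "{t1..<T'}" _ t1])
             (use has_vector_derivative_continuous[OF d[of s "{t1..<T'}"]] s before sT in \<open>auto intro!: continuous_intros\<close>)
        then have le: "norm (z r) \<le> \<epsilon>" if "r \<in> {t1..s}" for r
          using before[of r] that sT by (cases "r = s") auto
        have "norm (z s) \<le> norm (z t1) * exp (L * (s - t1))"
        proof (rule gronwall_norm)
          fix r assume r: "r \<in> {t1..s}"
          show "(z has_vector_derivative vec_field P r (z r)) (at r within {t1..s})" by (rule d) (use r s in auto)
          show "norm (vec_field P r (z r)) \<le> L * norm (z r)"
            using L(2)[of r "z r" 0] le[OF r] r sT assms vec_field_0[of r] by simp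
        qed (use s in simp)
        also have "\<dots> \<le> norm (z t1) * exp (L * (T - t1))"
          using sT L(1) by (intro mult_left_mono) auto
        also have "\<dots> < \<delta> * exp (L * (T - t1))" using z by simp
        also have "\<dots> = \<epsilon>" by (simp add: \<delta>_def mult.assoc flip: exp_add)
        finally show "norm (z s) < \<epsilon>" .
      qed
    qed (use t in auto)
  qed
qed

text \<open>The decay estimate starts only at late times, whereas stability concerns every positive
  initial time; \<open>short_time_bound\<close> bridges the finite gap. The resulting bound on
  half-open intervals is just the a priori estimate for global existence.\<close>

lemma polynomially_stable_of_decay:
  assumes a: "0 < a" and T0: "1 \<le> T0"
    and decay: "\<And>T. T0 \<le> T \<Longrightarrow> \<exists>\<delta>>0. \<forall>T' z. solves_on P {T..<T'} z \<and> norm (z T) < \<delta> \<longrightarrow>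
      (\<forall>t\<in>{T..<T'}. (norm (z t))\<^sup>2 \<le> 8 * t powr - a)"
  shows "polynomially_stable P"
proof -
  have alim: "((\<lambda>t. 8 * t powr - a) \<longlongrightarrow> 8 * 0) at_top"
    using a by (intro tendsto_intros tendsto_neg_powr filterlim_ident) auto
  have key: "\<exists>\<delta>>0. \<delta> \<le> \<epsilon> \<and> (\<exists>T. t1 < T \<and> (\<forall>T'>t1. \<forall>z. solves_on P {t1..<T'} z \<and> norm (z t1) < \<delta> \<longrightarrow>
      (\<forall>t\<in>{t1..<T'}. norm (z t) < \<epsilon> \<and> (T \<le> t \<longrightarrow> (norm (z t))\<^sup>2 \<le> 8 * t powr - a))))"
    if t1: "0 < t1" and \<epsilon>: "0 < \<epsilon>" for t1 \<epsilon> :: real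
  proof -
    have "\<forall>\<^sub>F t in at_top. 8 * t powr - a < \<epsilon>\<^sup>2" using order_tendstoD(2)[OF alim] \<epsilon> by simp
    then have "\<forall>\<^sub>F t in at_top. 8 * t powr - a < \<epsilon>\<^sup>2 \<and> T0 \<le> t \<and> t1 < t"
      by (intro eventually_conj eventually_ge_at_top eventually_gt_at_top)
    then obtain T where T: "\<And>t. T \<le> t \<Longrightarrow> 8 * t powr - a < \<epsilon>\<^sup>2 \<and> T0 \<le> t \<and> t1 < t"
      unfolding eventually_at_top_linorder by blast
    obtain \<delta>1 where \<delta>1: "\<delta>1 > 0" "\<forall>T' z. solves_on P {T..<T'} z \<and> norm (z T) < \<delta>1 \<longrightarrow>
      (\<forall>t\<in>{T..<T'}. (norm (z t))\<^sup>2 \<le> 8 * t powr - a)" using decay[of T] T[of T] by blast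
    have t1T: "t1 < T" using T[of T] by simp
    obtain \<delta> where \<delta>: "0 < \<delta>" "\<delta> \<le> min \<epsilon> \<delta>1"
      "\<And>T' z t. solves_on P {t1..<T'} z \<Longrightarrow> norm (z t1) < \<delta> \<Longrightarrow> t \<in> {t1..<T'} \<Longrightarrow> t \<le> T \<Longrightarrow> norm (z t) < min \<epsilon> \<delta>1"
      by (rule short_time_bound[OF t1 less_imp_le[OF t1T], of "min \<epsilon> \<delta>1"]) (use \<epsilon> \<delta>1(1) in simp, rule that)
    have "norm (z t) < \<epsilon> \<and> (T \<le> t \<longrightarrow> (norm (z t))\<^sup>2 \<le> 8 * t powr - a)"
      if z: "solves_on P {t1..<T'} z" "norm (z t1) < \<delta>" and t: "t \<in> {t1..<T'}" for T' z t
    proof (cases "T \<le> t")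
      case True
      have "norm (z T) < \<delta>1" using \<delta>(3)[OF z, of T] True t t1T by auto
      moreover have "solves_on P {T..<T'} z" by (rule solves_on_subset[OF z(1)]) (use t1T in auto)
      ultimately have 1: "(norm (z t))\<^sup>2 \<le> 8 * t powr - a" using \<delta>1(2) True t by auto
      then have "(norm (z t))\<^sup>2 < \<epsilon>\<^sup>2" using T[OF True] by linarith
      then have "norm (z t) < \<epsilon>" by (rule power2_less_imp_less) (use \<epsilon> in simp)
      then show ?thesis using 1 by simp
    next
      case False
      then show ?thesis using \<delta>(3)[OF z t] by simp
    qed
    then show ?thesis using \<delta>(1,2) t1T by (intro exI[of _ \<delta>]) auto
  qed
  have "lyapunov_stable P"
    unfolding lyapunov_stable_def
  proof (intro allI impI)
    fix t1 \<epsilon> :: real assume t1: "0 < t1" and \<epsilon>: "0 < \<epsilon>"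
    obtain \<delta> where \<delta>: "\<delta> > 0" "\<delta> \<le> \<epsilon>"
      "\<And>T' z t. t1 < T' \<Longrightarrow> solves_on P {t1..<T'} z \<Longrightarrow> norm (z t1) < \<delta> \<Longrightarrow> t \<in> {t1..<T'} \<Longrightarrow> norm (z t) < \<epsilon>"
      using key[OF t1 \<epsilon>] by blast
    show "\<exists>\<delta>>0. (\<forall>z0. norm z0 < \<delta> \<longrightarrow> (\<exists>z. solves_on P {t1..} z \<and> z t1 = z0)) \<and>
        (\<forall>T>t1. \<forall>z. solves_on P {t1..<T} z \<and> norm (z t1) < \<delta> \<longrightarrow> (\<forall>t\<in>{t1..<T}. norm (z t) < \<epsilon>))"
    proof (intro exI[of _ \<delta>] conjI allI impI)
      fix z0 :: "real \<times> real" assume z0: "norm z0 < \<delta>"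
      show "\<exists>z. solves_on P {t1..} z \<and> z t1 = z0"
        by (rule solution_exists[OF t1 \<epsilon>]) (use z0 \<delta> in auto)
    qed (use \<delta> in auto)
  qed
  moreover have "\<exists>\<gamma>>0. \<forall>t1>0. \<exists>\<delta>>0. \<forall>z. solves_on P {t1..} z \<and> norm (z t1) < \<delta> \<longrightarrow>
        (\<exists>C. \<forall>\<^sub>F t in at_top. (fst (z t))\<^sup>2 + (snd (z t))\<^sup>2 \<le> C * t powr (- \<gamma>))"
  proof (rule exI[of _ a], intro conjI allI impI a)
    fix t1 :: real assume t1: "0 < t1"
    obtain \<delta> T where \<delta>: "\<delta> > 0" "t1 < T" "\<And>T' z t. t1 < T' \<Longrightarrow> solves_on P {t1..<T'} z \<Longrightarrow> norm (z t1) < \<delta> \<Longrightarrow>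
      t \<in> {t1..<T'} \<Longrightarrow> T \<le> t \<Longrightarrow> (norm (z t))\<^sup>2 \<le> 8 * t powr - a"
      using key[OF t1 zero_less_one] by blast
    have "(fst (z t))\<^sup>2 + (snd (z t))\<^sup>2 \<le> 8 * t powr - a" if "solves_on P {t1..} z" "norm (z t1) < \<delta>" "T \<le> t" for z t
    proof -
      \<comment> \<open>The estimates hold on half-open intervals, so the interval is extended by 1
        to contain \<open>t\<close>.\<close>
      have "solves_on P {t1..<t + 1} z" by (rule solves_on_subset[OF that(1)]) auto
      from \<delta>(3)[OF _ this that(2) _ that(3)] \<delta>(2) that(3) have "(norm (z t))\<^sup>2 \<le> 8 * t powr - a" by simp
      then show ?thesis by (simp add: norm_prod_def)
    qed
    then show "\<exists>\<delta>>0. \<forall>z. solves_on P {t1..} z \<and> norm (z t1) < \<delta> \<longrightarrow>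
        (\<exists>C. \<forall>\<^sub>F t in at_top. (fst (z t))\<^sup>2 + (snd (z t))\<^sup>2 \<le> C * t powr (- a))"
      using \<delta>(1) unfolding eventually_at_top_linorder by blast
  qed
  ultimately show ?thesis by (simp add: polynomially_stable_def)
qed

end

text \<open>\<open>lam\<close> is the uniform limit of
  \<open>\<Lambda> (v, \<psi>) / v powr \<beta>\<close> as \<open>v\<close> tends to 0, hence
  continuous; being periodic and negative it has a negative maximum, and the correction is
  eventually smaller than half of it.\<close>

lemma leading_coefficient_bound:
  fixes \<Lambda> :: "real \<times> real \<Rightarrow> real"
  assumes D: "0 < D" and cont: "continuous_on ({0..D} \<times> UNIV) \<Lambda>"
    and eq: "\<And>v \<psi>. 0 < v \<Longrightarrow> v \<le> D \<Longrightarrow> \<Lambda> (v, \<psi>) = v powr \<beta> * (lam \<psi> + lamt v \<psi>)"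
    and per: "\<And>\<psi>. lam (\<psi> + 2 * pi) = lam \<psi>" and neg: "\<And>\<psi>. lam \<psi> < 0"
    and small: "\<exists>C. \<exists>\<eta>>0. \<forall>v\<in>{0<..<\<eta>}. \<forall>\<psi>. \<bar>lamt v \<psi>\<bar> \<le> C * sqrt v"
  obtains c \<eta> where "0 < c" "0 < \<eta>" "\<And>v \<psi>. 0 < v \<Longrightarrow> v < \<eta> \<Longrightarrow> \<Lambda> (v, \<psi>) \<le> - c * v powr \<beta>"
proof -
  obtain C \<eta>0 where C: "0 < \<eta>0" "\<And>v \<psi>. 0 < v \<Longrightarrow> v < \<eta>0 \<Longrightarrow> \<bar>lamt v \<psi>\<bar> \<le> C * sqrt v"
    using small by (auto simp: Ball_def)
  have vanish: "\<forall>\<^sub>F v in at_right 0. 0 < v \<and> v < D \<and> (\<forall>\<psi>. \<bar>lamt v \<psi>\<bar> < \<delta>)" if "0 < \<delta>" for \<delta>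
  proof -
    have "((\<lambda>v. C * sqrt v) \<longlongrightarrow> C * sqrt 0) (at_right 0)"
      by (intro tendsto_intros)
    then have "\<forall>\<^sub>F v in at_right 0. C * sqrt v < \<delta>" using order_tendstoD(2) that by simp
    moreover have "\<forall>\<^sub>F v in at_right 0. v \<in> {0<..<min \<eta>0 D}"
      using C(1) D by (intro eventually_at_right_real) simp
    ultimately show ?thesis
    proof eventually_elim
      case (elim v)
      then show ?case using order_le_less_trans[OF C(2)[of v]] by simp
    qed
  qed
  have unif: "uniform_limit UNIV (\<lambda>v \<psi>. \<Lambda> (v, \<psi>) / v powr \<beta>) lam (at_right 0)"
  proof (rule uniform_limitI)
    fix \<delta> :: real assume "0 < \<delta>"
    from vanish[OF this] show "\<forall>\<^sub>F v in at_right 0. \<forall>\<psi>\<in>UNIV. dist (\<Lambda> (v, \<psi>) / v powr \<beta>) (lam \<psi>) < \<delta>"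
      by eventually_elim (simp add: eq dist_real_def)
  qed
  have "\<forall>\<^sub>F v in at_right 0. continuous_on UNIV (\<lambda>\<psi>. \<Lambda> (v, \<psi>) / v powr \<beta>)"
    using vanish[OF zero_less_one]
  proof eventually_elim
    case (elim v)
    have "continuous_on UNIV (\<lambda>\<psi>. \<Lambda> (v, \<psi>))"
      by (rule continuous_on_compose2[OF cont]) (use elim in \<open>auto intro!: continuous_intros\<close>)
    then show ?case using elim by (intro continuous_on_divide) auto
  qed
  then have "continuous_on UNIV lam"
    by (rule uniform_limit_theorem[OF _ unif]) simp
  then have "continuous_on {0..2 * pi} lam" by (rule continuous_on_subset) simp
  then obtain \<psi>0 where \<psi>0: "\<And>\<psi>. \<psi> \<in> {0..2 * pi} \<Longrightarrow> lam \<psi> \<le> lam \<psi>0"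
    using continuous_attains_sup[OF compact_Icc, of 0 "2 * pi" lam] by (metis atLeastAtMost_iff empty_iff order_refl pi_ge_zero mult_nonneg_nonneg zero_le_numeral)
  have le: "lam \<psi> \<le> lam \<psi>0" for \<psi>
  proof -
    define k where "k = \<lfloor>\<psi> / (2 * pi)\<rfloor>"
    have "of_int k \<le> \<psi> / (2 * pi)" "\<psi> / (2 * pi) \<le> of_int k + 1" unfolding k_def by linarith+
    then have "of_int k * (2 * pi) \<le> \<psi>" "\<psi> \<le> (of_int k + 1) * (2 * pi)"
      by (simp_all only: pos_le_divide_eq pos_divide_le_eq mult_pos_pos zero_less_numeral pi_gt_zero)
    then have "\<psi> + of_int (- k) * (2 * pi) \<in> {0..2 * pi}" by (simp add: distrib_right)
    moreover have "lam (\<psi> + of_int (- k) * (2 * pi)) = lam \<psi>"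
      by (rule periodic_int[where h = lam]) (rule per)
    ultimately show ?thesis using \<psi>0 by metis
  qed
  \<comment> \<open>Half of the extremal value is reserved for the correction
    \<open>lamt\<close>.\<close>
  define c where "c = - lam \<psi>0 / 2"
  have c: "0 < c" using neg by (simp add: c_def)
  from vanish[OF this] obtain \<eta> where \<eta>: "0 < \<eta>" "\<And>v. 0 < v \<Longrightarrow> v < \<eta> \<Longrightarrow> v < D \<and> (\<forall>\<psi>. \<bar>lamt v \<psi>\<bar> < c)"
    unfolding eventually_at_right_field by auto
  show ?thesis
  proof (rule that[OF c \<eta>(1)])
    fix v \<psi> :: real assume v: "0 < v" "v < \<eta>"
    have "lam \<psi> + lamt v \<psi> \<le> - c"
      using le[of \<psi>] \<eta>(2)[OF v, THEN conjunct2, THEN spec, of \<psi>] by (simp add: c_def abs_less_iff)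
    then have "v powr \<beta> * (lam \<psi> + lamt v \<psi>) \<le> v powr \<beta> * - c" by (intro mult_left_mono) auto
    then show "\<Lambda> (v, \<psi>) \<le> - c * v powr \<beta>" using eq[of v \<psi>] \<eta>(2)[OF v] v(1) by (simp add: mult.commute)
  qed
qed

theorem theorem9:
  fixes P :: osc_system
    and l n m d N \<sigma> :: nat
    and w u :: "nat \<Rightarrow> real \<times> real \<times> real \<Rightarrow> real"
    and \<Lambda> \<Omega> :: "nat \<Rightarrow> real \<times> real \<Rightarrow> real"
    and \<epsilon> t0 \<Delta>s :: real
    and lam :: "nat \<Rightarrow> real \<Rightarrow> real" and lamt :: "nat \<Rightarrow> real \<Rightarrow> real \<Rightarrow> real"
    and mu :: "real \<Rightarrow> real" and mut :: "real \<Rightarrow> real \<Rightarrow> real"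
  assumes standing: "standing_assumptions P"
    and scaling: "scaling_exponent P l"
    and averaged: "averaging P l (scaled_Emax P l t0) N m w \<Lambda> u \<Omega>"
    and near_id: "near_identity P l N m w u \<epsilon> t0"
    and leading: "leading_phase_term (\<Omega> m)"
    and ranges: "2 \<le> n" "n \<le> 2 * qpar P" "2 \<le> m" "m \<le> 2 * qpar P" "2 \<le> \<sigma>" "1 \<le> d"
      "n + d \<le> N"
    and a_Lambda_zero: "\<And>j v \<psi>. 2 \<le> j \<Longrightarrow> j < n \<Longrightarrow> v \<in> {0..Delta0 P l \<epsilon> t0} \<Longrightarrow> \<Lambda> j (v, \<psi>) = 0"
    and a_Omega_zero: "\<And>i v \<psi>. 2 \<le> i \<Longrightarrow> i < m \<Longrightarrow> v \<in> {0..Delta0 P l \<epsilon> t0} \<Longrightarrow> \<Omega> i (v, \<psi>) = 0"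
    and a_Lambda_z: "\<And>z v \<psi>. n \<le> z \<Longrightarrow> z < n + d \<Longrightarrow> v \<in> {0..Delta0 P l \<epsilon> t0} \<Longrightarrow>
      \<Lambda> z (v, \<psi>) = v powr (real (\<sigma> + 1) / 2) * (lam z \<psi> + lamt z v \<psi>)
        + v * (if z = 2 * qpar P then real l / real (qpar P) else 0)"
    and a_Lambda_nd: "\<And>v \<psi>. v \<in> {0..Delta0 P l \<epsilon> t0} \<Longrightarrow>
      \<Lambda> (n + d) (v, \<psi>) = v * (mu \<psi> + mut v \<psi>
        + (if n + d = 2 * qpar P then real l / real (qpar P) else 0))"
    and a_periodic_z: "\<And>z v \<psi>. n \<le> z \<Longrightarrow> z < n + d \<Longrightarrow> v \<in> {0..Delta0 P l \<epsilon> t0} \<Longrightarrow>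
      lam z (\<psi> + 2 * pi) = lam z \<psi> \<and> lamt z v (\<psi> + 2 * pi) = lamt z v \<psi>"
    and a_periodic_nd: "\<And>v \<psi>. v \<in> {0..Delta0 P l \<epsilon> t0} \<Longrightarrow>
      mu (\<psi> + 2 * pi) = mu \<psi> \<and> mut v (\<psi> + 2 * pi) = mut v \<psi>"
    and a_small_z: "\<And>z. n \<le> z \<Longrightarrow> z < n + d \<Longrightarrow>
      \<exists>C. \<exists>\<eta>>0. \<forall>v\<in>{0<..<\<eta>}. \<forall>\<psi>. \<bar>lamt z v \<psi>\<bar> \<le> C * sqrt v"
    and a_small_nd: "\<exists>C. \<exists>\<eta>>0. \<forall>v\<in>{0<..<\<eta>}. \<forall>\<psi>. \<bar>mut v \<psi>\<bar> \<le> C * sqrt v"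
    and b_Delta: "0 < \<Delta>s" "\<Delta>s \<le> Delta0 P l \<epsilon> t0"
    and b_Omega: "\<And>v \<psi>. v \<in> {0..\<Delta>s} \<Longrightarrow> \<Omega> m (v, \<psi>) \<noteq> 0"
    and order: "n + d < m"
    and positive: "\<And>\<psi>. 0 < mu \<psi>"
    and negative: "\<And>\<psi>. lam n \<psi> < 0"
  shows "polynomially_stable P"
proof -
  interpret osc P by unfold_locales (rule standing)
  define R0 where "R0 = scaled_Emax P l t0"
  define D0 where "D0 = Delta0 P l \<epsilon> t0"
  \<comment> \<open>Below \<open>D0\<close> the vanishing of the earlier \<open>\<Lambda>\<close> is
    available, and below \<open>Emax P\<close> the cancellation \<open>scaled_G_0\<close>; since
    \<open>D0 < R0\<close>, the averaging relations hold as well.\<close>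
  define R where "R = min D0 (Emax P)"
  define W where "W = V_co w N"
  define L where "L = 2 * pi * real (kap P)"
  \<comment> \<open>The averaged right-hand sides up to order \<open>n\<close> as functions of three
    variables; not depending on the third, they can be removed as means.\<close>
  define Lm where "Lm = (\<lambda>k (x :: real \<times> real \<times> real). if k = n then \<Lambda> n (fst x, fst (snd x)) else 0 :: real)"
  have t0: "0 < \<epsilon>" "\<epsilon> < 1" "1 < t0" using near_id by (auto simp: near_identity_def)
  have R0: "0 < R0" using t0(3) standing_basic(1) by (simp add: R0_def scaled_Emax_def)
  have D0: "0 < D0" "D0 < R0" using t0 R0 by (auto simp: D0_def Delta0_def R0_def)
  have R: "0 < R" "R \<le> D0" "R \<le> Emax P" using D0 standing_basic(1) by (auto simp: R_def)
  \<comment> \<open>The order condition enters here: \<open>n < n + d < m \<le> 2q\<close>.\<close>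
  have n: "n < 2 * qpar P" and nN: "n \<le> N" and d: "n < n + d" using ranges order by auto
  have L: "0 < L" using standing_basic(6) by (simp add: L_def)
  have av: "\<And>k. k \<in> {2..N} \<Longrightarrow> smooth_fun_on ({0<..<R0} \<times> UNIV \<times> UNIV) (w k) \<and> periodic_zero_mean P R0 (w k)
      \<and> continuous_on ({0..R0} \<times> UNIV) (\<Lambda> k)"
    "\<And>x k. x \<in> {0<..<R0} \<times> UNIV \<times> UNIV \<Longrightarrow> k \<le> N \<Longrightarrow>
      fps_nth (total_deriv P l (V_co w N) x) k = fps_nth (averaged_rhs \<Lambda> N w N u m x) k"
    using averaged unfolding averaging_def R0_def by blast+
  have sub: "strip R \<subseteq> {0<..<R0} \<times> UNIV \<times> UNIV" using R D0 by (auto simp: strip_def)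
  have rel: "(\<Sum>i\<le>k. scaled_F P l i x * pd (1, 0, 0) (W (k - i)) x + scaled_G P l i x * pd (0, 1, 0) (W (k - i)) x
      + S_co P i * pd (0, 0, 1) (W (k - i)) x) = Lm k x" if k: "k \<le> n" and x: "x \<in> strip R" for k x
  proof -
    obtain e \<theta> s where xe: "x = (e, \<theta>, s)" by (metis prod_cases3)
    have e: "0 < e" "e < D0" using x R by (auto simp: xe)
    have "fps_nth (averaged_rhs \<Lambda> N w N u m (e, \<theta>, s)) k = (if k = n then \<Lambda> n (e, \<theta>) else 0)"
      by (rule averaged_rhs_nth[where D = D0]) (use a_Lambda_zero e k ranges(1) nN in \<open>auto simp: D0_def\<close>)
    then show ?thesis
      using av(2)[of x k] e D0(2) k nN total_deriv_nth[of k P l W x] n by (auto simp: W_def Lm_def xe)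
  qed
  have wk: "smooth_fun_on (strip R) (w k)" "zero_mean L R (w k)"
    "\<And>x. x \<in> strip R \<Longrightarrow> w k (x + (0, 0, L)) = w k x"
    "\<And>e \<theta> s. 0 < e \<Longrightarrow> e < R \<Longrightarrow> w k (e, \<theta> + 2 * pi, s) = w k (e, \<theta>, s)"
    if k: "2 \<le> k" "k \<le> n" for k
  proof -
    have a: "smooth_fun_on ({0<..<R0} \<times> UNIV \<times> UNIV) (w k)" and p: "periodic_zero_mean P R0 (w k)"
      using av(1)[of k] k nN by auto
    show "smooth_fun_on (strip R) (w k)" by (rule smooth_subset[OF a sub])
    show "zero_mean L R (w k)" using p R D0 by (simp add: zero_mean_def periodic_zero_mean_def L_def)
    show "w k (x + (0, 0, L)) = w k x" if "x \<in> strip R" for x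
      using p that R D0 by (cases x) (simp add: periodic_zero_mean_def L_def)
    show "w k (e, \<theta> + 2 * pi, s) = w k (e, \<theta>, s)" if "0 < e" "e < R" for e \<theta> s
      using p that R D0 by (simp add: periodic_zero_mean_def)
  qed
  have sym: "symbol 1 (W k)" if "k \<le> n" for k
    unfolding W_def
  proof (rule symbol_V_co[where F = "scaled_F P l" and G = "scaled_G P l" and S = "S_co P" and Lm = Lm, OF R(1) L S_co_0(2) nN])
    show "symbol 1 (scaled_F P l i)" for i by (rule symbol_scaled_F)
    show "symbol 0 (scaled_G P l i)" for i by (rule symbol_scaled_G[OF scaling])
    show "scaled_F P l 0 x = 0" for x by (rule scaled_F_0)
    show "scaled_G P l 0 x = 0" if "x \<in> strip R" for x
      using that R by (intro scaled_G_0[OF scaling]) (auto simp: strip_fst)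
    show "Lm k (x + (0, 0, s)) = Lm k x" for k x s by (simp add: Lm_def)
  qed (use rel[unfolded W_def] wk that in simp_all)
  have cases: "k = 0 \<or> k = Suc 0 \<or> 2 \<le> k" for k :: nat by linarith
  have W0: "W 0 = fst" by (simp add: W_def V_co_simps)
  have sm: "smooth_fun_on (strip R) (W k)" if "k \<le> n" for k
    using cases[of k] wk(1)[of k] that nN smooth_const[of _ 0] smooth_linear[OF bounded_linear_fst]
    by (auto simp: W_def V_co_simps)
  have perW: "W k (e, \<theta> + 2 * pi, s) = W k (e, \<theta>, s)" if "k \<le> n" "0 < e" "e < R" for k e \<theta> s
    using cases[of k] wk(4)[of k e \<theta> s] that nN by (auto simp: W_def V_co_simps)
  obtain c \<eta>L where c: "0 < c" "0 < \<eta>L" "\<And>v \<psi>. 0 < v \<Longrightarrow> v < \<eta>L \<Longrightarrow> \<Lambda> n (v, \<psi>) \<le> - c * v powr (real (\<sigma> + 1) / 2)"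
  proof (rule leading_coefficient_bound[where \<Lambda> = "\<Lambda> n" and D = D0 and lam = "lam n" and lamt = "lamt n" and \<beta> = "real (\<sigma> + 1) / 2"])
    show "continuous_on ({0..D0} \<times> UNIV) (\<Lambda> n)"
      by (rule continuous_on_subset[of "{0..R0} \<times> UNIV"]) (use av(1)[of n] ranges(1) nN D0 in auto)
    \<comment> \<open>The linear term with \<open>l/q\<close> belongs to order \<open>2q\<close> and
      is absent at order \<open>n < 2q\<close>.\<close>
    show "\<Lambda> n (v, \<psi>) = v powr (real (\<sigma> + 1) / 2) * (lam n \<psi> + lamt n v \<psi>)" if "0 < v" "v \<le> D0" for v \<psi>
      using a_Lambda_z[OF order_refl d, of v \<psi>] that n by (simp add: D0_def)
    show "lam n (\<psi> + 2 * pi) = lam n \<psi>" for \<psi>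
      using a_periodic_z[OF order_refl d, of 0 \<psi>] D0 by (simp add: D0_def)
    show "\<exists>C. \<exists>\<eta>>0. \<forall>v\<in>{0<..<\<eta>}. \<forall>\<psi>. \<bar>lamt n v \<psi>\<bar> \<le> C * sqrt v"
      by (rule a_small_z[OF order_refl d])
  qed (use D0 negative in auto)
  have Lmn: "Lm n x \<le> - c * fst x powr (real (\<sigma> + 1) / 2)" if "x \<in> strip \<eta>L" for x
    using c(3) that by (simp add: Lm_def strip_fst)
  have rel': "(\<Sum>i\<le>k. scaled_F P l i x * pd (1, 0, 0) (W (k - i)) x + scaled_G P l i x * pd (0, 1, 0) (W (k - i)) x
      + S_co P i * pd (0, 0, 1) (W (k - i)) x) = (if k = n then Lm n x else 0)" if k: "k \<le> n" and x: "x \<in> strip R" for k x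
    using rel[OF k x] by (simp add: Lm_def)
  \<comment> \<open>From \<open>\<sigma> \<ge> 2\<close> the damping is superlinear, so that the
    barrier exponent, which contains \<open>1 / (\<beta> - 1)\<close>, is positive and
    finite.\<close>
  have \<beta>: "1 < real (\<sigma> + 1) / 2" using ranges(5) by simp
  obtain a T0 where a: "0 < a" "1 \<le> T0"
    "\<And>T. T0 \<le> T \<Longrightarrow> \<exists>\<delta>>0. \<forall>T' z. solves_on P {T..<T'} z \<and> norm (z T) < \<delta> \<longrightarrow>
      (\<forall>t\<in>{T..<T'}. (norm (z t))\<^sup>2 \<le> 8 * t powr - a)"
    by (rule solution_decay[where W = W and Lm = "Lm n", OF scaling n R(1) sym W0 sm perW rel' c(1,2) Lmn \<beta>]) (assumption+, rule that)
  show ?thesis by (rule polynomially_stable_of_decay[OF a])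
qed

end
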